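(* As $\varepsilon\to0$, the solution $u^\varepsilon$ of Problem $(P^\varepsilon)$ converges to $\tilde u$ everywhere (pointwise) in $\bigcup_{0<t\le T}(\Omega_t^{\pm}\times\{t\})$, where $\tilde u(x,t)=-1$ for $x\in\Omega_t^-$ and $\tilde u(x,t)=+1$ for $x\in\Omega_t^+$, $t\in[0,T]$.
   Context: Setting. $\Omega$ is a smooth bounded domain in $\mathbb R^N$ ($N\ge2$), and $\nu$ is the Euclidean unit normal vector exterior to $\partial\Omega$. The nonlinearity $f(u,v)$ is a smooth real function of two real variables. Put $\tilde f(u):=f(u,0)=-W'(u)$ ($W$ a double-well potential). It is assumed that $\tilde f$ has exactly three zeros $-1<a<1$, that $\tilde f'(\pm1)<0$, $\tilde f'(a)>0$, and that $\int_{-1}^{1}\tilde f(u)\,du=0$. For $\varepsilon>0$, $u^\varepsilon$ denotes the solution of Problem $(P^\varepsilon)$: $$u_t=\Delta u+\frac1{\varepsilon^2}f\Big(u,\varepsilon\int_\Omega u\,dx\Big)\ \text{in }\Omega\times(0,\infty),\qquad \frac{\partial u}{\partial\nu}=0\ \text{on }\partial\Omega\times(0,\infty),\qquad u(x,0)=u_0(x)\ \text{in }\Omega .$$ Initial data. $u_0$ is independent of $\varepsilon$ and smooth, and $C_0\ge1$ is a constant such that $\|u_0\|_{C^0(\overline\Omega)}+\|\nabla u_0\|_{C^0(\overline\Omega)}+\|D^2u_0\|_{C^0(\overline\Omega)}\le C_0$. The set $\Gamma_0:=\{x\in\Omega:\ u_0(x)=a\}$ is a smooth closed hypersurface without boundary,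 with $\Gamma_0\subset\subset\Omega$ and $\nabla u_0(x)\ne0$ for $x\in\Gamma_0$. Denote by $\Omega_0^-$ the region enclosed by $\Gamma_0$ and by $\Omega_0^+$ the region enclosed between $\partial\Omega$ and $\Gamma_0$; it is assumed that $u_0>a$ in $\Omega_0^+$ and $u_0<a$ in $\Omega_0^-$. Limit problem. $(\Gamma_t)_{0\le t\le T}$ is the smooth solution, on a time interval $[0,T]$ on which it exists (as smooth closed hypersurfaces contained in $\Omega$), of the free boundary problem $(P^0)$: $$V_n=-\kappa+c_0\big(|\Omega_t^+|-|\Omega_t^-|\big)\ \text{on }\Gamma_t,\qquad \Gamma_t|_{t=0}=\Gamma_0,$$ where $\Omega_t^-$ is the region enclosed by $\Gamma_t$, $\Omega_t^+$ is the region enclosed between $\partial\Omega$ and $\Gamma_t$, $V_n$ is the normal velocity of $\Gamma_t$ in the exterior direction (pointing out of $\Omega_t^-$), $\kappa$ is the mean curvature at each point of $\Gamma_t$ (the sum of the principal curvatures, equal to $\Delta d$ on $\Gamma_t$ where $d$ is the signed distance to $\Gamma_t$, negative in $\Omega_t^-$ and positive in $\Omega_t^+$), $|A|$ is the measure of the set $A$, and $$c_0=-\frac{\int_{-1}^{1}\frac{\partial f}{\partial v}(u,0)\,du}{\int_{-1}^{1}[2(W(u)-W(-1))]^{1/2}\,du}.$$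
   Formalization: It is additionally assumed that u_0 ≠ a on ∂Ω; if u_0 equals a on ∂Ω, the O(ε) nonlocal term can create a second interface at the boundary and the claimed convergence can fail. *)

theory Defs
  imports "HOL-Analysis.Analysis"
begin

(* For open S: all iterated directional derivatives up to order k exist and are continuous. *)
primrec Ck_on :: "nat \<Rightarrow> 'a::real_normed_vector set \<Rightarrow> ('a \<Rightarrow> 'b::real_normed_vector) \<Rightarrow> bool" where
  "Ck_on 0 S f \<longleftrightarrow> continuous_on S f"
| "Ck_on (Suc k) S f \<longleftrightarrow>
     (\<forall>x\<in>S. f differentiable (at x)) \<and>
     (\<forall>v. Ck_on k S (\<lambda>x. frechet_derivative f (at x) v))"

definition smooth_on :: "'a::real_normed_vector set \<Rightarrow> ('a \<Rightarrow> 'b::real_normed_vector) \<Rightarrow> bool" where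
  "smooth_on S f \<longleftrightarrow> (\<forall>k. Ck_on k S f)"

definition grad :: "('a::euclidean_space \<Rightarrow> real) \<Rightarrow> 'a \<Rightarrow> 'a" where
  "grad f x = (\<Sum>i\<in>Basis. frechet_derivative f (at x) i *\<^sub>R i)"

definition hess :: "('a::euclidean_space \<Rightarrow> real) \<Rightarrow> 'a \<Rightarrow> 'a \<Rightarrow> 'a" where
  "hess f x = frechet_derivative (grad f) (at x)"

definition laplacian :: "('a::euclidean_space \<Rightarrow> real) \<Rightarrow> 'a \<Rightarrow> real" where
  "laplacian f x = (\<Sum>i\<in>Basis. hess f x i \<bullet> i)"

(* On U the set A is the sublevel set of a smooth function without critical points; for open A
   and p on the frontier this forces \<phi> p = 0, and the frontier of A in U is the zero set. *)
definition local_defining_function ::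
  "'a::euclidean_space set \<Rightarrow> 'a \<Rightarrow> 'a set \<Rightarrow> ('a \<Rightarrow> real) \<Rightarrow> bool" where
  "local_defining_function A p U \<phi> \<longleftrightarrow>
     open U \<and> p \<in> U \<and> smooth_on U \<phi> \<and> (\<forall>x\<in>U. grad \<phi> x \<noteq> 0) \<and>
     A \<inter> U = {x\<in>U. \<phi> x < 0}"

definition smooth_bounded_domain :: "'a::euclidean_space set \<Rightarrow> bool" where
  "smooth_bounded_domain \<Omega> \<longleftrightarrow>
     open \<Omega> \<and> connected \<Omega> \<and> \<Omega> \<noteq> {} \<and> bounded \<Omega> \<and>
     (\<forall>p\<in>frontier \<Omega>. \<exists>U \<phi>. local_defining_function \<Omega> p U \<phi>)"

(* n is the unit normal at the frontier point p pointing out of A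
   (it does not depend on the choice of the defining function). *)
definition exterior_unit_normal :: "'a::euclidean_space set \<Rightarrow> 'a \<Rightarrow> 'a \<Rightarrow> bool" where
  "exterior_unit_normal A p n \<longleftrightarrow> p \<in> frontier A \<and>
     (\<exists>U \<phi>. local_defining_function A p U \<phi> \<and> n = (1 / norm (grad \<phi> p)) *\<^sub>R grad \<phi> p)"

definition smooth_closed_hypersurface :: "'a::euclidean_space set \<Rightarrow> bool" where
  "smooth_closed_hypersurface \<Gamma> \<longleftrightarrow> compact \<Gamma> \<and> \<Gamma> \<noteq> {} \<and>
     (\<forall>p\<in>\<Gamma>. \<exists>U \<phi>. open U \<and> p \<in> U \<and> smooth_on U \<phi> \<and> (\<forall>x\<in>U. grad \<phi> x \<noteq> 0) \<and>
        \<Gamma> \<inter> U = {x\<in>U. \<phi> x = 0})"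

(* The region of \<Omega> enclosed by \<Gamma>, and the region between \<Gamma> and the boundary of \<Omega>. If \<Omega> has
   holes, a hole surrounded by \<Gamma> belongs to neither region. *)
definition inner_region :: "'a::euclidean_space set \<Rightarrow> 'a set \<Rightarrow> 'a set" where
  "inner_region \<Omega> \<Gamma> = \<Omega> \<inter> inside \<Gamma>"

definition outer_region :: "'a::euclidean_space set \<Rightarrow> 'a set \<Rightarrow> 'a set" where
  "outer_region \<Omega> \<Gamma> = \<Omega> \<inter> outside \<Gamma>"

(* Used only near \<Gamma>, which is contained in the open set \<Omega>. *)
definition signed_distance :: "'a::euclidean_space set \<Rightarrow> 'a set \<Rightarrow> 'a \<Rightarrow> real" where
  "signed_distance \<Omega> \<Gamma> x =
     (if x \<in> inner_region \<Omega> \<Gamma> then - infdist x \<Gamma> else infdist x \<Gamma>)"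

(* Sum of the principal curvatures, positive for spheres. *)
definition mean_curvature :: "'a::euclidean_space set \<Rightarrow> 'a set \<Rightarrow> 'a \<Rightarrow> real" where
  "mean_curvature \<Omega> \<Gamma> x = laplacian (signed_distance \<Omega> \<Gamma>) x"

(* Space-time description of a smooth family, smooth up to t = 0 and t = T: \<phi> is smooth on a full
   space-time neighbourhood, but represents \<Gamma> only at times in [0,T]. Compactness of the
   space-time track keeps components from appearing or disappearing. *)
definition smooth_hypersurface_family :: "real \<Rightarrow> (real \<Rightarrow> 'a::euclidean_space set) \<Rightarrow> bool" where
  "smooth_hypersurface_family T \<Gamma> \<longleftrightarrow>
     (\<forall>t\<in>{0..T}. smooth_closed_hypersurface (\<Gamma> t)) \<and>
     compact {(x, t). t \<in> {0..T} \<and> x \<in> \<Gamma> t} \<and>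
     (\<forall>t\<in>{0..T}. \<forall>x\<in>\<Gamma> t. \<exists>U \<phi>. open U \<and> (x, t) \<in> U \<and> smooth_on U \<phi> \<and>
        (\<forall>(y, s)\<in>U. grad (\<lambda>z. \<phi> (z, s)) y \<noteq> 0) \<and>
        (\<forall>(y, s)\<in>U. s \<in> {0..T} \<longrightarrow> (y \<in> \<Gamma> s \<longleftrightarrow> \<phi> (y, s) = 0)))"

(* V is the component in direction n of the velocity at time t of a point moving with \<Gamma>. For n
   normal to \<Gamma> t and a smooth family, V does not depend on the choice of the moving point. *)
definition has_normal_velocity ::
  "real \<Rightarrow> (real \<Rightarrow> 'a::euclidean_space set) \<Rightarrow> real \<Rightarrow> 'a \<Rightarrow> 'a \<Rightarrow> real \<Rightarrow> bool" where
  "has_normal_velocity T \<Gamma> t x n V \<longleftrightarrow>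
     (\<exists>\<gamma> v. \<gamma> t = x \<and> (\<forall>s\<in>{0..T}. \<gamma> s \<in> \<Gamma> s) \<and>
        (\<gamma> has_vector_derivative v) (at t within {0..T}) \<and> V = v \<bullet> n)"

definition limit_problem_solution ::
  "'a::euclidean_space set \<Rightarrow> real \<Rightarrow> 'a set \<Rightarrow> real \<Rightarrow> (real \<Rightarrow> 'a set) \<Rightarrow> bool" where
  "limit_problem_solution \<Omega> c0 \<Gamma>0 T \<Gamma> \<longleftrightarrow>
     smooth_hypersurface_family T \<Gamma> \<and> (\<forall>t\<in>{0..T}. \<Gamma> t \<subseteq> \<Omega>) \<and> \<Gamma> 0 = \<Gamma>0 \<and>
     (\<forall>t\<in>{0..T}. \<forall>x\<in>\<Gamma> t. \<exists>n. exterior_unit_normal (inner_region \<Omega> (\<Gamma> t)) x n \<and>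
        has_normal_velocity T \<Gamma> t x n
          (- mean_curvature \<Omega> (\<Gamma> t) x
           + c0 * (measure lebesgue (outer_region \<Omega> (\<Gamma> t))
                   - measure lebesgue (inner_region \<Omega> (\<Gamma> t)))))"

(* Classical solutions: u is continuous on the closure of \<Omega> up to t = 0, and for t > 0 it is C^1
   in x up to the boundary (with gradient G) and C^2 in x inside; continuity of u_t follows from
   the equation. No compatibility between u0 and the Neumann condition is required. *)
definition nonlocal_AC_solution ::
  "(real \<Rightarrow> real \<Rightarrow> real) \<Rightarrow> 'a::euclidean_space set \<Rightarrow> ('a \<Rightarrow> real) \<Rightarrow> real \<Rightarrow>
   ('a \<Rightarrow> real \<Rightarrow> real) \<Rightarrow> bool" where
  "nonlocal_AC_solution f \<Omega> u0 \<epsilon> u \<longleftrightarrow>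
     continuous_on (closure \<Omega> \<times> {0..}) (\<lambda>(x, t). u x t) \<and>
     (\<forall>x\<in>\<Omega>. \<forall>t>0. grad (\<lambda>y. u y t) differentiable (at x)) \<and>
     (\<forall>h. continuous_on (\<Omega> \<times> {0<..}) (\<lambda>(x, t). hess (\<lambda>y. u y t) x h)) \<and>
     (\<forall>x\<in>\<Omega>. \<forall>t>0. ((\<lambda>s. u x s) has_real_derivative
        laplacian (\<lambda>y. u y t) x
        + 1 / \<epsilon>\<^sup>2 * f (u x t) (\<epsilon> * integral \<Omega> (\<lambda>y. u y t))) (at t)) \<and>
     (\<exists>G. continuous_on (closure \<Omega> \<times> {0<..}) (\<lambda>(x, t). G x t) \<and>
        (\<forall>x\<in>closure \<Omega>. \<forall>t>0.
           ((\<lambda>y. u y t) has_derivative (\<lambda>h. G x t \<bullet> h)) (at x within closure \<Omega>)) \<and>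
        (\<forall>x\<in>frontier \<Omega>. \<forall>t>0. \<forall>n. exterior_unit_normal \<Omega> x n \<longrightarrow> G x t \<bullet> n = 0)) \<and>
     (\<forall>x\<in>\<Omega>. u x 0 = u0 x)"

end

theory Submission
  imports Defs
begin

text \<open>
  The solution is squeezed between sub- and supersolutions. During a first layer of duration \<open>\<epsilon>\<^sup>2 m\<close> the
  reaction term alone drives \<open>u\<close> close to \<open>\<plusminus>1\<close> away from \<open>\<Gamma>\<^sub>0\<close>. Afterwards the barriers are
  \<open>U(z) + \<epsilon> v(t) \<Psi>(z) + q(t) + \<epsilon>\<^sup>2 \<zeta>(x)\<close> with \<open>z = (D(x,t) + r(t)) / \<epsilon>\<close>, where \<open>D\<close> is a truncated signed
  distance to \<open>\<Gamma>\<^sub>t\<close>, \<open>U\<close> the standing wave, \<open>\<Psi>\<close> its corrector for the slope of \<open>f\<close> in the nonlocal variable, \<open>v\<close>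
  a smooth approximation of the difference of the volumes, and \<open>\<zeta>\<close> increases across the boundary of \<open>\<Omega>\<close>. The
  constant \<open>c\<^sub>0\<close> is the solvability condition for \<open>\<Psi>\<close>; the terms of order \<open>1/\<epsilon>\<close> in the residual vanish by the
  motion law. The nonlocal term depends on \<open>u\<close> through an integral that the two barriers control up to \<open>O(r)\<close>,
  so the comparison principle is applied to both barriers at once, at the first time one of them is touched,
  and the exponential growth of \<open>r\<close> absorbs the error. Lower barriers are upper ones for the reflected
  nonlinearity \<open>- f(-p, -q)\<close>.
\<close>

section \<open>Calculus\<close>

text \<open>The obstacle is that the nonlocal equation has no comparison principle of its own:
  \<open>fv\<close> may have either sign, so ordered data need not stay ordered. With the integral
  frozen as a number the equation is local, and this number has to be known only up to
  \<open>(1 + 15 * Cm) * (\<delta> * exp (K * t))\<close>. Hence the order of choices: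
  \<open>M\<close> and \<open>K = motion_rate M\<close>, then the width \<open>\<delta>\<close> and
  the height \<open>\<sigma>\<close>, then \<open>eps\<close>. \<open>K\<close> must not depend on
  \<open>\<delta>\<close>; and as \<open>\<delta>\<close> stays fixed while \<open>eps\<close> tends
  to 0, the result is convergence without a rate. The geometric half is shaped by what the limit
  problem provides: local space-time charts, and at each point a moving point and an exterior
  normal. That the hypersurface locally separates inside from outside, that these sides persist in
  time, and that the signed distance has second derivatives nearby are all extracted from this. The
  volume difference is obtained only as a continuous function of time, whereas the barrier
  differentiates its factor \<open>v\<close>; hence the approximation. The slope of
  \<open>\<zeta>\<close> makes the boundary inequality strict where the barriers are otherwise
  flat.\<close>

lemma smooth_on_derivD:
 assumes "smooth_on S f"
 shows "smooth_on S (\<lambda>x. frechet_derivative f (at x) v)" "\<And>x. x \<in> S ==> f differentiable (at x)"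
  "continuous_on S f"
proof -
 have *: "Ck_on (Suc k) S f" "Ck_on k S f" for k using assms unfolding smooth_on_def by auto
 show "smooth_on S (\<lambda>x. frechet_derivative f (at x) v)"
  unfolding smooth_on_def using *(1) by simp
 show "\<And>x. x \<in> S ==> f differentiable (at x)" using *(1)[of 0] by simp
 show "continuous_on S f" using *(2)[of 0] by simp
qed

lemma smooth_on_has_derivative:
 assumes "smooth_on S f" "x \<in> S"
 shows "(f has_derivative frechet_derivative f (at x)) (at x)"
 using smooth_on_derivD(2)[OF assms] frechet_derivative_works by blast

lemma norm_linear_le_Basis:
 fixes F :: "'a::euclidean_space => 'b::real_normed_vector"
  and C :: real
 assumes "linear F" "\<And>b. b \<in> Basis ==> norm (F b) \<le> C"
 shows "norm (F h) \<le> (DIM('a) * C) * norm h"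
proof -
 have "F h = F (\<Sum>b\<in>Basis. (h \<bullet> b) *\<^sub>R b)" by (simp add: euclidean_representation)
 also have "\<dots> = (\<Sum>b\<in>Basis. (h \<bullet> b) *\<^sub>R F b)"
  by (simp add: linear_sum[OF assms(1)] linear_cmul[OF assms(1)])
 finally have "norm (F h) \<le> (\<Sum>b\<in>Basis. norm ((h \<bullet> b) *\<^sub>R F b))" by (metis norm_sum)
 also have "\<dots> \<le> (\<Sum>b\<in>(Basis::'a set). norm h * C)"
  using assms(2) by (intro sum_mono) (simp add: Basis_le_norm mult_mono)
 finally show ?thesis by (simp add: algebra_simps)
qed

text \<open>\<open>Ck_on\<close> speaks of one direction at a time; a bound uniform in the direction
  is assembled from the finitely many basis directions by linearity.\<close>

lemma smooth_on_derivative_bounded: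
 fixes f :: "'a::euclidean_space => 'b::real_normed_vector"
 assumes f: "smooth_on S f" and K: "compact K" "K \<subseteq> S"
 obtains C where "C > 0" "\<And>x h. x \<in> K ==> norm (frechet_derivative f (at x) h) \<le> C * norm h"
proof -
 have "\<exists>C. \<forall>x\<in>K. norm (frechet_derivative f (at x) b) \<le> C" for b
 proof -
  have "continuous_on K (\<lambda>x. frechet_derivative f (at x) b)"
   using smooth_on_derivD(3)[OF smooth_on_derivD(1)[OF f]] K(2) continuous_on_subset by blast
  then have "bounded ((\<lambda>x. frechet_derivative f (at x) b) ` K)"
   using K(1) compact_continuous_image compact_imp_bounded by blast
  then show ?thesis by (auto simp: bounded_iff)
 qed
 then obtain C where C: "\<And>b x. x \<in> K ==> norm (frechet_derivative f (at x) b) \<le> C b" by metis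
 define M where "M = (\<Sum>b\<in>Basis. \<bar>C b\<bar>)"
 have M: "norm (frechet_derivative f (at x) b) \<le> M" if "x \<in> K" "b \<in> Basis" for x b
  using C[OF that(1), of b] member_le_sum[OF that(2), of "\<lambda>b. \<bar>C b\<bar>"] unfolding M_def by fastforce
 have "norm (frechet_derivative f (at x) h) \<le> (DIM('a) * M + 1) * norm h" if "x \<in> K" for x h
 proof -
  have "x \<in> S" using that K(2) by blast
  from norm_linear_le_Basis[OF linear_frechet_derivative[OF smooth_on_derivD(2)[OF f this]] M[OF that], of h]
  have "norm (frechet_derivative f (at x) h) \<le> (DIM('a) * M) * norm h" .
  then show ?thesis using norm_ge_zero[of h] unfolding distrib_right mult_1 by linarith
 qed
 moreover have "M \<ge> 0" unfolding M_def by (simp add: sum_nonneg)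
 ultimately show thesis by (intro that[of "DIM('a) * M + 1"]) (auto simp: add_nonneg_pos)
qed

lemma smooth_on_lipschitz:
 fixes f :: "'a::euclidean_space => 'b::real_normed_vector"
 assumes f: "smooth_on S f" and K: "compact K" "K \<subseteq> S" "convex K"
 obtains C where "C > 0" "\<And>x y. x \<in> K ==> y \<in> K ==> norm (f y - f x) \<le> C * norm (y - x)"
proof -
 obtain C where C: "C > 0" "\<And>x h. x \<in> K ==> norm (frechet_derivative f (at x) h) \<le> C * norm h"
  using smooth_on_derivative_bounded[OF f K(1,2)] by blast
 have "norm (f y - f x) \<le> C * norm (y - x)" if "x \<in> K" "y \<in> K" for x y
 proof (rule differentiable_bound[OF K(3)])
  show "(f has_derivative frechet_derivative f (at z)) (at z within K)" if "z \<in> K" for z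
   using smooth_on_has_derivative[OF f] that K(2) has_derivative_at_withinI by blast
  show "onorm (frechet_derivative f (at z)) \<le> C" if "z \<in> K" for z
   using C that by (intro onorm_bound) auto
 qed (use that in auto)
 with C(1) that show thesis by blast
qed

text \<open>The directional derivatives along the basis are Lipschitz, hence so is the derivative as
  a linear map; the quadratic Taylor remainder then follows from the mean value inequality applied
  on the segment after subtracting the linearization.\<close>

lemma smooth_on_C2_bounds:
 fixes f :: "'a::euclidean_space => 'b::real_normed_vector"
 assumes f: "smooth_on S f" and K: "compact K" "K \<subseteq> S" "convex K"
 obtains C where "C > 0"
  "\<And>x y h. x \<in> K ==> y \<in> K ==>
    norm (frechet_derivative f (at y) h - frechet_derivative f (at x) h) \<le> C * norm (y - x) * norm h"
  "\<And>x y. x \<in> K ==> y \<in> K ==>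
    norm (f y - f x - frechet_derivative f (at x) (y - x)) \<le> C * (norm (y - x))^2"
proof -
 let ?D = "\<lambda>x. frechet_derivative f (at x)"
 have "\<exists>C>0. \<forall>x\<in>K. \<forall>y\<in>K. norm (?D y b - ?D x b) \<le> C * norm (y - x)" for b
  using smooth_on_lipschitz[OF smooth_on_derivD(1)[OF f] K] by metis
 then obtain C where C: "\<And>b. C b > 0" "\<And>b x y. x \<in> K ==> y \<in> K ==> norm (?D y b - ?D x b) \<le> C b * norm (y - x)"
  by metis
 define M where "M = (\<Sum>b\<in>Basis. C b)"
 have Mpos: "M \<ge> 0" unfolding M_def using C(1) by (simp add: sum_nonneg less_imp_le)
 have M: "norm (?D y b - ?D x b) \<le> M * norm (y - x)" if "x \<in> K" "y \<in> K" "b \<in> Basis" for x y b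
 proof -
  have "C b \<le> M" unfolding M_def using C(1) that(3) by (intro member_le_sum) (auto simp: less_imp_le)
  then show ?thesis using C(2)[OF that(1,2), of b] by (meson mult_right_mono norm_ge_zero order_trans)
 qed
 define N where "N = DIM('a) * M + 1"
 have lin: "linear (?D x)" if "x \<in> K" for x
  using that K(2) linear_frechet_derivative[OF smooth_on_derivD(2)[OF f]] by blast
 have 1: "norm (?D y h - ?D x h) \<le> N * norm (y - x) * norm h" if "x \<in> K" "y \<in> K" for x y h
 proof -
  have "linear (\<lambda>h. ?D y h - ?D x h)" using lin that by (intro linear_compose_sub) auto
  from norm_linear_le_Basis[OF this M[OF that]]
  have "norm (?D y h - ?D x h) \<le> (DIM('a) * (M * norm (y-x))) * norm h" .
  also have "\<dots> \<le> N * norm (y - x) * norm h" unfolding N_def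
   by (intro mult_right_mono) (auto simp: algebra_simps)
  finally show ?thesis .
 qed
 have Npos: "N > 0" unfolding N_def using Mpos by (simp add: add_nonneg_pos)
 have 2: "norm (f y - f x - ?D x (y - x)) \<le> N * (norm (y - x))^2" if "x \<in> K" "y \<in> K" for x y
 proof -
  have seg: "closed_segment x y \<subseteq> K" using that K(3) by (simp add: closed_segment_subset)
  have "norm (f y - f x - ?D x (y - x)) \<le> norm (y - x) * (N * norm (y - x))"
  proof (rule differentiable_bound_linearization[where S = "closed_segment x y" and f' = ?D])
   show "x + t *\<^sub>R (y - x) \<in> closed_segment x y" if "t \<in> {0..1}" for t
    using that by (auto simp: closed_segment_def algebra_simps intro!: exI[of _ t])
   show "(f has_derivative ?D z) (at z within closed_segment x y)" if "z \<in> closed_segment x y" for z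
    using smooth_on_has_derivative[OF f] that seg K(2) has_derivative_at_withinI by blast
   show "onorm (?D z - ?D x) \<le> N * norm (y - x)" if z: "z \<in> closed_segment x y" for z
   proof (rule onorm_bound)
    show "norm ((?D z - ?D x) h) \<le> N * norm (y - x) * norm h" for h
    proof -
     have "norm (z - x) \<le> norm (y - x)"
      using segment_bound(1)[OF z] by (simp add: norm_minus_commute)
     then show ?thesis
      using 1[of x z h] that seg \<open>x \<in> K\<close> Npos
      by (simp add: subset_iff)
       (smt (verit, best) mult_left_mono mult_right_mono norm_ge_zero)
    qed
   qed (use Npos in auto)
  qed auto
  then show ?thesis by (simp add: power2_eq_square algebra_simps)
 qed
 show thesis using that[OF Npos 1 2] by blast
qed

text \<open>\<open>a\<close> and \<open>b\<close> are the first and second derivative at 0. The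
  first derivative must exist near 0, the second only at 0: this survives composition and still
  decides the sign of \<open>b\<close> at a maximum, while nothing has to be known about continuity
  of second derivatives.\<close>

definition has_d2 :: "(real => real) => real => real => bool" where
 "has_d2 G a b \<longleftrightarrow> (\<exists>g. (\<forall>\<^sub>F s in nhds 0. (G has_real_derivative g s) (at s)) \<and> g 0 = a \<and>
   (g has_real_derivative b) (at 0))"

lemma has_d2_const [simp]: "has_d2 (\<lambda>_. c) 0 0"
 unfolding has_d2_def by (rule exI[of _ "\<lambda>_. 0"]) auto

lemma has_d2_add:
 assumes "has_d2 G a b" "has_d2 H c d"
 shows "has_d2 (\<lambda>s. G s + H s) (a + c) (b + d)"
proof -
 obtain g h where "\<forall>\<^sub>F s in nhds 0. (G has_real_derivative g s) (at s)" "g 0 = a" "(g has_real_derivative b) (at 0)"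
  "\<forall>\<^sub>F s in nhds 0. (H has_real_derivative h s) (at s)" "h 0 = c" "(h has_real_derivative d) (at 0)"
  using assms unfolding has_d2_def by blast
 then show ?thesis unfolding has_d2_def
  by (intro exI[of _ "\<lambda>s. g s + h s"]) (auto intro!: derivative_eq_intros elim: eventually_elim2)
qed

lemma has_d2_compose:
 assumes "has_d2 G a b" "\<forall>\<^sub>F y in nhds (G 0). (h has_real_derivative h1 y) (at y)"
  "(h1 has_real_derivative h2) (at (G 0))"
 shows "has_d2 (\<lambda>s. h (G s)) (h1 (G 0) * a) (h2 * a^2 + h1 (G 0) * b)"
proof -
 obtain g where *: "\<forall>\<^sub>F s in nhds 0. (G has_real_derivative g s) (at s)" "g 0 = a" "(g has_real_derivative b) (at 0)"
  using assms unfolding has_d2_def by blast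
 have 0: "(G has_real_derivative g 0) (at 0)" using *(1) eventually_nhds_x_imp_x by blast
 have "(G \<longlongrightarrow> G 0) (nhds 0)"
  using DERIV_isCont[OF 0] by (simp add: isCont_def tendsto_nhds_iff)
 then have ev: "\<forall>\<^sub>F s in nhds 0. (h has_real_derivative h1 (G s)) (at (G s))"
  using eventually_compose_filterlim[OF assms(2)] by blast
 show ?thesis unfolding has_d2_def
 proof (intro exI[of _ "\<lambda>s. h1 (G s) * g s"] conjI)
  show "\<forall>\<^sub>F s in nhds 0. ((\<lambda>s. h (G s)) has_real_derivative h1 (G s) * g s) (at s)"
   using *(1) ev by eventually_elim (rule DERIV_chain2)
  have "((\<lambda>s. h1 (G s)) has_real_derivative h2 * g 0) (at 0)" by (rule DERIV_chain2[OF assms(3) 0])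
  then show "((\<lambda>s. h1 (G s) * g s) has_real_derivative h2 * a^2 + h1 (G 0) * b) (at 0)"
   using *(2,3) by (auto intro!: derivative_eq_intros simp: power2_eq_square)
 qed (use * in auto)
qed

lemma has_d2_cong:
 assumes "has_d2 G a b" "\<forall>\<^sub>F s in nhds 0. G s = H s"
 shows "has_d2 H a b"
proof -
 obtain g where *: "\<forall>\<^sub>F s in nhds 0. (G has_real_derivative g s) (at s)" "g 0 = a" "(g has_real_derivative b) (at 0)"
  using assms unfolding has_d2_def by blast
 have "\<forall>\<^sub>F s in nhds 0. \<forall>\<^sub>F t in nhds s. G t = H t" using assms(2) by (simp add: eventually_eventually)
 with *(1) have "\<forall>\<^sub>F s in nhds 0. (H has_real_derivative g s) (at s)"
  by eventually_elim (use DERIV_cong_ev in blast)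
 with * show ?thesis unfolding has_d2_def by blast
qed

text \<open>If \<open>b\<close> were positive, the derivative, which vanishes at the maximum, would
  be positive just to the right of 0, and the function would increase there.\<close>

lemma has_d2_max_le:
 assumes "has_d2 G a b" "\<forall>\<^sub>F s in nhds 0. G s \<le> G 0"
 shows "b \<le> 0"
proof (rule ccontr)
 assume "\<not> b \<le> 0" then have b: "b > 0" by simp
 obtain g where g: "\<forall>\<^sub>F s in nhds 0. (G has_real_derivative g s) (at s)" "g 0 = a" "(g has_real_derivative b) (at 0)"
  using assms unfolding has_d2_def by blast
 have 0: "(G has_real_derivative g 0) (at 0)" using g(1) eventually_nhds_x_imp_x by blast
 obtain d where d: "d > 0" "\<And>s. \<bar>s\<bar> < d ==> G s \<le> G 0" "\<And>s. \<bar>s\<bar> < d ==> (G has_real_derivative g s) (at s)"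
  using eventually_conj[OF assms(2) g(1)] by (auto simp: eventually_nhds_metric dist_real_def)
 have "g 0 = 0" using DERIV_local_max[OF 0 d(1)] d(2) by auto
 with DERIV_pos_inc_right[OF g(3) b] obtain e where e: "e > 0" "\<And>h. 0 < h ==> h < e ==> 0 < g h" by auto
 define h where "h = min d e / 2"
 have h: "h > 0" "h < d" "h < e" using d e unfolding h_def by auto
 have cont: "continuous_on {0..h} G"
 proof (intro continuous_at_imp_continuous_on ballI)
  show "isCont G s" if "s \<in> {0..h}" for s using DERIV_isCont[OF d(3)[of s]] h that by auto
 qed
 have "G 0 < G h"
  by (rule DERIV_pos_imp_increasing_open[OF h(1) _ cont]) (use d(3) e(2) h in force)
 with d(2)[of h] h show False by auto
qed

lemma has_d2_line:
 fixes F :: "'a::euclidean_space => real"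
 assumes "\<forall>\<^sub>F y in nhds x. (F has_derivative (\<lambda>h. g y \<bullet> h)) (at y)" "(g has_derivative H) (at x)"
 shows "has_d2 (\<lambda>s. F (x + s *\<^sub>R e)) (g x \<bullet> e) (H e \<bullet> e)"
 unfolding has_d2_def
proof (intro exI[of _ "\<lambda>s. g (x + s *\<^sub>R e) \<bullet> e"] conjI)
 have "((\<lambda>s::real. x + s *\<^sub>R e) \<longlongrightarrow> x + 0 *\<^sub>R e) (nhds 0)"
  by (intro tendsto_intros) (simp add: filterlim_ident)
 then have "\<forall>\<^sub>F s in nhds 0. (F has_derivative (\<lambda>h. g (x + s *\<^sub>R e) \<bullet> h)) (at (x + s *\<^sub>R e))"
  using eventually_compose_filterlim[OF assms(1)] by fastforce
 then show "\<forall>\<^sub>F s in nhds 0. ((\<lambda>s. F (x + s *\<^sub>R e)) has_real_derivative g (x + s *\<^sub>R e) \<bullet> e) (at s)"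
 proof eventually_elim
  case (elim s)
  have "((\<lambda>s. F (x + s *\<^sub>R e)) has_derivative (\<lambda>h. g (x + s *\<^sub>R e) \<bullet> (h *\<^sub>R e))) (at s)"
   by (rule has_derivative_compose[where f = "\<lambda>s. x + s *\<^sub>R e" and f' = "\<lambda>h. h *\<^sub>R e", OF _ elim])
    (auto intro!: derivative_eq_intros)
  then show ?case by (simp add: has_field_derivative_def mult_commute_abs)
 qed
 have "(g has_derivative H) (at (x + 0 *\<^sub>R e))" using assms(2) by simp
 then have "((\<lambda>s. g (x + s *\<^sub>R e)) has_derivative (\<lambda>h. H (h *\<^sub>R e))) (at 0)"
  by (rule has_derivative_compose[where f = "\<lambda>s. x + s *\<^sub>R e" and f' = "\<lambda>h. h *\<^sub>R e", rotated])
   (auto intro!: derivative_eq_intros)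
 then have "((\<lambda>s. g (x + s *\<^sub>R e) \<bullet> e) has_derivative (\<lambda>h. H (h *\<^sub>R e) \<bullet> e)) (at 0)"
  by (rule has_derivative_inner_left)
 moreover have "linear H" using assms(2) has_derivative_linear by blast
 ultimately show "((\<lambda>s. g (x + s *\<^sub>R e) \<bullet> e) has_real_derivative H e \<bullet> e) (at 0)"
  by (simp add: has_field_derivative_def linear_cmul mult_commute_abs)
qed simp

text \<open>\<open>has_jet F x G L\<close>: along the coordinate lines through \<open>x\<close> the function has second derivatives;
 \<open>G\<close> is the squared length of the gradient and \<open>L\<close> the Laplacian.\<close>

definition has_jet :: "('a::euclidean_space => real) => 'a => real => real => bool" where
 "has_jet F x G L \<longleftrightarrow> (\<exists>a b. (\<forall>e\<in>Basis. has_d2 (\<lambda>s. F (x + s *\<^sub>R e)) (a e) (b e)) \<and>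
   G = (\<Sum>e\<in>Basis. (a e)^2) \<and> L = (\<Sum>e\<in>Basis. b e))"

text \<open>The squared gradient of a sum contains the inner product of the two gradients, which a
  jet does not record; hence only the Laplacian is given explicitly.\<close>

lemma has_jet_add:
 assumes "has_jet F x G L" "has_jet F' x G' L'"
 shows "\<exists>G''. has_jet (\<lambda>y. F y + F' y) x G'' (L + L')"
proof -
 obtain a b a' b' where "\<forall>e\<in>Basis. has_d2 (\<lambda>s. F (x + s *\<^sub>R e)) (a e) (b e)" "L = (\<Sum>e\<in>Basis. b e)"
  "\<forall>e\<in>Basis. has_d2 (\<lambda>s. F' (x + s *\<^sub>R e)) (a' e) (b' e)" "L' = (\<Sum>e\<in>Basis. b' e)"
  using assms unfolding has_jet_def by blast
 then show ?thesis unfolding has_jet_def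
  by (intro exI[of _ "\<Sum>e\<in>Basis. (a e + a' e)^2"] exI[of _ "\<lambda>e. a e + a' e"] exI[of _ "\<lambda>e. b e + b' e"])
   (auto simp: sum.distrib intro: has_d2_add)
qed

lemma has_jet_const: "has_jet (\<lambda>_. c) x 0 0"
 unfolding has_jet_def by (intro exI[of _ "\<lambda>_. 0"]) auto

lemma has_jet_compose:
 fixes F :: "'a::euclidean_space => real"
 assumes "has_jet F x G L" "\<forall>\<^sub>F y in nhds (F x). (h has_real_derivative h1 y) (at y)"
  "(h1 has_real_derivative h2) (at (F x))"
 shows "has_jet (\<lambda>y. h (F y)) x ((h1 (F x))^2 * G) (h2 * G + h1 (F x) * L)"
proof -
 obtain a b where *: "\<And>e. e \<in> Basis ==> has_d2 (\<lambda>s. F (x + s *\<^sub>R e)) (a e) (b e)"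
  "G = (\<Sum>e\<in>Basis. (a e)^2)" "L = (\<Sum>e\<in>Basis. b e)"
  using assms unfolding has_jet_def by blast
 have "has_d2 (\<lambda>s. h (F (x + s *\<^sub>R e))) (h1 (F x) * a e) (h2 * (a e)^2 + h1 (F x) * b e)"
  if "e \<in> Basis" for e
  using has_d2_compose[OF *(1)[OF that], of h h1 h2] assms by simp
 moreover have "(h1 (F x))^2 * G = (\<Sum>e\<in>Basis. (h1 (F x) * a e)^2)"
  "h2 * G + h1 (F x) * L = (\<Sum>e\<in>Basis. h2 * (a e)^2 + h1 (F x) * b e)"
  by (auto simp: * sum_distrib_left sum.distrib power_mult_distrib)
 ultimately have "\<exists>b. (\<forall>e\<in>Basis. has_d2 (\<lambda>s. h (F (x + s *\<^sub>R e))) (h1 (F x) * a e) (b e)) \<and>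
   (h1 (F x))^2 * G = (\<Sum>e\<in>Basis. (h1 (F x) * a e)^2) \<and> h2 * G + h1 (F x) * L = (\<Sum>e\<in>Basis. b e)"
  by (intro exI[of _ "\<lambda>e. h2 * (a e)^2 + h1 (F x) * b e"]) simp
 then show ?thesis unfolding has_jet_def by (rule exI[of _ "\<lambda>e. h1 (F x) * a e"])
qed

lemma has_jet_cmult:
 assumes "has_jet F x G L" shows "has_jet (\<lambda>y. k * F y) x (k^2 * G) (k * L)"
 using has_jet_compose[OF assms, of "\<lambda>y. k * y" "\<lambda>_. k" 0] by (auto intro!: derivative_eq_intros)

lemma has_jet_cong:
 assumes "has_jet F x G L" "\<forall>\<^sub>F y in nhds x. F y = F' y"
 shows "has_jet F' x G L"
proof -
 obtain a b where *: "\<And>e. e \<in> Basis ==> has_d2 (\<lambda>s. F (x + s *\<^sub>R e)) (a e) (b e)"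
  "G = (\<Sum>e\<in>Basis. (a e)^2)" "L = (\<Sum>e\<in>Basis. b e)"
  using assms unfolding has_jet_def by blast
 have "has_d2 (\<lambda>s. F' (x + s *\<^sub>R e)) (a e) (b e)" if "e \<in> Basis" for e
 proof (rule has_d2_cong[OF *(1)[OF that]])
  have "((\<lambda>s::real. x + s *\<^sub>R e) \<longlongrightarrow> x + 0 *\<^sub>R e) (nhds 0)"
   by (intro tendsto_intros) (simp add: filterlim_ident)
  then show "\<forall>\<^sub>F s in nhds 0. F (x + s *\<^sub>R e) = F' (x + s *\<^sub>R e)"
   using eventually_compose_filterlim[OF assms(2)] by fastforce
 qed
 with * show ?thesis unfolding has_jet_def by blast
qed

lemma has_jet_gradient:
 fixes F :: "'a::euclidean_space => real"
 assumes "\<forall>\<^sub>F y in nhds x. (F has_derivative (\<lambda>h. g y \<bullet> h)) (at y)" "(g has_derivative H) (at x)"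
 shows "has_jet F x (g x \<bullet> g x) (\<Sum>e\<in>Basis. H e \<bullet> e)"
 unfolding has_jet_def
 by (intro exI[of _ "\<lambda>e. g x \<bullet> e"] exI[of _ "\<lambda>e. H e \<bullet> e"])
  (auto intro: has_d2_line[OF assms] simp: euclidean_inner[of "g x" "g x"] power2_eq_square)

lemma has_jet_max_le:
 assumes "has_jet F x G L" "\<forall>\<^sub>F y in nhds x. F y \<le> F x"
 shows "L \<le> 0"
proof -
 obtain a b where *: "\<And>e. e \<in> Basis ==> has_d2 (\<lambda>s. F (x + s *\<^sub>R e)) (a e) (b e)" "L = (\<Sum>e\<in>Basis. b e)"
  using assms unfolding has_jet_def by blast
 have "b e \<le> 0" if "e \<in> Basis" for e
 proof (rule has_d2_max_le[OF *(1)[OF that]])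
  have "((\<lambda>s::real. x + s *\<^sub>R e) \<longlongrightarrow> x + 0 *\<^sub>R e) (nhds 0)"
   by (intro tendsto_intros) (simp add: filterlim_ident)
  then show "\<forall>\<^sub>F s in nhds 0. F (x + s *\<^sub>R e) \<le> F (x + 0 *\<^sub>R e)"
   using eventually_compose_filterlim[OF assms(2)] by fastforce
 qed
 then show ?thesis using * by (simp add: sum_nonpos)
qed

section \<open>Charts of the moving hypersurface\<close>

lemma gradient_of_has_derivative:
 fixes F :: "'a::euclidean_space => real"
 assumes "(F has_derivative (\<lambda>h. w \<bullet> h)) (at x)"
 shows "grad F x = w"
 unfolding grad_def using frechet_derivative_at[OF assms]
 by (metis (mono_tags, lifting) euclidean_representation sum.cong)

lemma has_derivative_grad:
 fixes F :: "'a::euclidean_space => real"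
 assumes "F differentiable (at x)"
 shows "(F has_derivative (\<lambda>h. grad F x \<bullet> h)) (at x)"
proof -
 have d: "(F has_derivative frechet_derivative F (at x)) (at x)" using assms frechet_derivative_works by blast
 have "frechet_derivative F (at x) h = grad F x \<bullet> h" for h
 proof -
  have "frechet_derivative F (at x) h = frechet_derivative F (at x) (\<Sum>i\<in>Basis. (h \<bullet> i) *\<^sub>R i)"
   by (simp add: euclidean_representation)
  also have "\<dots> = (\<Sum>i\<in>Basis. (h \<bullet> i) * frechet_derivative F (at x) i)"
   using has_derivative_linear[OF d] by (simp add: linear_sum linear_cmul)
  also have "\<dots> = grad F x \<bullet> h" unfolding grad_def
   by (simp add: inner_sum_left inner_commute[of h] mult.commute)
  finally show ?thesis .
 qed
 then have "frechet_derivative F (at x) = (\<lambda>h. grad F x \<bullet> h)" by (rule ext)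
 with d show ?thesis by simp
qed

lemma dist_Pair_le:
 fixes a c :: "'a::real_normed_vector" and b d :: "'b::real_normed_vector"
 shows "dist (a, b) (c, d) \<le> dist a c + dist b d"
 unfolding dist_norm using norm_Pair_le[of "a - c" "b - d"] by simp

lemma side_of_connected_component:
 assumes "connected_component (- M) x y"
 shows "x \<in> inside M \<longleftrightarrow> y \<in> inside M" "x \<in> outside M \<longleftrightarrow> y \<in> outside M"
 using assms connected_component_sym[OF assms] inside_same_component outside_same_component by metis+

locale limit_flow =
 fixes \<Omega> :: "'a::euclidean_space set" and c0 T :: real and \<Gamma>0 :: "'a set" and \<Gamma> :: "real => 'a set"
 assumes open_Omega: "open \<Omega>" and bounded_Omega: "bounded \<Omega>" and T_pos: "T > 0"
  and limit: "limit_problem_solution \<Omega> c0 \<Gamma>0 T \<Gamma>"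
begin

definition track :: "('a \<times> real) set" where "track = {(x, t). t \<in> {0..T} \<and> x \<in> \<Gamma> t}"

text \<open>Quantitative form of the local description of the family: \<open>g\<close> and
  \<open>q\<close> are the spatial gradient and the time derivative of \<open>\<phi>\<close>, and
  the single constant \<open>C\<close> bounds \<open>g\<close> from both sides, \<open>q\<close>,
  the Lipschitz constant of \<open>g\<close> and the second order Taylor remainder. The function
  lives on a full space-time ball, also at times outside \<open>{0..T}\<close>, where its zero set
  has no meaning.\<close>

definition chart :: "'a => real => real => ('a \<times> real => real) => ('a \<times> real => 'a) =>
  ('a \<times> real => real) => real => bool" where
 "chart p t \<rho> \<phi> g q C \<longleftrightarrow> \<rho> > 0 \<and> C > 0 \<and>
   (\<forall>z\<in>cball (p, t) \<rho>.
    (\<phi> has_derivative (\<lambda>(h, k). g z \<bullet> h + q z * k)) (at z) \<and>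
    1 / C \<le> norm (g z) \<and> norm (g z) \<le> C \<and> \<bar>q z\<bar> \<le> C \<and>
    (\<lambda>y. g (y, snd z)) differentiable (at (fst z)) \<and>
    (\<forall>z'\<in>cball (p, t) \<rho>.
      \<bar>\<phi> z' - \<phi> z - (g z \<bullet> (fst z' - fst z) + q z * (snd z' - snd z))\<bar> \<le> C * (norm (z' - z))^2 \<and>
      norm (g z' - g z) \<le> C * norm (z' - z)) \<and>
    (snd z \<in> {0..T} --> (fst z \<in> \<Gamma> (snd z) \<longleftrightarrow> \<phi> z = 0)))"

lemma compact_track: "compact track"
 using limit unfolding limit_problem_solution_def smooth_hypersurface_family_def track_def by blast

lemma
 assumes "t \<in> {0..T}"
 shows compact_Gamma: "compact (\<Gamma> t)" and Gamma_nonempty: "\<Gamma> t \<noteq> {}" and Gamma_subset: "\<Gamma> t \<subseteq> \<Omega>"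
 using limit assms
 unfolding limit_problem_solution_def smooth_hypersurface_family_def smooth_closed_hypersurface_def by blast+

lemma moving_point:
 assumes "t \<in> {0..T}" "x \<in> \<Gamma> t"
 obtains \<gamma> v n where "\<gamma> t = x" "\<And>s. s \<in> {0..T} ==> \<gamma> s \<in> \<Gamma> s"
  "(\<gamma> has_vector_derivative v) (at t within {0..T})"
  "exterior_unit_normal (inner_region \<Omega> (\<Gamma> t)) x n"
  "v \<bullet> n = - mean_curvature \<Omega> (\<Gamma> t) x + c0 * (measure lebesgue (outer_region \<Omega> (\<Gamma> t))
          - measure lebesgue (inner_region \<Omega> (\<Gamma> t)))"
proof -
 obtain n where n: "exterior_unit_normal (inner_region \<Omega> (\<Gamma> t)) x n"
  "has_normal_velocity T \<Gamma> t x n (- mean_curvature \<Omega> (\<Gamma> t) x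
    + c0 * (measure lebesgue (outer_region \<Omega> (\<Gamma> t)) - measure lebesgue (inner_region \<Omega> (\<Gamma> t))))"
  using limit assms unfolding limit_problem_solution_def by blast
 from n(2) obtain \<gamma> v where "\<gamma> t = x" "\<forall>s\<in>{0..T}. \<gamma> s \<in> \<Gamma> s"
  "(\<gamma> has_vector_derivative v) (at t within {0..T})"
  "- mean_curvature \<Omega> (\<Gamma> t) x + c0 * (measure lebesgue (outer_region \<Omega> (\<Gamma> t))
    - measure lebesgue (inner_region \<Omega> (\<Gamma> t))) = v \<bullet> n"
  unfolding has_normal_velocity_def by blast
 with n(1) show thesis using that by simp
qed

text \<open>On a closed ball inside the domain of \<open>\<phi>\<close> the nonvanishing spatial
  gradient attains a positive minimum, and the smoothness bounds are finite by compactness;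
  \<open>C\<close> is the sum of all these constants.\<close>

lemma chart_exists:
 assumes "t \<in> {0..T}" "p \<in> \<Gamma> t"
 obtains \<rho> \<phi> g q C where "chart p t \<rho> \<phi> g q C"
proof -
 have all: "\<forall>t\<in>{0..T}. \<forall>x\<in>\<Gamma> t. \<exists>U \<phi>. open U \<and> (x, t) \<in> U \<and> smooth_on U \<phi> \<and>
    (\<forall>(y, s)\<in>U. grad (\<lambda>z. \<phi> (z, s)) y \<noteq> 0) \<and>
    (\<forall>(y, s)\<in>U. s \<in> {0..T} --> (y \<in> \<Gamma> s \<longleftrightarrow> \<phi> (y, s) = 0))"
  using limit unfolding limit_problem_solution_def smooth_hypersurface_family_def by (elim conjE)
 from bspec[OF bspec[OF all assms(1)] assms(2)] obtain U \<phi> where U0: "open U" "(p, t) \<in> U" "smooth_on U \<phi>"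
   "\<forall>(y, s)\<in>U. grad (\<lambda>z. \<phi> (z, s)) y \<noteq> 0"
   "\<forall>(y, s)\<in>U. s \<in> {0..T} --> (y \<in> \<Gamma> s \<longleftrightarrow> \<phi> (y, s) = 0)"
  by (elim exE conjE) (rule that)
 have U: "open U" "(p, t) \<in> U" "smooth_on U \<phi>"
   "\<And>y s. (y, s) \<in> U ==> grad (\<lambda>z. \<phi> (z, s)) y \<noteq> 0"
   "\<And>y s. (y, s) \<in> U ==> s \<in> {0..T} ==> (y \<in> \<Gamma> s \<longleftrightarrow> \<phi> (y, s) = 0)"
  using U0 by (auto simp: split_beta)
 obtain \<rho> where \<rho>: "\<rho> > 0" "cball (p, t) \<rho> \<subseteq> U" using U(1,2) open_contains_cball by blast
 let ?Z = "cball (p, t) \<rho>"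
 let ?D = "\<lambda>z. frechet_derivative \<phi> (at z)"
 define g where "g z = (\<Sum>i\<in>Basis. ?D z (i, 0) *\<^sub>R i)" for z
 define q where "q z = ?D z (0, 1)" for z
 have D: "?D z = (\<lambda>(h, k). g z \<bullet> h + q z * k)" if "z \<in> U" for z
 proof (rule ext, clarify)
  fix h :: 'a and k :: real
  interpret linear "?D z"
   using smooth_on_derivD(2)[OF U(3) that] linear_frechet_derivative by blast
  have "?D z (h, k) = ?D z ((h, 0) + k *\<^sub>R (0, 1))" by simp
  also have "\<dots> = ?D z (h, 0) + k * q z" unfolding q_def by (simp only: add scale real_scaleR_def)
  also have "(h, 0::real) = (\<Sum>i\<in>Basis. (h \<bullet> i) *\<^sub>R (i, 0))"
   by (rule prod_eqI) (simp_all add: fst_sum snd_sum euclidean_representation)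
  also have "?D z \<dots> = (\<Sum>i\<in>Basis. (h \<bullet> i) * ?D z (i, 0))" by (simp only: sum scale real_scaleR_def)
  also have "\<dots> = g z \<bullet> h" unfolding g_def
   by (simp add: inner_sum_left inner_commute[of h] mult.commute)
  finally show "?D z (h, k) = g z \<bullet> h + q z * k" by simp
 qed
 have der: "(\<phi> has_derivative (\<lambda>(h, k). g z \<bullet> h + q z * k)) (at z)" if "z \<in> U" for z
  using smooth_on_has_derivative[OF U(3) that] D[OF that] by simp
 have gnz: "g z \<noteq> 0" if z: "z \<in> U" for z
 proof -
  obtain y s where ys: "z = (y, s)" by fastforce
  have "((\<lambda>w. \<phi> (w, s)) has_derivative (\<lambda>h. (\<lambda>(h, k). g z \<bullet> h + q z * k) (h, 0))) (at y)"
   by (rule has_derivative_compose[where f = "\<lambda>w. (w, s)" and f' = "\<lambda>h. (h, 0)"])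
    (use der[OF z] ys in \<open>auto intro!: derivative_eq_intros\<close>)
  then have "grad (\<lambda>w. \<phi> (w, s)) y = g z" by (intro gradient_of_has_derivative) simp
  with U(4) z ys show ?thesis by metis
 qed
 have cK: "compact ?Z" "?Z \<subseteq> U" "convex ?Z" using \<rho> by auto
 obtain C1 where C1: "C1 > 0" "\<And>x h. x \<in> ?Z ==> norm (?D x h) \<le> C1 * norm h"
  using smooth_on_derivative_bounded[OF U(3) cK(1,2)] by blast
 obtain C2 where C2: "C2 > 0"
  "\<And>x y h. x \<in> ?Z ==> y \<in> ?Z ==> norm (?D y h - ?D x h) \<le> C2 * norm (y - x) * norm h"
  "\<And>x y. x \<in> ?Z ==> y \<in> ?Z ==> norm (\<phi> y - \<phi> x - ?D x (y - x)) \<le> C2 * (norm (y - x))^2"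
  using smooth_on_C2_bounds[OF U(3) cK] by blast
 have gb: "norm (g z) \<le> DIM('a) * C1" if "z \<in> ?Z" for z
 proof -
  have "norm (g z) \<le> (\<Sum>i\<in>Basis. norm (?D z (i, 0) *\<^sub>R i))" unfolding g_def by (rule norm_sum)
  also have "\<dots> \<le> (\<Sum>i\<in>(Basis::'a set). C1)"
  proof (rule sum_mono)
   fix i :: 'a assume "i \<in> Basis"
   then show "norm (?D z (i, 0) *\<^sub>R i) \<le> C1" using C1(2)[OF that, of "(i, 0)"] by simp
  qed
  finally show ?thesis by simp
 qed
 have qb: "\<bar>q z\<bar> \<le> C1" if "z \<in> ?Z" for z
  using C1(2)[OF that, of "(0, 1)"] unfolding q_def by simp
 have gl: "norm (g z' - g z) \<le> (DIM('a) * C2) * norm (z' - z)" if "z \<in> ?Z" "z' \<in> ?Z" for z z'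
 proof -
  have eq: "g z' - g z = (\<Sum>i\<in>Basis. (?D z' (i, 0) - ?D z (i, 0)) *\<^sub>R i)"
   unfolding g_def by (simp add: sum_subtractf scaleR_diff_left)
  have "norm (g z' - g z) \<le> (\<Sum>i\<in>Basis. norm ((?D z' (i, 0) - ?D z (i, 0)) *\<^sub>R i))"
   unfolding eq by (rule norm_sum)
  also have "\<dots> \<le> (\<Sum>i\<in>(Basis::'a set). C2 * norm (z' - z))"
  proof (rule sum_mono)
   fix i :: 'a assume "i \<in> Basis"
   then show "norm ((?D z' (i, 0) - ?D z (i, 0)) *\<^sub>R i) \<le> C2 * norm (z' - z)"
    using C2(2)[OF that, of "(i, 0)"] by simp
  qed
  finally show ?thesis by simp
 qed
 have gdiff: "(\<lambda>y. g (y, snd z)) differentiable (at (fst z))" if "z \<in> ?Z" for z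
 proof -
  have "(\<lambda>y. ?D (y, snd z) (i, 0)) differentiable (at (fst z))" for i :: 'a
  proof -
   have "z \<in> U" using that \<rho> by blast
   from smooth_on_derivD(2)[OF smooth_on_derivD(1)[OF U(3)] this, of "(i, 0)"]
   obtain D' where D': "((\<lambda>z. ?D z (i, 0)) has_derivative D') (at z)"
    unfolding differentiable_def by (rule exE)
   have "((\<lambda>w. (w, snd z)) has_derivative (\<lambda>h. (h, 0))) (at (fst z))"
    by (auto intro!: derivative_eq_intros)
   from has_derivative_compose[OF this, of "\<lambda>z. ?D z (i, 0)" D'] D'
   have "((\<lambda>y. ?D (y, snd z) (i, 0)) has_derivative (\<lambda>h. D' (h, 0))) (at (fst z))"
    by simp
   then show ?thesis by (auto simp: differentiable_def)
  qed
  then show ?thesis unfolding g_def by (intro differentiable_sum differentiable_scaleR) auto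
 qed
 have "continuous_on ?Z (\<lambda>z. norm (g z))"
 proof (intro continuous_intros)
  have "continuous_on ?Z (\<lambda>z. ?D z (i, 0))" for i :: 'a
   using smooth_on_derivD(3)[OF smooth_on_derivD(1)[OF U(3)]] cK(2) continuous_on_subset by blast
  then show "continuous_on ?Z g" unfolding g_def by (intro continuous_intros)
 qed
 then obtain z0 where z0: "z0 \<in> ?Z" "\<And>z. z \<in> ?Z ==> norm (g z0) \<le> norm (g z)"
  using continuous_attains_inf[OF cK(1)] \<rho>(1) by force
 have m: "norm (g z0) > 0" using gnz[OF subsetD[OF cK(2) z0(1)]] by simp
 define C where "C = 1 / norm (g z0) + DIM('a) * C1 + C1 + DIM('a) * C2 + C2"
 have Cge: "1 / norm (g z0) \<le> C" "DIM('a) * C1 \<le> C" "C1 \<le> C" "DIM('a) * C2 \<le> C" "C2 \<le> C" "C > 0"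
  unfolding C_def using m C1(1) C2(1) by (auto simp: add_pos_nonneg add_nonneg_pos)
 have "chart p t \<rho> \<phi> g q C" unfolding chart_def
 proof (intro conjI ballI impI)
  fix z assume z: "z \<in> ?Z"
  then have zU: "z \<in> U" using cK by blast
  show "(\<phi> has_derivative (\<lambda>(h, k). g z \<bullet> h + q z * k)) (at z)" by (rule der[OF zU])
  have "1 / C \<le> norm (g z0)" using Cge(1,6) m by (simp add: field_simps)
  then show "1 / C \<le> norm (g z)" using z0(2)[OF z] by linarith
  show "norm (g z) \<le> C" "\<bar>q z\<bar> \<le> C" using gb[OF z] qb[OF z] Cge by linarith+
  show "(\<lambda>y. g (y, snd z)) differentiable (at (fst z))" by (rule gdiff[OF z])
  show "fst z \<in> \<Gamma> (snd z) \<longleftrightarrow> \<phi> z = 0" if "snd z \<in> {0..T}"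
   using U(5)[of "fst z" "snd z"] that zU by simp
  fix z' assume z': "z' \<in> ?Z"
  show "norm (g z' - g z) \<le> C * norm (z' - z)"
   using gl[OF z z'] Cge(4) by (meson mult_right_mono norm_ge_zero order_trans)
  have "norm (\<phi> z' - \<phi> z - ?D z (z' - z)) \<le> C2 * (norm (z' - z))^2" by (rule C2(3)[OF z z'])
  also have "\<dots> \<le> C * (norm (z' - z))^2" using Cge by (intro mult_right_mono) auto
  finally show "\<bar>\<phi> z' - \<phi> z - (g z \<bullet> (fst z' - fst z) + q z * (snd z' - snd z))\<bar> \<le> C * (norm (z' - z))^2"
   by (simp add: D[OF zU] case_prod_beta)
 qed (use \<rho> Cge in auto)
 then show thesis by (rule that)
qed

lemma chart_mono:
 assumes "chart p t \<rho> \<phi> g q C" "0 < \<rho>'" "\<rho>' \<le> \<rho>"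
 shows "chart p t \<rho>' \<phi> g q C"
proof -
 have "cball (p, t) \<rho>' \<subseteq> cball (p, t) \<rho>" using assms(3) by auto
 with assms(1,2) show ?thesis unfolding chart_def by (meson subsetD)
qed

lemma chart_uminus:
 assumes "chart p t \<rho> \<phi> g q C"
 shows "chart p t \<rho> (\<lambda>z. - \<phi> z) (\<lambda>z. - g z) (\<lambda>z. - q z) C"
 unfolding chart_def
proof (intro conjI ballI impI)
 fix z assume z: "z \<in> cball (p, t) \<rho>"
 have "((\<lambda>z. - \<phi> z) has_derivative (\<lambda>x. - (case x of (h, k) => g z \<bullet> h + q z * k))) (at z)"
  using assms z unfolding chart_def by (intro has_derivative_minus) blast
 then show "((\<lambda>z. - \<phi> z) has_derivative (\<lambda>(h, k). - g z \<bullet> h + - q z * k)) (at z)"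
  by (rule has_derivative_eq_rhs) (auto simp: fun_eq_iff)
 show "(\<lambda>y. - g (y, snd z)) differentiable (at (fst z))"
  using assms z unfolding chart_def by (intro differentiable_minus) blast
 fix z' assume z': "z' \<in> cball (p, t) \<rho>"
 have "norm (g z' - g z) \<le> C * norm (z' - z)"
   "\<bar>\<phi> z' - \<phi> z - (g z \<bullet> (fst z' - fst z) + q z * (snd z' - snd z))\<bar> \<le> C * (norm (z' - z))^2"
  using assms z z' unfolding chart_def by blast+
 then show "norm (- g z' - - g z) \<le> C * norm (z' - z)"
  "\<bar>- \<phi> z' - - \<phi> z - (- g z \<bullet> (fst z' - fst z) + - q z * (snd z' - snd z))\<bar> \<le> C * (norm (z' - z))^2"
  unfolding inner_minus_left by (simp_all add: norm_minus_commute)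
qed (use assms in \<open>auto simp: chart_def\<close>)

end

section \<open>Inside and outside near the moving hypersurface; orientation of charts\<close>

context limit_flow
begin

text \<open>Compactness of the space-time track is used here: \<open>P \<times> {t}\<close> and the
  track are disjoint compact sets, so they have positive distance, and no component of the
  hypersurface can appear suddenly.\<close>

lemma avoid_persists:
 assumes "t \<in> {0..T}" "compact P" "P \<inter> \<Gamma> t = {}"
 obtains d where "d > 0" "\<And>s x y. s \<in> {0..T} ==> \<bar>s - t\<bar> < d ==> x \<in> P ==> dist y x < d ==> y \<notin> \<Gamma> s"
proof -
 have "(P \<times> {t}) \<inter> track = {}" using assms(3) by (auto simp: track_def)
 then obtain e where e: "e > 0" "\<And>z w. z \<in> P \<times> {t} ==> w \<in> track ==> e \<le> dist z w"
  using separate_compact_closed[of "P \<times> {t}" track] compact_Times[OF assms(2) compact_sing[of t]]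
   compact_imp_closed[OF compact_track] by blast
 show thesis
 proof (rule that[of "e/2"])
  fix s x y assume *: "s \<in> {0..T}" "\<bar>s - t\<bar> < e/2" "x \<in> P" "dist y x < e/2"
  have "dist (x, t) (y, s) < e"
   using dist_Pair_le[of x t y s] * by (simp add: dist_commute dist_real_def)
  with e(2)[of "(x, t)" "(y, s)"] * show "y \<notin> \<Gamma> s" by (auto simp: track_def)
 qed (use e in auto)
qed

text \<open>A path joining \<open>x\<close> and \<open>y\<close> off the hypersurface is compact and
  thus keeps avoiding it for nearby times; a short segment joins \<open>x'\<close> to its starting
  point.\<close>

lemma connect_persists:
 assumes "t \<in> {0..T}" "connected_component (- \<Gamma> t) x y"
 obtains d where "d > 0" "\<And>s x'. s \<in> {0..T} ==> \<bar>s - t\<bar> < d ==> dist x' x < d ==>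
   connected_component (- \<Gamma> s) x' y"
proof -
 have "open (- \<Gamma> t)" using compact_imp_closed[OF compact_Gamma[OF assms(1)]] by (rule open_Compl)
 from open_path_connected_component[OF this] have "path_component (- \<Gamma> t) x y" using assms(2) by simp
 then obtain g where g: "path g" "path_image g \<subseteq> - \<Gamma> t" "pathstart g = x" "pathfinish g = y"
  unfolding path_component_def by blast
 obtain d where d: "d > 0" "\<And>s x y. s \<in> {0..T} ==> \<bar>s - t\<bar> < d ==> x \<in> path_image g ==> dist y x < d ==> y \<notin> \<Gamma> s"
  using avoid_persists[OF assms(1) compact_path_image[OF g(1)]] g(2) by blast
 show thesis
 proof (rule that[OF d(1)])
  fix s x' assume *: "s \<in> {0..T}" "\<bar>s - t\<bar> < d" "dist x' x < d"
  have xg: "x \<in> path_image g" "y \<in> path_image g" using g(3,4) by auto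
  let ?S = "closed_segment x' x \<union> path_image g"
  have "connected ?S"
   using xg by (intro connected_Un connected_path_image g) auto
  moreover have "z \<notin> \<Gamma> s" if "z \<in> ?S" for z
  proof (cases "z \<in> path_image g")
   case True then show ?thesis using d(2)[OF *(1,2) True, of z] d(1) by simp
  next
   case False
   then have "z \<in> closed_segment x' x" using that by auto
   then have "dist z x \<le> dist x' x" by (metis dist_commute dist_in_closed_segment)
   then show ?thesis using d(2)[OF *(1,2) xg(1), of z] * by simp
  qed
  ultimately show "connected_component (- \<Gamma> s) x' y"
   unfolding connected_component_def using xg by (intro exI[of _ ?S]) auto
 qed
qed

text \<open>A point outside can be joined to a point \<open>y\<close> farther away than the whole
  track reaches. Such a \<open>y\<close> is outside at every time, and the joining path
  survives.\<close>

lemma outside_persists: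
 assumes "t \<in> {0..T}" "x \<in> outside (\<Gamma> t)"
 obtains d where "d > 0" "\<And>s y. s \<in> {0..T} ==> \<bar>s - t\<bar> < d ==> dist y x < d ==> y \<in> outside (\<Gamma> s)"
proof -
 obtain R where R: "\<And>z. z \<in> track ==> norm z \<le> R"
  using compact_imp_bounded[OF compact_track] by (auto simp: bounded_iff)
 have R': "norm y \<le> R" if "s \<in> {0..T}" "y \<in> \<Gamma> s" for y s
  using R[of "(y, s)"] that norm_fst_le[of y s] by (auto simp: track_def)
 have "\<not> bounded (connected_component_set (- \<Gamma> t) x)" using assms(2) by (simp add: outside)
 then obtain y where y: "connected_component (- \<Gamma> t) x y" "norm y > R"
  unfolding bounded_iff by (meson mem_Collect_eq not_le)
 obtain d where d: "d > 0" "\<And>s x'. s \<in> {0..T} ==> \<bar>s - t\<bar> < d ==> dist x' x < d ==>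
   connected_component (- \<Gamma> s) x' y"
  using connect_persists[OF assms(1) y(1)] by blast
 show thesis
 proof (rule that[OF d(1)])
  fix s x' assume *: "s \<in> {0..T}" "\<bar>s - t\<bar> < d" "dist x' x < d"
  have "\<Gamma> s \<subseteq> cball 0 R" using R'[OF *(1)] by auto
  then have "y \<in> outside (\<Gamma> s)" using outside_subset_convex[of "cball 0 R" "\<Gamma> s"] y(2) by auto
  with d(2)[OF *] show "x' \<in> outside (\<Gamma> s)" using side_of_connected_component(2) by metis
 qed
qed

text \<open>\<open>a\<close> is one base point representing the positive side of the chart at all
  nearby times at once. No claim is made yet whether this side is inside or outside.\<close>

definition reached :: "'a => 'a => real => real => ('a \<times> real => real) => bool" where
 "reached a p t \<rho> \<phi> \<longleftrightarrow> (\<forall>s\<in>{0..T}. \<bar>s - t\<bar> \<le> \<rho> --> a \<notin> \<Gamma> s) \<and>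
   (\<forall>s\<in>{0..T}. \<forall>y. (y, s) \<in> cball (p, t) \<rho> --> \<phi> (y, s) > 0 --> connected_component (- \<Gamma> s) y a)"

lemma reached_mono: "reached a p t \<rho> \<phi> ==> \<rho>' \<le> \<rho> ==> reached a p t \<rho>' \<phi>"
 unfolding reached_def mem_cball by (meson order_trans)

lemma reachedD:
 assumes "reached a p t \<rho> \<phi>" "s \<in> {0..T}"
 shows "\<bar>s - t\<bar> \<le> \<rho> ==> a \<notin> \<Gamma> s"
  "(y, s) \<in> cball (p, t) \<rho> ==> \<phi> (y, s) > 0 ==> connected_component (- \<Gamma> s) y a"
 using assms unfolding reached_def by blast+

text \<open>Near \<open>(p, t)\<close> the function \<open>\<phi>\<close> increases along the fixed
  direction \<open>e\<close> of its gradient at \<open>(p, t)\<close>. Any point with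
  \<open>\<phi> > 0\<close> can thus be lifted along \<open>e\<close> by the height \<open>h\<close>
  without meeting the zero set, and at that height all points of the ball are on the positive
  side.\<close>

lemma chart_half:
 assumes ch: "chart p t \<rho> \<phi> g q C" and t: "t \<in> {0..T}" "p \<in> \<Gamma> t"
 obtains \<rho>' a where "0 < \<rho>'" "\<rho>' \<le> \<rho>" "reached a p t \<rho>' \<phi>"
proof -
 have C: "C > 0" "\<rho> > 0" using ch unfolding chart_def by auto
 \<comment> \<open>With this radius the gradient varies by at most \<open>1 / (2 * C)\<close>, half
   of its lower bound, so its component along \<open>e\<close> stays positive.\<close>
 define \<rho>1 where "\<rho>1 = min \<rho> (1 / (2 * C^2))"
 have \<rho>1: "\<rho>1 > 0" "\<rho>1 \<le> \<rho>" "C * \<rho>1 \<le> 1 / (2 * C)"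
  unfolding \<rho>1_def using C by (auto simp: min_def field_simps power2_eq_square)
 have ch1: "chart p t \<rho>1 \<phi> g q C" using chart_mono[OF ch \<rho>1(1,2)] .
 let ?B = "cball (p, t) \<rho>1"
 have pt: "(p, t) \<in> ?B" using \<rho>1 by simp
 have gpt: "norm (g (p, t)) \<ge> 1 / C" using ch1 pt unfolding chart_def by blast
 then have gpt0: "norm (g (p, t)) > 0" using C by (smt (verit) divide_pos_pos)
 define e where "e = g (p, t) /\<^sub>R norm (g (p, t))"
 have ne: "norm e = 1" unfolding e_def using gpt0 by simp
 define m where "m = 1 / (2 * C)"
 have m: "m > 0" unfolding m_def using C by simp
 have ge: "g z \<bullet> e \<ge> m" if "z \<in> ?B" for z
 proof -
  have "norm (g z - g (p, t)) \<le> C * norm (z - (p, t))" using ch1 pt that unfolding chart_def by blast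
  also have "\<dots> \<le> C * \<rho>1" using that C by (intro mult_left_mono) (auto simp: dist_norm norm_minus_commute)
  finally have "norm (g z - g (p, t)) \<le> m" using \<rho>1(3) unfolding m_def by linarith
  then have "\<bar>(g z - g (p, t)) \<bullet> e\<bar> \<le> m" using Cauchy_Schwarz_ineq2[of "g z - g (p, t)" e] ne by simp
  moreover have "g (p, t) \<bullet> e = norm (g (p, t))" unfolding e_def
   using gpt0 by (simp add: power2_norm_eq_inner[symmetric] power2_eq_square field_simps)
  moreover have "1 / C = 2 * m" unfolding m_def by simp
  ultimately show ?thesis using gpt by (simp add: inner_diff_left)
 qed
 have mono: "\<phi> (y + h *\<^sub>R e, s) \<ge> \<phi> (y, s) + m * h"
  if "(y, s) \<in> ?B" "(y + h *\<^sub>R e, s) \<in> ?B" "h \<ge> 0" for y s h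
 proof -
  define F where "F r = \<phi> (y + r *\<^sub>R e, s) - m * r" for r
  have "F 0 \<le> F h"
  proof (rule DERIV_nonneg_imp_nondecreasing[OF that(3)])
   fix r assume r: "0 \<le> r" "r \<le> h"
   have "(y + r *\<^sub>R e, s) \<in> ?B"
   proof (cases "h = 0")
    case False
    then have "(y + r *\<^sub>R e, s) = (1 - r/h) *\<^sub>R (y, s) + (r/h) *\<^sub>R (y + h *\<^sub>R e, s)"
     by (simp add: algebra_simps)
    then show ?thesis using convexD[OF convex_cball that(1,2), of "1 - r/h" "r/h"] r False by (simp add: field_simps)
   qed (use r that in auto)
   then have *: "(\<phi> has_derivative (\<lambda>(h, k). g (y + r *\<^sub>R e, s) \<bullet> h + q (y + r *\<^sub>R e, s) * k)) (at (y + r *\<^sub>R e, s))"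
    "g (y + r *\<^sub>R e, s) \<bullet> e \<ge> m"
    using ch1 ge unfolding chart_def by blast+
   have "((\<lambda>r. (y + r *\<^sub>R e, s)) has_derivative (\<lambda>k. (k *\<^sub>R e, 0))) (at r)"
    by (auto intro!: derivative_eq_intros)
   from has_derivative_compose[OF this *(1)]
   have "((\<lambda>r. \<phi> (y + r *\<^sub>R e, s)) has_real_derivative g (y + r *\<^sub>R e, s) \<bullet> e) (at r)"
    by (simp add: has_field_derivative_def mult.commute[of _ "g _ \<bullet> e"] mult_commute_abs)
   then have "(F has_real_derivative (g (y + r *\<^sub>R e, s) \<bullet> e - m)) (at r)"
    unfolding F_def by (auto intro!: derivative_eq_intros)
   then show "\<exists>y. (F has_real_derivative y) (at r) \<and> 0 \<le> y" using *(2) by (intro exI conjI) auto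
  qed
  then show ?thesis unfolding F_def by simp
 qed
 define h where "h = \<rho>1 / 2"
 have h: "h > 0" unfolding h_def using \<rho>1 by simp
 have \<phi>0: "\<phi> (p, t) = 0" using ch1 pt t unfolding chart_def by (metis fst_conv snd_conv)
 have top: "(p + h *\<^sub>R e, t) \<in> ?B" using dist_Pair_le[of p t "p + h *\<^sub>R e" t] ne h \<rho>1(1)
  unfolding h_def by (simp add: dist_norm)
 have "\<phi> (p + h *\<^sub>R e, t) > 0" using mono[OF pt top] \<phi>0 m h by (smt (verit) mult_pos_pos)
 moreover have "isCont \<phi> (p + h *\<^sub>R e, t)"
  using ch1 top unfolding chart_def by (meson has_derivative_continuous)
 then have "isCont (\<lambda>z. \<phi> (z + (h *\<^sub>R e, 0))) (p, t)"
  by (intro continuous_at_compose[of _ "\<lambda>z. z + (h *\<^sub>R e, 0)" \<phi>, unfolded o_def]) auto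
 ultimately have "\<forall>\<^sub>F z in nhds (p, t). \<phi> (z + (h *\<^sub>R e, 0)) > 0"
  by (auto simp: isCont_def eventually_nhds_conv_at dest!: order_tendstoD(1))
 then obtain d where d: "d > 0" "\<And>z. dist z (p, t) < d ==> \<phi> (z + (h *\<^sub>R e, 0)) > 0"
  unfolding eventually_nhds_metric by blast
 define \<rho>' where "\<rho>' = min (\<rho>1 / 2) (d / 2)"
 have \<rho>': "\<rho>' > 0" "\<rho>' \<le> \<rho>1/2" "\<rho>' < d" unfolding \<rho>'_def using \<rho>1 d by auto
 have inB: "(y + r *\<^sub>R e, s) \<in> ?B" if "(y, s) \<in> cball (p, t) \<rho>'" "0 \<le> r" "r \<le> h" for y s r
 proof -
  have "dist (p, t) (y + r *\<^sub>R e, s) \<le> dist (p, t) (y, s) + dist (y, s) (y + r *\<^sub>R e, s)" by (rule dist_triangle)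
  also have "dist (y, s) (y + r *\<^sub>R e, s) \<le> h" using dist_Pair_le[of y s "y + r *\<^sub>R e" s] that ne by (simp add: dist_norm)
  finally show ?thesis using that(1) \<rho>'(2) unfolding h_def by simp
 qed
 have topp: "\<phi> (y + h *\<^sub>R e, s) > 0" if "(y, s) \<in> cball (p, t) \<rho>'" for y s
  using d(2)[of "(y, s)"] that \<rho>'(3) by (simp add: dist_commute)
 have zero: "y \<in> \<Gamma> s \<longleftrightarrow> \<phi> (y, s) = 0" if "(y, s) \<in> ?B" "s \<in> {0..T}" for y s
  using ch1 that unfolding chart_def by (metis fst_conv snd_conv)
 show thesis
 proof (rule that[of \<rho>' "p + h *\<^sub>R e"], goal_cases _ _ R)
  case R
  show ?case unfolding reached_def
  proof (intro conjI ballI allI impI)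
  fix s assume s: "s \<in> {0..T}" "\<bar>s - t\<bar> \<le> \<rho>'"
  have "(p, s) \<in> cball (p, t) \<rho>'" using s dist_Pair_le[of p t p s] by (simp add: dist_real_def)
  then show "p + h *\<^sub>R e \<notin> \<Gamma> s" using zero[OF inB s(1)] topp h by fastforce
 next
  fix s y assume z: "s \<in> {0..T}" "(y, s) \<in> cball (p, t) \<rho>'" "\<phi> (y, s) > 0"
  have ps: "(p, s) \<in> cball (p, t) \<rho>'" using z(2) dist_snd_le[of "(p, t)" "(y, s)"] dist_Pair_le[of p t p s] by simp
  \<comment> \<open>The path goes up along \<open>e\<close> and then across at height
    \<open>h\<close> to the lifted center, which is the base point.\<close>
  let ?S = "closed_segment y (y + h *\<^sub>R e) \<union> closed_segment (y + h *\<^sub>R e) (p + h *\<^sub>R e)"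
  have "connected ?S" by (intro connected_Un) auto
  moreover have "w \<notin> \<Gamma> s" if "w \<in> ?S" for w
  proof (cases "w \<in> closed_segment y (y + h *\<^sub>R e)")
   case True
   then obtain u where u: "0 \<le> u" "u \<le> 1" "w = y + (u * h) *\<^sub>R e"
    by (auto simp: closed_segment_def algebra_simps)
   have uh: "0 \<le> u * h" "u * h \<le> h" using u h by (auto simp: mult_left_le_one_le)
   have "\<phi> (w, s) > 0"
    using mono[of y s "u * h"] inB[of y s "u*h"] inB[of y s 0] z u(3) uh m h
    by (smt (verit) add.right_neutral mult_nonneg_nonneg scaleR_zero_left)
   moreover have "(w, s) \<in> ?B" using inB[of y s "u * h"] z u(3) uh by simp
   ultimately show ?thesis using zero[of w s] z(1) by auto
  next
   case False
   then have "w \<in> closed_segment (y + h *\<^sub>R e) (p + h *\<^sub>R e)" using that by blast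
   then obtain u where u: "0 \<le> u" "u \<le> 1" "w = (1 - u) *\<^sub>R (y + h *\<^sub>R e) + u *\<^sub>R (p + h *\<^sub>R e)"
    by (auto simp: closed_segment_def)
   define w' where "w' = (1 - u) *\<^sub>R y + u *\<^sub>R p"
   have w: "w = w' + h *\<^sub>R e" unfolding u(3) w'_def by (simp add: algebra_simps)
   have "(w', s) = (1 - u) *\<^sub>R (y, s) + u *\<^sub>R (p, s)" unfolding w'_def by (simp add: algebra_simps)
   then have "(w', s) \<in> cball (p, t) \<rho>'"
    using convexD[OF convex_cball, of "(y, s)" "(p, t)" \<rho>' "(p, s)" "1 - u" u] z(2) ps u by simp
   then show ?thesis using topp[of w' s] zero[OF inB[of w' s h]] z(1) w h by auto
  qed
  ultimately show "connected_component (- \<Gamma> s) y (p + h *\<^sub>R e)"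
   unfolding connected_component_def by (intro exI[of _ ?S]) auto
  qed
 qed (use \<rho>' \<rho>1 in auto)
qed

text \<open>On an open piece of the hypersurface the chart function would vanish identically, and
  with it its spatial gradient.\<close>

lemma Gamma_no_interior:
 assumes "t \<in> {0..T}" "p \<in> \<Gamma> t" "open V" "p \<in> V"
 shows "\<not> V \<subseteq> \<Gamma> t"
proof
 assume V: "V \<subseteq> \<Gamma> t"
 obtain \<rho> \<phi> g q C where ch: "chart p t \<rho> \<phi> g q C" using chart_exists[OF assms(1,2)] .
 have \<rho>: "\<rho> > 0" "C > 0" and pt: "(p, t) \<in> cball (p, t) \<rho>" using ch unfolding chart_def by auto
 have der: "(\<phi> has_derivative (\<lambda>(h, k). g (p, t) \<bullet> h + q (p, t) * k)) (at (p, t))" and g: "1 / C \<le> norm (g (p, t))"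
  using ch pt unfolding chart_def by blast+
 have "((\<lambda>y. (y, t)) has_derivative (\<lambda>h. (h, 0))) (at p)" by (auto intro!: derivative_eq_intros)
 from has_derivative_compose[OF this der]
 have 1: "((\<lambda>y. \<phi> (y, t)) has_derivative (\<lambda>h. g (p, t) \<bullet> h)) (at p)" by simp
 have "\<phi> (y, t) = 0" if "y \<in> V \<inter> ball p \<rho>" for y
 proof -
  have "(y, t) \<in> cball (p, t) \<rho>" using that dist_Pair_le[of p t y t] by simp
  then show ?thesis using ch assms(1) that V unfolding chart_def
   by (metis IntD1 fst_conv snd_conv subsetD)
 qed
 then have "\<forall>\<^sub>F y in nhds p. \<phi> (y, t) = 0"
  using assms(3,4) \<rho> by (intro eventually_nhds[THEN iffD2] exI[of _ "V \<inter> ball p \<rho>"]) auto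
 then have "((\<lambda>y. \<phi> (y, t)) has_derivative (\<lambda>h. 0)) (at p)"
  by - (rule has_derivative_transform_eventually[where f = "\<lambda>_. 0"],
    auto simp: eventually_nhds_conv_at elim: eventually_mono)
 from has_derivative_unique[OF 1 this] have "g (p, t) \<bullet> g (p, t) = 0" by (rule fun_cong)
 then show False using g \<rho>(2) by (simp add: field_simps)
qed

definition oriented_chart :: "'a => real => real => ('a \<times> real => real) => ('a \<times> real => 'a) =>
  ('a \<times> real => real) => real => bool" where
 "oriented_chart p t \<rho> \<phi> g q C \<longleftrightarrow> chart p t \<rho> \<phi> g q C \<and>
   (\<forall>z\<in>cball (p, t) \<rho>. snd z \<in> {0..T} -->
    (fst z \<in> inside (\<Gamma> (snd z)) \<longleftrightarrow> \<phi> z < 0) \<and> (fst z \<in> outside (\<Gamma> (snd z)) \<longleftrightarrow> \<phi> z > 0))"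

text \<open>Otherwise \<open>p\<close> would be a local maximum of \<open>\<psi>\<close>, since
  \<open>\<psi> p\<close> is nonnegative off \<open>A\<close>, and the gradient would vanish
  there.\<close>

lemma local_defining_function_positive_nearby:
 assumes "local_defining_function A p V \<psi>" "p \<notin> A" "open W" "p \<in> W"
 shows "\<exists>y\<in>V \<inter> W. \<psi> y > 0"
proof (rule ccontr)
 assume neg: "\<not> ?thesis"
 have V: "open V" "p \<in> V" "smooth_on V \<psi>" "grad \<psi> p \<noteq> 0" "A \<inter> V = {x\<in>V. \<psi> x < 0}"
  using assms(1) unfolding local_defining_function_def by auto
 have "\<psi> p \<ge> 0" using V assms(2) by force
 obtain r where r: "r > 0" "ball p r \<subseteq> V \<inter> W"
  using open_Int[OF V(1) assms(3)] V(2) assms(4) by (meson IntI open_contains_ball)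
 have der: "(\<psi> has_derivative frechet_derivative \<psi> (at p)) (at p)"
  by (rule smooth_on_has_derivative[OF V(3,2)])
 have "frechet_derivative \<psi> (at p) = (\<lambda>v. 0)"
 proof (rule differential_zero_maxmin[OF _ _ der])
  show "p \<in> ball p r" "open (ball p r)" using r by auto
  have "\<forall>y\<in>ball p r. \<psi> y \<le> \<psi> p"
  proof
   fix y assume "y \<in> ball p r"
   then have "\<not> 0 < \<psi> y" using neg r(2) by blast
   with \<open>\<psi> p \<ge> 0\<close> show "\<psi> y \<le> \<psi> p" by linarith
  qed
  then show "(\<forall>y\<in>ball p r. \<psi> y \<le> \<psi> p) \<or> (\<forall>y\<in>ball p r. \<psi> p \<le> \<psi> y)" ..
 qed
 then have "grad \<psi> p = 0" unfolding grad_def by simp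
 with V(4) show False ..
qed

text \<open>The motion law provides an exterior normal of the inner region, hence a defining
  function \<open>\<psi>\<close> at \<open>p\<close>. If both sides were inside, the open set
  \<open>\<psi> > 0\<close> near \<open>p\<close> could contain only points of the hypersurface,
  which has no interior. If both were outside, the inner region would have no points near
  \<open>p\<close>, although \<open>p\<close> lies on its frontier.\<close>

lemma chart_sides_differ:
 assumes s: "s \<in> {0..T}" "p \<in> \<Gamma> s" and V: "open V" "p \<in> V" "V \<subseteq> \<Omega>"
  and sides: "\<And>y. y \<in> V ==> y \<notin> \<Gamma> s ==> connected_component (- \<Gamma> s) y a \<or> connected_component (- \<Gamma> s) y b"
 shows "\<not> (a \<in> inside (\<Gamma> s) \<and> b \<in> inside (\<Gamma> s))" "\<not> (a \<in> outside (\<Gamma> s) \<and> b \<in> outside (\<Gamma> s))"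
proof -
 let ?I = "inner_region \<Omega> (\<Gamma> s)"
 obtain n where "exterior_unit_normal ?I p n" using moving_point[OF s] by metis
 then obtain V' \<psi> where \<psi>: "local_defining_function ?I p V' \<psi>" and fr: "p \<in> frontier ?I"
  unfolding exterior_unit_normal_def by blast
 have pI: "p \<notin> ?I" using s(2) inside_no_overlap unfolding inner_region_def by blast
 show "\<not> (a \<in> inside (\<Gamma> s) \<and> b \<in> inside (\<Gamma> s))"
 proof
  assume ab: "a \<in> inside (\<Gamma> s) \<and> b \<in> inside (\<Gamma> s)"
  have V': "open V'" "smooth_on V' \<psi>" "?I \<inter> V' = {x\<in>V'. \<psi> x < 0}"
   using \<psi> unfolding local_defining_function_def by auto
  obtain y where y: "y \<in> V' \<inter> V" "\<psi> y > 0"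
   using local_defining_function_positive_nearby[OF \<psi> pI V(1,2)] by blast
  have *: "z \<in> \<Gamma> s" if "z \<in> V' \<inter> V" "\<psi> z > 0" for z
  proof (rule ccontr)
   assume "z \<notin> \<Gamma> s"
   with sides[of z] that ab have "z \<in> inside (\<Gamma> s)" using side_of_connected_component(1) by (metis IntD2)
   then have "z \<in> ?I" using that V(3) unfolding inner_region_def by blast
   with V'(3) that show False by force
  qed
  have "open {z \<in> V'. 0 < \<psi> z}"
   using continuous_open_preimage[OF smooth_on_derivD(3)[OF V'(2)] V'(1), of "{0<..}"]
   by (simp add: vimage_def Int_def)
  then have "open ({z \<in> V'. 0 < \<psi> z} \<inter> V)" using V(1) by blast
  from Gamma_no_interior[OF s(1) _ this, of y] * y show False by blast
 qed
 show "\<not> (a \<in> outside (\<Gamma> s) \<and> b \<in> outside (\<Gamma> s))"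
 proof
  assume ab: "a \<in> outside (\<Gamma> s) \<and> b \<in> outside (\<Gamma> s)"
  have "p \<in> closure ?I" using fr by (simp add: frontier_def)
  then obtain y where y: "y \<in> ?I" "y \<in> V" using V(1,2) by (meson closure_iff_nhds_not_empty disjoint_iff subset_refl)
  then have "y \<in> inside (\<Gamma> s)" "y \<notin> \<Gamma> s" using inside_no_overlap unfolding inner_region_def by blast+
  moreover from this(2) have "y \<in> outside (\<Gamma> s)"
   using sides[OF y(2)] ab side_of_connected_component(2) by metis
  ultimately show False using inside_Int_outside by blast
 qed
qed

text \<open>The positive side stays outside for nearby times because
  \<open>outside_persists\<close>; that the negative side is then inside cannot be inherited in the
  same way and is decided anew at each time by \<open>chart_sides_differ\<close>.\<close>

lemma orient_chart:
 assumes ch: "chart p t \<rho> \<phi> g q C" and t: "t \<in> {0..T}" "p \<in> \<Gamma> t"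
  and \<rho>: "cball p \<rho> \<subseteq> \<Omega>"
  and ab: "reached a p t \<rho> \<phi>" "reached b p t \<rho> (\<lambda>z. - \<phi> z)"
  and out: "a \<in> outside (\<Gamma> t)"
 shows "\<exists>\<rho>'>0. oriented_chart p t \<rho>' \<phi> g q C"
proof -
 note a = reachedD[OF ab(1)] and b = reachedD[OF ab(2)]
 have \<rho>0: "\<rho> > 0" using ch unfolding chart_def by simp
 have zero: "y \<in> \<Gamma> s \<longleftrightarrow> \<phi> (y, s) = 0" if "(y, s) \<in> cball (p, t) \<rho>" "s \<in> {0..T}" for y s
  using ch that unfolding chart_def by (metis fst_conv snd_conv)
 obtain d1 where d1: "d1 > 0" "\<And>s y. s \<in> {0..T} ==> \<bar>s - t\<bar> < d1 ==> dist y a < d1 ==> y \<in> outside (\<Gamma> s)"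
  using outside_persists[OF t(1) out] by blast
 \<comment> \<open>The moving point through \<open>p\<close> supplies a point of
   \<open>\<Gamma> s\<close> within the chart at every nearby time \<open>s\<close>, where the two
   sides can be compared.\<close>
 obtain \<gamma> v n where \<gamma>: "\<gamma> t = p" "\<And>s. s \<in> {0..T} ==> \<gamma> s \<in> \<Gamma> s"
  "(\<gamma> has_vector_derivative v) (at t within {0..T})" using moving_point[OF t] by metis
 have "continuous (at t within {0..T}) \<gamma>" by (rule has_vector_derivative_continuous[OF \<gamma>(3)])
 then obtain d2 where d2: "d2 > 0" "\<And>s. s \<in> {0..T} ==> \<bar>s - t\<bar> < d2 ==> dist (\<gamma> s) p < \<rho> / 2"
  using \<rho>0 \<gamma>(1) unfolding continuous_within_eps_delta dist_real_def by (metis half_gt_zero)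
 define \<rho>' where "\<rho>' = Min {\<rho> / 4, d1 / 2, d2 / 2}"
 have \<rho>': "\<rho>' > 0" "\<rho>' \<le> \<rho> / 4" "\<rho>' < d1" "\<rho>' < d2" unfolding \<rho>'_def using \<rho>0 d1(1) d2(1) by auto
 have sides: "(\<phi> (y, s) > 0 --> y \<in> outside (\<Gamma> s)) \<and> (\<phi> (y, s) < 0 --> y \<in> inside (\<Gamma> s))"
  if y: "(y, s) \<in> cball (p, t) \<rho>" and s: "s \<in> {0..T}" "\<bar>s - t\<bar> \<le> \<rho>'" for y s
 proof -
  have aout: "a \<in> outside (\<Gamma> s)" using d1(2)[of s a] s \<rho>' d1(1) by simp
  have sr: "\<bar>s - t\<bar> \<le> \<rho>" using s(2) \<rho>'(2) \<rho>0 by linarith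
  have "\<not> (a \<in> outside (\<Gamma> s) \<and> b \<in> outside (\<Gamma> s))"
  proof (rule chart_sides_differ(2)[OF s(1) \<gamma>(2)[OF s(1)]])
   show "open (ball p (\<rho>/2))" "\<gamma> s \<in> ball p (\<rho>/2)" "ball p (\<rho>/2) \<subseteq> \<Omega>"
    using d2(2)[OF s(1)] s(2) \<rho>' \<rho> \<rho>0 by (auto simp: dist_commute)
   fix w assume w: "w \<in> ball p (\<rho>/2)" "w \<notin> \<Gamma> s"
   have "(w, s) \<in> cball (p, t) \<rho>" using w(1) s(2) \<rho>'(2) dist_Pair_le[of p t w s] \<rho>0
    by (simp add: dist_real_def)
   with zero[of w s] w(2) a(2)[OF s(1), of w] b(2)[OF s(1), of w] s(1)
   show "connected_component (- \<Gamma> s) w a \<or> connected_component (- \<Gamma> s) w b"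
    by (metis linorder_neqE_linordered_idom neg_0_less_iff_less)
  qed
  then have bin: "b \<in> inside (\<Gamma> s)" using aout b(1)[OF s(1) sr] inside_Un_outside by blast
  show ?thesis using side_of_connected_component(2)[OF a(2)[OF s(1) y]] side_of_connected_component(1)[OF b(2)[OF s(1) y]] aout bin
   by auto
 qed
 have "oriented_chart p t \<rho>' \<phi> g q C" unfolding oriented_chart_def
 proof (intro conjI ballI impI)
  show "chart p t \<rho>' \<phi> g q C" using chart_mono[OF ch \<rho>'(1)] \<rho>'(2) \<rho>0 by linarith
  fix z assume z: "z \<in> cball (p, t) \<rho>'" "snd z \<in> {0..T}"
  obtain y s where ys: "z = (y, s)" by fastforce
  have *: "(y, s) \<in> cball (p, t) \<rho>" "\<bar>s - t\<bar> \<le> \<rho>'"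
   using z(1) ys \<rho>'(2) \<rho>0 dist_snd_le[of "(p, t)" z] by (auto simp: dist_real_def)
  have sT: "s \<in> {0..T}" using z(2) ys by simp
  have "y \<in> inside (\<Gamma> s) ==> y \<notin> outside (\<Gamma> s)" "y \<in> inside (\<Gamma> s) ==> y \<notin> \<Gamma> s"
   "y \<in> outside (\<Gamma> s) ==> y \<notin> \<Gamma> s"
   using inside_Int_outside inside_no_overlap outside_no_overlap by blast+
  then have "(y \<in> inside (\<Gamma> s) \<longleftrightarrow> \<phi> (y, s) < 0) \<and> (y \<in> outside (\<Gamma> s) \<longleftrightarrow> \<phi> (y, s) > 0)"
   using sides[OF *(1) sT *(2)] zero[OF *(1) sT] by (cases "\<phi> (y, s)" "0::real" rule: linorder_cases) auto
  then show "fst z \<in> inside (\<Gamma> (snd z)) \<longleftrightarrow> \<phi> z < 0" "fst z \<in> outside (\<Gamma> (snd z)) \<longleftrightarrow> \<phi> z > 0"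
   using ys by auto
 qed
 with \<rho>'(1) show ?thesis by blast
qed

text \<open>One of the two sides at time \<open>t\<close> is outside; if it is the negative one, the
  sign of the chart function is reversed.\<close>

theorem oriented_chart_exists:
 assumes t: "t \<in> {0..T}" "p \<in> \<Gamma> t"
 obtains \<rho> \<phi> g q C where "oriented_chart p t \<rho> \<phi> g q C"
proof -
 obtain \<rho>0 \<phi> g q C where ch0: "chart p t \<rho>0 \<phi> g q C" using chart_exists[OF t] .
 obtain r where r: "r > 0" "cball p r \<subseteq> \<Omega>" using open_Omega Gamma_subset[OF t(1)] t(2) by (meson open_contains_cball subsetD)
 have ch1: "chart p t (min \<rho>0 r) \<phi> g q C"
  by (rule chart_mono[OF ch0]) (use ch0 r in \<open>auto simp: chart_def\<close>)
 obtain \<rho>1 a where 1: "0 < \<rho>1" "\<rho>1 \<le> min \<rho>0 r" "reached a p t \<rho>1 \<phi>" using chart_half[OF ch1 t] .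
 obtain \<rho>2 b where 2: "0 < \<rho>2" "\<rho>2 \<le> min \<rho>0 r" "reached b p t \<rho>2 (\<lambda>z. - \<phi> z)"
  using chart_half[OF chart_uminus[OF ch1] t] .
 define \<rho> where "\<rho> = min \<rho>1 \<rho>2"
 have \<rho>: "\<rho> > 0" "\<rho> \<le> \<rho>1" "\<rho> \<le> \<rho>2" "\<rho> \<le> min \<rho>0 r" unfolding \<rho>_def using 1 2 by auto
 have ch: "chart p t \<rho> \<phi> g q C" using chart_mono[OF ch1 \<rho>(1,4)] .
 have sub: "cball p \<rho> \<subseteq> \<Omega>" using r(2) \<rho>(4) by force
 have A: "reached a p t \<rho> \<phi>" and B: "reached b p t \<rho> (\<lambda>z. - \<phi> z)"
  using reached_mono 1(3) 2(3) \<rho>(2,3) by blast+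
 have zero: "y \<in> \<Gamma> t \<longleftrightarrow> \<phi> (y, t) = 0" if "(y, t) \<in> cball (p, t) \<rho>" for y
  using ch that t(1) unfolding chart_def by (metis fst_conv snd_conv)
 have "\<not> (a \<in> inside (\<Gamma> t) \<and> b \<in> inside (\<Gamma> t))"
 proof (rule chart_sides_differ(1)[OF t])
  show "open (ball p \<rho>)" "p \<in> ball p \<rho>" "ball p \<rho> \<subseteq> \<Omega>" using \<rho>(1) sub by auto
  fix w assume w: "w \<in> ball p \<rho>" "w \<notin> \<Gamma> t"
  have "(w, t) \<in> cball (p, t) \<rho>" using w(1) dist_Pair_le[of p t w t] by simp
  with zero[of w] w(2) reachedD(2)[OF A t(1), of w] reachedD(2)[OF B t(1), of w]
  show "connected_component (- \<Gamma> t) w a \<or> connected_component (- \<Gamma> t) w b"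
   by (metis linorder_neqE_linordered_idom neg_0_less_iff_less)
 qed
 moreover have "a \<notin> \<Gamma> t" "b \<notin> \<Gamma> t" using reachedD(1)[OF A t(1)] reachedD(1)[OF B t(1)] \<rho>(1) by auto
 ultimately consider "a \<in> outside (\<Gamma> t)" | "b \<in> outside (\<Gamma> t)" using inside_Un_outside by blast
 then show thesis
 proof cases
  case 1
  from orient_chart[OF ch t sub A B 1] that show ?thesis by blast
 next
  case 2
  have "\<exists>\<rho>'>0. oriented_chart p t \<rho>' (\<lambda>z. - \<phi> z) (\<lambda>z. - g z) (\<lambda>z. - q z) C"
   by (rule orient_chart[OF chart_uminus[OF ch] t sub B _ 2]) (use A in simp)
  with that show ?thesis by blast
 qed
qed

text \<open>Boundedness of a component is not visibly stable under a change of the hypersurface.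
  Instead, the component of \<open>x\<close> has a frontier point on \<open>\<Gamma> t\<close>; an
  oriented chart there keeps a point \<open>y\<close> of the component inside for nearby times, and
  the path from \<open>x\<close> to \<open>y\<close> survives.\<close>

lemma inside_persists:
 assumes "t \<in> {0..T}" "x \<in> inside (\<Gamma> t)"
 obtains d where "d > 0" "\<And>s y. s \<in> {0..T} ==> \<bar>s - t\<bar> < d ==> dist y x < d ==> y \<in> inside (\<Gamma> s)"
proof -
 let ?C = "connected_component_set (- \<Gamma> t) x"
 have x: "x \<notin> \<Gamma> t" "bounded ?C" using assms(2) unfolding inside_def by auto
 have "x \<in> ?C" using x(1) by simp
 then have "frontier ?C \<noteq> {}" using frontier_eq_empty x(2) not_bounded_UNIV by (metis empty_iff)
 moreover have "frontier ?C \<subseteq> \<Gamma> t"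
  using frontier_of_connected_component_subset[of "- \<Gamma> t" x]
   frontier_subset_closed[OF compact_imp_closed[OF compact_Gamma[OF assms(1)]]]
  by (simp add: frontier_complement)
 ultimately obtain p where p: "p \<in> frontier ?C" "p \<in> \<Gamma> t" by blast
 obtain \<rho> \<phi> g q C where oc: "oriented_chart p t \<rho> \<phi> g q C" using oriented_chart_exists[OF assms(1) p(2)] .
 then have \<rho>: "\<rho> > 0" unfolding oriented_chart_def chart_def by simp
 have "p \<in> closure ?C" using p(1) by (simp add: frontier_def)
 then obtain y where y: "y \<in> ?C" "dist y p < \<rho>" using \<rho> closure_approachable by blast
 have yin: "y \<in> inside (\<Gamma> t)" using inside_same_component[of "\<Gamma> t" x y] y(1) assms(2) by simp
 have yb: "(y, t) \<in> ball (p, t) \<rho>" using y(2) dist_Pair_le[of p t y t] by (simp add: dist_commute)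
 then have "\<phi> (y, t) < 0" using oc yin assms(1) unfolding oriented_chart_def
  by (metis ball_subset_cball fst_conv snd_conv subsetD)
 moreover have "isCont \<phi> (y, t)" using oc yb unfolding oriented_chart_def chart_def
  by (meson ball_subset_cball has_derivative_continuous subsetD)
 ultimately have "\<forall>\<^sub>F z in nhds (y, t). \<phi> z < 0"
  by (auto simp: isCont_def eventually_nhds_conv_at dest!: order_tendstoD(2))
 moreover have "\<forall>\<^sub>F z in nhds (y, t). z \<in> ball (p, t) \<rho>" using yb by (rule eventually_nhds_in_open[OF open_ball])
 ultimately have "\<forall>\<^sub>F z in nhds (y, t). \<phi> z < 0 \<and> z \<in> ball (p, t) \<rho>" by (rule eventually_conj)
 then obtain d1 where d1: "d1 > 0" "\<And>z. dist z (y, t) < d1 ==> \<phi> z < 0 \<and> z \<in> ball (p, t) \<rho>"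
  unfolding eventually_nhds_metric by blast
 have yin': "y \<in> inside (\<Gamma> s)" if "s \<in> {0..T}" "\<bar>s - t\<bar> < d1" for s
 proof -
  have "dist (y, s) (y, t) < d1" using dist_Pair_le[of y s y t] that by (simp add: dist_real_def)
  with d1(2) oc that(1) show ?thesis unfolding oriented_chart_def
   by (metis ball_subset_cball fst_conv snd_conv subsetD)
 qed
 have "connected_component (- \<Gamma> t) x y" using y(1) by simp
 from connect_persists[OF assms(1) this]
 obtain d2 where d2: "d2 > 0" "\<And>s x'. s \<in> {0..T} ==> \<bar>s - t\<bar> < d2 ==> dist x' x < d2 ==>
   connected_component (- \<Gamma> s) x' y" by blast
 show thesis
 proof (rule that[of "min d1 d2"])
  fix s x' assume *: "s \<in> {0..T}" "\<bar>s - t\<bar> < min d1 d2" "dist x' x < min d1 d2"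
  then have "y \<in> inside (\<Gamma> s)" "connected_component (- \<Gamma> s) x' y"
   using yin'[of s] d2(2)[of s x'] by auto
  then show "x' \<in> inside (\<Gamma> s)" using side_of_connected_component(1) by metis
 qed (use d1 d2 in auto)
qed

end

section \<open>The signed distance near the moving hypersurface\<close>

text \<open>If the unit vectors differed, their difference would be a direction with negative
  product with \<open>a\<close> and positive product with \<open>b\<close>.\<close>

lemma normalized_eq_of_halfspace:
 fixes a b :: "'a::real_inner"
 assumes "a \<noteq> 0" "b \<noteq> 0" "\<And>h. a \<bullet> h < 0 ==> b \<bullet> h \<le> 0"
 shows "b /\<^sub>R norm b = a /\<^sub>R norm a"
proof (rule ccontr)
 define u w where "u = a /\<^sub>R norm a" and "w = b /\<^sub>R norm b"
 assume "b /\<^sub>R norm b \<noteq> a /\<^sub>R norm a"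
 then have ne: "w \<noteq> u" unfolding u_def w_def .
 have n: "norm u = 1" "norm w = 1" unfolding u_def w_def using assms by auto
 then have uw: "u \<bullet> u = 1" "w \<bullet> w = 1" by (auto simp: norm_eq_1)
 have "0 < (w - u) \<bullet> (w - u)" using ne by simp
 then have c: "u \<bullet> w < 1" using uw by (simp add: inner_diff inner_commute)
 have ab: "a = norm a *\<^sub>R u" "b = norm b *\<^sub>R w" unfolding u_def w_def using assms by auto
 have "a \<bullet> (w - u) = norm a * (u \<bullet> w - 1)" by (subst ab(1)) (simp add: inner_diff_right uw algebra_simps)
 also have "\<dots> < 0" using assms(1) c by (simp add: mult_less_0_iff)
 finally have "b \<bullet> (w - u) \<le> 0" by (rule assms(3))
 moreover have "b \<bullet> (w - u) = norm b * (1 - u \<bullet> w)"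
  by (subst ab(2)) (simp add: inner_diff_right uw inner_commute[of w u] algebra_simps)
 ultimately show False using assms(2) c by (simp add: mult_le_0_iff)
qed

lemma eventually_descent:
 fixes F :: "'a::real_inner => real"
 assumes "(F has_derivative (\<lambda>h. v \<bullet> h)) (at w)" "v \<bullet> h < 0"
 shows "\<forall>\<^sub>F r in at_right 0. F (w + r *\<^sub>R h) < F w"
proof -
 have "((\<lambda>r. w + r *\<^sub>R h) has_derivative (\<lambda>r. r *\<^sub>R h)) (at 0)" by (auto intro!: derivative_eq_intros)
 from has_derivative_compose[OF this, of F "\<lambda>h. v \<bullet> h"] assms(1)
 have "((\<lambda>r. F (w + r *\<^sub>R h)) has_real_derivative v \<bullet> h) (at 0)"
  by (simp add: has_field_derivative_def mult_commute_abs)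
 from DERIV_neg_dec_right[OF this assms(2)] show ?thesis unfolding eventually_at_right_field by auto
qed

lemma eventually_on_ray:
 fixes w h :: "'a::real_normed_vector"
 assumes "open S" "w \<in> S" shows "\<forall>\<^sub>F r in at_right 0. w + r *\<^sub>R h \<in> S"
proof -
 have "((\<lambda>r::real. w + r *\<^sub>R h) \<longlongrightarrow> w + 0 *\<^sub>R h) (at_right 0)" by (intro tendsto_intros)
 then show ?thesis using assms by (intro topological_tendstoD) auto
qed

text \<open>A descent direction of \<open>F\<close> cannot be an ascent direction of
  \<open>G\<close>, so the gradients are positively parallel. This identifies normals that come from
  different descriptions of the same surface: charts, touching balls and defining functions.\<close>

lemma normalized_eq_of_sublevel:
 fixes F G :: "'a::real_inner => real"
 assumes F: "(F has_derivative (\<lambda>h. v \<bullet> h)) (at w)" and G: "(G has_derivative (\<lambda>h. u \<bullet> h)) (at w)"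
  and ne: "v \<noteq> 0" "u \<noteq> 0" and sub: "\<forall>\<^sub>F y in nhds w. F y < F w --> G y \<le> G w"
 shows "u /\<^sub>R norm u = v /\<^sub>R norm v"
proof (rule normalized_eq_of_halfspace[OF ne], rule ccontr)
 fix h assume h: "v \<bullet> h < 0" and "\<not> u \<bullet> h \<le> 0"
 then have "- u \<bullet> h < 0" by simp
 from eventually_descent[OF _ this, of "\<lambda>y. - G y" w] has_derivative_minus[OF G]
 have 1: "\<forall>\<^sub>F r in at_right 0. G (w + r *\<^sub>R h) > G w" by simp
 obtain S where S: "open S" "w \<in> S" "\<And>y. y \<in> S ==> F y < F w --> G y \<le> G w"
  using sub unfolding eventually_nhds by blast
 have "\<forall>\<^sub>F r::real in at_right 0. False"
  using 1 eventually_descent[OF F h] eventually_on_ray[OF S(1,2), of h] by eventually_elim (use S(3) in force)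
 then show False by simp
qed

lemma lipschitz_derivative_le:
 fixes f :: "'a::real_normed_vector => 'b::real_normed_vector"
 assumes "(f has_derivative N) (at x)" "r > 0" "\<And>y. norm (y - x) < r ==> norm (f y - f x) \<le> M * norm (y - x)"
 shows "norm (N h) \<le> M * norm h"
proof (cases "h = 0")
 case True
 then show ?thesis using has_derivative_linear[OF assms(1)] by (simp add: linear_0)
next
 case False
 show ?thesis
 proof (rule field_le_epsilon)
  fix e :: real assume "e > 0"
  then have e': "e / norm h > 0" using False by simp
  obtain d where d: "d > 0" "\<And>y. norm (y - x) < d ==> norm (f y - f x - N (y - x)) \<le> (e / norm h) * norm (y - x)"
   using assms(1) e' unfolding has_derivative_at_alt by meson
  define k where "k = min d r / 2 / norm h"
  have k: "k > 0" unfolding k_def using d(1) assms(2) False by simp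
  have nk: "norm (k *\<^sub>R h) < d" "norm (k *\<^sub>R h) < r" unfolding k_def using d(1) assms(2) False by auto
  have "norm (N (k *\<^sub>R h)) \<le> norm (f (x + k *\<^sub>R h) - f x) + norm (f (x + k *\<^sub>R h) - f x - N (k *\<^sub>R h))"
   by (metis norm_triangle_sub norm_minus_commute add.commute)
  also have "\<dots> \<le> M * norm (k *\<^sub>R h) + (e / norm h) * norm (k *\<^sub>R h)"
   using assms(3)[of "x + k *\<^sub>R h"] d(2)[of "x + k *\<^sub>R h"] nk by (intro add_mono) auto
  finally have "k * norm (N h) \<le> k * (M * norm h + e)"
   using k False has_derivative_linear[OF assms(1)] by (simp add: linear_cmul algebra_simps)
  then show "norm (N h) \<le> M * norm h + e" using k by simp
 qed
qed

lemma normalize_diff_le: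
 fixes a b :: "'a::real_inner"
 assumes "a \<noteq> 0" "b \<noteq> 0"
 shows "norm (b /\<^sub>R norm b - a /\<^sub>R norm a) \<le> 2 * norm (b - a) / norm a"
proof -
 have "b /\<^sub>R norm b - a /\<^sub>R norm a = (1 / norm a) *\<^sub>R ((b - a) + ((norm a - norm b) / norm b) *\<^sub>R b)"
 proof -
  have "1 / norm b = 1 / norm a + (norm a - norm b) / (norm a * norm b)"
   using assms by (simp add: field_simps)
  then have "(1 / norm b) *\<^sub>R b = (1 / norm a) *\<^sub>R b + ((norm a - norm b) / (norm a * norm b)) *\<^sub>R b"
   by (metis scaleR_left_distrib)
  then show ?thesis by (simp add: algebra_simps divide_inverse_commute)
 qed
 also have "norm \<dots> \<le> (1 / norm a) * (norm (b - a) + \<bar>norm a - norm b\<bar>)"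
  using assms by (simp add: divide_right_mono norm_triangle_le)
 also have "\<dots> \<le> (1 / norm a) * (norm (b - a) + norm (b - a))"
  by (intro mult_left_mono add_left_mono) (auto simp: norm_triangle_ineq3 norm_minus_commute)
 finally show ?thesis by simp
qed

context limit_flow
begin

text \<open>Agrees with \<open>signed_distance\<close> on \<Omega>, but its sign ignores membership
  in \<Omega>, so that it is continuous on the whole space.\<close>

definition sd :: "'a => real => real" where
 "sd x t = (if x \<in> inside (\<Gamma> t) then - infdist x (\<Gamma> t) else infdist x (\<Gamma> t))"

definition nearest :: "'a => real => 'a" where
 "nearest x t = (SOME y. y \<in> \<Gamma> t \<and> dist x y = infdist x (\<Gamma> t))"

definition vol_diff :: "real => real" where
 "vol_diff t = measure lebesgue (outer_region \<Omega> (\<Gamma> t)) - measure lebesgue (inner_region \<Omega> (\<Gamma> t))"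

text \<open>The pair \<open>(n, \<theta>)\<close> is the space-time conormal of the track, scaled so
  that \<open>n\<close> is a unit vector; \<open>\<theta>\<close> is then minus the normal velocity.
  The clause on balls says that the center of a ball touching the hypersurface lies on the normal
  line, on the side given by the orientation. These facts replace the chart function from here
  on.\<close>

definition nchart :: "real => real => 'a => real => ('a \<times> real => 'a) => ('a \<times> real => real) => bool" where
 "nchart \<rho> M p t n \<theta> \<longleftrightarrow>
   (\<forall>z\<in>cball (p, t) \<rho>. norm (n z) = 1 \<and> \<bar>\<theta> z\<bar> \<le> M \<and>
    (\<lambda>y. n (y, snd z)) differentiable (at (fst z)) \<and>
    (\<forall>z'\<in>cball (p, t) \<rho>. norm (n z' - n z) \<le> M * norm (z' - z) \<and>
      (z \<in> track --> z' \<in> track -->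
       \<bar>n z \<bullet> (fst z' - fst z) + \<theta> z * (snd z' - snd z)\<bar> \<le> M * (norm (z' - z))^2))) \<and>
   (\<forall>z\<in>ball (p, t) \<rho> \<inter> track. \<forall>x.
    (ball x (dist x (fst z)) \<inter> \<Gamma> (snd z) = {} -->
     (x \<in> outside (\<Gamma> (snd z)) --> x = fst z + dist x (fst z) *\<^sub>R n z) \<and>
     (x \<in> inside (\<Gamma> (snd z)) --> x = fst z - dist x (fst z) *\<^sub>R n z)) \<and>
    (exterior_unit_normal (inner_region \<Omega> (\<Gamma> (snd z))) (fst z) x --> n z = x))"

lemma oriented_chart_recenter:
 assumes "oriented_chart p t \<rho> \<phi> g q C" "cball (y, s) \<rho>' \<subseteq> cball (p, t) \<rho>" "\<rho>' > 0" "C \<le> C'"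
 shows "oriented_chart y s \<rho>' \<phi> g q C'"
proof -
 have C: "C > 0" using assms(1) unfolding oriented_chart_def chart_def by blast
 have le: "C * r \<le> C' * r" if "r \<ge> 0" for r using assms(4) that by (rule mult_right_mono)
 show ?thesis unfolding oriented_chart_def chart_def
 proof (intro conjI ballI impI)
  fix z assume "z \<in> cball (y, s) \<rho>'"
  then have z: "z \<in> cball (p, t) \<rho>" using assms(2) by blast
  show "(\<phi> has_derivative (\<lambda>(h, k). g z \<bullet> h + q z * k)) (at z)"
   "(\<lambda>y. g (y, snd z)) differentiable (at (fst z))"
   "snd z \<in> {0..T} ==> (fst z \<in> \<Gamma> (snd z) \<longleftrightarrow> \<phi> z = 0)"
   "snd z \<in> {0..T} ==> (fst z \<in> inside (\<Gamma> (snd z)) \<longleftrightarrow> \<phi> z < 0)"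
   "snd z \<in> {0..T} ==> (fst z \<in> outside (\<Gamma> (snd z)) \<longleftrightarrow> \<phi> z > 0)"
   using assms(1) z unfolding oriented_chart_def chart_def by blast+
  have "1 / C \<le> norm (g z)" "norm (g z) \<le> C" "\<bar>q z\<bar> \<le> C"
   using assms(1) z unfolding oriented_chart_def chart_def by blast+
  moreover have "1 / C' \<le> 1 / C" using C assms(4) by (simp add: frac_le)
  ultimately show "1 / C' \<le> norm (g z)" "norm (g z) \<le> C'" "\<bar>q z\<bar> \<le> C'" using assms(4) by linarith+
  fix z' assume "z' \<in> cball (y, s) \<rho>'"
  then have z': "z' \<in> cball (p, t) \<rho>" using assms(2) by blast
  have "\<bar>\<phi> z' - \<phi> z - (g z \<bullet> (fst z' - fst z) + q z * (snd z' - snd z))\<bar> \<le> C * (norm (z' - z))^2"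
   "norm (g z' - g z) \<le> C * norm (z' - z)"
   using assms(1) z z' unfolding oriented_chart_def chart_def by blast+
  then show "\<bar>\<phi> z' - \<phi> z - (g z \<bullet> (fst z' - fst z) + q z * (snd z' - snd z))\<bar> \<le> C' * (norm (z' - z))^2"
   "norm (g z' - g z) \<le> C' * norm (z' - z)"
   using le by (meson order_trans norm_ge_zero zero_le_power2)+
 qed (use C assms in auto)
qed

text \<open>A ball free of the hypersurface is connected and lies on one side, so the sign of
  \<open>\<phi>\<close> is known on it; comparing \<open>\<phi>\<close> with the squared distance to
  the center by \<open>normalized_eq_of_sublevel\<close> makes the radius normal. In
  \<open>2 * C^2\<close> one factor \<open>C\<close> comes from the bounds of the chart, one from
  dividing by the norm of \<open>g\<close>, and the 2 from normalizing.\<close>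

lemma nchart_of_oriented_chart:
 assumes oc: "oriented_chart p t \<rho> \<phi> g q C" and C1: "C \<ge> 1"
 shows "nchart \<rho> (2 * C^2) p t (\<lambda>z. g z /\<^sub>R norm (g z)) (\<lambda>z. q z / norm (g z))"
 unfolding nchart_def
proof (intro conjI ballI impI allI)
 let ?n = "\<lambda>z. g z /\<^sub>R norm (g z)"
 have ch: "chart p t \<rho> \<phi> g q C" using oc unfolding oriented_chart_def by simp
 have ineq: "norm (g z) > 0" "1 / norm (g z) \<le> C" if "z \<in> cball (p, t) \<rho>" for z
 proof -
  have "1 / C \<le> norm (g z)" using ch that unfolding chart_def by blast
  then show "norm (g z) > 0" using C1 by (smt (verit) divide_pos_pos)
  then show "1 / norm (g z) \<le> C" using \<open>1 / C \<le> norm (g z)\<close> C1 by (simp add: field_simps)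
 qed
 {
  fix z assume z: "z \<in> cball (p, t) \<rho>"
  note i = ineq[OF z]
  show "norm (?n z) = 1" using i by simp
  have "\<bar>q z\<bar> \<le> C" using ch z unfolding chart_def by blast
  then have "\<bar>q z\<bar> * (1 / norm (g z)) \<le> C * C" using i C1 by (intro mult_mono) auto
  also have "\<dots> \<le> 2 * C^2" by (simp add: power2_eq_square)
  finally show "\<bar>q z / norm (g z)\<bar> \<le> 2 * C^2" by simp
  have gd: "(\<lambda>y. g (y, snd z)) differentiable (at (fst z))" using ch z unfolding chart_def by blast
  have "(norm \<circ> (\<lambda>y. g (y, snd z))) differentiable (at (fst z))"
   using i(1) by (intro differentiable_chain_at gd differentiable_norm_at) auto
  then have "(\<lambda>y. inverse (norm (g (y, snd z)))) differentiable (at (fst z))"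
   using i(1) by (intro differentiable_inverse) (auto simp: o_def)
  then show "(\<lambda>y. ?n (y, snd z)) differentiable (at (fst z))"
   by (intro differentiable_scaleR gd)
  fix z' assume z': "z' \<in> cball (p, t) \<rho>"
  have gl: "norm (g z' - g z) \<le> C * norm (z' - z)" and
   tay: "\<bar>\<phi> z' - \<phi> z - (g z \<bullet> (fst z' - fst z) + q z * (snd z' - snd z))\<bar> \<le> C * (norm (z' - z))^2"
   using ch z z' unfolding chart_def by blast+
  have "norm (?n z' - ?n z) \<le> 2 * norm (g z' - g z) / norm (g z)"
   using ineq(1)[OF z] ineq(1)[OF z'] by (intro normalize_diff_le) auto
  also have "\<dots> = 2 * norm (g z' - g z) * (1 / norm (g z))" by simp
  also have "\<dots> \<le> (2 * (C * norm (z' - z))) * C" using gl i C1 by (intro mult_mono) auto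
  finally show "norm (?n z' - ?n z) \<le> 2 * C^2 * norm (z' - z)" by (simp add: power2_eq_square algebra_simps)
  assume tr: "z \<in> track" "z' \<in> track"
  have "\<phi> z = 0" "\<phi> z' = 0" using ch z z' tr unfolding chart_def track_def by (auto simp: split_beta)
  then have "\<bar>g z \<bullet> (fst z' - fst z) + q z * (snd z' - snd z)\<bar> \<le> C * (norm (z' - z))^2"
   using tay by simp
  then have "\<bar>g z \<bullet> (fst z' - fst z) + q z * (snd z' - snd z)\<bar> * (1 / norm (g z)) \<le> (C * (norm (z' - z))^2) * C"
   using i C1 by (intro mult_mono) auto
  moreover have "?n z \<bullet> (fst z' - fst z) + q z / norm (g z) * (snd z' - snd z)
    = (g z \<bullet> (fst z' - fst z) + q z * (snd z' - snd z)) * (1 / norm (g z))"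
   using i(1) by (simp add: field_simps)
  ultimately have "\<bar>?n z \<bullet> (fst z' - fst z) + q z / norm (g z) * (snd z' - snd z)\<bar> \<le> (C * (norm (z' - z))^2) * C"
   using i(1) by (simp add: abs_mult)
  also have "\<dots> \<le> 2 * C^2 * (norm (z' - z))^2" using C1 by (simp add: power2_eq_square algebra_simps)
  finally show "\<bar>?n z \<bullet> (fst z' - fst z) + q z / norm (g z) * (snd z' - snd z)\<bar> \<le> 2 * C^2 * (norm (z' - z))^2" .
 }
 fix z x assume z: "z \<in> ball (p, t) \<rho> \<inter> track"
 obtain w s where ws: "z = (w, s)" by fastforce
 have zc: "z \<in> cball (p, t) \<rho>" using z by auto
 note i = ineq(1)[OF zc]
 have s: "s \<in> {0..T}" "w \<in> \<Gamma> s" using z ws by (auto simp: track_def)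
 have \<phi>0: "\<phi> (w, s) = 0" using ch zc s unfolding chart_def ws by (metis fst_conv snd_conv)
 obtain r where r: "r > 0" "ball z r \<subseteq> ball (p, t) \<rho>" using z open_contains_ball by (metis IntD1 open_ball)
 have near: "(y, s) \<in> cball (p, t) \<rho>" if "dist y w < r" for y
 proof -
  have "(y, s) \<in> ball z r" using that dist_Pair_le[of w s y s] ws by (simp add: dist_commute)
  then show ?thesis using r(2) by (meson ball_subset_cball subsetD)
 qed
 have sgn: "y \<in> inside (\<Gamma> s) \<longleftrightarrow> \<phi> (y, s) < 0" "y \<in> outside (\<Gamma> s) \<longleftrightarrow> \<phi> (y, s) > 0" if "dist y w < r" for y
  using oc near[OF that] s(1) unfolding oriented_chart_def by (metis fst_conv snd_conv)+
 have der: "((\<lambda>y. \<phi> (y, s)) has_derivative (\<lambda>h. g z \<bullet> h)) (at w)"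
 proof -
  have "((\<lambda>y. (y, s)) has_derivative (\<lambda>h. (h, 0))) (at w)" by (auto intro!: derivative_eq_intros)
  moreover have "(\<phi> has_derivative (\<lambda>(h, k). g z \<bullet> h + q z * k)) (at (w, s))"
   using ch zc ws unfolding chart_def by blast
  ultimately show ?thesis by (rule has_derivative_compose[THEN has_derivative_eq_rhs]) auto
 qed
 have ballr: "\<forall>\<^sub>F y in nhds w. dist y w < r" using r(1) unfolding eventually_nhds_metric by blast
 have d\<phi>: "((\<lambda>y. - \<phi> (y, s)) has_derivative (\<lambda>h. - g z \<bullet> h)) (at w)" using has_derivative_minus[OF der] by simp
 {
  assume "ball x (dist x (fst z)) \<inter> \<Gamma> (snd z) = {}"
  then have bx: "ball x (dist x w) \<subseteq> - \<Gamma> s" using ws by auto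
  have dx: "((\<lambda>y. (y - x) \<bullet> (y - x)) has_derivative (\<lambda>h. (2 *\<^sub>R (w - x)) \<bullet> h)) (at w)"
   by (auto intro!: derivative_eq_intros simp: inner_commute)
  have side: "(y \<in> inside (\<Gamma> s) \<longleftrightarrow> x \<in> inside (\<Gamma> s)) \<and> (y \<in> outside (\<Gamma> s) \<longleftrightarrow> x \<in> outside (\<Gamma> s))"
   if "(y - x) \<bullet> (y - x) < (w - x) \<bullet> (w - x)" for y
  proof -
   have "y \<in> ball x (dist x w)" using that by (simp add: dist_norm norm_minus_commute[of x] norm_lt)
   then have "connected_component (- \<Gamma> s) y x"
    unfolding connected_component_def using bx by (intro exI[of _ "ball x (dist x w)"]) auto
   then show ?thesis using side_of_connected_component by blast
  qed
  have xw: "2 *\<^sub>R (w - x) \<noteq> 0" if "x \<in> outside (\<Gamma> s) \<union> inside (\<Gamma> s)"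
  proof -
   have "x \<noteq> w" using that s(2) inside_no_overlap outside_no_overlap by blast
   then show ?thesis by simp
  qed
  have ev: "\<forall>\<^sub>F y in nhds w. (y - x) \<bullet> (y - x) < (w - x) \<bullet> (w - x) -->
    (x \<in> outside (\<Gamma> s) --> - \<phi> (y, s) < 0) \<and> (x \<in> inside (\<Gamma> s) --> \<phi> (y, s) < 0)"
   using ballr by eventually_elim (use side sgn in force)
  have unit: "(2 *\<^sub>R (w - x)) /\<^sub>R norm (2 *\<^sub>R (w - x)) = (w - x) /\<^sub>R norm (w - x)" by simp
  {
   assume x: "x \<in> outside (\<Gamma> (snd z))"
   have "(- g z) /\<^sub>R norm (- g z) = (2 *\<^sub>R (w - x)) /\<^sub>R norm (2 *\<^sub>R (w - x))"
    by (rule normalized_eq_of_sublevel[OF dx d\<phi> _ _ eventually_mono[OF ev]]) (use x ws xw i \<phi>0 in auto)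
   then have "- (g z /\<^sub>R norm (g z)) = (w - x) /\<^sub>R norm (w - x)" unfolding unit by simp
   then have "g z /\<^sub>R norm (g z) = - ((w - x) /\<^sub>R norm (w - x))" by (metis minus_minus)
   then show "x = fst z + dist x (fst z) *\<^sub>R (g z /\<^sub>R norm (g z))"
    using xw x ws by (simp add: dist_norm norm_minus_commute[of w x])
  next
   assume x: "x \<in> inside (\<Gamma> (snd z))"
   have "g z /\<^sub>R norm (g z) = (2 *\<^sub>R (w - x)) /\<^sub>R norm (2 *\<^sub>R (w - x))"
    by (rule normalized_eq_of_sublevel[OF dx der _ _ eventually_mono[OF ev]]) (use x ws xw i \<phi>0 in auto)
   then show "x = fst z - dist x (fst z) *\<^sub>R (g z /\<^sub>R norm (g z))"
    using xw x ws unfolding unit by (simp add: dist_norm norm_minus_commute[of w x])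
  }
 next
  assume "exterior_unit_normal (inner_region \<Omega> (\<Gamma> (snd z))) (fst z) x"
  then obtain V \<psi> where \<psi>: "local_defining_function (inner_region \<Omega> (\<Gamma> s)) w V \<psi>"
   and x: "x = (1 / norm (grad \<psi> w)) *\<^sub>R grad \<psi> w"
   unfolding exterior_unit_normal_def ws by auto
  have V: "open V" "w \<in> V" "smooth_on V \<psi>" "grad \<psi> w \<noteq> 0"
   "\<And>y. y \<in> V ==> (y \<in> inner_region \<Omega> (\<Gamma> s) \<longleftrightarrow> \<psi> y < 0)"
   using \<psi> unfolding local_defining_function_def by blast+
  have "w \<notin> inner_region \<Omega> (\<Gamma> s)" using s(2) inside_no_overlap unfolding inner_region_def by blast
  then have \<psi>0: "\<psi> w \<ge> 0" using V(2,5) by force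
  have "grad \<psi> w /\<^sub>R norm (grad \<psi> w) = g z /\<^sub>R norm (g z)"
  proof (rule normalized_eq_of_sublevel[OF der has_derivative_grad[OF smooth_on_derivD(2)[OF V(3,2)]] _ V(4)])
   have "open (V \<inter> \<Omega>)" "w \<in> V \<inter> \<Omega>" using V(1,2) open_Omega Gamma_subset[OF s(1)] s(2) by auto
   from eventually_nhds_in_open[OF this] ballr
   show "\<forall>\<^sub>F y in nhds w. \<phi> (y, s) < \<phi> (w, s) --> \<psi> y \<le> \<psi> w"
   proof eventually_elim
    case (elim y)
    then show ?case using sgn(1)[of y] V(5)[of y] \<psi>0 \<phi>0 unfolding inner_region_def by auto
   qed
  qed (use i in auto)
  then show "g z /\<^sub>R norm (g z) = x" unfolding x by (simp add: divide_inverse)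
 }
qed

text \<open>A Lebesgue number argument: finitely many charts of half radius cover the compact track,
  and each of them can be recentered at any point of its half ball.\<close>

theorem uniform_ncharts:
 obtains \<rho> M where "\<rho> > 0" "M \<ge> 1" "\<And>y t. (y, t) \<in> track ==> \<exists>n \<theta>. nchart \<rho> M y t n \<theta>"
proof -
 have "\<forall>z\<in>track. \<exists>\<rho> \<phi> g q C. oriented_chart (fst z) (snd z) \<rho> \<phi> g q C"
  unfolding track_def using oriented_chart_exists by (auto, metis)
 then obtain \<rho> \<phi> g q C where oc: "\<And>z. z \<in> track ==> oriented_chart (fst z) (snd z) (\<rho> z) (\<phi> z) (g z) (q z) (C z)"
  by metis
 then have \<rho>: "\<And>z. z \<in> track ==> \<rho> z > 0" unfolding oriented_chart_def chart_def by blast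
 obtain D where D: "D \<subseteq> track" "finite D" "track \<subseteq> (\<Union>z\<in>D. ball z (\<rho> z / 2))"
 proof (rule compactE_image[OF compact_track, of track "\<lambda>z. ball z (\<rho> z / 2)"])
  show "track \<subseteq> (\<Union>z\<in>track. ball z (\<rho> z / 2))" using \<rho> by force
 qed (use that in auto)
 define r where "r = Min (insert 1 ((\<lambda>z. \<rho> z / 2) ` D))"
 have r: "r > 0" unfolding r_def using D(1,2) \<rho> by (subst Min_gr_iff) auto
 have rle: "r \<le> \<rho> z / 2" if "z \<in> D" for z unfolding r_def using D(2) that by (intro Min_le) auto
 define L where "L = Max (insert 1 (C ` D))"
 have L: "L \<ge> 1" unfolding L_def using D(2) by (intro Max_ge) auto
 have Lge: "C z \<le> L" if "z \<in> D" for z unfolding L_def using D(2) that by (intro Max_ge) auto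
 show thesis
 proof (rule that[OF r, of "2 * L^2"])
  show "1 \<le> 2 * L^2" using one_le_power[OF L, of 2] by linarith
  fix y t assume "(y, t) \<in> track"
  then obtain z where z: "z \<in> D" "(y, t) \<in> ball z (\<rho> z / 2)" using D(3) by blast
  have "cball (y, t) r \<subseteq> cball (fst z, snd z) (\<rho> z)"
  proof
   fix w assume "w \<in> cball (y, t) r"
   then have "dist z w \<le> dist z (y, t) + r" using dist_triangle[of z w "(y, t)"] by simp
   also have "\<dots> \<le> \<rho> z" using z rle[OF z(1)] by simp
   finally show "w \<in> cball (fst z, snd z) (\<rho> z)" by simp
  qed
  from oriented_chart_recenter[OF oc this r Lge[OF z(1)]] D(1) z(1)
  have "oriented_chart y t r (\<phi> z) (g z) (q z) L" by blast
  from nchart_of_oriented_chart[OF this L] show "\<exists>n \<theta>. nchart r (2 * L^2) y t n \<theta>" by blast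
 qed
qed

end

section \<open>Nearest points and the expansion of the signed distance in space and time\<close>

context limit_flow
begin

lemma nearest:
 assumes "t \<in> {0..T}"
 shows "nearest x t \<in> \<Gamma> t" "dist x (nearest x t) = infdist x (\<Gamma> t)"
proof -
 obtain y where "y \<in> \<Gamma> t" "infdist x (\<Gamma> t) = dist x y"
  using infdist_attains_inf[OF compact_imp_closed[OF compact_Gamma[OF assms]] Gamma_nonempty[OF assms]] .
 then have "\<exists>y. y \<in> \<Gamma> t \<and> dist x y = infdist x (\<Gamma> t)" by auto
 from someI_ex[OF this] show "nearest x t \<in> \<Gamma> t" "dist x (nearest x t) = infdist x (\<Gamma> t)"
  unfolding nearest_def by auto
qed

lemma infdist_eq_0_iff:
 assumes "t \<in> {0..T}" shows "infdist x (\<Gamma> t) = 0 \<longleftrightarrow> x \<in> \<Gamma> t"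
 using in_closed_iff_infdist_zero[OF compact_imp_closed[OF compact_Gamma[OF assms]] Gamma_nonempty[OF assms]] by simp

lemma abs_sd: "\<bar>sd x t\<bar> = infdist x (\<Gamma> t)"
 unfolding sd_def by (simp add: infdist_nonneg)

lemma sd_sign:
 assumes "t \<in> {0..T}"
 shows "sd x t < 0 \<longleftrightarrow> x \<in> inside (\<Gamma> t)" "sd x t = 0 \<longleftrightarrow> x \<in> \<Gamma> t" "sd x t > 0 \<longleftrightarrow> x \<in> outside (\<Gamma> t)"
proof -
 have pos: "infdist x (\<Gamma> t) > 0" if "x \<notin> \<Gamma> t"
  using that infdist_eq_0_iff[OF assms, of x] infdist_nonneg[of x "\<Gamma> t"] by linarith
 have "(sd x t < 0 \<longleftrightarrow> x \<in> inside (\<Gamma> t)) \<and> (sd x t = 0 \<longleftrightarrow> x \<in> \<Gamma> t) \<and> (sd x t > 0 \<longleftrightarrow> x \<in> outside (\<Gamma> t))"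
 proof -
  consider "x \<in> \<Gamma> t" | "x \<in> inside (\<Gamma> t)" | "x \<in> outside (\<Gamma> t)" using inside_Un_outside by blast
  then show ?thesis
  proof cases
   case 1
   then have "x \<notin> inside (\<Gamma> t)" "x \<notin> outside (\<Gamma> t)" using inside_no_overlap outside_no_overlap by blast+
   then show ?thesis using 1 by (simp add: sd_def)
  next
   case 2
   then have "x \<notin> \<Gamma> t" "x \<notin> outside (\<Gamma> t)" using inside_no_overlap inside_Int_outside by blast+
   then show ?thesis using 2 pos by (simp add: sd_def)
  next
   case 3
   then have "x \<notin> \<Gamma> t" "x \<notin> inside (\<Gamma> t)" using outside_no_overlap inside_Int_outside by blast+
   then show ?thesis using 3 pos by (simp add: sd_def)
  qed
 qed
 then show "sd x t < 0 \<longleftrightarrow> x \<in> inside (\<Gamma> t)" "sd x t = 0 \<longleftrightarrow> x \<in> \<Gamma> t" "sd x t > 0 \<longleftrightarrow> x \<in> outside (\<Gamma> t)"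
  by blast+
qed

text \<open>Upper bound: the nearest point at time \<open>t\<close> lies on a moving point of the
  family. Lower bound: a slightly smaller closed ball about \<open>x\<close> is free of the
  hypersurface at time \<open>t\<close> and stays free.\<close>

lemma infdist_continuous_in_time:
 assumes "t \<in> {0..T}" "e > 0"
 obtains d where "d > 0" "\<And>s. s \<in> {0..T} ==> \<bar>s - t\<bar> < d ==> \<bar>infdist x (\<Gamma> s) - infdist x (\<Gamma> t)\<bar> \<le> e"
proof -
 let ?r = "infdist x (\<Gamma> t)"
 obtain \<gamma> v n where \<gamma>: "\<gamma> t = nearest x t" "\<And>s. s \<in> {0..T} ==> \<gamma> s \<in> \<Gamma> s"
  "(\<gamma> has_vector_derivative v) (at t within {0..T})" using moving_point[OF assms(1) nearest(1)[OF assms(1)]] by metis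
 have "continuous (at t within {0..T}) \<gamma>" by (rule has_vector_derivative_continuous[OF \<gamma>(3)])
 then obtain d1 where d1: "d1 > 0" "\<And>s. s \<in> {0..T} ==> \<bar>s - t\<bar> < d1 ==> dist (\<gamma> s) (nearest x t) < e"
  using assms(2) \<gamma>(1) unfolding continuous_within_eps_delta dist_real_def by metis
 have "cball x (?r - e) \<inter> \<Gamma> t = {}"
 proof -
  have False if "y \<in> cball x (?r - e)" "y \<in> \<Gamma> t" for y
   using infdist_le[OF that(2), of x] that(1) assms(2) by simp
  then show ?thesis by blast
 qed
 from avoid_persists[OF assms(1) compact_cball this]
 obtain d2 where d2: "d2 > 0" "\<And>s z y. s \<in> {0..T} ==> \<bar>s - t\<bar> < d2 ==> z \<in> cball x (?r - e) ==> dist y z < d2 ==> y \<notin> \<Gamma> s"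
  by blast
 show thesis
 proof (rule that[of "min d1 d2"])
  fix s assume s: "s \<in> {0..T}" "\<bar>s - t\<bar> < min d1 d2"
  have "infdist x (\<Gamma> s) \<le> dist x (\<gamma> s)" using infdist_le[OF \<gamma>(2)[OF s(1)]] .
  also have "\<dots> \<le> dist x (nearest x t) + dist (\<gamma> s) (nearest x t)" by (metis dist_triangle dist_commute)
  also have "\<dots> \<le> ?r + e" using d1(2)[of s] s nearest(2)[OF assms(1), of x] by simp
  finally have 1: "infdist x (\<Gamma> s) \<le> ?r + e" .
  have "nearest x s \<notin> cball x (?r - e)"
   using d2(2)[of s "nearest x s" "nearest x s"] d2(1) s nearest(1)[OF s(1)] by auto
  then have "infdist x (\<Gamma> s) \<ge> ?r - e" using nearest(2)[OF s(1), of x] by simp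
  with 1 show "\<bar>infdist x (\<Gamma> s) - ?r\<bar> \<le> e" by simp
 qed (use d1 d2 in auto)
qed

text \<open>The unsigned distance is continuous, and away from the hypersurface the sign is locally
  constant in space-time because both sides persist; on the hypersurface the sign is
  irrelevant.\<close>

lemma sd_continuous: "continuous_on (UNIV \<times> {0..T}) (\<lambda>(x, t). sd x t)"
 unfolding continuous_on_iff
proof (intro ballI allI impI)
 fix z :: "'a \<times> real" and e :: real assume z: "z \<in> UNIV \<times> {0..T}" and e: "0 < e"
 obtain x t where xt: "z = (x, t)" by fastforce
 then have t: "t \<in> {0..T}" using z by simp
 have "e / 4 > 0" using e by simp
 from infdist_continuous_in_time[OF t this, of x]
 obtain d1 where d1: "d1 > 0" "\<And>s. s \<in> {0..T} ==> \<bar>s - t\<bar> < d1 ==> \<bar>infdist x (\<Gamma> s) - infdist x (\<Gamma> t)\<bar> \<le> e / 4"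
  by blast
 have inf: "\<bar>infdist y (\<Gamma> s) - infdist x (\<Gamma> t)\<bar> \<le> e / 2"
  if "s \<in> {0..T}" "\<bar>s - t\<bar> < d1" "dist y x < e / 4" for y s
  using d1(2)[OF that(1,2)] infdist_triangle_abs[of y "\<Gamma> s" x] that(3) by linarith
 consider "x \<in> \<Gamma> t" | "x \<in> inside (\<Gamma> t)" | "x \<in> outside (\<Gamma> t)" using inside_Un_outside by blast
 then have "\<exists>d>0. \<forall>s y. s \<in> {0..T} --> \<bar>s - t\<bar> < d --> dist y x < d --> \<bar>sd y s - sd x t\<bar> < e"
 proof cases
  case 1
  then have "infdist x (\<Gamma> t) = 0" "sd x t = 0" using sd_sign(2)[OF t] by auto
  show ?thesis
  proof (intro exI[of _ "min d1 (e/4)"] conjI allI impI)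
   fix s y assume "s \<in> {0..T}" "\<bar>s - t\<bar> < min d1 (e/4)" "dist y x < min d1 (e/4)"
   then have "\<bar>infdist y (\<Gamma> s)\<bar> \<le> e / 2" using inf[of s y] \<open>infdist x (\<Gamma> t) = 0\<close> by simp
   then show "\<bar>sd y s - sd x t\<bar> < e" using abs_sd[of y s] \<open>sd x t = 0\<close> e by simp
  qed (use d1 e in auto)
 next
  case 2
  then obtain d2 where d2: "d2 > 0" "\<And>s y. s \<in> {0..T} ==> \<bar>s - t\<bar> < d2 ==> dist y x < d2 ==> y \<in> inside (\<Gamma> s)"
   using inside_persists[OF t] by metis
  show ?thesis
  proof (intro exI[of _ "Min {d1, d2, e/4}"] conjI allI impI)
   fix s y assume *: "s \<in> {0..T}" "\<bar>s - t\<bar> < Min {d1, d2, e/4}" "dist y x < Min {d1, d2, e/4}"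
   have "y \<in> inside (\<Gamma> s)" using d2(2)[of s y] * by simp
   then have eq: "sd y s = - infdist y (\<Gamma> s)" "sd x t = - infdist x (\<Gamma> t)" using 2 by (auto simp: sd_def)
   have "\<bar>infdist y (\<Gamma> s) - infdist x (\<Gamma> t)\<bar> \<le> e / 2" using inf[of s y] * by simp
   then show "\<bar>sd y s - sd x t\<bar> < e" unfolding eq using e by linarith
  qed (use d1 d2 e in auto)
 next
  case 3
  then obtain d2 where d2: "d2 > 0" "\<And>s y. s \<in> {0..T} ==> \<bar>s - t\<bar> < d2 ==> dist y x < d2 ==> y \<in> outside (\<Gamma> s)"
   using outside_persists[OF t] by metis
  have ni: "w \<notin> inside (\<Gamma> r)" if "w \<in> outside (\<Gamma> r)" for w r using that inside_Int_outside by blast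
  show ?thesis
  proof (intro exI[of _ "Min {d1, d2, e/4}"] conjI allI impI)
   fix s y assume *: "s \<in> {0..T}" "\<bar>s - t\<bar> < Min {d1, d2, e/4}" "dist y x < Min {d1, d2, e/4}"
   have "y \<in> outside (\<Gamma> s)" using d2(2)[of s y] * by simp
   then show "\<bar>sd y s - sd x t\<bar> < e" using inf[of s y] * ni[OF 3] ni[of y s] e unfolding sd_def by simp
  qed (use d1 d2 e in auto)
 qed
 then obtain d where d: "d > 0" "\<And>s y. s \<in> {0..T} ==> \<bar>s - t\<bar> < d ==> dist y x < d ==> \<bar>sd y s - sd x t\<bar> < e" by blast
 show "\<exists>d>0. \<forall>z'\<in>UNIV \<times> {0..T}. dist z' z < d --> dist (case z' of (x, t) => sd x t) (case z of (x, t) => sd x t) < e"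
 proof (intro exI[of _ d] conjI ballI impI)
  fix z' :: "'a \<times> real" assume z': "z' \<in> UNIV \<times> {0..T}" "dist z' z < d"
  have "dist (fst z') x < d" "\<bar>snd z' - t\<bar> < d"
   using dist_fst_le[of z' z] dist_snd_le[of z' z] z'(2) xt by (auto simp: dist_real_def)
  with d(2)[of "snd z'" "fst z'"] z'(1) show "dist (case z' of (x, t) => sd x t) (case z of (x, t) => sd x t) < e"
   by (simp add: split_beta xt dist_real_def mem_Times_iff)
 qed (rule d(1))
qed

text \<open>The ball about \<open>x\<close> through its nearest point contains no point of the
  hypersurface, so its radius is normal there.\<close>

lemma sd_representation:
 assumes "nchart \<rho> M p t0 n \<theta>" "t \<in> {0..T}" "(nearest x t, t) \<in> ball (p, t0) \<rho>"
 shows "x = nearest x t + sd x t *\<^sub>R n (nearest x t, t)"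
proof -
 let ?y = "nearest x t"
 have tr: "(?y, t) \<in> ball (p, t0) \<rho> \<inter> track" using assms nearest(1) by (auto simp: track_def)
 have "ball x (dist x ?y) \<inter> \<Gamma> t = {}"
 proof -
  have False if "w \<in> ball x (dist x ?y)" "w \<in> \<Gamma> t" for w
   using infdist_le[OF that(2), of x] that(1) nearest(2)[OF assms(2), of x] by simp
  then show ?thesis by blast
 qed
 with assms(1) tr have *: "x \<in> outside (\<Gamma> t) ==> x = ?y + dist x ?y *\<^sub>R n (?y, t)"
  "x \<in> inside (\<Gamma> t) ==> x = ?y - dist x ?y *\<^sub>R n (?y, t)"
  unfolding nchart_def by (metis fst_conv snd_conv)+
 consider "x \<in> \<Gamma> t" | "x \<in> inside (\<Gamma> t)" | "x \<in> outside (\<Gamma> t)" using inside_Un_outside by blast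
 then show ?thesis
 proof cases
  case 1
  then have "dist x ?y = 0" "sd x t = 0" using sd_sign(2)[OF assms(2)] nearest(2)[OF assms(2), of x] by auto
  then show ?thesis by simp
 next
  case 2
  then show ?thesis using *(2) nearest(2)[OF assms(2), of x] by (simp add: sd_def)
 next
  case 3
  then have "x \<notin> inside (\<Gamma> t)" using inside_Int_outside by blast
  then show ?thesis using *(1)[OF 3] nearest(2)[OF assms(2), of x] by (simp add: sd_def)
 qed
qed

text \<open>Subtracting the representations of the two points along their normals and multiplying by
  the first normal, the displacement \<open>Y\<close> of the nearest points is controlled by the
  tangency clause of \<open>nchart\<close>. This gives the linear expansion of the distance with an
  error quadratic in \<open>S\<close>. Since distance times curvature is at most 1/16,
  \<open>Y\<close> itself can be bounded by the displacement of the points, which makes the error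
  quadratic in the latter.\<close>

lemma nearest_estimate:
 assumes ch: "nchart \<rho> M p t0 n \<theta>" and M: "M \<ge> 1" and t: "t \<in> {0..T}" "t' \<in> {0..T}"
  and z: "(nearest x t, t) \<in> ball (p, t0) \<rho>" "(nearest x' t', t') \<in> ball (p, t0) \<rho>"
  and small: "\<bar>sd x' t'\<bar> \<le> 1 / (16 * M)" "norm (nearest x' t' - nearest x t) + \<bar>t' - t\<bar> \<le> 1 / (4 * M)"
 shows "norm (nearest x' t' - nearest x t) \<le> 6 * M * (norm (x' - x) + \<bar>t' - t\<bar>)"
  "\<bar>sd x' t' - sd x t - n (nearest x t, t) \<bullet> (x' - x) - \<theta> (nearest x t, t) * (t' - t)\<bar>
    \<le> 98 * M^3 * (norm (x' - x) + \<bar>t' - t\<bar>)^2"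
proof -
 define z1 z2 where "z1 = (nearest x t, t)" and "z2 = (nearest x' t', t')"
 define Y h where "Y = nearest x' t' - nearest x t" and "h = x' - x"
 define \<tau> d d' where "\<tau> = t' - t" and "d = sd x t" and "d' = sd x' t'"
 define m where "m = n z2 - n z1"
 have zc: "z1 \<in> cball (p, t0) \<rho>" "z2 \<in> cball (p, t0) \<rho>" "z1 \<in> track" "z2 \<in> track"
  using z nearest(1) t unfolding z1_def z2_def track_def by auto
 have z21: "norm (z2 - z1) \<le> norm Y + \<bar>\<tau>\<bar>"
  using norm_Pair_le[of Y \<tau>] unfolding z1_def z2_def Y_def \<tau>_def by simp
 have n1: "norm (n z1) = 1" "norm (n z2) = 1" and \<theta>: "\<bar>\<theta> z1\<bar> \<le> M"
  using ch zc unfolding nchart_def by blast+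
 have "norm m \<le> M * norm (z2 - z1)" using ch zc unfolding nchart_def m_def by blast
 also have "\<dots> \<le> M * (norm Y + \<bar>\<tau>\<bar>)" using z21 M by (intro mult_left_mono) auto
 finally have m: "norm m \<le> M * (norm Y + \<bar>\<tau>\<bar>)" .
 define S where "S = norm Y + \<bar>\<tau>\<bar>"
 have S: "S \<ge> 0" "S \<le> 1 / (4 * M)" unfolding S_def Y_def \<tau>_def using small(2) by auto
 have "\<bar>n z1 \<bullet> (fst z2 - fst z1) + \<theta> z1 * (snd z2 - snd z1)\<bar> \<le> M * (norm (z2 - z1))^2"
  using ch zc unfolding nchart_def by blast
 also have "\<dots> \<le> M * S^2" using z21 M unfolding S_def by (intro mult_left_mono power_mono) auto
 finally have tan: "\<bar>n z1 \<bullet> Y + \<theta> z1 * \<tau>\<bar> \<le> M * S^2" unfolding Y_def \<tau>_def z1_def z2_def by simp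
 have hrep: "h = Y + (d' - d) *\<^sub>R n z1 + d' *\<^sub>R m"
 proof -
  have *: "x = nearest x t + d *\<^sub>R n z1" "x' = nearest x' t' + d' *\<^sub>R n z2"
   unfolding d_def d'_def z1_def z2_def using sd_representation[OF ch] t z by blast+
  have "h = (nearest x' t' + d' *\<^sub>R n z2) - (nearest x t + d *\<^sub>R n z1)"
   unfolding h_def by (rule arg_cong2[where f = minus, OF *(2,1)])
  then show ?thesis unfolding Y_def m_def by (simp add: algebra_simps)
 qed
 \<comment> \<open>The normal component of a difference of unit vectors is of second order.\<close>
 have nm: "n z1 \<bullet> m = - ((norm m)^2) / 2"
 proof -
  have "n z1 \<bullet> n z1 = 1" "n z2 \<bullet> n z2 = 1" using n1 by (auto simp: norm_eq_1)
  then show ?thesis unfolding m_def power2_norm_eq_inner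
   by (simp add: inner_diff_left inner_diff_right inner_commute)
 qed
 have nh: "n z1 \<bullet> h = n z1 \<bullet> Y + (d' - d) - d' * (norm m)^2 / 2"
  unfolding hrep using n1(1) nm by (simp add: inner_add_right norm_eq_1)
 have MS: "M * S \<le> 1/4" using S(2) M by (simp add: field_simps)
 have dM: "\<bar>d'\<bar> * M \<le> 1/16" using small(1) M unfolding d'_def by (simp add: field_simps)
 have dm: "\<bar>d' * (norm m)^2 / 2\<bar> \<le> M * S^2"
 proof -
  have "(norm m)^2 \<le> (M * S)^2" using m unfolding S_def by (intro power_mono) auto
  then have "\<bar>d'\<bar> * (norm m)^2 \<le> \<bar>d'\<bar> * (M * S)^2" by (intro mult_left_mono) auto
  also have "\<dots> = (\<bar>d'\<bar> * M) * (M * S^2)" by (simp add: power2_eq_square algebra_simps)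
  also have "\<dots> \<le> (1/16) * (M * S^2)" using dM M S by (intro mult_right_mono) auto
  finally have "\<bar>d'\<bar> * (norm m)^2 \<le> (1/16) * (M * S^2)" .
  moreover have "M * S^2 \<ge> 0" using M by simp
  ultimately show ?thesis by (simp add: abs_mult)
 qed
 have eq: "(d' - d) - n z1 \<bullet> h - \<theta> z1 * \<tau> = d' * (norm m)^2 / 2 - (n z1 \<bullet> Y + \<theta> z1 * \<tau>)"
  using nh by linarith
 have A: "\<bar>(d' - d) - n z1 \<bullet> h - \<theta> z1 * \<tau>\<bar> \<le> 2 * M * S^2"
  unfolding eq using dm tan by linarith
 have nhle: "\<bar>n z1 \<bullet> h\<bar> \<le> norm h" using Cauchy_Schwarz_ineq2[of "n z1" h] n1 by simp
 have \<theta>\<tau>: "\<bar>\<theta> z1 * \<tau>\<bar> \<le> M * \<bar>\<tau>\<bar>" using \<theta> by (simp add: abs_mult mult_right_mono)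
 have "2 * M * S^2 = 2 * (M * S) * S" by (simp add: power2_eq_square)
 also have "\<dots> \<le> (1/2) * S" using MS S by (intro mult_right_mono) auto
 finally have dd: "\<bar>d' - d\<bar> \<le> norm h + M * \<bar>\<tau>\<bar> + S / 2" using A nhle \<theta>\<tau> by linarith
 have "norm Y \<le> norm h + \<bar>d' - d\<bar> + \<bar>d'\<bar> * norm m"
 proof -
  have "Y = h - (d' - d) *\<^sub>R n z1 - d' *\<^sub>R m" unfolding hrep by simp
  then have "norm Y = norm (h - (d' - d) *\<^sub>R n z1 - d' *\<^sub>R m)" by simp
  then have "norm Y \<le> norm h + norm ((d' - d) *\<^sub>R n z1) + norm (d' *\<^sub>R m)"
   using norm_triangle_ineq4[of "h - (d' - d) *\<^sub>R n z1" "d' *\<^sub>R m"] norm_triangle_ineq4[of h "(d' - d) *\<^sub>R n z1"]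
   by linarith
  then show ?thesis using n1 by simp
 qed
 also have "\<bar>d'\<bar> * norm m \<le> S / 16"
 proof -
  have "\<bar>d'\<bar> * norm m \<le> \<bar>d'\<bar> * (M * S)" using m unfolding S_def by (intro mult_left_mono) auto
  also have "\<dots> = (\<bar>d'\<bar> * M) * S" by simp
  also have "\<dots> \<le> (1/16) * S" using dM S by (intro mult_right_mono) auto
  finally show ?thesis by simp
 qed
 finally have "norm Y \<le> 2 * norm h + M * \<bar>\<tau>\<bar> + (9/16) * S" using dd by linarith
 \<comment> \<open>The multiple 9/16 of \<open>norm Y\<close> contained in \<open>S\<close> is
   absorbed on the left.\<close>
 then have "norm Y \<le> 5 * norm h + 3 * (M * \<bar>\<tau>\<bar>) + 2 * \<bar>\<tau>\<bar>"
 proof -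
  have gen: "a \<le> 5 * b + 3 * c + 2 * e" if "a \<le> 2 * b + c + (9/16) * (a + e)" "0 \<le> c" "0 \<le> b" "0 \<le> e" for a b c e :: real
  proof -
   have "16 * a \<le> 32 * b + 16 * c + 9 * a + 9 * e" using that(1) by (simp add: field_simps)
   then show ?thesis using that by linarith
  qed
  show ?thesis by (rule gen) (use \<open>norm Y \<le> 2 * norm h + M * \<bar>\<tau>\<bar> + (9/16) * S\<close> M in \<open>simp_all add: S_def\<close>)
 qed
 also have "\<dots> \<le> 5 * (M * norm h) + 3 * (M * \<bar>\<tau>\<bar>) + 2 * (M * \<bar>\<tau>\<bar>)"
  using mult_right_mono[OF M, of "norm h"] mult_right_mono[OF M, of "\<bar>\<tau>\<bar>"] by simp
 also have "\<dots> \<le> 6 * M * (norm h + \<bar>\<tau>\<bar>)"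
 proof -
  have "0 \<le> M * norm h" "0 \<le> M * \<bar>\<tau>\<bar>" using M by auto
  then show ?thesis unfolding distrib_left mult.assoc by linarith
 qed
 finally have Yle: "norm Y \<le> 6 * M * (norm h + \<bar>\<tau>\<bar>)" .
 then show "norm (nearest x' t' - nearest x t) \<le> 6 * M * (norm (x' - x) + \<bar>t' - t\<bar>)"
  unfolding Y_def h_def \<tau>_def .
 have "S \<le> 7 * M * (norm h + \<bar>\<tau>\<bar>)"
 proof -
  have "\<bar>\<tau>\<bar> \<le> M * \<bar>\<tau>\<bar>" "0 \<le> M * norm h" using mult_right_mono[OF M, of "\<bar>\<tau>\<bar>"] M by auto
  then show ?thesis using Yle unfolding S_def distrib_left mult.assoc by linarith
 qed
 then have "S^2 \<le> (7 * M * (norm h + \<bar>\<tau>\<bar>))^2" using S by (intro power_mono) auto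
 then have "2 * M * S^2 \<le> 2 * M * (7 * M * (norm h + \<bar>\<tau>\<bar>))^2" using M by (intro mult_left_mono) auto
 also have "\<dots> = 98 * M^3 * (norm h + \<bar>\<tau>\<bar>)^2" by (simp add: power_mult_distrib power2_eq_square power3_eq_cube)
 finally show "\<bar>sd x' t' - sd x t - n (nearest x t, t) \<bullet> (x' - x) - \<theta> (nearest x t, t) * (t' - t)\<bar>
    \<le> 98 * M^3 * (norm (x' - x) + \<bar>t' - t\<bar>)^2"
  using A unfolding d_def d'_def h_def \<tau>_def z1_def by linarith
qed

end

section \<open>First and second derivatives of the signed distance in a tube\<close>

lemma has_derivative_of_quadratic_error:
 assumes "bounded_linear F'" "r > 0"
  "\<And>y. y \<in> S ==> norm (y - x) < r ==> norm (f y - f x - F' (y - x)) \<le> K * (norm (y - x))^2"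
 shows "(f has_derivative F') (at x within S)"
 unfolding has_derivative_within_alt
proof (intro conjI allI impI assms(1))
 fix e :: real assume e: "e > 0"
 show "\<exists>d>0. \<forall>y\<in>S. norm (y - x) < d --> norm (f y - f x - F' (y - x)) \<le> e * norm (y - x)"
 proof (intro exI[of _ "min r (e / (\<bar>K\<bar> + 1))"] conjI ballI impI)
  fix y assume y: "y \<in> S" "norm (y - x) < min r (e / (\<bar>K\<bar> + 1))"
  then have "norm (y - x) * (\<bar>K\<bar> + 1) \<le> e" by (simp add: pos_less_divide_eq add_nonneg_pos less_imp_le)
  then have *: "(norm (y - x) * (\<bar>K\<bar> + 1)) * norm (y - x) \<le> e * norm (y - x)" by (rule mult_right_mono) simp
  have "norm (f y - f x - F' (y - x)) \<le> K * (norm (y - x))^2" using assms(3)[OF y(1)] y(2) by simp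
  also have "\<dots> \<le> (\<bar>K\<bar> + 1) * (norm (y - x))^2" by (intro mult_right_mono) auto
  also have "\<dots> = (norm (y - x) * (\<bar>K\<bar> + 1)) * norm (y - x)" by (simp add: power2_eq_square)
  finally show "norm (f y - f x - F' (y - x)) \<le> e * norm (y - x)" using * by linarith
 qed (use assms(2) e in \<open>auto simp: add_nonneg_pos\<close>)
qed

locale limit_flow_tube = limit_flow +
 fixes \<rho> M :: real
 assumes rho_pos: "\<rho> > 0" and M_ge_1: "M \<ge> 1"
  and ncharts: "\<And>y t. (y, t) \<in> track ==> \<exists>n \<theta>. nchart \<rho> M y t n \<theta>"
begin

text \<open>Width of the tube: small against the chart radius, so that the nearest points of nearby
  points lie in a common chart, and small against the curvature bound, so that
  \<open>\<delta> * M\<close> is at most 1/16.\<close>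

definition \<delta> :: real where "\<delta> = min (\<rho> / 16) (1 / (16 * M))"

lemma delta: "\<delta> > 0" "\<delta> \<le> \<rho> / 16" "\<delta> \<le> 1 / (16 * M)" "\<delta> * M \<le> 1 / 16" "\<delta> \<le> 1 / 16"
proof -
 show d: "\<delta> > 0" "\<delta> \<le> \<rho> / 16" "\<delta> \<le> 1 / (16 * M)" unfolding \<delta>_def using rho_pos M_ge_1 by auto
 show "\<delta> * M \<le> 1 / 16" using d(3) M_ge_1 by (simp add: field_simps)
 moreover have "\<delta> * 1 \<le> \<delta> * M" using d(1) M_ge_1 by (intro mult_left_mono) auto
 ultimately show "\<delta> \<le> 1 / 16" by simp
qed

lemma nearest_dist:
 assumes "t \<in> {0..T}" "t' \<in> {0..T}"
 shows "norm (nearest x' t' - nearest x t) \<le> norm (x' - x) + \<bar>sd x t\<bar> + \<bar>sd x' t'\<bar>"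
proof -
 have "dist (nearest x' t') (nearest x t) \<le> dist (nearest x' t') x' + dist x' x + dist x (nearest x t)"
  by (metis add.assoc add_left_mono dist_triangle order_trans)
 then show ?thesis using nearest(2)[OF assms(1), of x] nearest(2)[OF assms(2), of x']
  by (simp add: abs_sd dist_commute dist_norm[symmetric])
qed

lemma sd_lipschitz: "\<bar>\<bar>sd x' t\<bar> - \<bar>sd x t\<bar>\<bar> \<le> norm (x' - x)"
 unfolding abs_sd using infdist_triangle_abs[of x' "\<Gamma> t" x] by (simp add: dist_norm)

lemma tube_chart:
 assumes "t0 \<in> {0..T}" "t \<in> {0..T}" "norm (x - x0) < \<delta>" "\<bar>t - t0\<bar> < \<delta>" "\<bar>sd x0 t0\<bar> < \<delta>" "\<bar>sd x t\<bar> < \<delta>"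
 shows "(nearest x t, t) \<in> ball (nearest x0 t0, t0) \<rho>"
proof -
 have "norm (nearest x t - nearest x0 t0) < 3 * \<delta>"
  using nearest_dist[OF assms(1,2), of x x0] assms(3-) by linarith
 then have "dist (nearest x0 t0, t0) (nearest x t, t) < 4 * \<delta>"
  using dist_Pair_le[of "nearest x0 t0" t0 "nearest x t" t] assms(4)
  by (simp add: dist_norm norm_minus_commute abs_minus_commute)
 then show ?thesis using delta(1,2) by simp
qed

lemma tube_estimate:
 assumes ch: "nchart \<rho> M (nearest x0 t0) t0 n \<theta>"
  and t0: "t0 \<in> {0..T}" "\<bar>sd x0 t0\<bar> < \<delta>"
  and t: "t \<in> {0..T}" "norm (x - x0) < \<delta>" "\<bar>t - t0\<bar> < \<delta>" "\<bar>sd x t\<bar> < \<delta>"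
  and t': "t' \<in> {0..T}" "norm (x' - x0) < \<delta>" "\<bar>t' - t0\<bar> < \<delta>" "\<bar>sd x' t'\<bar> < \<delta>"
  and close: "norm (x' - x) < \<delta>" "\<bar>t' - t\<bar> < \<delta>"
 shows "norm (nearest x' t' - nearest x t) \<le> 6 * M * (norm (x' - x) + \<bar>t' - t\<bar>)"
  "\<bar>sd x' t' - sd x t - n (nearest x t, t) \<bullet> (x' - x) - \<theta> (nearest x t, t) * (t' - t)\<bar>
    \<le> 98 * M^3 * (norm (x' - x) + \<bar>t' - t\<bar>)^2"
proof -
 have 1: "\<bar>sd x' t'\<bar> \<le> 1 / (16 * M)" using t'(4) delta(3) by linarith
 have "norm (nearest x' t' - nearest x t) + \<bar>t' - t\<bar> \<le> 4 * \<delta>"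
  using nearest_dist[OF t(1) t'(1), of x' x] t(4) t'(4) close by linarith
 also have "\<dots> \<le> 4 * (1 / (16 * M))" using delta(3) by (rule mult_left_mono) simp
 also have "\<dots> = 1 / (4 * M)" by simp
 finally have 2: "norm (nearest x' t' - nearest x t) + \<bar>t' - t\<bar> \<le> 1 / (4 * M)" .
 note * = nearest_estimate[OF ch M_ge_1 t(1) t'(1) tube_chart[OF t0(1) t(1-3) t0(2) t(4)]
   tube_chart[OF t0(1) t'(1-3) t0(2) t'(4)] 1 2]
 show "norm (nearest x' t' - nearest x t) \<le> 6 * M * (norm (x' - x) + \<bar>t' - t\<bar>)" by (rule *(1))
 show "\<bar>sd x' t' - sd x t - n (nearest x t, t) \<bullet> (x' - x) - \<theta> (nearest x t, t) * (t' - t)\<bar>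
    \<le> 98 * M^3 * (norm (x' - x) + \<bar>t' - t\<bar>)^2" by (rule *(2))
qed

lemma sd_gradient:
 assumes ch: "nchart \<rho> M (nearest x0 t0) t0 n \<theta>" and t0: "t0 \<in> {0..T}" "\<bar>sd x0 t0\<bar> < \<delta>"
  and x: "t \<in> {0..T}" "norm (x - x0) < \<delta>" "\<bar>t - t0\<bar> < \<delta>" "\<bar>sd x t\<bar> < \<delta>"
 shows "((\<lambda>y. sd y t) has_derivative (\<lambda>h. n (nearest x t, t) \<bullet> h)) (at x)"
proof (rule has_derivative_of_quadratic_error)
 let ?r = "Min {\<delta>, \<delta> - norm (x - x0), \<delta> - \<bar>sd x t\<bar>}"
 show "?r > 0" using x delta(1) by auto
 show "bounded_linear ((\<bullet>) (n (nearest x t, t)))" by (rule bounded_linear_inner_right)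
 fix y assume y: "norm (y - x) < ?r"
 have "norm (y - x0) \<le> norm (y - x) + norm (x - x0)" by (rule norm_diff_triangle_le) auto
 then have 1: "norm (y - x0) < \<delta>" "norm (y - x) < \<delta>" using y by auto
 have 2: "\<bar>sd y t\<bar> < \<delta>" using sd_lipschitz[of y t x] y by auto
 have 3: "\<bar>t - t\<bar> < \<delta>" using delta(1) by simp
 from tube_estimate(2)[OF ch t0 x x(1) 1(1) x(3) 2 1(2) 3]
 show "norm (sd y t - sd x t - n (nearest x t, t) \<bullet> (y - x)) \<le> 98 * M^3 * (norm (y - x))^2" by simp
qed

lemma sd_time_derivative:
 assumes ch: "nchart \<rho> M (nearest x t) t n \<theta>" and t: "t \<in> {0..T}" "\<bar>sd x t\<bar> < \<delta>"
 shows "((\<lambda>s. sd x s) has_real_derivative \<theta> (nearest x t, t)) (at t within {0..T})"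
proof -
 have "(\<delta> - \<bar>sd x t\<bar>) / 2 > 0" using t(2) by simp
 from infdist_continuous_in_time[OF t(1) this, of x]
 obtain d where d: "d > 0" "\<And>s. s \<in> {0..T} ==> \<bar>s - t\<bar> < d ==> \<bar>\<bar>sd x s\<bar> - \<bar>sd x t\<bar>\<bar> \<le> (\<delta> - \<bar>sd x t\<bar>) / 2"
  unfolding abs_sd by blast
 show ?thesis unfolding has_field_derivative_def
 proof (rule has_derivative_of_quadratic_error)
 show "min d \<delta> > 0" using d(1) delta(1) by simp
 show "bounded_linear ((*) (\<theta> (nearest x t, t)))" by (rule bounded_linear_mult_right)
 fix s assume s: "s \<in> {0..T}" "norm (s - t) < min d \<delta>"
 have 1: "\<bar>sd x s\<bar> < \<delta>" using d(2)[OF s(1)] s(2) t(2) by (simp add: abs_le_iff) (argo | linarith)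
 have 2: "norm (x - x) < \<delta>" "\<bar>t - t\<bar> < \<delta>" "\<bar>s - t\<bar> < \<delta>" using delta(1) s(2) by auto
 from tube_estimate(2)[OF ch t t(1) 2(1,2) t(2) s(1) 2(1,3) 1 2(1,3)]
 show "norm (sd x s - sd x t - \<theta> (nearest x t, t) * (s - t)) \<le> 98 * M^3 * (norm (s - t))^2" by simp
 qed
qed

text \<open>A moving point stays on the track, so by the tangency clause
  \<open>n z \<bullet> \<gamma> s + \<theta> z * s\<close> has derivative zero at \<open>t\<close>.
  Hence \<open>\<theta>\<close> is minus the normal velocity, which the motion law
  prescribes.\<close>

lemma theta_eq_normal_velocity:
 assumes ch: "nchart \<rho> M p t0 n \<theta>" and t: "t \<in> {0..T}" "y \<in> \<Gamma> t" "(y, t) \<in> ball (p, t0) \<rho>"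
 shows "\<theta> (y, t) = mean_curvature \<Omega> (\<Gamma> t) y - c0 * vol_diff t"
proof -
 obtain \<gamma> v m where \<gamma>: "\<gamma> t = y" "\<And>s. s \<in> {0..T} ==> \<gamma> s \<in> \<Gamma> s"
  "(\<gamma> has_vector_derivative v) (at t within {0..T})"
  "exterior_unit_normal (inner_region \<Omega> (\<Gamma> t)) y m"
  "v \<bullet> m = - mean_curvature \<Omega> (\<Gamma> t) y + c0 * vol_diff t"
  using moving_point[OF t(1,2)] unfolding vol_diff_def by metis
 define z where "z = (y, t)"
 have ztr: "z \<in> track" "z \<in> ball (p, t0) \<rho> \<inter> track" "z \<in> cball (p, t0) \<rho>"
  using t unfolding z_def track_def by auto
 have nm: "n z = m" using ch ztr(2) \<gamma>(4) unfolding nchart_def z_def by (metis fst_conv snd_conv)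
 obtain r where r: "r > 0" "ball z r \<subseteq> ball (p, t0) \<rho>" using t(3) open_contains_ball unfolding z_def by (metis open_ball)
 obtain d where d: "d > 0" "\<And>s. s \<in> {0..T} ==> \<bar>s - t\<bar> < d ==> norm (\<gamma> s - \<gamma> t - (s - t) *\<^sub>R v) \<le> 1 * \<bar>s - t\<bar>"
 proof -
  have "\<forall>e>0. \<exists>d>0. \<forall>s\<in>{0..T}. norm (s - t) < d --> norm (\<gamma> s - \<gamma> t - (s - t) *\<^sub>R v) \<le> e * norm (s - t)"
   using \<gamma>(3) unfolding has_vector_derivative_def has_derivative_within_alt by blast
  from this[rule_format, of 1] show thesis using that by auto
 qed
 have \<gamma>le: "norm (\<gamma> s - y) \<le> (norm v + 1) * \<bar>s - t\<bar>" if "s \<in> {0..T}" "\<bar>s - t\<bar> < d" for s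
 proof -
  have "norm (\<gamma> s - \<gamma> t) \<le> norm ((s - t) *\<^sub>R v) + norm (\<gamma> s - \<gamma> t - (s - t) *\<^sub>R v)"
   by (metis norm_triangle_sub)
  with d(2)[OF that] \<gamma>(1) have "norm (\<gamma> s - y) \<le> norm v * \<bar>s - t\<bar> + \<bar>s - t\<bar>" by (simp add: mult.commute)
  then show ?thesis unfolding distrib_right by simp
 qed
 have "((\<lambda>s. n z \<bullet> \<gamma> s + \<theta> z * s) has_derivative (\<lambda>h. 0)) (at t within {0..T})"
 proof (rule has_derivative_of_quadratic_error)
  let ?r = "min d (r / (norm v + 2))"
  show "?r > 0" using d(1) r(1) by (simp add: add_nonneg_pos)
  fix s assume s: "s \<in> {0..T}" "norm (s - t) < ?r"
  have z': "norm ((\<gamma> s, s) - z) \<le> (norm v + 2) * \<bar>s - t\<bar>"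
   using norm_Pair_le[of "\<gamma> s - y" "s - t"] \<gamma>le[OF s(1)] s(2) unfolding z_def by (simp add: algebra_simps)
  have "(norm v + 2) * \<bar>s - t\<bar> < r" using s(2) by (simp add: pos_less_divide_eq add_nonneg_pos mult.commute)
  then have "(\<gamma> s, s) \<in> ball z r" using z' by (simp add: dist_norm norm_minus_commute)
  then have "(\<gamma> s, s) \<in> cball (p, t0) \<rho>" "(\<gamma> s, s) \<in> track"
   using r(2) \<gamma>(2)[OF s(1)] s(1) by (auto simp: track_def)
  then have "\<bar>n z \<bullet> (fst (\<gamma> s, s) - fst z) + \<theta> z * (snd (\<gamma> s, s) - snd z)\<bar> \<le> M * (norm ((\<gamma> s, s) - z))^2"
   using ch ztr unfolding nchart_def by blast
  also have "\<dots> \<le> M * ((norm v + 2) * \<bar>s - t\<bar>)^2"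
   using z' M_ge_1 by (intro mult_left_mono power_mono) auto
  also have "\<dots> = (M * (norm v + 2)^2) * (norm (s - t))^2" by (simp add: power_mult_distrib)
  also have "n z \<bullet> (fst (\<gamma> s, s) - fst z) + \<theta> z * (snd (\<gamma> s, s) - snd z)
    = n z \<bullet> \<gamma> s + \<theta> z * s - (n z \<bullet> \<gamma> t + \<theta> z * t) - 0"
   by (simp add: z_def \<gamma>(1) inner_diff_right algebra_simps)
  finally show "norm (n z \<bullet> \<gamma> s + \<theta> z * s - (n z \<bullet> \<gamma> t + \<theta> z * t) - 0) \<le> (M * (norm v + 2)^2) * (norm (s - t))^2"
   by simp
 qed simp
 then have 1: "((\<lambda>s. n z \<bullet> \<gamma> s + \<theta> z * s) has_vector_derivative 0) (at t within {0..T})"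
  by (simp add: has_vector_derivative_def)
 have "((\<lambda>s. n z \<bullet> \<gamma> s) has_vector_derivative n z \<bullet> v) (at t within {0..T})"
  using bounded_linear.has_vector_derivative[OF bounded_linear_inner_right \<gamma>(3)] .
 then have 2: "((\<lambda>s. n z \<bullet> \<gamma> s + \<theta> z * s) has_vector_derivative n z \<bullet> v + \<theta> z) (at t within {0..T})"
  by (auto intro!: derivative_eq_intros simp flip: has_real_derivative_iff_has_vector_derivative)
 have "n z \<bullet> v + \<theta> z = 0"
  by (rule vector_derivative_unique_within_closed_interval[OF T_pos, unfolded cbox_interval, OF t(1) 2 1])
 then show ?thesis using \<gamma>(5) nm unfolding z_def by (simp add: inner_commute)
qed

text \<open>The perturbation is at most half the identity in norm, so the map is injective with a
  lower bound; in finite dimension it is invertible.\<close>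

lemma near_identity_inverse:
 fixes N :: "'a => 'a"
 assumes N: "linear N" "\<And>h. norm (N h) \<le> M * norm h" and d: "\<bar>d\<bar> * M \<le> 1 / 2"
 obtains B where "linear B" "\<And>w. B (w + d *\<^sub>R N w) = w" "\<And>w. B w + d *\<^sub>R N (B w) = w" "\<And>w. norm (B w) \<le> 2 * norm w"
proof -
 let ?A = "\<lambda>w. w + d *\<^sub>R N w"
 have linA: "linear ?A" using N(1) by (intro linear_compose_add linear_compose_scale_right linear_id[unfolded id_def])
 have lower: "norm w \<le> 2 * norm (?A w)" for w
 proof -
  have "norm (d *\<^sub>R N w) \<le> \<bar>d\<bar> * (M * norm w)" using N(2)[of w] by (simp add: mult_left_mono)
  also have "\<dots> = (\<bar>d\<bar> * M) * norm w" by simp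
  also have "\<dots> \<le> (1/2) * norm w" using d by (intro mult_right_mono) auto
  finally have "norm (d *\<^sub>R N w) \<le> norm w / 2" by simp
  moreover have "norm w \<le> norm (?A w) + norm (d *\<^sub>R N w)" by (metis norm_triangle_ineq4 add_diff_cancel_right')
  ultimately show ?thesis by linarith
 qed
 have "inj ?A"
 proof (rule injI)
  fix a b assume "?A a = ?A b"
  then have "?A (a - b) = 0" using linear_diff[OF linA, of a b] by simp
  then show "a = b" using lower[of "a - b"] by simp
 qed
 from linear_injective_isomorphism[OF linA this refl]
 obtain B where B: "linear B" "\<forall>w. B (?A w) = w" "\<forall>w. ?A (B w) = w" by blast
 show thesis
 proof (rule that[OF B(1)])
  fix w show "norm (B w) \<le> 2 * norm w" using lower[of "B w"] B(3) by simp
 qed (use B in auto)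
qed

lemma normal_derivative:
 assumes ch: "nchart \<rho> M p t0 n \<theta>" and z: "(y, t) \<in> ball (p, t0) \<rho>"
 obtains N where "((\<lambda>w. n (w, t)) has_derivative N) (at y)" "linear N" "\<And>h. norm (N h) \<le> M * norm h"
proof -
 have zc: "(y, t) \<in> cball (p, t0) \<rho>" using z by auto
 then have "(\<lambda>w. n (w, snd (y, t))) differentiable (at (fst (y, t)))"
  using ch unfolding nchart_def by blast
 then obtain N where N: "((\<lambda>w. n (w, t)) has_derivative N) (at y)" by (auto simp: differentiable_def)
 obtain r where r: "r > 0" "ball (y, t) r \<subseteq> ball (p, t0) \<rho>" using z open_contains_ball by (metis open_ball)
 have "norm (N h) \<le> M * norm h" for h
 proof (rule lipschitz_derivative_le[OF N r(1)])
  fix w assume w: "norm (w - y) < r"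
  then have "(w, t) \<in> ball (y, t) r" using dist_Pair_le[of y t w t] by (simp add: dist_norm norm_minus_commute)
  then have "(w, t) \<in> cball (p, t0) \<rho>" using r(2) by auto
  then have "norm (n (w, t) - n (y, t)) \<le> M * norm ((w, t) - (y, t))" using ch zc unfolding nchart_def by blast
  then show "norm (n (w, t) - n (y, t)) \<le> M * norm (w - y)" by simp
 qed
 with N has_derivative_linear[OF N] that show thesis by blast
qed

text \<open>Differentiating \<open>x = y + d * n(y)\<close> in the direction \<open>h\<close> shows
  that \<open>1 + d * N\<close> maps the displacement of the nearest point \<open>y\<close> to the
  tangential part of \<open>h\<close>. The nearest point therefore has derivative \<open>B\<close>
  after the tangential projection, and the gradient of the distance is the normal at the nearest
  point, to which the chain rule applies.\<close>

lemma sd_hessian: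
 assumes ch: "nchart \<rho> M (nearest x0 t) t n \<theta>" and t: "t \<in> {0..T}" "\<bar>sd x0 t\<bar> < \<delta>"
  and x: "norm (x - x0) < \<delta>" "\<bar>sd x t\<bar> < \<delta>"
  and N: "((\<lambda>w. n (w, t)) has_derivative N) (at (nearest x t))" "linear N"
  and B: "linear B" "\<And>w. B (w + sd x t *\<^sub>R N w) = w" "\<And>w. norm (B w) \<le> 2 * norm w"
 shows "((\<lambda>y. n (nearest y t, t)) has_derivative
   (\<lambda>h. N (B (h - (n (nearest x t, t) \<bullet> h) *\<^sub>R n (nearest x t, t))))) (at x)"
proof -
 let ?y = "nearest x t" and ?d = "sd x t"
 define nx where "nx = n (?y, t)"
 define P where "P h = h - (nx \<bullet> h) *\<^sub>R nx" for h
 have tt: "\<bar>t - t\<bar> < \<delta>" using delta(1) by simp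
 have yb: "(?y, t) \<in> ball (nearest x0 t, t) \<rho>" by (rule tube_chart[OF t(1) t(1) x(1) tt t(2) x(2)])
 have nx1: "norm nx = 1" using ch yb unfolding nchart_def nx_def by (meson ball_subset_cball subsetD)
 have d1: "\<bar>?d\<bar> \<le> 1" using x(2) delta(5) by linarith
 have blP: "bounded_linear P" unfolding P_def
  by (intro bounded_linear_sub bounded_linear_ident bounded_linear_scaleR_const bounded_linear_inner_right)
 have "((\<lambda>y. nearest y t) has_derivative (\<lambda>h. B (P h))) (at x)"
  unfolding has_derivative_at_alt
 proof (intro conjI allI impI)
  show "bounded_linear (\<lambda>h. B (P h))"
   using bounded_linear_compose[OF linear_conv_bounded_linear[THEN iffD1, OF B(1)] blP] .
  fix e :: real assume e: "e > 0"
  define e1 where "e1 = e / (24 * M)"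
  have e1: "e1 > 0" unfolding e1_def using e M_ge_1 by simp
  define K where "K = 98 * M^3 + (1 + 98 * M^3) * (6 * M^2)"
  have K: "K > 0" unfolding K_def using M_ge_1 by (intro add_pos_pos mult_pos_pos) (auto simp: add_pos_pos)
  obtain r1 where r1: "r1 > 0" "\<And>w. norm (w - ?y) < r1 ==> norm (n (w, t) - nx - N (w - ?y)) \<le> e1 * norm (w - ?y)"
   using N(1) e1 unfolding has_derivative_at_alt nx_def by meson
  define r where "r = Min {\<delta>, \<delta> - norm (x - x0), \<delta> - \<bar>?d\<bar>, r1 / (6 * M), e / (4 * K), 1}"
  have r: "r > 0" unfolding r_def using x delta(1) r1(1) e K M_ge_1 by auto
  show "\<exists>d>0. \<forall>y. norm (y - x) < d --> norm (nearest y t - nearest x t - B (P (y - x))) \<le> e * norm (y - x)"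
  proof (intro exI conjI allI impI, rule r)
   fix y assume y: "norm (y - x) < r"
   define h Y where "h = y - x" and "Y = nearest y t - ?y"
   have hr: "norm h < \<delta>" "norm h < \<delta> - norm (x - x0)" "norm h < \<delta> - \<bar>?d\<bar>" "norm h < r1 / (6 * M)"
    "norm h < e / (4 * K)" "norm h < 1"
   proof -
    have rle: "norm h < v" if "v \<in> {\<delta>, \<delta> - norm (x - x0), \<delta> - \<bar>?d\<bar>, r1 / (6 * M), e / (4 * K), 1}" for v
     using Min_le[OF _ that] y unfolding r_def h_def by (meson finite.intros order_less_le_trans)
    show "norm h < \<delta>" "norm h < \<delta> - norm (x - x0)" "norm h < \<delta> - \<bar>?d\<bar>" "norm h < r1 / (6 * M)"
     "norm h < e / (4 * K)" "norm h < 1" by (rule rle; blast)+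
   qed
   have yx0: "norm (y - x0) < \<delta>" using hr(2) norm_triangle_ineq[of "y - x" "x - x0"] unfolding h_def by simp
   have sdy: "\<bar>sd y t\<bar> < \<delta>" using sd_lipschitz[of y t x] hr(3) unfolding h_def by linarith
   note est = tube_estimate[OF ch t(1,2) t(1) x(1) tt x(2) t(1) yx0 tt sdy, unfolded h_def[symmetric], OF hr(1) tt]
   have Y: "norm Y \<le> 6 * M * norm h" using est(1) unfolding Y_def h_def by simp
   have S: "\<bar>sd y t - ?d - nx \<bullet> h\<bar> \<le> 98 * M^3 * (norm h)^2" using est(2) unfolding nx_def h_def by simp
   define m where "m = n (nearest y t, t) - nx"
   have yb': "(nearest y t, t) \<in> ball (nearest x0 t, t) \<rho>" by (rule tube_chart[OF t(1) t(1) yx0 tt t(2) sdy])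
   have "norm m \<le> M * norm ((nearest y t, t) - (?y, t))"
    using ch yb yb' unfolding nchart_def m_def nx_def by (meson ball_subset_cball subsetD)
   then have m1: "norm m \<le> M * norm Y" unfolding Y_def by simp
   also have "\<dots> \<le> M * (6 * M * norm h)" using Y M_ge_1 by (intro mult_left_mono) auto
   finally have m2: "norm m \<le> 6 * M^2 * norm h" by (simp add: power2_eq_square)
   have "norm Y < r1"
   proof -
    have "6 * M * norm h < r1" using hr(4) M_ge_1 by (simp add: field_simps)
    then show ?thesis using Y by linarith
   qed
   then have "norm (m - N Y) \<le> e1 * norm Y" using r1(2)[of "nearest y t"] unfolding m_def Y_def by simp
   also have "\<dots> \<le> e1 * (6 * M * norm h)" using Y e1 by (intro mult_left_mono) auto
   finally have mN: "norm (m - N Y) \<le> (e / 4) * norm h" unfolding e1_def using M_ge_1 by (simp add: field_simps)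
   have rep: "x = ?y + ?d *\<^sub>R nx" "y = nearest y t + sd y t *\<^sub>R n (nearest y t, t)"
    unfolding nx_def using sd_representation[OF ch t(1)] yb yb' by blast+
   have hrep: "h = Y + (sd y t - ?d) *\<^sub>R nx + sd y t *\<^sub>R m"
   proof -
    have "h = (nearest y t + sd y t *\<^sub>R n (nearest y t, t)) - (?y + ?d *\<^sub>R nx)"
     unfolding h_def by (rule arg_cong2[where f = minus, OF rep(2,1)])
    then show ?thesis unfolding Y_def m_def by (simp add: algebra_simps)
   qed
   \<comment> \<open>Residual of the linearized equation for the nearest point. Its three terms are
     the Taylor remainder of the distance, that of the normal, and a product of two first order
     quantities.\<close>
   have AY: "Y + ?d *\<^sub>R N Y - P h = - ((sd y t - ?d - nx \<bullet> h) *\<^sub>R nx) - ?d *\<^sub>R (m - N Y) - (sd y t - ?d) *\<^sub>R m"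
   proof -
    have "P h = Y + (sd y t - ?d) *\<^sub>R nx + sd y t *\<^sub>R m - (nx \<bullet> h) *\<^sub>R nx"
     unfolding P_def by (subst hrep) simp
    then show ?thesis by (simp add: algebra_simps)
   qed
   have hh: "(norm h)^2 \<le> norm h" using hr(6) by (simp add: power2_eq_square mult_left_le_one_le)
   have sdd: "\<bar>sd y t - ?d\<bar> \<le> (1 + 98 * M^3) * norm h"
   proof -
    have "\<bar>nx \<bullet> h\<bar> \<le> norm h" using Cauchy_Schwarz_ineq2[of nx h] nx1 by simp
    moreover have "98 * M^3 * (norm h)^2 \<le> 98 * M^3 * norm h" using hh M_ge_1 by (intro mult_left_mono) auto
    ultimately show ?thesis using S unfolding distrib_right by linarith
   qed
   have "norm (Y + ?d *\<^sub>R N Y - P h) \<le> \<bar>sd y t - ?d - nx \<bullet> h\<bar> + \<bar>?d\<bar> * norm (m - N Y) + \<bar>sd y t - ?d\<bar> * norm m"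
   proof -
    have tri: "norm (- a - b - c) \<le> norm a + norm b + norm c" for a b c :: 'a
     using norm_triangle_ineq4[of "- a - b" c] norm_triangle_ineq4[of "- a" b] by simp
    have "norm (Y + ?d *\<^sub>R N Y - P h) \<le> norm ((sd y t - ?d - nx \<bullet> h) *\<^sub>R nx) + norm (?d *\<^sub>R (m - N Y))
      + norm ((sd y t - ?d) *\<^sub>R m)" unfolding AY by (rule tri)
    then show ?thesis using nx1 by simp
   qed
   also have "\<dots> \<le> 98 * M^3 * (norm h)^2 + (e / 4) * norm h + ((1 + 98 * M^3) * norm h) * (6 * M^2 * norm h)"
   proof (rule add_mono[OF add_mono[OF S]])
    show "\<bar>?d\<bar> * norm (m - N Y) \<le> e / 4 * norm h"
     using mult_mono[OF d1 mN] by simp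
    show "\<bar>sd y t - ?d\<bar> * norm m \<le> ((1 + 98 * M^3) * norm h) * (6 * M^2 * norm h)"
     using M_ge_1 by (intro mult_mono[OF sdd m2]) auto
   qed
   also have "\<dots> = K * norm h * norm h + (e / 4) * norm h" unfolding K_def by (simp add: power2_eq_square algebra_simps)
   also have "K * norm h * norm h \<le> (e / 4) * norm h"
   proof (intro mult_right_mono)
    show "K * norm h \<le> e / 4" using hr(5) K by (simp add: field_simps)
   qed simp
   finally have fin: "norm (Y + ?d *\<^sub>R N Y - P h) \<le> (e / 2) * norm h" by simp
   have "Y - B (P h) = B (Y + ?d *\<^sub>R N Y - P h)" using B(2)[of Y] linear_diff[OF B(1)] by simp
   then have "norm (Y - B (P h)) \<le> 2 * norm (Y + ?d *\<^sub>R N Y - P h)" using B(3) by metis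
   then show "norm (nearest y t - nearest x t - B (P (y - x))) \<le> e * norm (y - x)"
    using fin unfolding Y_def h_def by simp
  qed
 qed
 from has_derivative_compose[OF this N(1)] show ?thesis unfolding P_def nx_def .
qed

text \<open>The time derivative at \<open>x\<close> equals that at its nearest point, where it is
  the mean curvature minus \<open>c0 * vol_diff t\<close>. The Laplacian at \<open>x\<close> is a
  trace with the inverse \<open>B\<close>; on the hypersurface \<open>B\<close> is the identity and
  the trace is the mean curvature. The defect in the fifth claim is thus the difference of two
  traces, which is proportional to the distance.\<close>

theorem tube:
 assumes t: "t \<in> {0..T}" and x: "\<bar>sd x t\<bar> < \<delta>"
 obtains l \<theta> where "has_jet (\<lambda>y. sd y t) x 1 l"
  "((\<lambda>s. sd x s) has_real_derivative \<theta>) (at t within {0..T})" "\<bar>\<theta>\<bar> \<le> M"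
  "\<bar>l\<bar> \<le> DIM('a) * (4 * M)"
  "\<bar>\<theta> - l + c0 * vol_diff t\<bar> \<le> DIM('a) * (4 * M^2) * \<bar>sd x t\<bar>"
  "\<exists>G. \<forall>\<^sub>F y in nhds x. ((\<lambda>y. sd y t) has_derivative G y) (at y)"
proof -
 let ?y = "nearest x t" and ?d = "sd x t"
 have ytr: "(?y, t) \<in> track" using nearest(1)[OF t] t by (simp add: track_def)
 then obtain n \<theta> where ch: "nchart \<rho> M ?y t n \<theta>" using ncharts by blast
 have yb: "(?y, t) \<in> ball (?y, t) \<rho>" using rho_pos by simp
 have xx: "norm (x - x) < \<delta>" using delta(1) by simp
 define nx where "nx = n (?y, t)"
 have nx1: "norm nx = 1" "\<bar>\<theta> (?y, t)\<bar> \<le> M" using ch yb unfolding nchart_def nx_def by (meson ball_subset_cball subsetD)+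
 have sdy0: "sd ?y t = 0" using sd_sign(2)[OF t] nearest(1)[OF t] by simp
 have yy: "nearest ?y t = ?y" using nearest(2)[OF t, of ?y] infdist_eq_0_iff[OF t] nearest(1)[OF t] by simp
 have ch': "nchart \<rho> M (nearest ?y t) t n \<theta>" using ch yy by simp
 have sdy1: "\<bar>sd ?y t\<bar> < \<delta>" using sdy0 delta(1) by simp
 have yy1: "norm (?y - ?y) < \<delta>" using delta(1) by simp
 obtain N where N: "((\<lambda>w. n (w, t)) has_derivative N) (at ?y)" "linear N" "\<And>h. norm (N h) \<le> M * norm h"
  using normal_derivative[OF ch yb] by blast
 define P where "P h = h - (nx \<bullet> h) *\<^sub>R nx" for h
 have Ple: "norm (P e) \<le> 2 * norm e" for e
 proof -
  have "norm (P e) \<le> norm e + norm ((nx \<bullet> e) *\<^sub>R nx)" unfolding P_def by (rule norm_triangle_ineq4)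
  also have "norm ((nx \<bullet> e) *\<^sub>R nx) \<le> norm e" using nx1 Cauchy_Schwarz_ineq2[of nx e] by simp
  finally show ?thesis by simp
 qed
 have "\<bar>?d\<bar> * M \<le> \<delta> * M" using x M_ge_1 by (intro mult_right_mono) auto
 then have dM: "\<bar>?d\<bar> * M \<le> 1 / 2" using delta(4) by simp
 obtain B where B: "linear B" "\<And>w. B (w + ?d *\<^sub>R N w) = w" "\<And>w. B w + ?d *\<^sub>R N (B w) = w" "\<And>w. norm (B w) \<le> 2 * norm w"
  using near_identity_inverse[OF N(2,3) dM] by blast
 have H: "((\<lambda>y. n (nearest y t, t)) has_derivative (\<lambda>h. N (B (P h)))) (at x)"
  using sd_hessian[OF ch t x xx x N(1,2) B(1,2,4)] unfolding P_def nx_def .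
 \<comment> \<open>On the hypersurface the distance vanishes, so the identity may play the part of
   \<open>B\<close>.\<close>
 have H0: "((\<lambda>y. n (nearest y t, t)) has_derivative (\<lambda>h. N (P h))) (at ?y)"
  using sd_hessian[OF ch' t sdy1 yy1 sdy1, of N "\<lambda>h. h"] N(1,2) sdy0 yy
  unfolding P_def nx_def by (simp add: linear_id[unfolded id_def])
 have grad_near: "\<forall>\<^sub>F w in nhds v. ((\<lambda>y. sd y t) has_derivative (\<lambda>h. n (nearest w t, t) \<bullet> h)) (at w)"
  if v: "\<bar>sd v t\<bar> < \<delta>" "nearest v t = ?y" for v
 proof -
  have "min \<delta> (\<delta> - \<bar>sd v t\<bar>) > 0" using v delta(1) by simp
  moreover have "((\<lambda>y. sd y t) has_derivative (\<lambda>h. n (nearest w t, t) \<bullet> h)) (at w)"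
   if "dist w v < min \<delta> (\<delta> - \<bar>sd v t\<bar>)" for w
  proof (rule sd_gradient[of v t])
   show "\<bar>sd w t\<bar> < \<delta>" using sd_lipschitz[of w t v] that by (simp add: dist_norm)
  qed (use that v ch t delta(1) in \<open>auto simp: dist_norm\<close>)
  ultimately show ?thesis unfolding eventually_nhds_metric by blast
 qed
 define l where "l = (\<Sum>e\<in>Basis. N (B (P e)) \<bullet> e)"
 define l0 where "l0 = (\<Sum>e\<in>Basis. N (P e) \<bullet> e)"
 have jet: "has_jet (\<lambda>y. sd y t) x 1 l"
  using has_jet_gradient[OF grad_near[OF x refl] H] nx1 unfolding l_def nx_def by (simp add: norm_eq_1)
 have mc: "mean_curvature \<Omega> (\<Gamma> t) ?y = l0"
 proof -
  have yO: "?y \<in> \<Omega>" using nearest(1)[OF t] Gamma_subset[OF t] by blast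
  let ?s = "signed_distance \<Omega> (\<Gamma> t)"
  have eq: "?s w = sd w t" if "w \<in> \<Omega>" for w
   using that unfolding signed_distance_def sd_def inner_region_def by simp
  have gev: "\<forall>\<^sub>F w in nhds ?y. grad ?s w = n (nearest w t, t)"
  proof -
   have "\<forall>\<^sub>F w in nhds ?y. w \<in> \<Omega>" using open_Omega yO by (rule eventually_nhds_in_open)
   with grad_near[OF sdy1 yy] show ?thesis
   proof eventually_elim
    case (elim w)
    from has_derivative_transform_within_open[OF elim(1) open_Omega elim(2)] eq
    have "(?s has_derivative (\<lambda>h. n (nearest w t, t) \<bullet> h)) (at w)" by simp
    then show ?case by (rule gradient_of_has_derivative)
   qed
  qed
  then have "(grad ?s has_derivative (\<lambda>h. N (P h))) (at ?y)"
   by - (rule has_derivative_transform_eventually[OF H0], auto simp: eventually_nhds_conv_at elim: eventually_mono)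
  then have "hess ?s ?y = (\<lambda>h. N (P h))" unfolding hess_def using frechet_derivative_at by metis
  then show ?thesis unfolding mean_curvature_def laplacian_def l0_def by simp
 qed
 have \<theta>: "\<theta> (?y, t) = l0 - c0 * vol_diff t"
  using theta_eq_normal_velocity[OF ch t nearest(1)[OF t] yb] mc by simp
 have bnd: "\<bar>N (B (P e)) \<bullet> e\<bar> \<le> 4 * M" if "e \<in> Basis" for e
 proof -
  have "\<bar>N (B (P e)) \<bullet> e\<bar> \<le> norm (N (B (P e))) * norm e" by (rule Cauchy_Schwarz_ineq2)
  also have "\<dots> \<le> M * norm (B (P e))" using N(3) that by simp
  also have "norm (B (P e)) \<le> 4" using B(4)[of "P e"] Ple[of e] that by simp
  finally show ?thesis using M_ge_1 by (simp add: mult_left_mono)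
 qed
 have lle: "\<bar>l\<bar> \<le> DIM('a) * (4 * M)"
 proof -
  have "\<bar>l\<bar> \<le> (\<Sum>e\<in>Basis. \<bar>N (B (P e)) \<bullet> e\<bar>)" unfolding l_def by (rule sum_abs)
  also have "\<dots> \<le> (\<Sum>e\<in>(Basis::'a set). 4 * M)" using bnd by (rule sum_mono)
  finally show ?thesis by simp
 qed
 \<comment> \<open>As \<open>B\<close> inverts \<open>1 + d * N\<close>, replacing
   \<open>P e\<close> by \<open>B (P e)\<close> costs exactly one factor \<open>d\<close>.\<close>
 have diff: "\<bar>N (P e) \<bullet> e - N (B (P e)) \<bullet> e\<bar> \<le> 4 * M^2 * \<bar>?d\<bar>" if "e \<in> Basis" for e
 proof -
  have "P e - B (P e) = ?d *\<^sub>R N (B (P e))" using B(3)[of "P e"] by (simp add: algebra_simps)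
  then have "N (P e) - N (B (P e)) = ?d *\<^sub>R N (N (B (P e)))"
   using N(2) by (metis linear_diff linear_cmul)
  then have "\<bar>N (P e) \<bullet> e - N (B (P e)) \<bullet> e\<bar> = \<bar>(?d *\<^sub>R N (N (B (P e)))) \<bullet> e\<bar>" by (metis inner_diff_left)
  also have "\<dots> \<le> norm (?d *\<^sub>R N (N (B (P e)))) * norm e" by (rule Cauchy_Schwarz_ineq2)
  also have "\<dots> = \<bar>?d\<bar> * norm (N (N (B (P e))))" using that by simp
  also have "\<dots> \<le> \<bar>?d\<bar> * (M * (M * 4))"
  proof (rule mult_left_mono)
   have "norm (B (P e)) \<le> 4" using B(4)[of "P e"] Ple[of e] that by simp
   then have "norm (N (B (P e))) \<le> M * 4" using N(3)[of "B (P e)"] M_ge_1 by (meson mult_left_mono order_trans zero_le_one)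
   then show "norm (N (N (B (P e)))) \<le> M * (M * 4)"
    using N(3)[of "N (B (P e))"] M_ge_1 by (meson mult_left_mono order_trans zero_le_one)
  qed simp
  finally show ?thesis by (simp add: power2_eq_square algebra_simps)
 qed
 have "\<bar>l0 - l\<bar> \<le> DIM('a) * (4 * M^2) * \<bar>?d\<bar>"
 proof -
  have "l0 - l = (\<Sum>e\<in>Basis. N (P e) \<bullet> e - N (B (P e)) \<bullet> e)" unfolding l_def l0_def by (simp add: sum_subtractf)
  then have "\<bar>l0 - l\<bar> \<le> (\<Sum>e\<in>Basis. \<bar>N (P e) \<bullet> e - N (B (P e)) \<bullet> e\<bar>)" by (simp only: sum_abs)
  also have "\<dots> \<le> (\<Sum>e\<in>(Basis::'a set). 4 * M^2 * \<bar>?d\<bar>)" using diff by (rule sum_mono)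
  finally show ?thesis by simp
 qed
 then have "\<bar>\<theta> (?y, t) - l + c0 * vol_diff t\<bar> \<le> DIM('a) * (4 * M^2) * \<bar>?d\<bar>" unfolding \<theta> by simp
 with jet sd_time_derivative[OF ch t x] nx1(2) lle grad_near[OF x refl] show thesis by (intro that) auto
qed

end

section \<open>Truncation of the signed distance\<close>

lemma has_real_derivative_square_pos_part:
 "((\<lambda>x::real. (max 0 x)^2) has_real_derivative 2 * max 0 x) (at x)"
proof (cases x "0::real" rule: linorder_cases)
 case less
 have "((\<lambda>_. 0) has_real_derivative 2 * max 0 x) (at x)" using less by (simp add: max_def)
 then show ?thesis
  by (rule has_field_derivative_transform_within_open[where S = "{..<0}"]) (use less in \<open>auto simp: max_def\<close>)
next
 case greater
 have "((\<lambda>x. x^2) has_real_derivative 2 * max 0 x) (at x)"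
  using greater by (auto intro!: derivative_eq_intros simp: max_def)
 then show ?thesis
  by (rule has_field_derivative_transform_within_open[where S = "{0<..}"]) (use greater in \<open>auto simp: max_def\<close>)
next
 case equal
 have "((\<lambda>x::real. (max 0 x)^2) has_derivative (*) 0) (at 0)"
  by (rule has_derivative_of_quadratic_error[where r = 1 and K = 1])
   (auto simp: max_def intro: bounded_linear_mult_right)
 then show ?thesis using equal by (simp add: has_field_derivative_def)
qed

text \<open>The derivative of \<open>\<eta>\<close> is the bump \<open>b\<close>, built from squared
  positive parts so that it is continuously differentiable, equal to 1 up to \<open>r\<close> and to
  0 from \<open>2 * r\<close> on; \<open>\<eta>\<close> is its antiderivative vanishing at
  0.\<close>

lemma smooth_truncation:
 fixes r :: real
 assumes r: "r > 0"
 obtains \<eta> \<eta>1 \<eta>2 C where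
  "\<And>s. (\<eta> has_real_derivative \<eta>1 s) (at s)" "\<And>s. (\<eta>1 has_real_derivative \<eta>2 s) (at s)"
  "C > 0" "\<And>s. \<bar>\<eta>1 s\<bar> \<le> 1" "\<And>s. \<bar>\<eta>2 s\<bar> \<le> C"
  "\<And>s. \<bar>s\<bar> \<le> r ==> \<eta> s = s" "\<And>s. \<bar>s\<bar> \<le> r ==> \<eta>1 s = 1" "\<And>s. \<bar>s\<bar> \<le> r ==> \<eta>2 s = 0"
  "\<And>s. s \<ge> 2 * r ==> \<eta> s = \<eta> (2 * r)" "\<And>s. s \<le> - 2 * r ==> \<eta> s = \<eta> (- 2 * r)"
  "\<And>s. s \<ge> r ==> \<eta> s \<ge> r" "\<And>s. s \<le> - r ==> \<eta> s \<le> - r"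
proof -
 define m where "m x = (max 0 x)^2" for x :: real
 define A where "A s = 1 - m (s / r - 1) - m (- s / r - 1)" for s
 define b where "b s = m (A s)" for s
 define b' where "b' s = 2 * max 0 (A s) * ((2 * max 0 (- s / r - 1) - 2 * max 0 (s / r - 1)) / r)" for s
 have dm: "(m has_real_derivative 2 * max 0 x) (at x)" for x
  unfolding m_def by (rule has_real_derivative_square_pos_part)
 have dA: "(A has_real_derivative (2 * max 0 (- s / r - 1) - 2 * max 0 (s / r - 1)) / r) (at s)" for s
  unfolding A_def using r
  by (auto intro!: derivative_eq_intros DERIV_chain2[OF dm] simp: field_simps)
 have db: "(b has_real_derivative b' s) (at s)" for s
  unfolding b_def b'_def by (rule DERIV_chain2[OF dm dA])
 have m0: "m x \<ge> 0" for x unfolding m_def by simp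
 have A1: "A s \<le> 1" for s unfolding A_def using m0[of "s / r - 1"] m0[of "- s / r - 1"] by linarith
 have b01: "0 \<le> b s" "b s \<le> 1" for s
  using A1[of s] m0 unfolding b_def m_def by (auto simp: power_le_one max_def)
 have "isCont b s" for s using db DERIV_isCont by blast
 then obtain F where "\<And>x. (F has_vector_derivative b x) (at x)"
  using einterval_antiderivative[of "-\<infinity>" "\<infinity>" b] by auto
 then have F: "(F has_real_derivative b x) (at x)" for x by (simp add: has_real_derivative_iff_has_vector_derivative)
 define \<eta> where "\<eta> s = F s - F 0" for s
 have d\<eta>: "(\<eta> has_real_derivative b s) (at s)" for s unfolding \<eta>_def using F by (auto intro!: derivative_eq_intros)
 have mvt: "\<exists>z\<in>{x<..<y}. \<eta> y - \<eta> x = (y - x) * b z" if "x < y" for x y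
  using MVT2[OF that, of \<eta> b] d\<eta> by auto
 have small: "A s = 1" "b s = 1" "b' s = 0" if "\<bar>s\<bar> \<le> r" for s
 proof -
  have "s / r - 1 \<le> 0" "- s / r - 1 \<le> 0" using that r by (auto simp: field_simps)
  then show "A s = 1" "b s = 1" "b' s = 0" unfolding b_def b'_def A_def m_def by (auto simp: max_def)
 qed
 have large: "b s = 0" "b' s = 0" if "\<bar>s\<bar> \<ge> 2 * r" for s
 proof -
  have "s / r - 1 \<ge> 1 \<or> - s / r - 1 \<ge> 1" using that r by (auto simp: field_simps abs_if split: if_splits)
  then have "m (s / r - 1) \<ge> 1 \<or> m (- s / r - 1) \<ge> 1" unfolding m_def by (auto simp: max_def)
  then have "A s \<le> 0" using m0[of "s / r - 1"] m0[of "- s / r - 1"] unfolding A_def by linarith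
  then show "b s = 0" "b' s = 0" unfolding b_def b'_def m_def by (simp_all add: max_def)
 qed
 have "continuous_on {-2 * r..2 * r} b'"
  unfolding b'_def A_def m_def using r by (intro continuous_intros) auto
 then have "bounded (b' ` {-2 * r..2 * r})" using compact_continuous_image compact_imp_bounded by blast
 then obtain C where "\<forall>s\<in>{-2 * r..2 * r}. \<bar>b' s\<bar> \<le> C" unfolding bounded_iff by auto
 then have b'le: "\<bar>b' s\<bar> \<le> \<bar>C\<bar> + 1" for s
 proof (cases "\<bar>s\<bar> \<ge> 2 * r")
  case True then show ?thesis using large(2) by simp
 next
  case False
  then have "s \<in> {-2 * r..2 * r}" by auto
  then have "\<bar>b' s\<bar> \<le> C" using \<open>\<forall>s\<in>_. _\<close> by blast
  then show ?thesis by linarith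
 qed
 have \<eta>0: "\<eta> 0 = 0" unfolding \<eta>_def by simp
 have id: "\<eta> s = s" if "\<bar>s\<bar> \<le> r" for s
 proof (cases s "0::real" rule: linorder_cases)
  case less
  obtain z where "z \<in> {s<..<0}" "\<eta> 0 - \<eta> s = (0 - s) * b z" using mvt[OF less] by blast
  then show ?thesis using small(2)[of z] that \<eta>0 by auto
 next
  case greater
  obtain z where "z \<in> {0<..<s}" "\<eta> s - \<eta> 0 = (s - 0) * b z" using mvt[OF greater] by blast
  then show ?thesis using small(2)[of z] that \<eta>0 by auto
 qed (use \<eta>0 in auto)
 have mono: "\<eta> x \<le> \<eta> y" if "x \<le> y" for x y
 proof (cases "x = y")
  case False
  then have lt: "x < y" using that by simp
  obtain z where "\<eta> y - \<eta> x = (y - x) * b z" using mvt[OF lt] by blast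
  then show ?thesis using b01(1)[of z] that by (smt (verit) mult_nonneg_nonneg)
 qed simp
 show thesis
 proof (rule that[OF d\<eta> db, of "\<bar>C\<bar> + 1"])
  show "\<eta> s = \<eta> (2 * r)" if "s \<ge> 2 * r" for s
  proof (cases "s = 2 * r")
   case False
   then have lt: "2 * r < s" using that by simp
   obtain z where "z \<in> {2*r<..<s}" "\<eta> s - \<eta> (2*r) = (s - 2*r) * b z" using mvt[OF lt] by blast
   then show ?thesis using large(1)[of z] r by auto
  qed simp
  show "\<eta> s = \<eta> (- 2 * r)" if "s \<le> - 2 * r" for s
  proof (cases "s = - 2 * r")
   case False
   then have lt: "s < - 2 * r" using that by simp
   obtain z where "z \<in> {s<..<- 2 * r}" "\<eta> (- 2*r) - \<eta> s = (- 2*r - s) * b z" using mvt[OF lt] by blast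
   then show ?thesis using large(1)[of z] r by auto
  qed simp
  show "\<eta> s \<ge> r" if "s \<ge> r" for s using mono[OF that] id[of r] r by simp
  show "\<eta> s \<le> - r" if "s \<le> - r" for s using mono[OF that] id[of "- r"] r by simp
 qed (use r b01 b'le small id in \<open>auto simp: abs_le_iff intro: order_trans[of _ 0]\<close>)
qed

text \<open>The properties of the truncated signed distance \<open>D\<close> on which the barriers rest. They are invariant
 under \<open>D \<mapsto> - D\<close>, \<open>v \<mapsto> - v\<close>, which turns supersolutions into subsolutions.\<close>

definition flow_distance ::
 "'a::euclidean_space set => real => real => (real => real) => ('a => real => real) => real => real => bool" where
 "flow_distance \<Omega> T c0 v D C r \<longleftrightarrow> C > 0 \<and> r > 0 \<and>
   continuous_on (UNIV \<times> {0..T}) (\<lambda>(x, t). D x t) \<and>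
   (\<forall>t\<in>{0..T}. \<forall>x. \<exists>G L \<theta>. has_jet (\<lambda>y. D y t) x G L \<and>
    ((\<lambda>s. D x s) has_real_derivative \<theta>) (at t within {0..T}) \<and>
    \<bar>G\<bar> \<le> C \<and> \<bar>L\<bar> \<le> C \<and> \<bar>\<theta>\<bar> \<le> C \<and>
    (\<bar>D x t\<bar> < r --> G = 1 \<and> \<bar>\<theta> - L + c0 * v t\<bar> \<le> C * \<bar>D x t\<bar>)) \<and>
   (\<forall>t\<in>{0..T}. \<forall>x\<in>frontier \<Omega>. \<forall>\<^sub>F y in nhds x. D y t = D x t)"

lemma has_jet_uminus:
 assumes "has_jet F x G L" shows "has_jet (\<lambda>y. - F y) x G (- L)"
 using has_jet_cmult[OF assms, of "-1"] by simp

lemma flow_distance_uminus: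
 assumes "flow_distance \<Omega> T c0 v D C r"
 shows "flow_distance \<Omega> T c0 (\<lambda>t. - v t) (\<lambda>x t. - D x t) C r"
 unfolding flow_distance_def
proof (intro conjI ballI allI)
 show "C > 0" "r > 0" using assms unfolding flow_distance_def by auto
 have "continuous_on (UNIV \<times> {0..T}) (\<lambda>(x, t). D x t)" using assms unfolding flow_distance_def by blast
 from continuous_on_minus[OF this] show "continuous_on (UNIV \<times> {0..T}) (\<lambda>(x, t). - D x t)" by (simp add: split_beta)
 fix t assume t: "t \<in> {0..T}"
 show "\<forall>\<^sub>F y in nhds x. - D y t = - D x t" if "x \<in> frontier \<Omega>" for x
  using assms t that unfolding flow_distance_def by simp
 fix x
 obtain G L \<theta> where *: "has_jet (\<lambda>y. D y t) x G L" "((\<lambda>s. D x s) has_real_derivative \<theta>) (at t within {0..T})"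
  "\<bar>G\<bar> \<le> C" "\<bar>L\<bar> \<le> C" "\<bar>\<theta>\<bar> \<le> C" "\<bar>D x t\<bar> < r --> G = 1 \<and> \<bar>\<theta> - L + c0 * v t\<bar> \<le> C * \<bar>D x t\<bar>"
  using assms t unfolding flow_distance_def by metis
 have "\<bar>- \<theta> - - L + c0 * - v t\<bar> = \<bar>\<theta> - L + c0 * v t\<bar>" by simp
 then have "\<bar>- D x t\<bar> < r --> G = 1 \<and> \<bar>- \<theta> - - L + c0 * - v t\<bar> \<le> C * \<bar>- D x t\<bar>"
  using *(6) unfolding abs_minus_cancel by simp
 moreover have "\<bar>- L\<bar> \<le> C" "\<bar>- \<theta>\<bar> \<le> C" using * by simp_all
 ultimately show "\<exists>G L \<theta>. has_jet (\<lambda>y. - D y t) x G L \<and>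
    ((\<lambda>s. - D x s) has_real_derivative \<theta>) (at t within {0..T}) \<and>
    \<bar>G\<bar> \<le> C \<and> \<bar>L\<bar> \<le> C \<and> \<bar>\<theta>\<bar> \<le> C \<and>
    (\<bar>- D x t\<bar> < r --> G = 1 \<and> \<bar>\<theta> - L + c0 * - v t\<bar> \<le> C * \<bar>- D x t\<bar>)"
  using has_jet_uminus[OF *(1)] DERIV_minus[OF *(2)] *(3) by blast
qed

context limit_flow_tube
begin

lemma frontier_gap:
 obtains d where "d > 0" "\<And>x t. x \<in> frontier \<Omega> ==> t \<in> {0..T} ==> \<bar>sd x t\<bar> \<ge> d"
proof -
 have "compact (frontier \<Omega>)" using bounded_Omega by (simp add: compact_frontier_bounded)
 then have c: "compact (frontier \<Omega> \<times> {0..T})" by (intro compact_Times) auto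
 have "(frontier \<Omega> \<times> {0..T}) \<inter> track = {}"
  using Gamma_subset open_Omega by (auto simp: track_def frontier_def interior_open)
 then obtain d where d: "d > 0" "\<And>z w. z \<in> frontier \<Omega> \<times> {0..T} ==> w \<in> track ==> d \<le> dist z w"
  using separate_compact_closed[OF c compact_imp_closed[OF compact_track]] by blast
 show thesis
 proof (rule that[OF d(1)])
  fix x t assume *: "x \<in> frontier \<Omega>" "t \<in> {0..T}"
  have "d \<le> dist (x, t) (nearest x t, t)" using * nearest(1) by (intro d(2)) (auto simp: track_def)
  also have "\<dots> \<le> dist x (nearest x t)" using dist_Pair_le[of x t "nearest x t" t] by simp
  finally show "\<bar>sd x t\<bar> \<ge> d" unfolding abs_sd using nearest(2)[OF *(2)] by simp
 qed
qed

lemma sd_continuous_at: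
 assumes "t \<in> {0..T}" "e > 0"
 obtains d where "d > 0" "\<And>y s. s \<in> {0..T} ==> dist y x < d ==> \<bar>s - t\<bar> < d ==> \<bar>sd y s - sd x t\<bar> < e"
proof -
 obtain d where d: "d > 0" "\<And>z. z \<in> UNIV \<times> {0..T} ==> dist z (x, t) < d ==>
   dist (case z of (x, t) => sd x t) (case (x, t) of (x, t) => sd x t) < e"
  using sd_continuous assms unfolding continuous_on_iff by (metis SigmaI UNIV_I)
 show thesis
 proof (rule that[of "d/2"])
  fix y s assume "s \<in> {0..T}" "dist y x < d/2" "\<bar>s - t\<bar> < d/2"
  then show "\<bar>sd y s - sd x t\<bar> < e"
   using d(2)[of "(y, s)"] dist_Pair_le[of y s x t] by (simp add: dist_real_def)
 qed (use d in auto)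
qed

text \<open>Inside the tube the derivatives come from \<open>tube\<close> and the chain rule. Where
  \<open>\<bar>sd x t\<bar>\<close> exceeds \<open>2 * r\<close> the truncation is locally constant
  in space-time, so no regularity of the distance is needed there, and the two regimes
  overlap.\<close>

theorem truncated_distance:
 obtains D C r where "flow_distance \<Omega> T c0 vol_diff D C r"
  "\<And>x t. t \<in> {0..T} ==> D x t < 0 \<longleftrightarrow> x \<in> inside (\<Gamma> t)"
  "\<And>x t. t \<in> {0..T} ==> D x t > 0 \<longleftrightarrow> x \<in> outside (\<Gamma> t)"
  "\<And>x t. \<bar>D x t\<bar> < r ==> D x t = sd x t"
proof -
 obtain d where d: "d > 0" "\<And>x t. x \<in> frontier \<Omega> ==> t \<in> {0..T} ==> \<bar>sd x t\<bar> \<ge> d" using frontier_gap by blast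
 \<comment> \<open>\<open>2 * r\<close> stays below the width of the tube and below the distance of
   the hypersurfaces from the frontier of \<Omega>; the truncation is therefore already flat at the
   frontier.\<close>
 define r where "r = min \<delta> d / 4"
 have r: "r > 0" "2 * r < \<delta>" "2 * r < d" unfolding r_def using d(1) delta(1) by auto
 obtain \<eta> \<eta>1 \<eta>2 C1 where \<eta>:
  "\<And>s. (\<eta> has_real_derivative \<eta>1 s) (at s)" "\<And>s. (\<eta>1 has_real_derivative \<eta>2 s) (at s)"
  "C1 > 0" "\<And>s. \<bar>\<eta>1 s\<bar> \<le> 1" "\<And>s. \<bar>\<eta>2 s\<bar> \<le> C1"
  "\<And>s. \<bar>s\<bar> \<le> r ==> \<eta> s = s" "\<And>s. \<bar>s\<bar> \<le> r ==> \<eta>1 s = 1" "\<And>s. \<bar>s\<bar> \<le> r ==> \<eta>2 s = 0"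
  "\<And>s. s \<ge> 2 * r ==> \<eta> s = \<eta> (2 * r)" "\<And>s. s \<le> - 2 * r ==> \<eta> s = \<eta> (- 2 * r)"
  "\<And>s. s \<ge> r ==> \<eta> s \<ge> r" "\<And>s. s \<le> - r ==> \<eta> s \<le> - r"
  using smooth_truncation[OF r(1)] by blast
 define D where "D x t = \<eta> (sd x t)" for x t
 define C where "C = 1 + C1 + M + DIM('a) * (4 * M) + DIM('a) * (4 * M^2)"
 have Cnn: "0 \<le> DIM('a) * (4 * M)" "0 \<le> DIM('a) * (4 * M^2)" using M_ge_1 by auto
 have C: "C > 0" "C \<ge> 1" unfolding C_def using \<eta>(3) M_ge_1 Cnn by linarith+
 have sgn: "\<bar>\<eta> s\<bar> < r ==> \<bar>s\<bar> < r \<and> \<eta> s = s" "\<eta> s < 0 \<longleftrightarrow> s < 0" "\<eta> s > 0 \<longleftrightarrow> s > 0" for s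
 proof -
  consider "\<bar>s\<bar> \<le> r" | "s > r" | "s < - r" by linarith
  then have "(\<bar>\<eta> s\<bar> < r --> \<bar>s\<bar> < r \<and> \<eta> s = s) \<and> (\<eta> s < 0 \<longleftrightarrow> s < 0) \<and> (\<eta> s > 0 \<longleftrightarrow> s > 0)"
  proof cases
   case 1 then show ?thesis using \<eta>(6)[of s] by simp
  next
   case 2 then show ?thesis using \<eta>(11)[of s] r(1) by auto
  next
   case 3 then show ?thesis using \<eta>(12)[of s] r(1) by auto
  qed
  then show "\<bar>\<eta> s\<bar> < r ==> \<bar>s\<bar> < r \<and> \<eta> s = s" "\<eta> s < 0 \<longleftrightarrow> s < 0" "\<eta> s > 0 \<longleftrightarrow> s > 0" by blast+
 qed
 have locconst: "\<forall>s. \<bar>s - s0\<bar> < \<bar>s0\<bar> - 2 * r --> \<eta> s = \<eta> s0" if "\<bar>s0\<bar> > 2 * r" for s0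
 proof (intro allI impI)
  fix s assume "\<bar>s - s0\<bar> < \<bar>s0\<bar> - 2 * r"
  then consider "s \<ge> 2 * r" "s0 \<ge> 2 * r" | "s \<le> - 2 * r" "s0 \<le> - 2 * r" using that r(1) by linarith
  then show "\<eta> s = \<eta> s0" by cases (use \<eta>(9,10) in metis)+
 qed
 have far: "\<exists>d>0. \<forall>y s. s \<in> {0..T} --> dist y x < d --> \<bar>s - t\<bar> < d --> D y s = D x t"
  if t: "t \<in> {0..T}" and "\<bar>sd x t\<bar> > 2 * r" for x t
 proof -
  obtain e where "e > 0" "\<And>y s. s \<in> {0..T} ==> dist y x < e ==> \<bar>s - t\<bar> < e ==> \<bar>sd y s - sd x t\<bar> < \<bar>sd x t\<bar> - 2 * r"
   using sd_continuous_at[OF t, of "\<bar>sd x t\<bar> - 2 * r" x] \<open>\<bar>sd x t\<bar> > 2 * r\<close> by auto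
  with locconst[OF that(2)] show ?thesis unfolding D_def by blast
 qed
 have "flow_distance \<Omega> T c0 vol_diff D C r" unfolding flow_distance_def
 proof (intro conjI ballI allI C(1) r(1))
  have "continuous_on UNIV \<eta>" by (intro continuous_at_imp_continuous_on ballI DERIV_isCont[OF \<eta>(1)])
  from continuous_on_compose2[OF this sd_continuous]
  show "continuous_on (UNIV \<times> {0..T}) (\<lambda>(x, t). D x t)" unfolding D_def by (simp add: split_beta)
  fix t assume t: "t \<in> {0..T}"
  {
   fix x assume x: "x \<in> frontier \<Omega>"
   have "\<bar>sd x t\<bar> > 2 * r" using d(2)[OF x t] r(3) by linarith
   from far[OF t this] obtain e where "e > 0"
    and e: "\<forall>y s. s \<in> {0..T} --> dist y x < e --> \<bar>s - t\<bar> < e --> D y s = D x t"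
    by (elim exE conjE) (rule that)
   have "D y t = D x t" if "dist y x < e" for y
    by (rule e[rule_format]) (use t that \<open>e > 0\<close> in auto)
   with \<open>e > 0\<close> show "\<forall>\<^sub>F y in nhds x. D y t = D x t" unfolding eventually_nhds_metric by blast
  }
  fix x
  show "\<exists>G L \<theta>. has_jet (\<lambda>y. D y t) x G L \<and>
    ((\<lambda>s. D x s) has_real_derivative \<theta>) (at t within {0..T}) \<and>
    \<bar>G\<bar> \<le> C \<and> \<bar>L\<bar> \<le> C \<and> \<bar>\<theta>\<bar> \<le> C \<and>
    (\<bar>D x t\<bar> < r --> G = 1 \<and> \<bar>\<theta> - L + c0 * vol_diff t\<bar> \<le> C * \<bar>D x t\<bar>)"
  proof (cases "\<bar>sd x t\<bar> < \<delta>")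
   case True
   obtain l \<theta> where tube: "has_jet (\<lambda>y. sd y t) x 1 l"
    "((\<lambda>s. sd x s) has_real_derivative \<theta>) (at t within {0..T})" "\<bar>\<theta>\<bar> \<le> M"
    "\<bar>l\<bar> \<le> DIM('a) * (4 * M)"
    "\<bar>\<theta> - l + c0 * vol_diff t\<bar> \<le> DIM('a) * (4 * M^2) * \<bar>sd x t\<bar>"
    by (rule tube[OF t True], rule that)
   let ?s = "sd x t"
   have jet: "has_jet (\<lambda>y. D y t) x ((\<eta>1 ?s)^2 * 1) (\<eta>2 ?s * 1 + \<eta>1 ?s * l)"
    unfolding D_def using has_jet_compose[OF tube(1), of \<eta> \<eta>1 "\<eta>2 ?s"] \<eta>(1,2) by simp
   have time: "((\<lambda>s. D x s) has_real_derivative \<eta>1 ?s * \<theta>) (at t within {0..T})"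
    unfolding D_def by (rule DERIV_chain2[OF \<eta>(1) tube(2)])
   have b1: "\<bar>(\<eta>1 ?s)^2 * 1\<bar> \<le> C" using \<eta>(4)[of ?s] C(2) power_le_one[of "\<bar>\<eta>1 ?s\<bar>" 2] by simp
   have "\<bar>\<eta>1 ?s * l\<bar> \<le> 1 * (DIM('a) * (4 * M))" unfolding abs_mult using \<eta>(4) tube(4) by (intro mult_mono) auto
   then have b2: "\<bar>\<eta>2 ?s * 1 + \<eta>1 ?s * l\<bar> \<le> C" using \<eta>(5)[of ?s] M_ge_1 Cnn(2) unfolding C_def by linarith
   have "\<bar>\<eta>1 ?s * \<theta>\<bar> \<le> 1 * M" unfolding abs_mult using \<eta>(4) tube(3) by (intro mult_mono) auto
   then have b3: "\<bar>\<eta>1 ?s * \<theta>\<bar> \<le> C" using \<eta>(3) Cnn unfolding C_def by linarith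
   have b4: "(\<eta>1 ?s)^2 * 1 = 1 \<and> \<bar>\<eta>1 ?s * \<theta> - (\<eta>2 ?s * 1 + \<eta>1 ?s * l) + c0 * vol_diff t\<bar> \<le> C * \<bar>D x t\<bar>"
    if "\<bar>D x t\<bar> < r"
   proof -
    have s: "\<bar>?s\<bar> < r" "D x t = ?s" using that sgn(1) unfolding D_def by auto
    then have e: "\<eta>1 ?s = 1" "\<eta>2 ?s = 0" using \<eta>(7,8) by auto
    have "DIM('a) * (4 * M^2) \<le> C" unfolding C_def using \<eta>(3) M_ge_1 Cnn(1) by linarith
    then have "DIM('a) * (4 * M^2) * \<bar>?s\<bar> \<le> C * \<bar>?s\<bar>" by (rule mult_right_mono) simp
    then show ?thesis using tube(5) unfolding s(2) e by simp
   qed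
   show ?thesis using jet time b1 b2 b3 b4 by blast
  next
   case False
   then have big: "\<bar>sd x t\<bar> > 2 * r" using r(2) by simp
   from far[OF t big] obtain e where e: "e > 0"
    "\<forall>y s. s \<in> {0..T} --> dist y x < e --> \<bar>s - t\<bar> < e --> D y s = D x t"
    by (elim exE conjE) (rule that)
   have "D x t = D y t" if "dist y x < e" for y
    by (rule e(2)[rule_format, symmetric]) (use t that e(1) in auto)
   then have "has_jet (\<lambda>y. D y t) x 0 0"
    by - (rule has_jet_cong[OF has_jet_const[of "D x t"]], use e(1) in \<open>auto simp: eventually_nhds_metric\<close>)
   moreover have "D x s = D x t" if "s \<in> {0..T}" "\<bar>s - t\<bar> < e" for s
    by (rule e(2)[rule_format]) (use that e(1) in auto)
   then have "((\<lambda>s. D x s) has_real_derivative 0) (at t within {0..T})"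
    by - (rule has_field_derivative_transform_within[of "\<lambda>_. D x t", OF _ e(1) t], auto simp: dist_real_def)
   moreover have "\<not> \<bar>D x t\<bar> < r" using sgn(1)[of "sd x t"] big r(1) unfolding D_def by auto
   ultimately show ?thesis using C(1) by (intro exI[of _ 0]) auto
  qed
 qed
 then show thesis
  by (rule that) (use sgn sd_sign in \<open>auto simp: D_def\<close>)
qed

end

section \<open>Volume estimates\<close>

lemma continuous_on_slice:
 assumes "continuous_on (UNIV \<times> I) (\<lambda>(x, t). f x t)" "t \<in> I"
 shows "continuous_on UNIV (\<lambda>x. f x t)"
proof -
 have "continuous_on UNIV (\<lambda>x. (x, t))" by (intro continuous_intros)
 from continuous_on_compose2[OF assms(1) this] assms(2) show ?thesis by auto
qed

lemma continuous_bounded_integrable: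
 fixes g :: "'a::euclidean_space => real"
 assumes "open S" "bounded S" "continuous_on S g" "\<And>x. x \<in> S ==> \<bar>g x\<bar> \<le> R"
 shows "g integrable_on S"
proof -
 have S: "S \<in> lmeasurable" using assms(1,2) by (simp add: lmeasurable_open)
 have "g absolutely_integrable_on S"
  by (rule measurable_bounded_by_integrable_imp_absolutely_integrable[where g = "\<lambda>_. R"])
   (use S assms continuous_imp_measurable_on_sets_lebesgue integrable_on_const[OF S] fmeasurableD in auto)
 then show ?thesis by (rule set_lebesgue_integral_eq_integral(1))
qed

text \<open>Outside the slab the integrand is within \<open>\<kappa>\<close> of the sign, inside it
  only the crude bound \<open>R + 1\<close> holds. The volume of the slab is the price for not
  knowing the solution within the layer.\<close>

lemma integral_near_sign:
 fixes g :: "'a::euclidean_space => real"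
 assumes Om: "open \<Omega>" "bounded \<Omega>" and g: "continuous_on \<Omega> g" "\<And>x. x \<in> \<Omega> ==> \<bar>g x\<bar> \<le> R"
  and F: "continuous_on UNIV F" and \<kappa>: "\<kappa> \<ge> 0"
  and near: "\<And>x. x \<in> \<Omega> ==> s < \<bar>F x\<bar> ==> \<bar>g x - sgn (F x)\<bar> \<le> \<kappa>"
 shows "\<bar>integral \<Omega> g - (measure lebesgue {x\<in>\<Omega>. F x > 0} - measure lebesgue {x\<in>\<Omega>. F x < 0})\<bar>
   \<le> \<kappa> * measure lebesgue \<Omega> + (R + 1) * measure lebesgue {x\<in>\<Omega>. \<bar>F x\<bar> \<le> s}"
proof -
 let ?P = "{x\<in>\<Omega>. F x > 0}" and ?N = "{x\<in>\<Omega>. F x < 0}" and ?E = "{x\<in>\<Omega>. \<bar>F x\<bar> \<le> s}"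
 have OmL: "\<Omega> \<in> lmeasurable" using Om by (simp add: lmeasurable_open)
 have "open {x. F x > 0}" "open {x. F x < 0}"
  using open_Collect_less[OF continuous_on_const F] open_Collect_less[OF F continuous_on_const] by auto
 then have "open ?P" "open ?N" using Om(1) by (auto simp: Collect_conj_eq)
 moreover have "bounded ?P" "bounded ?N" using Om(2) by (auto intro: bounded_subset)
 ultimately have PN: "?P \<in> lmeasurable" "?N \<in> lmeasurable" by (simp_all add: lmeasurable_open)
 have "closed {x. \<bar>F x\<bar> \<le> s}" using closed_Collect_le[OF continuous_on_rabs[OF F] continuous_on_const] by simp
 then have "?E \<in> sets lebesgue" using Om(1) by (auto simp: Collect_conj_eq)
 then have E: "?E \<in> lmeasurable" using bounded_set_imp_lmeasurable[of ?E] Om(2) by (auto intro: bounded_subset)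
 have gi: "g integrable_on \<Omega>" by (rule continuous_bounded_integrable[OF Om g])
 have ii: "indicat_real S integrable_on \<Omega>" "integral \<Omega> (indicat_real S) = measure lebesgue S"
  if "S \<in> lmeasurable" "S \<subseteq> \<Omega>" for S
  using that integrable_on_indicator[of S \<Omega>] Equivalence_Lebesgue_Henstock_Integration.integral_indicator[of S \<Omega>]
  by (auto simp: Int_absorb2)
 have P: "indicat_real ?P integrable_on \<Omega>" "integral \<Omega> (indicat_real ?P) = measure lebesgue ?P"
  and N: "indicat_real ?N integrable_on \<Omega>" "integral \<Omega> (indicat_real ?N) = measure lebesgue ?N"
  and E': "indicat_real ?E integrable_on \<Omega>" "integral \<Omega> (indicat_real ?E) = measure lebesgue ?E"
  using ii PN E by auto
 let ?h = "\<lambda>x. g x - (indicat_real ?P x - indicat_real ?N x)"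
 let ?b = "\<lambda>x. \<kappa> + (R + 1) * indicat_real ?E x"
 have "norm (integral \<Omega> ?h) \<le> integral \<Omega> ?b"
 proof (rule Henstock_Kurzweil_Integration.integral_norm_bound_integral)
  show "?h integrable_on \<Omega>" using gi P N by (intro integrable_diff)
  show "?b integrable_on \<Omega>" using E' integrable_on_const[OF OmL] by (intro integrable_add integrable_on_mult_right)
  fix x assume x: "x \<in> \<Omega>"
  then have R: "R \<ge> 0" using g(2)[OF x] by linarith
  have sg: "indicat_real ?P x - indicat_real ?N x = sgn (F x)" using x by (auto simp: sgn_real_def indicator_def)
  show "norm (?h x) \<le> ?b x"
  proof (cases "s < \<bar>F x\<bar>")
   case True
   then show ?thesis using near[OF x] sg R by (simp add: indicator_def)
  next
   case False
   have "\<bar>sgn (F x)\<bar> \<le> 1" by (simp add: sgn_real_def)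
   then have "\<bar>g x - sgn (F x)\<bar> \<le> R + 1" using g(2)[OF x] by linarith
   then show ?thesis using False x sg \<kappa> by (simp add: indicator_def)
  qed
 qed
 also have "integral \<Omega> ?b = \<kappa> * measure lebesgue \<Omega> + (R + 1) * measure lebesgue ?E"
  using E' integrable_on_const[OF OmL, of \<kappa>] lmeasure_integral[OF OmL]
  by (simp add: Henstock_Kurzweil_Integration.integral_add integrable_on_mult_right
    Henstock_Kurzweil_Integration.integral_mult_right[of \<Omega> \<kappa> "\<lambda>_. 1", simplified])
 also have "integral \<Omega> ?h = integral \<Omega> g - (measure lebesgue ?P - measure lebesgue ?N)"
  using gi P N by (simp add: Henstock_Kurzweil_Integration.integral_diff integrable_diff)
 finally show ?thesis by simp
qed

text \<open>The translates of \<open>A\<close> by multiples of \<open>h\<close> along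
  \<open>e\<close> are disjoint. About \<open>1 / h\<close> of them fit into a ball larger by 1, and
  rounding down costs at most a factor 2.\<close>

lemma disjoint_translates_measure_le:
 fixes A :: "'a::euclidean_space set"
 assumes A: "A \<in> lmeasurable" "A \<subseteq> ball p R" and e: "norm e = 1" and h: "0 < h" "h \<le> 1 / 2"
  and dis: "\<And>x k. x \<in> A ==> k \<ge> h ==> x + k *\<^sub>R e \<notin> A"
 shows "measure lebesgue A \<le> 2 * h * measure lebesgue (ball p (R + 1))"
proof -
 define m where "m = nat \<lfloor>1 / h\<rfloor>"
 have m: "real m \<le> 1 / h" "real m \<ge> 1 / (2 * h)"
 proof -
  have "1 / h \<ge> 2" using h by (simp add: field_simps)
  moreover have "real m = of_int \<lfloor>1 / h\<rfloor>" unfolding m_def using h by simp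
  ultimately show "real m \<le> 1 / h" "real m \<ge> 1 / (2 * h)" by (simp_all, linarith+)
 qed
 let ?F = "\<lambda>j::nat. (+) ((real j * h) *\<^sub>R e) ` A"
 have "pairwise (\<lambda>i j. disjnt (?F i) (?F j)) {..<m}"
 proof -
  have "disjnt (?F i) (?F j)" if "i < j" for i j
  proof -
   have False if xy: "x \<in> A" "y \<in> A" "(real i * h) *\<^sub>R e + x = (real j * h) *\<^sub>R e + y" for x y
   proof -
    have "x = y + ((real j - real i) * h) *\<^sub>R e" using xy(3) by (simp add: algebra_simps)
    moreover have "(real j - real i) * h \<ge> h" using \<open>i < j\<close> h(1) by simp
    ultimately show False using dis[OF xy(2)] xy(1) by blast
   qed
   then show ?thesis unfolding disjnt_def by blast
  qed
  then show ?thesis unfolding pairwise_def by (metis disjnt_sym linorder_neqE_nat)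
 qed
 then have "measure lebesgue (\<Union>j\<in>{..<m}. ?F j) = (\<Sum>j\<in>{..<m}. measure lebesgue (?F j))"
  using A(1) by (intro measure_UNION') (auto intro: measurable_translation)
 also have "\<dots> = real m * measure lebesgue A" by (simp add: measure_translation)
 finally have 1: "real m * measure lebesgue A = measure lebesgue (\<Union>j\<in>{..<m}. ?F j)" by simp
 also have "\<dots> \<le> measure lebesgue (ball p (R + 1))"
 proof (rule measure_mono_fmeasurable)
  show "(\<Union>j\<in>{..<m}. ?F j) \<subseteq> ball p (R + 1)"
  proof
   fix y assume "y \<in> (\<Union>j\<in>{..<m}. ?F j)"
   then obtain j x where j: "j < m" "x \<in> A" "y = (real j * h) *\<^sub>R e + x" by auto
   have "real j * h \<le> real m * h" using j(1) h(1) by simp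
   also have "\<dots> \<le> 1" using m(1) h(1) by (simp add: field_simps)
   finally have "norm ((real j * h) *\<^sub>R e) \<le> 1" using e h(1) by simp
   moreover have "dist p y \<le> dist p x + norm ((real j * h) *\<^sub>R e)"
    using j(3) by (metis add.commute add_diff_cancel_left' dist_norm dist_triangle norm_minus_commute)
   moreover have "dist p x < R" using j(2) A(2) by auto
   ultimately show "y \<in> ball p (R + 1)" by simp
  qed
  show "(\<Union>j\<in>{..<m}. ?F j) \<in> sets lebesgue"
   using A(1) by (intro sets.finite_UN) (auto intro!: fmeasurableD measurable_translation)
 qed simp
 finally have "1 / (2 * h) * measure lebesgue A \<le> measure lebesgue (ball p (R + 1))"
  using m(2) by (meson measure_nonneg mult_right_mono order_trans)
 then show ?thesis using h(1) by (simp add: field_simps)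
qed

section \<open>Volume of thin slabs around the hypersurface\<close>

context limit_flow_tube
begin

lemma sd_continuous_space:
 assumes "t \<in> {0..T}" shows "continuous_on UNIV (\<lambda>x. sd x t)"
 by (rule continuous_on_slice[OF sd_continuous assms])

text \<open>Near \<open>p\<close> the distance grows at rate at least 1/2 in the direction of the
  normal at \<open>p\<close>, so two points of the slab on a line in that direction are at most
  \<open>4 * s\<close> apart. Translates by \<open>5 * s\<close> are therefore disjoint.\<close>

lemma local_slab_measure:
 assumes p: "t0 \<in> {0..T}" "p \<in> \<Gamma> t0" and t: "t \<in> {0..T}" "\<bar>t - t0\<bar> < \<delta> / 4" and s: "0 < s" "s < \<delta> / 4"
 shows "measure lebesgue {x \<in> ball p (\<delta> / 4). \<bar>sd x t\<bar> \<le> s} \<le> 10 * s * measure lebesgue (ball p (\<delta> / 4 + 1))"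
proof -
 let ?A = "{x \<in> ball p (\<delta> / 4). \<bar>sd x t\<bar> \<le> s}"
 have np: "nearest p t0 = p" using nearest(2)[OF p(1), of p] infdist_eq_0_iff[OF p(1)] p(2) by simp
 have sdp: "sd p t0 = 0" using sd_sign(2)[OF p(1)] p(2) by simp
 have "(p, t0) \<in> track" using p by (simp add: track_def)
 from ncharts[OF this] obtain n \<theta> where ch: "nchart \<rho> M p t0 n \<theta>" by blast
 then have ch': "nchart \<rho> M (nearest p t0) t0 n \<theta>" using np by simp
 define e where "e = n (p, t0)"
 have pc: "(p, t0) \<in> cball (p, t0) \<rho>" using rho_pos by simp
 have e1: "norm e = 1" using ch pc unfolding nchart_def e_def by blast
 have sdp1: "\<bar>sd p t0\<bar> < \<delta>" using sdp delta(1) by simp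
 have grad: "((\<lambda>y. sd y t) has_derivative (\<lambda>h. n (nearest z t, t) \<bullet> h)) (at z)" "n (nearest z t, t) \<bullet> e \<ge> 1 / 2"
  if z: "norm (z - p) < \<delta> / 4" "\<bar>sd z t\<bar> < 3 * \<delta> / 4" for z
 proof -
  have zz: "norm (z - p) < \<delta>" "\<bar>sd z t\<bar> < \<delta>" "\<bar>t - t0\<bar> < \<delta>" using z t delta(1) by auto
  show "((\<lambda>y. sd y t) has_derivative (\<lambda>h. n (nearest z t, t) \<bullet> h)) (at z)"
   by (rule sd_gradient[OF ch' p(1) sdp1 t(1) zz(1,3,2)])
  have "(nearest z t, t) \<in> ball (nearest p t0, t0) \<rho>" by (rule tube_chart[OF p(1) t(1) zz(1,3) sdp1 zz(2)])
  then have zb: "(nearest z t, t) \<in> cball (p, t0) \<rho>" using np by auto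
  have "norm (n (nearest z t, t) - e) \<le> M * norm ((nearest z t, t) - (p, t0))"
   using ch pc zb unfolding nchart_def e_def by blast
  also have "\<dots> \<le> M * (2 * \<delta>)"
  proof (rule mult_left_mono)
   have "norm (nearest z t - p) < \<delta>" using nearest_dist[OF p(1) t(1), of z p] z sdp np by simp
   then show "norm ((nearest z t, t) - (p, t0)) \<le> 2 * \<delta>"
    using norm_Pair_le[of "nearest z t - p" "t - t0"] zz(3) by simp
  qed (use M_ge_1 in auto)
  also have "\<dots> \<le> 1 / 2" using delta(4) by (simp add: mult.commute)
  finally have "\<bar>(n (nearest z t, t) - e) \<bullet> e\<bar> \<le> 1 / 2"
   using Cauchy_Schwarz_ineq2[of "n (nearest z t, t) - e" e] e1 by simp
  then have "\<bar>n (nearest z t, t) \<bullet> e - 1\<bar> \<le> 1 / 2" using e1 by (simp add: inner_diff_left norm_eq_1)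
  then show "n (nearest z t, t) \<bullet> e \<ge> 1 / 2" by linarith
 qed
 have slope: "h \<le> 4 * s" if x: "x \<in> ?A" "x + h *\<^sub>R e \<in> ?A" "h > 0" for x h
 proof -
  let ?g = "\<lambda>r. sd (x + r *\<^sub>R e) t"
  have dx: "norm (x - p) < \<delta> / 4" "norm (x + h *\<^sub>R e - p) < \<delta> / 4"
   using x by (auto simp: dist_norm norm_minus_commute)
  have "h = norm ((x + h *\<^sub>R e - p) - (x - p))" using e1 x(3) by simp
  also have "\<dots> < \<delta> / 4 + \<delta> / 4" using norm_triangle_ineq4[of "x + h *\<^sub>R e - p" "x - p"] dx by linarith
  finally have h\<delta>: "h < \<delta> / 2" by simp
  have mid: "norm (x + r *\<^sub>R e - p) < \<delta> / 4" "\<bar>sd (x + r *\<^sub>R e) t\<bar> < 3 * \<delta> / 4" if r: "0 \<le> r" "r \<le> h" for r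
  proof -
   have "x + r *\<^sub>R e = (1 - r / h) *\<^sub>R x + (r / h) *\<^sub>R (x + h *\<^sub>R e)" using x(3) by (simp add: algebra_simps)
   then have "x + r *\<^sub>R e \<in> ball p (\<delta> / 4)"
    using convexD[OF convex_ball, of x p "\<delta>/4" "x + h *\<^sub>R e" "1 - r / h" "r / h"] x r by (simp add: field_simps)
   then show "norm (x + r *\<^sub>R e - p) < \<delta> / 4" by (simp add: dist_norm norm_minus_commute)
   have "\<bar>sd (x + r *\<^sub>R e) t\<bar> \<le> \<bar>sd x t\<bar> + norm (r *\<^sub>R e)" using sd_lipschitz[of "x + r *\<^sub>R e" t x] by simp
   also have "\<dots> < \<delta> / 4 + \<delta> / 2" using x(1) s(2) r h\<delta> e1 by simp
   finally show "\<bar>sd (x + r *\<^sub>R e) t\<bar> < 3 * \<delta> / 4" by simp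
  qed
  have der: "(?g has_real_derivative n (nearest (x + r *\<^sub>R e) t, t) \<bullet> e) (at r)" if r: "0 \<le> r" "r \<le> h" for r
  proof -
   have "((\<lambda>r. x + r *\<^sub>R e) has_derivative (\<lambda>k. k *\<^sub>R e)) (at r)" by (auto intro!: derivative_eq_intros)
   from has_derivative_compose[OF this grad(1)[OF mid[OF r]]]
   show ?thesis by (simp add: has_field_derivative_def mult_commute_abs)
  qed
  obtain z where z: "0 < z" "z < h" "?g h - ?g 0 = (h - 0) * (n (nearest (x + z *\<^sub>R e) t, t) \<bullet> e)"
   using MVT2[OF x(3), of ?g "\<lambda>r. n (nearest (x + r *\<^sub>R e) t, t) \<bullet> e"] der by auto
  have "n (nearest (x + z *\<^sub>R e) t, t) \<bullet> e \<ge> 1 / 2" using grad(2)[OF mid] z by simp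
  then have "h * (1 / 2) \<le> h * (n (nearest (x + z *\<^sub>R e) t, t) \<bullet> e)" using x(3) by (intro mult_left_mono) auto
  also have "\<dots> = ?g h - ?g 0" using z(3) by simp
  also have "\<dots> \<le> 2 * s" using x(1,2) by (simp add: abs_le_iff)
  finally show ?thesis by simp
 qed
 have "closed {x. \<bar>sd x t\<bar> \<le> s}"
  using closed_Collect_le[OF continuous_on_rabs[OF sd_continuous_space[OF t(1)]] continuous_on_const] by simp
 then have "?A \<in> sets lebesgue" by (auto simp: Collect_conj_eq)
 moreover have "bounded ?A" by (rule bounded_subset[OF bounded_ball]) blast
 ultimately have A: "?A \<in> lmeasurable" by (intro bounded_set_imp_lmeasurable)
 have "measure lebesgue ?A \<le> 2 * (5 * s) * measure lebesgue (ball p (\<delta> / 4 + 1))"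
 proof (rule disjoint_translates_measure_le[OF A _ e1])
  show "5 * s \<le> 1 / 2" using s(2) delta(5) by simp
  fix x k assume "x \<in> ?A" "5 * s \<le> k"
  then show "x + k *\<^sub>R e \<notin> ?A" using slope[of x k] s(1) by force
 qed (use s in auto)
 then show ?thesis by simp
qed

text \<open>Finitely many space-time balls cover the track, so the local bounds add up with a
  constant independent of the time.\<close>

lemma slab_measure:
 obtains C \<kappa> where "C > 0" "\<kappa> > 0"
  "\<And>t s. t \<in> {0..T} ==> 0 < s ==> s < \<kappa> ==> measure lebesgue {x. \<bar>sd x t\<bar> \<le> s} \<le> C * s"
proof -
 define \<kappa> where "\<kappa> = \<delta> / 8"
 have \<kappa>: "\<kappa> > 0" unfolding \<kappa>_def using delta(1) by simp
 obtain D where D: "D \<subseteq> track" "finite D" "track \<subseteq> (\<Union>z\<in>D. ball z \<kappa>)"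
 proof (rule compactE_image[OF compact_track, of track "\<lambda>z. ball z \<kappa>"])
  show "track \<subseteq> (\<Union>z\<in>track. ball z \<kappa>)" using \<kappa> by force
 qed (use that in auto)
 define V where "V z = measure lebesgue (ball (fst z) (\<delta> / 4 + 1))" for z :: "'a \<times> real"
 define C where "C = 10 * (\<Sum>z\<in>D. V z) + 1"
 have V0: "V z \<ge> 0" for z unfolding V_def by simp
 show thesis
 proof (rule that[of C \<kappa>])
  show "C > 0" unfolding C_def using V0 by (simp add: sum_nonneg add_nonneg_pos)
  fix t s assume t: "t \<in> {0..T}" and s: "0 < s" "s < \<kappa>"
  define A where "A z = (if \<bar>t - snd z\<bar> < \<delta> / 4 then {x \<in> ball (fst z) (\<delta> / 4). \<bar>sd x t\<bar> \<le> s} else {})" for z :: "'a \<times> real"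
  have cl: "closed {x. \<bar>sd x t\<bar> \<le> s}"
   using closed_Collect_le[OF continuous_on_rabs[OF sd_continuous_space[OF t]] continuous_on_const] by simp
  have Aset: "A z \<in> sets lebesgue" for z unfolding A_def using cl by (auto simp: Collect_conj_eq)
  have "A z \<subseteq> ball (fst z) (\<delta> / 4)" for z unfolding A_def by auto
  then have "bounded (A z)" for z by (rule bounded_subset[OF bounded_ball])
  then have Am: "A z \<in> lmeasurable" for z using bounded_set_imp_lmeasurable[OF _ Aset] by blast
  have cover: "{x. \<bar>sd x t\<bar> \<le> s} \<subseteq> (\<Union>z\<in>D. A z)"
  proof
   fix x assume "x \<in> {x. \<bar>sd x t\<bar> \<le> s}"
   then have x: "\<bar>sd x t\<bar> \<le> s" by simp
   have "(nearest x t, t) \<in> track" using nearest(1)[OF t] t by (simp add: track_def)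
   then obtain z where z: "z \<in> D" "dist z (nearest x t, t) < \<kappa>" using D(3) by auto
   have "dist (fst z) (nearest x t) < \<kappa>" "\<bar>snd z - t\<bar> < \<kappa>"
    using z(2) dist_fst_le[of z "(nearest x t, t)"] dist_snd_le[of z "(nearest x t, t)"] by (auto simp: dist_real_def)
   moreover have "dist x (nearest x t) \<le> s" using nearest(2)[OF t, of x] x by (simp add: abs_sd)
   ultimately have "dist (fst z) x < \<delta> / 4" "\<bar>t - snd z\<bar> < \<delta> / 4"
    using dist_triangle[of "fst z" x "nearest x t"] s(2) delta(1) dist_commute[of x "nearest x t"]
    unfolding \<kappa>_def by linarith+
   then show "x \<in> (\<Union>z\<in>D. A z)" using z(1) x unfolding A_def by auto
  qed
  have "measure lebesgue {x. \<bar>sd x t\<bar> \<le> s} \<le> measure lebesgue (\<Union>z\<in>D. A z)"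
   using cl D(2) Am by (intro measure_mono_fmeasurable[OF cover] fmeasurable.finite_UN) auto
  also have "\<dots> \<le> (\<Sum>z\<in>D. measure lebesgue (A z))" by (rule measure_UNION_le[OF D(2) Aset])
  also have "\<dots> \<le> (\<Sum>z\<in>D. 10 * s * V z)"
  proof (rule sum_mono)
   fix z assume "z \<in> D"
   then have z: "snd z \<in> {0..T}" "fst z \<in> \<Gamma> (snd z)" using D(1) by (auto simp: track_def)
   show "measure lebesgue (A z) \<le> 10 * s * V z"
   proof (cases "\<bar>t - snd z\<bar> < \<delta> / 4")
    case True
    have "s < \<delta> / 4" using s delta(1) unfolding \<kappa>_def by simp
    from local_slab_measure[OF z t True s(1) this] True show ?thesis unfolding A_def V_def by simp
   qed (use s V0 in \<open>auto simp: A_def\<close>)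
  qed
  also have "\<dots> = 10 * s * (\<Sum>z\<in>D. V z)" by (simp add: sum_distrib_left)
  also have "\<dots> \<le> C * s" unfolding C_def using s by (simp add: algebra_simps)
  finally show "measure lebesgue {x. \<bar>sd x t\<bar> \<le> s} \<le> C * s" .
 qed (rule \<kappa>)
qed

end

theorem (in limit_flow) flow_distance_exists:
 obtains D C r where "flow_distance \<Omega> T c0 vol_diff D C r"
  "\<And>x t. t \<in> {0..T} ==> D x t < 0 \<longleftrightarrow> x \<in> inside (\<Gamma> t)"
  "\<And>x t. t \<in> {0..T} ==> D x t > 0 \<longleftrightarrow> x \<in> outside (\<Gamma> t)"
  "\<And>t s. t \<in> {0..T} ==> s > 0 ==> measure lebesgue {x\<in>\<Omega>. \<bar>D x t\<bar> \<le> s} \<le> C * s"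
  "continuous_on {0..T} vol_diff"
proof -
 obtain \<rho> M where "\<rho> > 0" "M \<ge> 1" "\<And>y t. (y, t) \<in> track ==> \<exists>n \<theta>. nchart \<rho> M y t n \<theta>"
  using uniform_ncharts by blast
 then interpret limit_flow_tube \<Omega> c0 T \<Gamma>0 \<Gamma> \<rho> M by unfold_locales
 obtain D C1 r where D: "flow_distance \<Omega> T c0 vol_diff D C1 r"
  "\<And>x t. t \<in> {0..T} ==> D x t < 0 \<longleftrightarrow> x \<in> inside (\<Gamma> t)"
  "\<And>x t. t \<in> {0..T} ==> D x t > 0 \<longleftrightarrow> x \<in> outside (\<Gamma> t)"
  "\<And>x t. \<bar>D x t\<bar> < r ==> D x t = sd x t"
  using truncated_distance by blast
 have C1: "C1 > 0" "r > 0" and Dcont: "continuous_on (UNIV \<times> {0..T}) (\<lambda>(x, t). D x t)"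
  using D(1) unfolding flow_distance_def by auto
 obtain C2 \<kappa> where sl: "C2 > 0" "\<kappa> > 0"
  "\<And>t s. t \<in> {0..T} ==> 0 < s ==> s < \<kappa> ==> measure lebesgue {x. \<bar>sd x t\<bar> \<le> s} \<le> C2 * s"
  using slab_measure by blast
 have OmL: "\<Omega> \<in> lmeasurable" using open_Omega bounded_Omega by (simp add: lmeasurable_open)
 have Dx: "continuous_on UNIV (\<lambda>x. D x t)" if "t \<in> {0..T}" for t
  by (rule continuous_on_slice[OF Dcont that])
 have Em: "{x\<in>\<Omega>. \<bar>D x t\<bar> \<le> s} \<in> lmeasurable" if "t \<in> {0..T}" for t s
 proof -
  have "closed {x. \<bar>D x t\<bar> \<le> s}"
   using closed_Collect_le[OF continuous_on_rabs[OF Dx[OF that]] continuous_on_const] by simp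
  then have "{x\<in>\<Omega>. \<bar>D x t\<bar> \<le> s} \<in> sets lebesgue" using open_Omega by (auto simp: Collect_conj_eq)
  then show ?thesis
   using bounded_set_imp_lmeasurable[of "{x\<in>\<Omega>. \<bar>D x t\<bar> \<le> s}"] bounded_Omega by (auto intro: bounded_subset)
 qed
 define s0 where "s0 = min r \<kappa>"
 have s0: "s0 > 0" "s0 \<le> r" "s0 \<le> \<kappa>" unfolding s0_def using C1 sl by auto
 \<comment> \<open>The last term makes the slab bound trivial for \<open>s \<ge> s0\<close>, so that
   it holds for all positive \<open>s\<close>.\<close>
 define C where "C = C1 + C2 + measure lebesgue \<Omega> / s0"
 have Cge: "C1 \<le> C" "C2 \<le> C" "measure lebesgue \<Omega> / s0 \<le> C" "C > 0"
  unfolding C_def using C1 sl s0 by (auto simp: add_pos_nonneg)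
 have vol: "measure lebesgue {x\<in>\<Omega>. \<bar>D x t\<bar> \<le> s} \<le> C * s" if t: "t \<in> {0..T}" and s: "s > 0" for t s
 proof (cases "s < s0")
  case True
  have sub: "{x\<in>\<Omega>. \<bar>D x t\<bar> \<le> s} \<subseteq> {x. \<bar>sd x t\<bar> \<le> s}"
  proof clarify
   fix x assume "\<bar>D x t\<bar> \<le> s"
   moreover from this have "D x t = sd x t" using True s0(2) by (intro D(4)) simp
   ultimately show "\<bar>sd x t\<bar> \<le> s" by simp
  qed
  have "bounded {x. \<bar>sd x t\<bar> \<le> s}"
  proof -
   obtain B where B: "\<And>y. y \<in> \<Gamma> t ==> norm y \<le> B"
    using compact_imp_bounded[OF compact_Gamma[OF t]] by (auto simp: bounded_iff)
   have "norm x \<le> B + s" if "\<bar>sd x t\<bar> \<le> s" for x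
   proof -
    have "norm x \<le> norm (nearest x t) + dist x (nearest x t)" by (simp add: dist_norm norm_triangle_sub)
    then show ?thesis using B[OF nearest(1)[OF t]] nearest(2)[OF t, of x] that by (simp add: abs_sd) (smt (verit))
   qed
   then show ?thesis by (auto simp: bounded_iff)
  qed
  moreover have "closed {x. \<bar>sd x t\<bar> \<le> s}"
   using closed_Collect_le[OF continuous_on_rabs[OF sd_continuous_space[OF t]] continuous_on_const] by simp
  ultimately have "{x. \<bar>sd x t\<bar> \<le> s} \<in> lmeasurable" by (simp add: lmeasurable_compact compact_eq_bounded_closed)
  from measure_mono_fmeasurable[OF sub fmeasurableD[OF Em[OF t]] this]
  have "measure lebesgue {x\<in>\<Omega>. \<bar>D x t\<bar> \<le> s} \<le> C2 * s" using sl(3)[OF t s] True s0(3) by linarith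
  also have "\<dots> \<le> C * s" using Cge(2) s by (intro mult_right_mono) auto
  finally show ?thesis .
 next
  case False
  have "measure lebesgue {x\<in>\<Omega>. \<bar>D x t\<bar> \<le> s} \<le> measure lebesgue \<Omega>"
   by (rule measure_mono_fmeasurable[OF _ fmeasurableD[OF Em[OF t]] OmL]) auto
  also have "\<dots> = measure lebesgue \<Omega> / s0 * s0" using s0(1) by simp
  also have "\<dots> \<le> C * s" using Cge s0(1) False by (intro mult_mono) auto
  finally show ?thesis .
 qed
 have fd: "flow_distance \<Omega> T c0 vol_diff D C r" unfolding flow_distance_def
 proof (intro conjI ballI allI)
  show "continuous_on (UNIV \<times> {0..T}) (\<lambda>(x, t). D x t)" by (rule Dcont)
  fix t assume t: "t \<in> {0..T}"
  show "\<forall>\<^sub>F y in nhds x. D y t = D x t" if "x \<in> frontier \<Omega>" for x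
   using D(1) t that unfolding flow_distance_def by blast
  fix x
  obtain G L \<theta> where *: "has_jet (\<lambda>y. D y t) x G L" "((\<lambda>s. D x s) has_real_derivative \<theta>) (at t within {0..T})"
   "\<bar>G\<bar> \<le> C1" "\<bar>L\<bar> \<le> C1" "\<bar>\<theta>\<bar> \<le> C1" "\<bar>D x t\<bar> < r --> G = 1 \<and> \<bar>\<theta> - L + c0 * vol_diff t\<bar> \<le> C1 * \<bar>D x t\<bar>"
   using D(1) t unfolding flow_distance_def by metis
  have "C1 * \<bar>D x t\<bar> \<le> C * \<bar>D x t\<bar>" using Cge(1) by (rule mult_right_mono) simp
  with *(6) have "\<bar>D x t\<bar> < r --> G = 1 \<and> \<bar>\<theta> - L + c0 * vol_diff t\<bar> \<le> C * \<bar>D x t\<bar>" by linarith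
  moreover have "\<bar>G\<bar> \<le> C" "\<bar>L\<bar> \<le> C" "\<bar>\<theta>\<bar> \<le> C" using *(3-5) Cge(1) by linarith+
  ultimately show "\<exists>G L \<theta>. has_jet (\<lambda>y. D y t) x G L \<and>
    ((\<lambda>s. D x s) has_real_derivative \<theta>) (at t within {0..T}) \<and>
    \<bar>G\<bar> \<le> C \<and> \<bar>L\<bar> \<le> C \<and> \<bar>\<theta>\<bar> \<le> C \<and>
    (\<bar>D x t\<bar> < r --> G = 1 \<and> \<bar>\<theta> - L + c0 * vol_diff t\<bar> \<le> C * \<bar>D x t\<bar>)"
   using *(1,2) by blast
 qed (use Cge C1 in auto)
 have out: "outer_region \<Omega> (\<Gamma> t) = {x\<in>\<Omega>. D x t > 0}" "inner_region \<Omega> (\<Gamma> t) = {x\<in>\<Omega>. D x t < 0}" if "t \<in> {0..T}" for t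
  using D(2,3)[OF that] unfolding outer_region_def inner_region_def by auto
 have meas: "{x\<in>\<Omega>. D x t > 0} \<in> lmeasurable" "{x\<in>\<Omega>. D x t < 0} \<in> lmeasurable" if "t \<in> {0..T}" for t
 proof -
  have "open {x. D x t > 0}" "open {x. D x t < 0}"
   using open_Collect_less[OF continuous_on_const Dx[OF that]] open_Collect_less[OF Dx[OF that] continuous_on_const] by auto
  then show "{x\<in>\<Omega>. D x t > 0} \<in> lmeasurable" "{x\<in>\<Omega>. D x t < 0} \<in> lmeasurable"
   using open_Omega bounded_Omega by (auto simp: Collect_conj_eq intro!: lmeasurable_open bounded_subset[OF bounded_Omega])
 qed
 \<comment> \<open>If \<open>D\<close> moves by less than \<open>e1\<close> between the two times, a
   point of \<Omega> can leave or enter one of the two regions only where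
   \<open>\<bar>D x t\<bar> \<le> e1\<close>, and the slab bound controls the volume of these
   points.\<close>
 have "continuous_on {0..T} vol_diff" unfolding continuous_on_iff
 proof (intro ballI allI impI)
  fix t e assume t: "t \<in> {0..T}" and e: "(0::real) < e"
  define e1 where "e1 = e / (3 * C)"
  have e1: "e1 > 0" unfolding e1_def using e Cge by simp
  have "compact (closure \<Omega> \<times> {0..T})" using bounded_Omega by (intro compact_Times) (auto simp: compact_closure)
  then have "uniformly_continuous_on (closure \<Omega> \<times> {0..T}) (\<lambda>(x, t). D x t)"
   by (intro compact_uniformly_continuous continuous_on_subset[OF Dcont]) auto
  then obtain d where d: "d > 0" "\<And>z z'. z \<in> closure \<Omega> \<times> {0..T} ==> z' \<in> closure \<Omega> \<times> {0..T} ==> dist z' z < d ==>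
    dist (case z' of (x, t) => D x t) (case z of (x, t) => D x t) < e1"
   using e1 unfolding uniformly_continuous_on_def by meson
  show "\<exists>d>0. \<forall>s\<in>{0..T}. dist s t < d --> dist (vol_diff s) (vol_diff t) < e"
  proof (intro exI[of _ d] conjI ballI impI d(1))
   fix s assume s: "s \<in> {0..T}" "dist s t < d"
   have Dst: "\<bar>D x s - D x t\<bar> < e1" if "x \<in> \<Omega>" for x
    using d(2)[of "(x, t)" "(x, s)"] that s t dist_Pair_le[of x s x t] closure_subset[of \<Omega>] by (auto simp: dist_real_def)
   let ?E = "{x\<in>\<Omega>. \<bar>D x t\<bar> \<le> e1}"
   have le: "measure lebesgue A \<le> measure lebesgue B + C * e1"
    if "A \<in> lmeasurable" "B \<in> lmeasurable" "A \<subseteq> B \<union> ?E" for A B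
   proof -
    have "measure lebesgue A \<le> measure lebesgue (B \<union> ?E)"
     by (rule measure_mono_fmeasurable[OF that(3)]) (use that Em[OF t] in \<open>auto intro: fmeasurable.Un\<close>)
    also have "\<dots> \<le> measure lebesgue B + measure lebesgue ?E"
     by (rule measure_Un_le) (use that Em[OF t] in auto)
    finally show ?thesis using vol[OF t e1] by linarith
   qed
   have Dst': "D x t < D x s + e1" "D x s < D x t + e1" if "x \<in> \<Omega>" for x using Dst[OF that] by linarith+
   have "{x\<in>\<Omega>. D x s > 0} \<subseteq> {x\<in>\<Omega>. D x t > 0} \<union> ?E" "{x\<in>\<Omega>. D x t > 0} \<subseteq> {x\<in>\<Omega>. D x s > 0} \<union> ?E"
    "{x\<in>\<Omega>. D x s < 0} \<subseteq> {x\<in>\<Omega>. D x t < 0} \<union> ?E" "{x\<in>\<Omega>. D x t < 0} \<subseteq> {x\<in>\<Omega>. D x s < 0} \<union> ?E"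
    using Dst' by (fastforce simp: abs_le_iff)+
   then have "\<bar>measure lebesgue {x\<in>\<Omega>. D x s > 0} - measure lebesgue {x\<in>\<Omega>. D x t > 0}\<bar> \<le> C * e1"
    "\<bar>measure lebesgue {x\<in>\<Omega>. D x s < 0} - measure lebesgue {x\<in>\<Omega>. D x t < 0}\<bar> \<le> C * e1"
    using le meas[OF s(1)] meas[OF t] by (simp_all add: abs_le_iff) (smt (verit, best))+
   then have "\<bar>vol_diff s - vol_diff t\<bar> \<le> 2 * (C * e1)"
    unfolding vol_diff_def out[OF s(1)] out[OF t] by linarith
   also have "\<dots> < e" unfolding e1_def using e Cge(4) by (simp add: field_simps)
   finally show "dist (vol_diff s) (vol_diff t) < e" by (simp add: dist_real_def)
  qed
 qed
 from that[OF fd D(2,3) vol this] show thesis by blast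
qed

section \<open>Comparison principle\<close>

definition reflect :: "(real => real => real) => real => real => real" where
 "reflect f p q = - f (- p) (- q)"

text \<open>What touching arguments use of a solution: a jet in space and a time derivative inside,
  and a gradient relative to the closed domain on the frontier. The initial value is kept
  apart.\<close>

definition AC_sol :: "(real => real => real) => 'a::euclidean_space set => real => ('a => real => real) => bool" where
 "AC_sol f \<Omega> eps u \<longleftrightarrow>
   continuous_on (closure \<Omega> \<times> {0..}) (\<lambda>(x, t). u x t) \<and>
   (\<forall>x\<in>\<Omega>. \<forall>t>0. \<exists>G L. has_jet (\<lambda>y. u y t) x G L \<and>
    ((\<lambda>s. u x s) has_real_derivative L + 1 / eps^2 * f (u x t) (eps * integral \<Omega> (\<lambda>y. u y t))) (at t)) \<and>
   (\<forall>x\<in>frontier \<Omega>. \<forall>t>0. \<exists>g. ((\<lambda>y. u y t) has_derivative (\<lambda>h. g \<bullet> h)) (at x within closure \<Omega>) \<and>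
    (\<forall>n. exterior_unit_normal \<Omega> x n --> g \<bullet> n = 0))"

text \<open>A strict supersolution at a single point, with the nonlocal term frozen at the number
  \<open>v\<close>. Being a statement about one point, it can be demanded only where the solution
  touches the barrier, and with \<open>v\<close> the integral of the solution itself rather than of
  the barrier.\<close>

definition supersol_at :: "(real => real => real) => 'a::euclidean_space set => real => ('a => real => real) =>
  real => real => 'a => real => bool" where
 "supersol_at f \<Omega> eps B v T x t \<longleftrightarrow>
   (x \<in> \<Omega> --> (\<exists>\<beta> G L. ((\<lambda>s. B x s) has_real_derivative \<beta>) (at t within {0..T}) \<and>
    has_jet (\<lambda>y. B y t) x G L \<and> \<beta> - L > 1 / eps^2 * f (B x t) (eps * v))) \<and>
   (x \<in> frontier \<Omega> --> (\<exists>n b. exterior_unit_normal \<Omega> x n \<and> ((\<lambda>y. B y t) has_derivative b) (at x) \<and> b n > 0))"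

lemma nonlocal_AC_solution_imp_AC_sol:
 assumes "nonlocal_AC_solution f \<Omega> u0 eps u" "open \<Omega>"
 shows "AC_sol f \<Omega> eps u"
proof -
 obtain G where G: "\<forall>x\<in>closure \<Omega>. \<forall>t>0. ((\<lambda>y. u y t) has_derivative (\<lambda>h. G x t \<bullet> h)) (at x within closure \<Omega>)"
  "\<forall>x\<in>frontier \<Omega>. \<forall>t>0. \<forall>n. exterior_unit_normal \<Omega> x n --> G x t \<bullet> n = 0"
  using assms(1) unfolding nonlocal_AC_solution_def by auto
 have *: "continuous_on (closure \<Omega> \<times> {0..}) (\<lambda>(x, t). u x t)"
   "\<And>x t. x \<in> \<Omega> ==> t > 0 ==> grad (\<lambda>y. u y t) differentiable (at x)"
   "\<And>x t. x \<in> \<Omega> ==> t > 0 ==> ((\<lambda>s. u x s) has_real_derivative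
    laplacian (\<lambda>y. u y t) x + 1 / eps^2 * f (u x t) (eps * integral \<Omega> (\<lambda>y. u y t))) (at t)"
  using assms(1) unfolding nonlocal_AC_solution_def by auto
 show ?thesis unfolding AC_sol_def
 proof (intro conjI ballI allI impI *(1))
  fix x and t :: real assume x: "x \<in> frontier \<Omega>" and t: "t > 0"
  then have "x \<in> closure \<Omega>" by (simp add: frontier_def)
  then show "\<exists>g. ((\<lambda>y. u y t) has_derivative (\<lambda>h. g \<bullet> h)) (at x within closure \<Omega>) \<and>
    (\<forall>n. exterior_unit_normal \<Omega> x n --> g \<bullet> n = 0)" using G x t by blast
 next
  fix x and t :: real assume x: "x \<in> \<Omega>" and t: "t > 0"
  have diff: "((\<lambda>y. u y t) has_derivative (\<lambda>h. grad (\<lambda>y. u y t) w \<bullet> h)) (at w)" if w: "w \<in> \<Omega>" for w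
  proof (rule has_derivative_grad)
   have w': "w \<in> closure \<Omega>" using w closure_subset by blast
   have "((\<lambda>y. u y t) has_derivative (\<lambda>h. G w t \<bullet> h)) (at w within \<Omega>)"
    by (rule has_derivative_subset[OF G(1)[rule_format, OF w' t] closure_subset])
   then show "(\<lambda>y. u y t) differentiable at w"
    using at_within_open[OF w assms(2)] by (auto simp: differentiable_def)
  qed
  have ev: "\<forall>\<^sub>F w in nhds x. ((\<lambda>y. u y t) has_derivative (\<lambda>h. grad (\<lambda>y. u y t) w \<bullet> h)) (at w)"
   using eventually_nhds_in_open[OF assms(2) x] by eventually_elim (rule diff)
  have "(grad (\<lambda>y. u y t) has_derivative hess (\<lambda>y. u y t) x) (at x)"
   using *(2)[OF x t] unfolding hess_def using frechet_derivative_works by blast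
  from has_jet_gradient[OF ev this] *(3)[OF x t]
  show "\<exists>G L. has_jet (\<lambda>y. u y t) x G L \<and>
    ((\<lambda>s. u x s) has_real_derivative L + 1 / eps^2 * f (u x t) (eps * integral \<Omega> (\<lambda>y. u y t))) (at t)"
   unfolding laplacian_def by blast
 qed
qed

lemma AC_sol_reflect:
 assumes "AC_sol f \<Omega> eps u"
 shows "AC_sol (reflect f) \<Omega> eps (\<lambda>x t. - u x t)"
 unfolding AC_sol_def
proof (intro conjI ballI allI impI)
 have "continuous_on (closure \<Omega> \<times> {0..}) (\<lambda>(x, t). u x t)" using assms unfolding AC_sol_def by blast
 from continuous_on_minus[OF this] show "continuous_on (closure \<Omega> \<times> {0..}) (\<lambda>(x, t). - u x t)"
  by (simp add: split_beta)
 fix x and t :: real assume t: "t > 0"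
 {
  assume x: "x \<in> \<Omega>"
  obtain G L where *: "has_jet (\<lambda>y. u y t) x G L"
   "((\<lambda>s. u x s) has_real_derivative L + 1 / eps^2 * f (u x t) (eps * integral \<Omega> (\<lambda>y. u y t))) (at t)"
   using assms x t unfolding AC_sol_def by blast
  have "- (L + 1 / eps^2 * f (u x t) (eps * integral \<Omega> (\<lambda>y. u y t)))
   = - L + 1 / eps^2 * reflect f (- u x t) (eps * integral \<Omega> (\<lambda>y. - u y t))"
   unfolding reflect_def by simp
  with has_jet_uminus[OF *(1)] DERIV_minus[OF *(2)]
  show "\<exists>G L. has_jet (\<lambda>y. - u y t) x G L \<and> ((\<lambda>s. - u x s) has_real_derivative
    L + 1 / eps^2 * reflect f (- u x t) (eps * integral \<Omega> (\<lambda>y. - u y t))) (at t)" by metis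
 next
  assume x: "x \<in> frontier \<Omega>"
  obtain g where g: "((\<lambda>y. u y t) has_derivative (\<lambda>h. g \<bullet> h)) (at x within closure \<Omega>)"
    "\<forall>n. exterior_unit_normal \<Omega> x n --> g \<bullet> n = 0"
   using assms x t unfolding AC_sol_def by blast
  have "((\<lambda>y. - u y t) has_derivative (\<lambda>h. - g \<bullet> h)) (at x within closure \<Omega>)"
   using has_derivative_minus[OF g(1)] by simp
  then show "\<exists>g. ((\<lambda>y. - u y t) has_derivative (\<lambda>h. g \<bullet> h)) (at x within closure \<Omega>) \<and>
    (\<forall>n. exterior_unit_normal \<Omega> x n --> g \<bullet> n = 0)"
   using g(2) by (intro exI[of _ "- g"]) auto
 }
qed

lemma local_defining_function_frontier:
 assumes "local_defining_function A p U \<phi>" "open A" "p \<in> frontier A"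
 shows "\<phi> p = 0" "(\<phi> has_derivative (\<lambda>h. grad \<phi> p \<bullet> h)) (at p)"
proof -
 have U: "open U" "p \<in> U" "smooth_on U \<phi>" "\<And>x. x \<in> U ==> (x \<in> A \<longleftrightarrow> \<phi> x < 0)"
  using assms(1) unfolding local_defining_function_def by blast+
 show "(\<phi> has_derivative (\<lambda>h. grad \<phi> p \<bullet> h)) (at p)"
  by (rule has_derivative_grad[OF smooth_on_derivD(2)[OF U(3,2)]])
 have "p \<notin> A" using assms(2,3) by (simp add: frontier_def interior_open)
 then have "\<phi> p \<ge> 0" using U(2,4) by force
 moreover have "\<not> \<phi> p > 0"
 proof
  assume "\<phi> p > 0"
  have "open {x\<in>U. \<phi> x > 0}"
   using continuous_open_preimage[OF smooth_on_derivD(3)[OF U(3)] U(1), of "{0<..}"]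
   by (simp add: vimage_def Int_def)
  moreover have "p \<in> {x\<in>U. \<phi> x > 0}" using U(2) \<open>\<phi> p > 0\<close> by simp
  moreover have "p \<in> closure A" using assms(3) by (simp add: frontier_def)
  ultimately obtain y where "y \<in> A" "y \<in> U" "\<phi> y > 0" by (auto simp: closure_iff_nhds_not_empty disjoint_iff)
  then show False using U(4) by force
 qed
 ultimately show "\<phi> p = 0" by linarith
qed

lemma local_defining_function_normal_unique:
 assumes \<phi>: "local_defining_function A p U \<phi>" and \<psi>: "local_defining_function A p V \<psi>" and A: "open A" "p \<in> frontier A"
 shows "grad \<psi> p /\<^sub>R norm (grad \<psi> p) = grad \<phi> p /\<^sub>R norm (grad \<phi> p)"
proof (rule normalized_eq_of_sublevel)
 note fr = local_defining_function_frontier[OF \<phi> A] local_defining_function_frontier[OF \<psi> A]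
 show "(\<phi> has_derivative (\<lambda>h. grad \<phi> p \<bullet> h)) (at p)" "(\<psi> has_derivative (\<lambda>h. grad \<psi> p \<bullet> h)) (at p)" by (rule fr)+
 have UV: "open (U \<inter> V)" "p \<in> U \<inter> V" "\<And>x. x \<in> U ==> (x \<in> A \<longleftrightarrow> \<phi> x < 0)" "\<And>x. x \<in> V ==> (x \<in> A \<longleftrightarrow> \<psi> x < 0)"
  and "grad \<phi> p \<noteq> 0 \<and> grad \<psi> p \<noteq> 0"
  using \<phi> \<psi> unfolding local_defining_function_def by blast+
 then show "grad \<phi> p \<noteq> 0" "grad \<psi> p \<noteq> 0" by blast+
 show "\<forall>\<^sub>F y in nhds p. \<phi> y < \<phi> p --> \<psi> y \<le> \<psi> p"
  using eventually_nhds_in_open[OF UV(1,2)] by eventually_elim (use UV(3,4) fr in force)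
qed

lemma inward_points:
 assumes "exterior_unit_normal \<Omega> x n" "open \<Omega>"
 shows "norm n = 1" "\<forall>\<^sub>F k in at_right 0. x - k *\<^sub>R n \<in> \<Omega>"
proof -
 obtain U \<phi> where \<phi>: "local_defining_function \<Omega> x U \<phi>" "x \<in> frontier \<Omega>" and n: "n = (1 / norm (grad \<phi> x)) *\<^sub>R grad \<phi> x"
  using assms(1) unfolding exterior_unit_normal_def by blast
 have U: "open U" "x \<in> U" "grad \<phi> x \<noteq> 0" "\<And>x. x \<in> U ==> (x \<in> \<Omega> \<longleftrightarrow> \<phi> x < 0)"
  using \<phi>(1) unfolding local_defining_function_def by blast+
 show "norm n = 1" unfolding n using U(3) by simp
 note fr = local_defining_function_frontier[OF \<phi>(1) assms(2) \<phi>(2)]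
 have "grad \<phi> x \<bullet> (- n) < 0" unfolding n using U(3) by (simp add: power2_norm_eq_inner[symmetric])
 from eventually_descent[OF fr(2) this] eventually_on_ray[OF U(1,2), of "- n"]
 show "\<forall>\<^sub>F k in at_right 0. x - k *\<^sub>R n \<in> \<Omega>" by eventually_elim (use U(4) fr(1) in auto)
qed

text \<open>Inside, the difference to the barrier has a spatial maximum and a nonnegative time
  derivative, since it was nonpositive before; this contradicts the strict inequality for equal
  values. On the frontier the barrier has strictly positive outward slope and the solution slope
  zero, so the solution would exceed the barrier just inside.\<close>

lemma no_touching:
 assumes sol: "AC_sol f \<Omega> eps u" and Om: "open \<Omega>" and t: "0 \<le> t1" "t1 < t" "t \<le> T" and x: "x \<in> closure \<Omega>"
  and below: "\<And>y. y \<in> closure \<Omega> ==> u y t \<le> B y t" "\<And>s. t1 \<le> s ==> s < t ==> u x s \<le> B x s"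
  and touch: "u x t = B x t" and super: "supersol_at f \<Omega> eps B (integral \<Omega> (\<lambda>y. u y t)) T x t"
 shows False
proof (cases "x \<in> \<Omega>")
 case True
 let ?v = "integral \<Omega> (\<lambda>y. u y t)"
 have t0: "t > 0" using t by simp
 obtain G L where u: "has_jet (\<lambda>y. u y t) x G L" "((\<lambda>s. u x s) has_real_derivative L + 1 / eps^2 * f (u x t) (eps * ?v)) (at t)"
  using sol True t0 unfolding AC_sol_def by blast
 obtain \<beta> G' L' where B: "((\<lambda>s. B x s) has_real_derivative \<beta>) (at t within {0..T})"
  "has_jet (\<lambda>y. B y t) x G' L'" "\<beta> - L' > 1 / eps^2 * f (B x t) (eps * ?v)"
  using super True unfolding supersol_at_def by blast
 obtain G'' where "has_jet (\<lambda>y. u y t + - B y t) x G'' (L + - L')"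
  using has_jet_add[OF u(1) has_jet_uminus[OF B(2)]] by blast
 moreover have "\<forall>\<^sub>F y in nhds x. u y t + - B y t \<le> u x t + - B x t"
  using eventually_nhds_in_open[OF Om True]
 proof eventually_elim
  case (elim y)
  then have "y \<in> closure \<Omega>" using closure_subset by blast
  then show ?case using below(1)[of y] touch by simp
 qed
 ultimately have 1: "L - L' \<le> 0" using has_jet_max_le by fastforce
 let ?ut = "L + 1 / eps^2 * f (u x t) (eps * ?v)"
 have "((\<lambda>s. u x s - B x s) has_real_derivative ?ut - \<beta>) (at t within {0..T})"
  using u(2) B(1) by (intro DERIV_diff) (auto intro: has_field_derivative_at_within)
 have "?ut - \<beta> \<ge> 0"
 proof (rule ccontr)
  assume "\<not> ?ut - \<beta> \<ge> 0"
  then have "?ut - \<beta> < 0" by simp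
  from has_real_derivative_neg_dec_left[OF \<open>((\<lambda>s. u x s - B x s) has_real_derivative ?ut - \<beta>) (at t within {0..T})\<close> this]
  obtain d where d: "d > 0" "\<And>h. 0 < h ==> t - h \<in> {0..T} ==> h < d ==> u x t - B x t < u x (t - h) - B x (t - h)" by auto
  define h where "h = min d (t - t1) / 2"
  have h: "0 < h" "h < d" "h < t - t1" unfolding h_def using d(1) t by auto
  have "u x t - B x t < u x (t - h) - B x (t - h)" using h t by (intro d(2)) auto
  with below(2)[of "t - h"] touch h show False by simp
 qed
 then show False using 1 B(3) touch by simp
next
 case False
 then have fr: "x \<in> frontier \<Omega>" using x Om by (simp add: frontier_def interior_open)
 have t0: "t > 0" using t by simp
 obtain n b where b: "exterior_unit_normal \<Omega> x n" "((\<lambda>y. B y t) has_derivative b) (at x)" "b n > 0"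
  using super fr unfolding supersol_at_def by blast
 obtain g where g: "((\<lambda>y. u y t) has_derivative (\<lambda>h. g \<bullet> h)) (at x within closure \<Omega>)" "g \<bullet> n = 0"
  using sol fr t0 b(1) unfolding AC_sol_def by blast
 have "((\<lambda>y. u y t - B y t) has_derivative (\<lambda>h. g \<bullet> h - b h)) (at x within closure \<Omega>)"
  using g(1) has_derivative_at_withinI[OF b(2)] by (rule has_derivative_diff)
 then have "\<forall>e>0. \<exists>d>0. \<forall>y\<in>closure \<Omega>. norm (y - x) < d -->
   norm (u y t - B y t - (u x t - B x t) - (g \<bullet> (y - x) - b (y - x))) \<le> e * norm (y - x)"
  unfolding has_derivative_within_alt by blast
 from this[rule_format, of "b n / 2"] b(3)
 obtain d where d: "d > 0" "\<And>y. y \<in> closure \<Omega> ==> norm (y - x) < d ==>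
   norm (u y t - B y t - (u x t - B x t) - (g \<bullet> (y - x) - b (y - x))) \<le> b n / 2 * norm (y - x)" by auto
 note inw = inward_points[OF b(1) Om]
 have "\<forall>\<^sub>F k in at_right 0. k < d" using d(1) by (intro order_tendstoD(2)[OF tendsto_ident_at]) auto
 moreover have "\<forall>\<^sub>F k in at_right (0::real). k > 0" by (rule eventually_at_right_less)
 ultimately have "\<forall>\<^sub>F k in at_right (0::real). False"
  using inw(2)
 proof eventually_elim
  case (elim k)
  let ?y = "x - k *\<^sub>R n"
  have y: "?y \<in> closure \<Omega>" using elim(3) closure_subset by blast
  have lin: "b (- (k *\<^sub>R n)) = - (k * b n)"
   using has_derivative_linear[OF b(2)] by (simp add: linear_neg linear_cmul)
  have "norm (u ?y t - B ?y t - (u x t - B x t) - (g \<bullet> (?y - x) - b (?y - x))) \<le> b n / 2 * norm (?y - x)"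
   using elim inw(1) by (intro d(2)[OF y]) simp
  then have "\<bar>u ?y t - B ?y t - k * b n\<bar> \<le> b n / 2 * k" using touch g(2) lin inw(1) elim by simp
  moreover have "k * b n > 0" using elim b(3) by simp
  ultimately have "u ?y t - B ?y t > 0" by (simp add: abs_le_iff algebra_simps) (smt (verit) mult.commute)
  with below(1)[OF y] show False by simp
 qed
 then show False by simp
qed

text \<open>\<open>F \<ge> 0\<close> marks the points where one of the barriers is reached. If there
  are any, compactness yields a first time \<open>t0\<close>. The assumption \<open>step\<close> may
  use the order of both barriers at that very time, which is what allows it to estimate the integral
  of the solution.\<close>

theorem comparison:
 assumes sol: "AC_sol f \<Omega> eps u" and Om: "open \<Omega>" "bounded \<Omega>" and t12: "0 \<le> t1" "t1 \<le> t2" "t2 \<le> T"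
  and cont: "continuous_on (closure \<Omega> \<times> {t1..t2}) (\<lambda>(x, t). Bp x t)" "continuous_on (closure \<Omega> \<times> {t1..t2}) (\<lambda>(x, t). Bm x t)"
  and init: "\<And>x. x \<in> closure \<Omega> ==> Bm x t1 < u x t1 \<and> u x t1 < Bp x t1"
  and step: "\<And>t x. t1 < t ==> t \<le> t2 ==> (\<And>y. y \<in> closure \<Omega> ==> Bm y t \<le> u y t \<and> u y t \<le> Bp y t) ==> x \<in> closure \<Omega> ==>
    (u x t = Bp x t --> supersol_at f \<Omega> eps Bp (integral \<Omega> (\<lambda>y. u y t)) T x t) \<and>
    (u x t = Bm x t --> supersol_at (reflect f) \<Omega> eps (\<lambda>x t. - Bm x t) (- integral \<Omega> (\<lambda>y. u y t)) T x t)"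
  and x: "x \<in> closure \<Omega>" and t: "t \<in> {t1..t2}"
 shows "Bm x t < u x t \<and> u x t < Bp x t"
proof (rule ccontr)
 assume neg: "\<not> ?thesis"
 let ?K = "closure \<Omega> \<times> {t1..t2}"
 define F where "F z = max (u (fst z) (snd z) - Bp (fst z) (snd z)) (Bm (fst z) (snd z) - u (fst z) (snd z))" for z
 have K: "compact ?K" using Om(2) by (intro compact_Times) (auto simp: compact_closure)
 have "continuous_on (closure \<Omega> \<times> {0..}) (\<lambda>(x, t). u x t)" using sol unfolding AC_sol_def by blast
 then have "continuous_on ?K (\<lambda>(x, t). u x t)" by (rule continuous_on_subset) (use t12 in auto)
 then have Fc: "continuous_on ?K F" unfolding F_def using cont by (auto simp: split_beta intro!: continuous_intros)
 define S where "S = {z \<in> ?K. F z \<ge> 0}"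
 have "closedin (top_of_set ?K) S"
  using continuous_closedin_preimage[OF Fc, of "{0..}"] unfolding S_def by (simp add: vimage_def Int_def)
 then have S: "compact S" using K closedin_compact by blast
 have "(x, t) \<in> S" using neg x t unfolding S_def F_def by auto
 then have "S \<noteq> {}" by blast
 have "continuous_on S snd" by (intro continuous_intros)
 from continuous_attains_inf[OF S \<open>S \<noteq> {}\<close> this]
 obtain z0 where z0: "z0 \<in> S" "\<And>z. z \<in> S ==> snd z0 \<le> snd z" by blast
 obtain x0 t0 where xt: "z0 = (x0, t0)" by fastforce
 have x0: "x0 \<in> closure \<Omega>" "t0 \<in> {t1..t2}" "F (x0, t0) \<ge> 0" using z0(1) unfolding S_def xt by auto
 have t01: "t1 < t0"
 proof (rule ccontr)
  assume "\<not> t1 < t0"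
  then have "t0 = t1" using x0(2) by simp
  with init[OF x0(1)] x0(3) show False unfolding F_def by auto
 qed
 have before: "F (y, s) < 0" if "y \<in> closure \<Omega>" "t1 \<le> s" "s < t0" for y s
 proof (rule ccontr)
  assume "\<not> F (y, s) < 0"
  then have "(y, s) \<in> S" using that x0(2) unfolding S_def by auto
  from z0(2)[OF this] that xt show False by simp
 qed
 \<comment> \<open>The strict inequalities of all earlier times survive at \<open>t0\<close> as weak
   ones, by continuity from the left.\<close>
 have at0: "F (y, t0) \<le> 0" if y: "y \<in> closure \<Omega>" for y
 proof -
  have "continuous_on {t1..t2} (\<lambda>s. F (y, s))"
   by (rule continuous_on_compose2[OF Fc]) (use y in \<open>auto intro!: continuous_intros\<close>)
  then have "((\<lambda>s. F (y, s)) \<longlongrightarrow> F (y, t0)) (at t0 within {t1..t2})" using x0(2) by (simp add: continuous_on_def)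
  then have lim: "((\<lambda>s. F (y, s)) \<longlongrightarrow> F (y, t0)) (at t0 within {t1..<t0})" by (rule tendsto_within_subset) (use x0(2) in auto)
  have nb: "at t0 within {t1..<t0} \<noteq> bot"
  proof -
   have "t0 islimpt {t1..<t0}" using t01 islimpt_greaterThanLessThan2[of t1 t0] islimpt_subset[of t0 "{t1<..<t0}" "{t1..<t0}"] by auto
   then show ?thesis using trivial_limit_within by blast
  qed
  show ?thesis
  proof (rule tendsto_upperbound[OF lim _ nb])
   show "\<forall>\<^sub>F s in at t0 within {t1..<t0}. F (y, s) \<le> 0"
    unfolding eventually_at_filter using before[OF y] by (auto intro!: always_eventually less_imp_le)
  qed
 qed
 have bnds: "Bm y t0 \<le> u y t0 \<and> u y t0 \<le> Bp y t0" if "y \<in> closure \<Omega>" for y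
  using at0[OF that] unfolding F_def by simp
 have bnds': "Bm x0 s \<le> u x0 s \<and> u x0 s \<le> Bp x0 s" if "t1 \<le> s" "s < t0" for s
  using before[OF x0(1) that] unfolding F_def by simp
 have t0T: "t0 \<le> t2" "t0 \<le> T" using x0(2) t12 by auto
 note st = step[OF t01 t0T(1) bnds x0(1)]
 have "F (x0, t0) = 0" using x0(3) at0[OF x0(1)] by simp
 then consider "u x0 t0 = Bp x0 t0" | "u x0 t0 = Bm x0 t0" unfolding F_def by (auto simp: max_def split: if_splits)
 then show False
 proof cases
  case 1
  from st 1 have "supersol_at f \<Omega> eps Bp (integral \<Omega> (\<lambda>y. u y t0)) T x0 t0" by blast
  from no_touching[OF sol Om(1) t12(1) t01 t0T(2) x0(1) _ _ 1 this] bnds bnds' show False by blast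
 next
  case 2
  from st 2 have "supersol_at (reflect f) \<Omega> eps (\<lambda>x t. - Bm x t) (- integral \<Omega> (\<lambda>y. u y t0)) T x0 t0" by blast
  then have "supersol_at (reflect f) \<Omega> eps (\<lambda>x t. - Bm x t) (integral \<Omega> (\<lambda>y. - u y t0)) T x0 t0" by simp
  from no_touching[OF AC_sol_reflect[OF sol] Om(1) t12(1) t01 t0T(2) x0(1) _ _ _ this] bnds bnds' 2
  show False by simp
 qed
qed

section \<open>A corrector with positive normal derivative on the boundary\<close>

lemma has_real_derivative_cube_pos_part:
 "((\<lambda>x::real. (max 0 x)^3) has_real_derivative 3 * (max 0 x)^2) (at x)"
proof -
 have "(\<lambda>x::real. (max 0 x)^3) = (\<lambda>x. x * (max 0 x)^2)"
  by (auto simp: fun_eq_iff max_def power2_eq_square power3_eq_cube)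
 moreover have "((\<lambda>x. x * (max 0 x)^2) has_real_derivative 1 * (max 0 x)^2 + 2 * max 0 x * x) (at x)"
  by (rule DERIV_mult[OF DERIV_ident has_real_derivative_square_pos_part])
 ultimately show ?thesis by (simp add: max_def power2_eq_square split: if_splits)
qed

text \<open>The corrector near \<open>p\<close> is radial about a point \<open>q\<close> slightly outside of \<open>\<Omega>\<close>, and supported in a ball
 so small that the frontier is nearly flat there.\<close>

lemma local_corrector:
 fixes \<phi> :: "'a::euclidean_space => real"
 assumes \<phi>: "local_defining_function \<Omega> p U \<phi>" and Om: "open \<Omega>" and p: "p \<in> frontier \<Omega>"
 obtains \<rho> \<zeta> C where "\<rho> > 0" "continuous_on UNIV \<zeta>" "\<And>x. \<bar>\<zeta> x\<bar> \<le> C" "\<And>x. \<exists>G L. has_jet \<zeta> x G L \<and> \<bar>L\<bar> \<le> C"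
  "\<And>x n. exterior_unit_normal \<Omega> x n ==> \<exists>g. (\<zeta> has_derivative (\<lambda>h. g \<bullet> h)) (at x) \<and> g \<bullet> n \<ge> 0 \<and> (x \<in> ball p \<rho> --> g \<bullet> n > 0)"
proof -
 have U: "open U" "p \<in> U" "smooth_on U \<phi>" "\<And>x. x \<in> U ==> grad \<phi> x \<noteq> 0"
  using \<phi> unfolding local_defining_function_def by auto
 obtain R where R: "R > 0" "cball p R \<subseteq> U" using U(1,2) open_contains_cball by blast
 obtain L where L: "L > 0"
  "\<And>x y h. x \<in> cball p R ==> y \<in> cball p R ==> norm (frechet_derivative \<phi> (at y) h - frechet_derivative \<phi> (at x) h) \<le> L * norm (y - x) * norm h"
  "\<And>x y. x \<in> cball p R ==> y \<in> cball p R ==> norm (\<phi> y - \<phi> x - frechet_derivative \<phi> (at x) (y - x)) \<le> L * (norm (y - x))^2"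
  using smooth_on_C2_bounds[OF U(3) compact_cball R(2) convex_cball] by metis
 have D: "frechet_derivative \<phi> (at x) h = grad \<phi> x \<bullet> h" if "x \<in> cball p R" for x h
  using frechet_derivative_at[OF has_derivative_grad[OF smooth_on_derivD(2)[OF U(3)]]] that R(2) by (metis subsetD)
 define \<gamma> where "\<gamma> = grad \<phi> p"
 have \<gamma>: "norm \<gamma> > 0" using U(2,4) unfolding \<gamma>_def by simp
 \<comment> \<open>The first bound keeps the part of the frontier in the support within
   \<open>cball p R\<close>. In the second, 13 = 9 + 3 + 1: nine parts for the Taylor remainder of
   \<open>\<phi>\<close>, three for the variation of its gradient, one for strictness.\<close>
 define s where "s = min (R / (3 * norm \<gamma>)) (1 / (13 * L))"
 have s: "s > 0" "3 * (s * norm \<gamma>) \<le> R" "13 * (L * s) \<le> 1"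
 proof -
  have "s \<le> R / (3 * norm \<gamma>)" "s \<le> 1 / (13 * L)" unfolding s_def by simp_all
  then show "3 * (s * norm \<gamma>) \<le> R" "13 * (L * s) \<le> 1" using \<gamma> L(1) by (simp_all add: field_simps)
 qed (use R(1) \<gamma> L(1) in \<open>simp add: s_def\<close>)
 define d where "d = s * norm \<gamma>"
 have d: "d > 0" "3 * d \<le> R" unfolding d_def using s \<gamma> by simp_all
 define q where "q = p + s *\<^sub>R \<gamma>"
 have pq: "norm (q - p) = d" unfolding q_def d_def using s(1) by simp
 define F where "F x = (2 * d)^2 - (norm (x - q))^2" for x
 \<comment> \<open>The third power makes the function twice differentiable across the sphere where
   \<open>F\<close> vanishes.\<close>
 define \<zeta> where "\<zeta> x = (max 0 (F x))^3" for x
 have dF: "(F has_derivative (\<lambda>h. (- 2 *\<^sub>R (x - q)) \<bullet> h)) (at x)" for x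
  unfolding F_def power2_norm_eq_inner by (auto intro!: derivative_eq_intros simp: inner_commute)
 have d\<zeta>: "(\<zeta> has_derivative (\<lambda>h. ((6 * (max 0 (F x))^2) *\<^sub>R (q - x)) \<bullet> h)) (at x)" for x
 proof -
  have "((\<lambda>y. (max 0 y)^3) has_derivative (\<lambda>k. (3 * (max 0 (F x))^2) * k)) (at (F x))"
   using has_real_derivative_cube_pos_part[of "F x"] by (simp add: has_field_derivative_def)
  from has_derivative_compose[OF dF this] show ?thesis unfolding \<zeta>_def by (simp add: inner_diff_left algebra_simps)
 qed
 have near: "norm (x - q) < 2 * d" if "max 0 (F x) \<noteq> 0" for x
 proof -
  have "(norm (x - q))^2 < (2 * d)^2" using that unfolding F_def by (simp add: max_def split: if_splits)
  then show ?thesis by (rule power2_less_imp_less) (use d(1) in simp)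
 qed
 have outward: "grad \<phi> x \<bullet> (q - x) > 0" if x: "x \<in> frontier \<Omega>" "x \<in> cball p R" "norm (x - q) < 2 * d" for x
 proof -
  have "local_defining_function \<Omega> x U \<phi>" using \<phi> x(2) R(2) unfolding local_defining_function_def by blast
  from local_defining_function_frontier(1)[OF this Om x(1)] local_defining_function_frontier(1)[OF \<phi> Om p]
  have 0: "\<phi> x = 0" "\<phi> p = 0" .
  have xp: "norm (x - p) \<le> 3 * d" using norm_triangle_ineq[of "x - q" "q - p"] x(3) pq by simp
  have pR: "p \<in> cball p R" using R(1) by simp
  have "\<bar>grad \<phi> x \<bullet> (p - x)\<bar> \<le> L * (norm (x - p))^2"
   using L(3)[OF x(2) pR] 0 D[OF x(2)] by (simp add: norm_minus_commute)
  also have "\<dots> \<le> L * (3 * d)^2" using xp L(1) by (intro mult_left_mono power_mono) auto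
  finally have 1: "\<bar>grad \<phi> x \<bullet> (p - x)\<bar> \<le> 9 * (L * d^2)" by (simp add: power_mult_distrib)
  have "\<bar>grad \<phi> x \<bullet> \<gamma> - \<gamma> \<bullet> \<gamma>\<bar> \<le> L * norm (x - p) * norm \<gamma>"
   using L(2)[OF pR x(2), of \<gamma>] D[OF x(2)] D[OF pR] unfolding \<gamma>_def by simp
  also have "\<dots> \<le> L * (3 * d) * norm \<gamma>" using xp L(1) by (intro mult_right_mono mult_left_mono) auto
  finally have "s * (\<gamma> \<bullet> \<gamma> - L * (3 * d) * norm \<gamma>) \<le> s * (grad \<phi> x \<bullet> \<gamma>)" using s(1) by (intro mult_left_mono) auto
  moreover have "s * (\<gamma> \<bullet> \<gamma> - L * (3 * d) * norm \<gamma>) = d * norm \<gamma> - 3 * (L * d^2)"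
   unfolding d_def power2_norm_eq_inner[symmetric] by (simp add: algebra_simps power2_eq_square)
  moreover have "13 * (L * d^2) \<le> d * norm \<gamma>"
  proof -
   have "13 * (L * s) * (d * norm \<gamma>) \<le> 1 * (d * norm \<gamma>)" using s(3) d(1) by (intro mult_right_mono) auto
   then show ?thesis unfolding d_def by (simp add: power2_eq_square mult_ac)
  qed
  moreover have "0 < L * d^2" using L(1) d(1) by simp
  moreover have "grad \<phi> x \<bullet> (q - x) = grad \<phi> x \<bullet> (p - x) + s * (grad \<phi> x \<bullet> \<gamma>)"
   unfolding q_def by (simp add: inner_diff_right inner_add_right)
  ultimately show ?thesis using 1 by linarith
 qed
 define m where "m = (2 * d)^2"
 have mF: "max 0 (F x) \<le> m" "max 0 (F x) * (norm (x - q))^2 \<le> m * m" for x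
 proof -
  show le: "max 0 (F x) \<le> m" unfolding F_def m_def by simp
  show "max 0 (F x) * (norm (x - q))^2 \<le> m * m"
  proof (cases "max 0 (F x) = 0")
   case False
   then have "(norm (x - q))^2 \<le> m" unfolding F_def m_def by (simp add: max_def split: if_splits)
   then show ?thesis using le by (intro mult_mono) (auto simp: m_def)
  qed (simp add: m_def)
 qed
 define C where "C = m^3 + (24 * (m * m) + 6 * m^2 * DIM('a))"
 show thesis
 proof (rule that[OF d(1), of \<zeta> C])
  show "continuous_on UNIV \<zeta>" using has_derivative_continuous[OF d\<zeta>] by (simp add: continuous_at_imp_continuous_on)
  fix x
  have "0 \<le> \<zeta> x" "\<zeta> x \<le> m^3" unfolding \<zeta>_def using mF(1)[of x] by (auto intro!: power_mono)
  moreover have "0 \<le> 24 * (m * m) + 6 * m^2 * DIM('a)" by simp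
  ultimately show "\<bar>\<zeta> x\<bar> \<le> C" unfolding C_def by linarith
  have "((\<lambda>y. - 2 *\<^sub>R (y - q)) has_derivative (\<lambda>h. - 2 *\<^sub>R h)) (at x)" by (auto intro!: derivative_eq_intros)
  from has_jet_gradient[OF _ this, of F] dF
  have "has_jet F x (4 * (norm (x - q))^2) (- 2 * DIM('a))" by (simp add: power2_norm_eq_inner sum_negf mult.commute)
  moreover have "((\<lambda>y. 3 * (max 0 y)^2) has_real_derivative 6 * max 0 (F x)) (at (F x))"
   using DERIV_cmult[OF has_real_derivative_square_pos_part[of "F x"], of 3] by simp
  ultimately have "has_jet \<zeta> x ((3 * (max 0 (F x))^2)^2 * (4 * (norm (x - q))^2))
    (6 * max 0 (F x) * (4 * (norm (x - q))^2) + 3 * (max 0 (F x))^2 * (- 2 * DIM('a)))"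
   unfolding \<zeta>_def using has_real_derivative_cube_pos_part by (intro has_jet_compose) auto
  moreover have "\<bar>6 * max 0 (F x) * (4 * (norm (x - q))^2) + 3 * (max 0 (F x))^2 * (- 2 * DIM('a))\<bar> \<le> C"
  proof -
   have "(max 0 (F x))^2 \<le> m^2" using mF(1) by (intro power_mono) auto
   then have le: "(max 0 (F x))^2 * DIM('a) \<le> m^2 * DIM('a)" by (intro mult_right_mono) auto
   have gen: "\<bar>24 * a - 6 * b\<bar> \<le> c + (24 * a' + 6 * b')" if "0 \<le> a" "a \<le> a'" "0 \<le> b" "b \<le> b'" "0 \<le> c" for a b c a' b' :: real
    using that by linarith
   have "\<bar>24 * (max 0 (F x) * (norm (x - q))^2) - 6 * ((max 0 (F x))^2 * DIM('a))\<bar> \<le> m^3 + (24 * (m * m) + 6 * (m^2 * DIM('a)))"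
    by (rule gen[OF _ mF(2) _ le]) (simp_all add: m_def)
   then show ?thesis unfolding C_def by (simp add: algebra_simps)
  qed
  ultimately show "\<exists>G L. has_jet \<zeta> x G L \<and> \<bar>L\<bar> \<le> C" by blast
  fix n assume n: "exterior_unit_normal \<Omega> x n"
  then obtain V \<psi> where \<psi>: "local_defining_function \<Omega> x V \<psi>" and fr: "x \<in> frontier \<Omega>"
   and neq: "n = (1 / norm (grad \<psi> x)) *\<^sub>R grad \<psi> x"
   unfolding exterior_unit_normal_def by blast
  let ?g = "(6 * (max 0 (F x))^2) *\<^sub>R (q - x)"
  have pos: "?g \<bullet> n > 0" if nz: "max 0 (F x) \<noteq> 0"
  proof -
   have "norm (x - p) \<le> 3 * d" using norm_triangle_ineq[of "x - q" "q - p"] near[OF nz] pq by simp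
   then have xK: "x \<in> cball p R" using d(2) by (simp add: dist_norm norm_minus_commute)
   then have xU: "x \<in> U" using R(2) by blast
   then have \<phi>x: "local_defining_function \<Omega> x U \<phi>" using \<phi> unfolding local_defining_function_def by blast
   have "n = grad \<phi> x /\<^sub>R norm (grad \<phi> x)"
    using local_defining_function_normal_unique[OF \<phi>x \<psi> Om fr] neq by (simp add: divide_inverse)
   moreover have "(q - x) \<bullet> grad \<phi> x > 0" using outward[OF fr xK near[OF nz]] by (simp add: inner_commute)
   ultimately show ?thesis using nz U(4)[OF xU] by simp
  qed
  have nonneg: "?g \<bullet> n \<ge> 0"
  proof (cases "max 0 (F x) = 0")
   case False then show ?thesis by (rule less_imp_le[OF pos])
  qed simp
  have "max 0 (F x) \<noteq> 0" if "x \<in> ball p d"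
  proof -
   have "norm (x - q) < 2 * d" using that norm_triangle_ineq[of "x - p" "p - q"] pq by (simp add: dist_norm norm_minus_commute)
   then have "(norm (x - q))^2 < (2 * d)^2" by (intro power_strict_mono) auto
   then show ?thesis unfolding F_def by simp
  qed
  then show "\<exists>g. (\<zeta> has_derivative (\<lambda>h. g \<bullet> h)) (at x) \<and> g \<bullet> n \<ge> 0 \<and> (x \<in> ball p d --> g \<bullet> n > 0)"
   using d\<zeta>[of x] pos nonneg by blast
 qed
qed

text \<open>Finitely many local correctors are added. Each has nonnegative normal derivative on the
  whole frontier, and every frontier point lies in a ball where one of them is positive, so nothing
  cancels.\<close>

theorem boundary_corrector:
 fixes \<Omega> :: "'a::euclidean_space set"
 assumes "smooth_bounded_domain \<Omega>"
 obtains \<zeta> C where "C > 0" "continuous_on UNIV \<zeta>" "\<And>x. \<bar>\<zeta> x\<bar> \<le> C" "\<And>x. \<exists>G L. has_jet \<zeta> x G L \<and> \<bar>L\<bar> \<le> C"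
  "\<And>x. x \<in> frontier \<Omega> ==> \<exists>n b. exterior_unit_normal \<Omega> x n \<and> (\<zeta> has_derivative b) (at x) \<and> b n > 0"
proof -
 have Om: "open \<Omega>" "bounded \<Omega>" and loc: "\<forall>p\<in>frontier \<Omega>. \<exists>U \<phi>. local_defining_function \<Omega> p U \<phi>"
  using assms unfolding smooth_bounded_domain_def by auto
 define Q where "Q p \<rho> \<zeta> C \<longleftrightarrow> \<rho> > 0 \<and> continuous_on UNIV \<zeta> \<and> (\<forall>x. \<bar>\<zeta> x\<bar> \<le> C) \<and>
   (\<forall>x. \<exists>G L. has_jet \<zeta> x G L \<and> \<bar>L\<bar> \<le> C) \<and>
   (\<forall>x n. exterior_unit_normal \<Omega> x n -->
    (\<exists>g. (\<zeta> has_derivative (\<lambda>h. g \<bullet> h)) (at x) \<and> g \<bullet> n \<ge> 0 \<and> (x \<in> ball p \<rho> --> g \<bullet> n > 0)))" for p \<rho> \<zeta> C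
 have ex: "\<forall>p\<in>frontier \<Omega>. \<exists>\<rho> \<zeta> C. Q p \<rho> \<zeta> C"
 proof
  fix p assume p: "p \<in> frontier \<Omega>"
  then obtain U \<phi> where \<phi>: "local_defining_function \<Omega> p U \<phi>" using loc by blast
  show "\<exists>\<rho> \<zeta> C. Q p \<rho> \<zeta> C"
   by (rule local_corrector[OF \<phi> Om(1) p]) (unfold Q_def, blast)
 qed
 obtain \<rho> \<zeta> C where Q: "\<And>p. p \<in> frontier \<Omega> ==> Q p (\<rho> p) (\<zeta> p) (C p)" using ex by metis
 have Z: "\<And>p. p \<in> frontier \<Omega> ==> \<rho> p > 0" "\<And>p. p \<in> frontier \<Omega> ==> continuous_on UNIV (\<zeta> p)"
   "\<And>p x. p \<in> frontier \<Omega> ==> \<bar>\<zeta> p x\<bar> \<le> C p"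
   "\<And>p x. p \<in> frontier \<Omega> ==> \<exists>G L. has_jet (\<zeta> p) x G L \<and> \<bar>L\<bar> \<le> C p"
   "\<And>p x n. p \<in> frontier \<Omega> ==> exterior_unit_normal \<Omega> x n ==>
    (\<exists>g. (\<zeta> p has_derivative (\<lambda>h. g \<bullet> h)) (at x) \<and> g \<bullet> n \<ge> 0 \<and> (x \<in> ball p (\<rho> p) --> g \<bullet> n > 0))"
  using Q unfolding Q_def by blast+
 have "compact (frontier \<Omega>)" using Om(2) by (simp add: compact_frontier_bounded)
 then obtain P where P: "P \<subseteq> frontier \<Omega>" "finite P" "frontier \<Omega> \<subseteq> (\<Union>p\<in>P. ball p (\<rho> p))"
 proof (rule compactE_image[of "frontier \<Omega>" "frontier \<Omega>" "\<lambda>p. ball p (\<rho> p)"])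
  show "frontier \<Omega> \<subseteq> (\<Union>p\<in>frontier \<Omega>. ball p (\<rho> p))" using Z(1) by force
 qed (use that in auto)
 define \<zeta>s where "\<zeta>s x = (\<Sum>p\<in>P. \<zeta> p x)" for x
 define Cs where "Cs = (\<Sum>p\<in>P. C p)"
 have Cnn: "C p \<ge> 0" if "p \<in> frontier \<Omega>" for p using Z(3)[OF that, of p] by linarith
 have jets: "\<exists>G L. has_jet (\<lambda>x. \<Sum>p\<in>Q. \<zeta> p x) x G L \<and> \<bar>L\<bar> \<le> (\<Sum>p\<in>Q. C p)" if "Q \<subseteq> P" for Q x
  using finite_subset[OF that P(2)] that
 proof (induction Q rule: finite_induct)
  case empty
  show ?case using has_jet_const[of 0] by (intro exI[of _ 0]) simp
 next
  case (insert p Q)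
  then obtain G L where 1: "has_jet (\<lambda>x. \<Sum>p\<in>Q. \<zeta> p x) x G L" "\<bar>L\<bar> \<le> (\<Sum>p\<in>Q. C p)" by auto
  have "p \<in> frontier \<Omega>" using insert P(1) by auto
  then obtain G' L' where 2: "has_jet (\<zeta> p) x G' L'" "\<bar>L'\<bar> \<le> C p" using Z(4) by blast
  obtain G'' where "has_jet (\<lambda>x. \<zeta> p x + (\<Sum>p\<in>Q. \<zeta> p x)) x G'' (L' + L)" using has_jet_add[OF 2(1) 1(1)] by blast
  moreover have "\<bar>L' + L\<bar> \<le> C p + (\<Sum>p\<in>Q. C p)" using 1(2) 2(2) by linarith
  ultimately show ?case using insert(1,2) by (intro exI[of _ G''] exI[of _ "L' + L"]) simp
 qed
 have Cs0: "Cs \<ge> 0" unfolding Cs_def using Cnn P(1) by (intro sum_nonneg) auto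
 show thesis
 proof (rule that[of "Cs + 1" \<zeta>s])
  show "Cs + 1 > 0" using Cs0 by simp
  show "continuous_on UNIV \<zeta>s" unfolding \<zeta>s_def using Z(2) P(1) by (intro continuous_on_sum) auto
  show "\<bar>\<zeta>s x\<bar> \<le> Cs + 1" for x
  proof -
   have "\<bar>\<zeta>s x\<bar> \<le> (\<Sum>p\<in>P. C p)" unfolding \<zeta>s_def
    using Z(3) P(1) by (intro order_trans[OF sum_abs] sum_mono) auto
   then show ?thesis unfolding Cs_def by simp
  qed
  show "\<exists>G L. has_jet \<zeta>s x G L \<and> \<bar>L\<bar> \<le> Cs + 1" for x
  proof -
   obtain G L where "has_jet \<zeta>s x G L" "\<bar>L\<bar> \<le> Cs" using jets[of P x] unfolding \<zeta>s_def[abs_def] Cs_def by blast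
   then show ?thesis by (intro exI[of _ G] exI[of _ L]) simp
  qed
  fix x assume x: "x \<in> frontier \<Omega>"
  obtain U \<phi> where \<phi>: "local_defining_function \<Omega> x U \<phi>" using loc x by blast
  define n where "n = (1 / norm (grad \<phi> x)) *\<^sub>R grad \<phi> x"
  have n: "exterior_unit_normal \<Omega> x n" unfolding exterior_unit_normal_def n_def using x \<phi> by blast
  have "\<forall>p\<in>P. \<exists>g. (\<zeta> p has_derivative (\<lambda>h. g \<bullet> h)) (at x) \<and> g \<bullet> n \<ge> 0 \<and> (x \<in> ball p (\<rho> p) --> g \<bullet> n > 0)"
   using Z(5)[OF _ n] P(1) by blast
  then obtain g where g: "\<And>p. p \<in> P ==> (\<zeta> p has_derivative (\<lambda>h. g p \<bullet> h)) (at x)" "\<And>p. p \<in> P ==> g p \<bullet> n \<ge> 0"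
   "\<And>p. p \<in> P ==> x \<in> ball p (\<rho> p) ==> g p \<bullet> n > 0" by metis
  have der: "(\<zeta>s has_derivative (\<lambda>h. \<Sum>p\<in>P. g p \<bullet> h)) (at x)" unfolding \<zeta>s_def[abs_def] using g(1) by (rule has_derivative_sum)
  obtain p where p: "p \<in> P" "x \<in> ball p (\<rho> p)" using P(3) x by blast
  have "0 < g p \<bullet> n" by (rule g(3)[OF p])
  also have "g p \<bullet> n \<le> (\<Sum>p\<in>P. g p \<bullet> n)" using p(1) P(2) g(2) by (intro member_le_sum) auto
  finally have "0 < (\<Sum>p\<in>P. g p \<bullet> n)" .
  with der show "\<exists>n b. exterior_unit_normal \<Omega> x n \<and> (\<zeta>s has_derivative b) (at x) \<and> b n > 0"
   using n by blast
 qed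
qed

section \<open>The standing wave and its corrector\<close>

locale bistable =
 fixes f :: "real => real => real" and W :: "real => real" and a c0 :: real
 assumes smooth_f: "smooth_on UNIV (\<lambda>(p, q). f p q)"
  and W_deriv: "\<And>p. (W has_real_derivative - f p 0) (at p)"
  and a_bounds: "-1 < a" "a < 1" and zeros: "{p. f p 0 = 0} = {-1, a, 1}"
  and stable: "deriv (\<lambda>p. f p 0) (-1) < 0" "deriv (\<lambda>p. f p 0) 1 < 0"
  and balanced: "integral {-1..1} (\<lambda>p. f p 0) = 0"
  and c0_eq: "c0 = - integral {-1..1} (\<lambda>p. deriv (f p) 0)
       / integral {-1..1} (\<lambda>p. sqrt (2 * (W p - W (-1))))"
begin

definition fp :: "real => real" where
 "fp p = frechet_derivative (\<lambda>(p, q). f p q) (at (p, 0)) (1, 0)"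

definition fv :: "real => real" where
 "fv p = frechet_derivative (\<lambda>(p, q). f p q) (at (p, 0)) (0, 1)"

lemma f_has_derivative:
 "((\<lambda>(p, q). f p q) has_derivative frechet_derivative (\<lambda>(p, q). f p q) (at z)) (at z)"
 by (rule smooth_on_has_derivative[OF smooth_f UNIV_I])

lemma f_derivative_split:
 "frechet_derivative (\<lambda>(p, q). f p q) (at (p, 0)) (s, r) = fp p * s + fv p * r"
proof -
 interpret linear "frechet_derivative (\<lambda>(p, q). f p q) (at (p, 0))"
  by (rule has_derivative_linear[OF f_has_derivative])
 have "(s, r) = s *\<^sub>R (1, 0) + r *\<^sub>R (0, 1::real)" by simp
 then show ?thesis unfolding fp_def fv_def by (metis add scale mult.commute real_scaleR_def)
qed

lemma ft_deriv: "((\<lambda>p. f p 0) has_real_derivative fp p) (at p)"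
proof -
 have "((\<lambda>p. (p, 0::real)) has_derivative (\<lambda>h. (h, 0))) (at p)" by (auto intro!: derivative_eq_intros)
 from has_derivative_compose[OF this f_has_derivative]
 show ?thesis by (simp add: f_derivative_split has_field_derivative_def)
qed

lemma fv_deriv: "((\<lambda>q. f p q) has_real_derivative fv p) (at 0)"
proof -
 have "((\<lambda>q. (p, q)) has_derivative (\<lambda>h. (0, h))) (at (0::real))" by (auto intro!: derivative_eq_intros)
 from has_derivative_compose[OF this f_has_derivative]
 show ?thesis by (simp add: f_derivative_split has_field_derivative_def)
qed

lemma deriv_eqs: "deriv (\<lambda>p. f p 0) p = fp p" "deriv (f p) 0 = fv p"
 using DERIV_imp_deriv[OF ft_deriv] DERIV_imp_deriv[OF fv_deriv] by auto

lemma f_taylor: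
 assumes "R > 0"
 obtains C where "C > 0" "\<And>p s r. \<bar>p\<bar> \<le> R ==> \<bar>p + s\<bar> \<le> R ==> \<bar>r\<bar> \<le> 1 ==>
   \<bar>f (p + s) r - f p 0 - fp p * s - fv p * r\<bar> \<le> C * (s^2 + r^2)"
proof -
 let ?K = "{-R..R} \<times> {-1..1::real}"
 have K: "compact ?K" "?K \<subseteq> UNIV" "convex ?K" by (auto intro: compact_Times convex_Times)
 obtain C where C: "C > 0" "\<And>x y. x \<in> ?K ==> y \<in> ?K ==>
    norm ((\<lambda>(p, q). f p q) y - (\<lambda>(p, q). f p q) x - frechet_derivative (\<lambda>(p, q). f p q) (at x) (y - x)) \<le> C * (norm (y - x))^2"
  using smooth_on_C2_bounds[OF smooth_f K] by metis
 show thesis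
 proof (rule that[OF C(1)])
  fix p s r assume *: "\<bar>p\<bar> \<le> R" "\<bar>p + s\<bar> \<le> R" "\<bar>r\<bar> \<le> (1::real)"
  have "norm ((p + s, r) - (p, 0)) ^ 2 = s^2 + r^2" by (simp add: norm_Pair)
  moreover have "(p, 0) \<in> ?K" "(p + s, r) \<in> ?K" using * by (auto simp: abs_le_iff)
  ultimately show "\<bar>f (p + s) r - f p 0 - fp p * s - fv p * r\<bar> \<le> C * (s^2 + r^2)"
   using C(2)[of "(p, 0)" "(p + s, r)"] by (simp add: f_derivative_split algebra_simps)
 qed
qed

lemma partials_lipschitz:
 obtains C where "C > 0" "\<And>x y. \<bar>x\<bar> \<le> 1 ==> \<bar>y\<bar> \<le> 1 ==> \<bar>f y 0 - f x 0\<bar> \<le> C * \<bar>y - x\<bar>"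
  "\<And>x y. \<bar>x\<bar> \<le> 1 ==> \<bar>y\<bar> \<le> 1 ==> \<bar>fp y - fp x\<bar> \<le> C * \<bar>y - x\<bar>"
  "\<And>x y. \<bar>x\<bar> \<le> 1 ==> \<bar>y\<bar> \<le> 1 ==> \<bar>fv y - fv x\<bar> \<le> C * \<bar>y - x\<bar>"
  "\<And>x. \<bar>x\<bar> \<le> 1 ==> \<bar>f x 0\<bar> \<le> C \<and> \<bar>fp x\<bar> \<le> C \<and> \<bar>fv x\<bar> \<le> C"
proof -
 let ?K = "{-1..1::real} \<times> {-1..1::real}"
 have K: "compact ?K" "?K \<subseteq> UNIV" "convex ?K" by (auto intro: compact_Times convex_Times)
 have lip: "\<exists>C>0. \<forall>x y. \<bar>x\<bar> \<le> 1 --> \<bar>y\<bar> \<le> 1 --> \<bar>F (y, 0) - F (x, 0)\<bar> \<le> C * \<bar>y - x\<bar>"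
  if F: "smooth_on UNIV F" for F :: "real \<times> real => real"
 proof -
  obtain C where C: "C > 0" "\<And>x y. x \<in> ?K ==> y \<in> ?K ==> norm (F y - F x) \<le> C * norm (y - x)"
   using smooth_on_lipschitz[OF F K] by metis
  have "\<bar>F (y, 0) - F (x, 0)\<bar> \<le> C * \<bar>y - x\<bar>" if "\<bar>x\<bar> \<le> 1" "\<bar>y\<bar> \<le> 1" for x y
   using C(2)[of "(x, 0)" "(y, 0)"] that by (simp add: abs_le_iff)
  with C(1) show ?thesis by blast
 qed
 obtain C1 C2 C3 where C: "C1 > 0" "C2 > 0" "C3 > 0"
  "\<forall>x y. \<bar>x\<bar> \<le> 1 --> \<bar>y\<bar> \<le> 1 --> \<bar>f y 0 - f x 0\<bar> \<le> C1 * \<bar>y - x\<bar>"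
  "\<forall>x y. \<bar>x\<bar> \<le> 1 --> \<bar>y\<bar> \<le> 1 --> \<bar>fp y - fp x\<bar> \<le> C2 * \<bar>y - x\<bar>"
  "\<forall>x y. \<bar>x\<bar> \<le> 1 --> \<bar>y\<bar> \<le> 1 --> \<bar>fv y - fv x\<bar> \<le> C3 * \<bar>y - x\<bar>"
  using lip[OF smooth_f] lip[OF smooth_on_derivD(1)[OF smooth_f], of "(1, 0)"]
   lip[OF smooth_on_derivD(1)[OF smooth_f], of "(0, 1)"]
  unfolding fp_def fv_def by auto
 define C where "C = C1 + C2 + C3 + \<bar>f 0 0\<bar> + \<bar>fp 0\<bar> + \<bar>fv 0\<bar>"
 have le: "C1 + \<bar>f 0 0\<bar> \<le> C" "C2 + \<bar>fp 0\<bar> \<le> C" "C3 + \<bar>fv 0\<bar> \<le> C" "C1 \<le> C" "C2 \<le> C" "C3 \<le> C" "C > 0"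
  unfolding C_def using C(1-3) by auto
 have up: "\<bar>F y - F x\<bar> \<le> C * \<bar>y - x\<bar>" "\<bar>F y\<bar> \<le> C"
  if "\<forall>x y. \<bar>x\<bar> \<le> 1 --> \<bar>y\<bar> \<le> 1 --> \<bar>F y - F x\<bar> \<le> D * \<bar>y - x\<bar>" "D \<le> C" "D + \<bar>F 0\<bar> \<le> C" "\<bar>x\<bar> \<le> 1" "\<bar>y\<bar> \<le> 1" "D > 0"
  for F :: "real => real" and D x y
 proof -
  have "\<bar>F y - F x\<bar> \<le> D * \<bar>y - x\<bar>" using that by blast
  also have "\<dots> \<le> C * \<bar>y - x\<bar>" using that(2) by (rule mult_right_mono) simp
  finally show "\<bar>F y - F x\<bar> \<le> C * \<bar>y - x\<bar>" .
  have "\<bar>F y - F 0\<bar> \<le> D * \<bar>y - 0\<bar>" using that by (metis abs_zero zero_le_one)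
  also have "\<dots> \<le> D * 1" using that by (intro mult_left_mono) auto
  finally show "\<bar>F y\<bar> \<le> C" using that(3) by linarith
 qed
 show thesis
 proof (rule that[OF le(7)])
  fix x y :: real assume xy: "\<bar>x\<bar> \<le> 1" "\<bar>y\<bar> \<le> 1"
  show "\<bar>f y 0 - f x 0\<bar> \<le> C * \<bar>y - x\<bar>" using up(1)[of "\<lambda>p. f p 0", OF C(4) le(4) le(1) xy C(1)] .
  show "\<bar>fp y - fp x\<bar> \<le> C * \<bar>y - x\<bar>" using up(1)[of fp, OF C(5) le(5) le(2) xy C(2)] .
  show "\<bar>fv y - fv x\<bar> \<le> C * \<bar>y - x\<bar>" using up(1)[of fv, OF C(6) le(6) le(3) xy C(3)] .
  show "\<bar>f x 0\<bar> \<le> C \<and> \<bar>fp x\<bar> \<le> C \<and> \<bar>fv x\<bar> \<le> C"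
   using up(2)[of "\<lambda>p. f p 0", OF C(4) le(4) le(1) xy(1,1) C(1)] up(2)[of fp, OF C(5) le(5) le(2) xy(1,1) C(2)]
    up(2)[of fv, OF C(6) le(6) le(3) xy(1,1) C(3)] by simp
 qed
qed

lemma ft_zero: "f p 0 = 0 \<longleftrightarrow> p = -1 \<or> p = a \<or> p = 1"
 using zeros by auto

lemma ft_cont: "isCont (\<lambda>p. f p 0) p" by (rule DERIV_isCont[OF ft_deriv])

lemma ft_no_sign_change:
 assumes "x \<le> y" "\<And>p. x \<le> p ==> p \<le> y ==> p \<noteq> -1 \<and> p \<noteq> a \<and> p \<noteq> 1"
 shows "f x 0 < 0 \<longleftrightarrow> f y 0 < 0"
proof (rule ccontr)
 assume neg: "\<not> ?thesis"
 have "f x 0 \<noteq> 0" "f y 0 \<noteq> 0" using ft_zero assms by force+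
 then have "(f x 0 \<le> 0 \<and> 0 \<le> f y 0) \<or> (f y 0 \<le> 0 \<and> 0 \<le> f x 0)" using neg by linarith
 then obtain z where "x \<le> z" "z \<le> y" "f z 0 = 0"
  using IVT[of "\<lambda>p. f p 0" x 0 y] IVT2[of "\<lambda>p. f p 0" y 0 x] ft_cont assms(1) by auto
 then show False using ft_zero assms(2) by blast
qed

text \<open>The negative derivatives at -1 and 1 fix the signs next to these zeros, and between
  consecutive zeros the sign cannot change.\<close>

lemma ft_signs:
 "p < -1 ==> f p 0 > 0" "-1 < p ==> p < a ==> f p 0 < 0" "a < p ==> p < 1 ==> f p 0 > 0" "1 < p ==> f p 0 < 0"
proof -
 have near: "\<exists>d>0. \<forall>h. 0 < h --> h < d --> f (c - h) 0 > 0 \<and> f (c + h) 0 < 0" if "c = -1 \<or> c = 1" for c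
 proof -
  have d: "((\<lambda>p. f p 0) has_real_derivative fp c) (at c)" "fp c < 0" using that ft_deriv stable deriv_eqs by auto
  have "f c 0 = 0" using that ft_zero by auto
  then obtain d1 d2 where "d1 > 0" "\<And>h. 0 < h ==> h < d1 ==> 0 < f (c - h) 0" "d2 > 0" "\<And>h. 0 < h ==> h < d2 ==> f (c + h) 0 < 0"
   using DERIV_neg_dec_left[OF d] DERIV_neg_dec_right[OF d] by auto
  then show ?thesis by (intro exI[of _ "min d1 d2"]) auto
 qed
 have left: "f p 0 > 0" if c: "c = -1 \<or> c = 1" and p: "p < c" "\<And>q. p \<le> q ==> q < c ==> q \<noteq> -1 \<and> q \<noteq> a" for c p
 proof -
  obtain d where d: "d > 0" "\<And>h. 0 < h ==> h < d ==> f (c - h) 0 > 0" using near[OF c] by blast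
  define h where "h = min (d / 2) (c - p)"
  have h: "0 < h" "h < d" "p \<le> c - h" unfolding h_def using d(1) p by auto
  have q: "q \<noteq> -1 \<and> q \<noteq> a \<and> q \<noteq> 1" if "p \<le> q" "q \<le> c - h" for q using p(2)[of q] that h c by auto
  from ft_no_sign_change[OF h(3) this] d(2)[OF h(1,2)] ft_zero[of p] q[of p] h(3) show ?thesis by force
 qed
 have right: "f p 0 < 0" if c: "c = -1 \<or> c = 1" and p: "c < p" "\<And>q. c < q ==> q \<le> p ==> q \<noteq> a \<and> q \<noteq> 1" for c p
 proof -
  obtain d where d: "d > 0" "\<And>h. 0 < h ==> h < d ==> f (c + h) 0 < 0" using near[OF c] by blast
  define h where "h = min (d / 2) (p - c)"
  have h: "0 < h" "h < d" "c + h \<le> p" unfolding h_def using d(1) p by auto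
  have "q \<noteq> -1 \<and> q \<noteq> a \<and> q \<noteq> 1" if "c + h \<le> q" "q \<le> p" for q using p(2)[of q] that h c by auto
  from ft_no_sign_change[OF h(3) this] d(2)[OF h(1,2)] show ?thesis by simp
 qed
 show "f p 0 > 0" if "p < -1" by (rule left[of "-1"]) (use that a_bounds in auto)
 show "f p 0 < 0" if "-1 < p" "p < a" by (rule right[of "-1"]) (use that a_bounds in auto)
 show "f p 0 > 0" if "a < p" "p < 1" by (rule left[of 1]) (use that a_bounds in auto)
 show "f p 0 < 0" if "1 < p" by (rule right[of 1]) (use that a_bounds in auto)
qed

lemma W_equal: "W 1 = W (-1)"
proof -
 have "((\<lambda>p. - f p 0) has_integral (W 1 - W (-1))) {-1..1}"
  using W_deriv by (intro fundamental_theorem_of_calculus)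
   (auto simp: has_real_derivative_iff_has_vector_derivative[symmetric] intro: has_field_derivative_at_within)
 then have "integral {-1..1} (\<lambda>p. - f p 0) = W 1 - W (-1)" by (rule integral_unique)
 then show ?thesis using balanced by simp
qed

text \<open>The potential increases from -1 to \<open>a\<close> and decreases from \<open>a\<close>
  to 1, and the balance of \<open>f\<close> makes its two end values equal.\<close>

lemma W_pos:
 assumes "-1 < p" "p < 1" shows "W p > W (-1)"
proof (cases "p \<le> a")
 case True
 have "W (-1) < W p"
  by (rule DERIV_pos_imp_increasing_open[OF assms(1)])
   (use W_deriv ft_signs(2) True in \<open>force intro!: continuous_at_imp_continuous_on DERIV_isCont[OF W_deriv]\<close>)+
 then show ?thesis .
next
 case False
 have "W 1 < W p"
  by (rule DERIV_neg_imp_decreasing_open[OF assms(2)])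
   (use W_deriv ft_signs(3) False in \<open>force intro!: continuous_at_imp_continuous_on DERIV_isCont[OF W_deriv]\<close>)+
 then show ?thesis using W_equal by simp
qed

text \<open>Slope of the standing wave as a function of its height: multiplying
  \<open>U'' + f U 0 = 0\<close> by \<open>U'\<close> and integrating gives
  \<open>U' = P U\<close>.\<close>

definition P :: "real => real" where "P u = sqrt (2 * (W u - W (-1)))"

lemma P_pos: "-1 < u ==> u < 1 ==> P u > 0" unfolding P_def using W_pos by simp

lemma P_nonneg: "-1 \<le> u ==> u \<le> 1 ==> P u \<ge> 0"
 using W_pos[of u] W_equal unfolding P_def by (cases "u = -1"; cases "u = 1") auto

lemma P_cont: "isCont P u"
 unfolding P_def by (intro continuous_intros DERIV_isCont[OF W_deriv])

lemma P_lower_at_one: "\<exists>k d. k > 0 \<and> d > 0 \<and> (\<forall>u. 1 - d < u --> u \<le> 1 --> P u \<ge> k * (1 - u))"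
proof -
 define \<beta> where "\<beta> = - fp 1"
 have \<beta>: "\<beta> > 0" unfolding \<beta>_def using stable(2) deriv_eqs by simp
 have "((\<lambda>p. f p 0) has_derivative (\<lambda>h. fp 1 * h)) (at 1)" using ft_deriv[of 1] by (simp add: has_field_derivative_def)
 then have "\<forall>e>0. \<exists>d>0. \<forall>y. norm (y - 1) < d --> norm (f y 0 - f 1 0 - fp 1 * (y - 1)) \<le> e * norm (y - 1)"
  unfolding has_derivative_at_alt by blast
 from this[rule_format, of "\<beta> / 2"] \<beta> obtain d where d: "d > 0"
  "\<And>y. norm (y - 1) < d ==> norm (f y 0 - f 1 0 - fp 1 * (y - 1)) \<le> \<beta> / 2 * norm (y - 1)" by auto
 define d' where "d' = min d 1"
 have lin: "f u 0 \<ge> \<beta> / 2 * (1 - u)" if "1 - d' < u" "u \<le> 1" for u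
 proof -
  have "norm (u - 1) < d" using that unfolding d'_def by auto
  from d(2)[OF this] have "\<bar>f u 0 - \<beta> * (1 - u)\<bar> \<le> \<beta> / 2 * (1 - u)"
   using ft_zero[of 1] that unfolding \<beta>_def by (simp add: algebra_simps abs_le_iff)
  then show ?thesis by linarith
 qed
 have "P u \<ge> sqrt (\<beta> / 2) * (1 - u)" if u: "1 - d' < u" "u \<le> 1" for u
 proof -
  let ?G = "\<lambda>u. W u - W 1 - \<beta> / 4 * (1 - u)^2"
  have "?G 1 \<le> ?G u"
  proof (rule DERIV_nonpos_imp_nonincreasing[OF u(2)])
   fix x assume x: "u \<le> x" "x \<le> 1"
   have "(?G has_real_derivative (- f x 0 + \<beta> / 2 * (1 - x))) (at x)"
    by (auto intro!: derivative_eq_intros W_deriv simp: field_simps)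
   moreover have "- f x 0 + \<beta> / 2 * (1 - x) \<le> 0" using lin[of x] x u by simp
   ultimately show "\<exists>y. (?G has_real_derivative y) (at x) \<and> y \<le> 0" by blast
  qed
  then have "W u - W (-1) \<ge> \<beta> / 4 * (1 - u)^2" using W_equal by simp
  then have "(\<beta> / 2) * (1 - u)^2 \<le> 2 * (W u - W (-1))" by simp
  then have "sqrt ((\<beta> / 2) * (1 - u)^2) \<le> P u" unfolding P_def by (rule real_sqrt_le_mono)
  moreover have "sqrt ((\<beta> / 2) * (1 - u)^2) = sqrt (\<beta> / 2) * (1 - u)"
   using u(2) by (subst real_sqrt_mult) simp
  ultimately show ?thesis by linarith
 qed
 moreover have "sqrt (\<beta> / 2) > 0" "d' > 0" using \<beta> d(1) unfolding d'_def by auto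
 ultimately show ?thesis by blast
qed

lemma P_upper: obtains K where "K > 0" "\<And>u. 0 \<le> u ==> u \<le> 1 ==> P u \<le> K * (1 - u)"
proof -
 obtain C where C: "C > 0" "\<And>x y. \<bar>x\<bar> \<le> 1 ==> \<bar>y\<bar> \<le> 1 ==> \<bar>f y 0 - f x 0\<bar> \<le> C * \<bar>y - x\<bar>"
  using partials_lipschitz by metis
 have "P u \<le> sqrt C * (1 - u)" if u: "0 \<le> u" "u \<le> 1" for u
 proof -
  let ?G = "\<lambda>u. W u - W 1 - C / 2 * (1 - u)^2"
  have "?G u \<le> ?G 1"
  proof (rule DERIV_nonneg_imp_nondecreasing[OF u(2)])
   fix x assume x: "u \<le> x" "x \<le> 1"
   have "(?G has_real_derivative (- f x 0 + C * (1 - x))) (at x)"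
    by (auto intro!: derivative_eq_intros W_deriv simp: field_simps)
   moreover have "\<bar>f x 0\<bar> \<le> C * (1 - x)" using C(2)[of 1 x] x u ft_zero[of 1] by simp
   ultimately show "\<exists>y. (?G has_real_derivative y) (at x) \<and> 0 \<le> y" by (intro exI conjI) auto
  qed
  then have "2 * (W u - W (-1)) \<le> C * (1 - u)^2" using W_equal by simp
  then have "P u \<le> sqrt (C * (1 - u)^2)" unfolding P_def by (rule real_sqrt_le_mono)
  then show ?thesis using u(2) by (simp add: real_sqrt_mult)
 qed
 with C(1) show thesis by (intro that[of "sqrt C"]) auto
qed

end

text \<open>Besides exchanging the roles of upper and lower barriers, the symmetry transfers
  estimates at the well 1 to the well -1.\<close>

lemma bistable_reflect:
 assumes "bistable f W a c0"
 shows "bistable (reflect f) (\<lambda>p. W (- p)) (- a) c0"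
  "bistable.P (\<lambda>p. W (- p)) u = bistable.P W (- u)"
  "bistable.fp (reflect f) p = bistable.fp f (- p)" "bistable.fv (reflect f) p = bistable.fv f (- p)"
proof -
 interpret bistable f W a c0 by (rule assms)
 have sm: "smooth_on UNIV (\<lambda>(p, q). reflect f p q)"
 proof -
  \<comment> \<open>The factor \<open>c\<close> closes the induction: each derivative contributes a
    sign, so the induction hypothesis is needed for \<open>- c\<close>.\<close>
  have Ck: "Ck_on k UNIV (\<lambda>z. c * F (- z))" if "smooth_on UNIV F" for k c and F :: "real \<times> real => real"
   using that
  proof (induction k arbitrary: c F)
   case 0
   have "continuous_on UNIV (\<lambda>z. F (- z))"
    by (rule continuous_on_compose2[OF smooth_on_derivD(3)[OF 0]]) (auto intro: continuous_intros)
   then show ?case by (auto intro!: continuous_intros)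
  next
   case (Suc k)
   have d: "((\<lambda>z. c * F (- z)) has_derivative (\<lambda>h. - c * frechet_derivative F (at (- z)) h)) (at z)" for z
   proof -
    have dF: "(F has_derivative frechet_derivative F (at (- z))) (at (- z))"
     by (rule smooth_on_has_derivative[OF Suc(2)]) simp
    have "((\<lambda>z. - z) has_derivative (\<lambda>h. - h)) (at z)" by (auto intro!: derivative_eq_intros)
    from has_derivative_compose[OF this dF]
    have "((\<lambda>z. F (- z)) has_derivative (\<lambda>h. frechet_derivative F (at (- z)) (- h))) (at z)" .
    from has_derivative_mult_right[OF this, of c] has_derivative_linear[OF dF]
    show ?thesis by (simp add: linear_neg)
   qed
   then have fd: "frechet_derivative (\<lambda>z. c * F (- z)) (at z) v = - c * frechet_derivative F (at (- z)) v" for z v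
    using frechet_derivative_at by metis
   have "(\<lambda>z. c * F (- z)) differentiable at z" for z using d[of z] unfolding differentiable_def by blast
   then show ?case using Suc(1)[OF smooth_on_derivD(1)[OF Suc(2)], of "- c"] by (simp add: fd)
  qed
  have "(\<lambda>(p, q). reflect f p q) = (\<lambda>z. - 1 * (\<lambda>(p, q). f p q) (- z))"
   by (auto simp: reflect_def fun_eq_iff)
  then show ?thesis unfolding smooth_on_def using Ck[OF smooth_f] by metis
 qed
 have dft: "((\<lambda>p. reflect f p 0) has_real_derivative fp (- p)) (at p)" for p
 proof -
  have "((\<lambda>p. f (- p) 0) has_real_derivative fp (- p) * -1) (at p)"
   by (rule DERIV_chain2[where f = "\<lambda>p. f p 0" and g = uminus, OF ft_deriv]) (auto intro!: derivative_eq_intros)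
  from DERIV_minus[OF this] show ?thesis unfolding reflect_def by simp
 qed
 have dfv: "((\<lambda>q. reflect f p q) has_real_derivative fv (- p)) (at 0)" for p
 proof -
  have "((\<lambda>q. f (- p) (- q)) has_real_derivative fv (- p) * -1) (at 0)"
   by (rule DERIV_chain2[of "f (- p)"]) (use fv_deriv[of "- p"] in \<open>auto intro!: derivative_eq_intros\<close>)
  from DERIV_minus[OF this] show ?thesis unfolding reflect_def by simp
 qed
 have fvc: "integral {-1..1} (\<lambda>p. deriv (reflect f p) 0) = integral {-1..1} (\<lambda>p. deriv (f p) 0)"
 proof -
  have "(\<lambda>p. deriv (reflect f p) 0) = (\<lambda>p. fv (- p))" using DERIV_imp_deriv[OF dfv] by (simp add: fun_eq_iff)
  moreover have "(\<lambda>p. deriv (f p) 0) = fv" using deriv_eqs by (simp add: fun_eq_iff)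
  ultimately show ?thesis using Henstock_Kurzweil_Integration.integral_reflect_real[of 1 "-1" fv] by simp
 qed
 have Pc: "integral {-1..1} (\<lambda>p. sqrt (2 * (W (- p) - W (- (- 1))))) = integral {-1..1} (\<lambda>p. sqrt (2 * (W p - W (- 1))))"
  using Henstock_Kurzweil_Integration.integral_reflect_real[of 1 "-1" "\<lambda>p. sqrt (2 * (W p - W (- 1)))"] W_equal by simp
 show b: "bistable (reflect f) (\<lambda>p. W (- p)) (- a) c0"
 proof
  show "smooth_on UNIV (\<lambda>(p, q). reflect f p q)" by (rule sm)
  show "((\<lambda>p. W (- p)) has_real_derivative - reflect f p 0) (at p)" for p
  proof -
   have "((\<lambda>p. W (- p)) has_real_derivative - f (- p) 0 * -1) (at p)"
    by (rule DERIV_chain2[where f = W and g = uminus, OF W_deriv]) (auto intro!: derivative_eq_intros)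
   then show ?thesis by (simp add: reflect_def)
  qed
  have "{p. reflect f p 0 = 0} = {p. - p \<in> {p. f p 0 = 0}}" by (simp add: reflect_def)
  also have "\<dots> = {- 1, - a, 1}" unfolding zeros by (auto simp: minus_equation_iff equation_minus_iff)
  finally show "{p. reflect f p 0 = 0} = {- 1, - a, 1}" .
  show "deriv (\<lambda>p. reflect f p 0) (- 1) < 0" "deriv (\<lambda>p. reflect f p 0) 1 < 0"
   using DERIV_imp_deriv[OF dft] stable deriv_eqs by auto
  show "integral {- 1..1} (\<lambda>p. reflect f p 0) = 0"
   using Henstock_Kurzweil_Integration.integral_reflect_real[of 1 "-1" "\<lambda>p. f p 0"] balanced by (simp add: reflect_def)
  show "c0 = - integral {- 1..1} (\<lambda>p. deriv (reflect f p) 0) /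
     integral {- 1..1} (\<lambda>p. sqrt (2 * (W (- p) - W (- (- 1)))))"
   unfolding fvc Pc by (rule c0_eq)
 qed (use a_bounds in auto)
 interpret R: bistable "reflect f" "\<lambda>p. W (- p)" "- a" c0 by (rule b)
 show "R.P u = P (- u)" unfolding R.P_def P_def using W_equal by simp
 show "R.fp p = fp (- p)" using DERIV_unique[OF R.ft_deriv dft] .
 show "R.fv p = fv (- p)" using DERIV_unique[OF R.fv_deriv dfv] .
qed

lemma exp_beats_cubic:
 fixes k :: real assumes "k > 0"
 obtains C where "C > 0" "\<And>x. x \<ge> 0 ==> exp (- k * x) * (1 + x) * (1 + x^2) \<le> C"
proof -
 define m where "m = min 1 (k / 3)"
 have m: "m > 0" "m \<le> 1" "m \<le> k / 3" unfolding m_def using assms by auto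
 show thesis
 proof (rule that[of "1 / m^3"])
  fix x :: real assume x: "x \<ge> 0"
  have "m * (1 + x) \<le> 1 + k / 3 * x" using m x mult_right_mono[OF m(3) x] by (simp add: algebra_simps)
  also have "\<dots> \<le> exp (k / 3 * x)" by (rule exp_ge_add_one_self)
  finally have "(m * (1 + x))^3 \<le> (exp (k / 3 * x))^3" using m x by (intro power_mono) auto
  also have "\<dots> = exp (k * x)" by (simp flip: exp_of_nat_mult)
  finally have 1: "m^3 * (1 + x)^3 \<le> exp (k * x)" by (simp add: power_mult_distrib)
  have "(1 + x) * (1 + x^2) \<le> (1 + x) * (1 + x)^2" using x by (intro mult_left_mono) (auto simp: power2_eq_square algebra_simps)
  then have "(1 + x) * (1 + x^2) \<le> (1 + x)^3" by (simp add: power3_eq_cube power2_eq_square)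
  then have "m^3 * ((1 + x) * (1 + x^2)) \<le> exp (k * x)" using 1 m(1) by (meson mult_left_mono order_trans zero_le_power less_imp_le)
  then have "exp (- k * x) * (m^3 * ((1 + x) * (1 + x^2))) \<le> exp (- k * x) * exp (k * x)" by (rule mult_left_mono) simp
  also have "\<dots> = 1" by (simp flip: exp_add)
  finally show "exp (- k * x) * (1 + x) * (1 + x^2) \<le> 1 / m^3" using m(1) by (simp add: field_simps)
 qed (use m in simp)
qed

context bistable
begin

text \<open>At the well 1 the potential is compared with parabolas, at -1 by reflection; in between
  \<open>P\<close> is bounded below by compactness. The two bounds are what makes the wave exist for
  all \<open>z\<close> and approach the wells exponentially.\<close>

lemma P_linear_bounds:
 obtains k K where "k > 0" "K > 0" "\<And>u. \<bar>u\<bar> \<le> 1 ==> k * (1 - \<bar>u\<bar>) \<le> P u" "\<And>u. \<bar>u\<bar> \<le> 1 ==> P u \<le> K * (1 - \<bar>u\<bar>)"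
proof -
 have bis: "bistable f W a c0" by unfold_locales
 interpret R: bistable "reflect f" "\<lambda>p. W (- p)" "- a" c0 by (rule bistable_reflect(1)[OF bis])
 note PR = bistable_reflect(2)[OF bis]
 obtain k1 d1 where 1: "k1 > 0" "d1 > 0" "\<And>u. 1 - d1 < u ==> u \<le> 1 ==> P u \<ge> k1 * (1 - u)" using P_lower_at_one by blast
 obtain k2 d2 where 2: "k2 > 0" "d2 > 0" "\<And>u. 1 - d2 < u ==> u \<le> 1 ==> P (- u) \<ge> k2 * (1 - u)"
  using R.P_lower_at_one unfolding PR by blast
 define d where "d = min (min d1 d2) 1 / 2"
 have d: "d > 0" "d < d1" "d < d2" "d < 1" unfolding d_def using 1 2 by auto
 have "compact {-1 + d..1 - d}" "{-1 + d..1 - d} \<noteq> {}" "continuous_on {-1 + d..1 - d} P"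
  using d P_cont by (auto intro: continuous_at_imp_continuous_on)
 from continuous_attains_inf[OF this] obtain u0 where u0: "u0 \<in> {-1 + d..1 - d}" "\<And>u. u \<in> {-1 + d..1 - d} ==> P u0 \<le> P u" by blast
 have m: "P u0 > 0" using u0(1) d(1) by (intro P_pos) auto
 define k where "k = min (min k1 k2) (P u0)"
 have k: "k > 0" "k \<le> k1" "k \<le> k2" "k \<le> P u0" unfolding k_def using 1 2 m by auto
 have lower: "k * (1 - \<bar>u\<bar>) \<le> P u" if u: "\<bar>u\<bar> \<le> 1" for u
 proof -
  consider "u > 1 - d" | "u < - 1 + d" | "u \<in> {-1 + d..1 - d}" by fastforce
  then show ?thesis
  proof cases
   case 1
   then have "k * (1 - \<bar>u\<bar>) \<le> k1 * (1 - u)" using k u d by (intro mult_mono) auto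
   also have "\<dots> \<le> P u" using 1 d u by (intro \<open>\<And>u. 1 - d1 < u ==> u \<le> 1 ==> P u \<ge> k1 * (1 - u)\<close>) auto
   finally show ?thesis .
  next
   case 2
   then have "k * (1 - \<bar>u\<bar>) \<le> k2 * (1 - - u)" using k u d by (intro mult_mono) auto
   also have "\<dots> \<le> P (- (- u))" using 2 d u by (intro \<open>\<And>u. 1 - d2 < u ==> u \<le> 1 ==> P (- u) \<ge> k2 * (1 - u)\<close>) auto
   finally show ?thesis by simp
  next
   case 3
   have "k * (1 - \<bar>u\<bar>) \<le> P u0 * 1" using k u by (intro mult_mono) auto
   then show ?thesis using u0(2)[OF 3] by simp
  qed
 qed
 obtain K1 where K1: "K1 > 0" "\<And>u. 0 \<le> u ==> u \<le> 1 ==> P u \<le> K1 * (1 - u)" using P_upper by blast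
 obtain K2 where K2: "K2 > 0" "\<And>u. 0 \<le> u ==> u \<le> 1 ==> P (- u) \<le> K2 * (1 - u)" using R.P_upper unfolding PR by blast
 have upper: "P u \<le> max K1 K2 * (1 - \<bar>u\<bar>)" if u: "\<bar>u\<bar> \<le> 1" for u
 proof (cases "u \<ge> 0")
  case True
  then have "P u \<le> K1 * (1 - \<bar>u\<bar>)" using K1(2)[of u] u by simp
  also have "\<dots> \<le> max K1 K2 * (1 - \<bar>u\<bar>)" using u by (intro mult_right_mono) auto
  finally show ?thesis .
 next
  case False
  then have "P u \<le> K2 * (1 - \<bar>u\<bar>)" using K2(2)[of "- u"] u by simp
  also have "\<dots> \<le> max K1 K2 * (1 - \<bar>u\<bar>)" using u by (intro mult_right_mono) auto
  finally show ?thesis .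
 qed
 show thesis by (rule that[OF k(1) _ lower upper]) (use K1(1) in auto)
qed

text \<open>\<open>U\<close> is the inverse of \<open>G\<close>, the primitive of
  \<open>1 / P\<close> vanishing at 0. The upper linear bound of \<open>P\<close> makes
  \<open>G\<close> diverge logarithmically at both wells, so every real number is attained; the
  lower one gives the exponential approach, since \<open>(1 - \<bar>U\<bar>) * exp (k * t)\<close>
  does not increase away from 0.\<close>

theorem standing_wave:
 obtains U k where "k > 0" "\<And>z. (U has_real_derivative P (U z)) (at z)" "\<And>z. -1 < U z \<and> U z < 1"
  "\<And>z. 0 \<le> z ==> 0 \<le> U z" "\<And>z. z \<le> 0 ==> U z \<le> 0" "\<And>z. 1 - \<bar>U z\<bar> \<le> exp (- k * \<bar>z\<bar>)"
proof -
 obtain k K where kK: "k > 0" "K > 0" "\<And>u. \<bar>u\<bar> \<le> 1 ==> k * (1 - \<bar>u\<bar>) \<le> P u" "\<And>u. \<bar>u\<bar> \<le> 1 ==> P u \<le> K * (1 - \<bar>u\<bar>)"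
  using P_linear_bounds by blast
 have "isCont (\<lambda>u. 1 / P u) u" if "-1 < u" "u < 1" for u
  using P_pos[OF that] P_cont by (intro continuous_intros) auto
 then obtain Z where "\<forall>u. ereal (-1) < ereal u --> ereal u < ereal 1 --> (Z has_vector_derivative 1 / P u) (at u)"
  using einterval_antiderivative[of "ereal (-1)" "ereal 1" "\<lambda>u. 1 / P u"] by auto
 then have Z: "(Z has_real_derivative 1 / P u) (at u)" if "-1 < u" "u < 1" for u
  using that by (simp add: has_real_derivative_iff_has_vector_derivative)
 define G where "G u = Z u - Z 0" for u
 have G: "(G has_real_derivative 1 / P u) (at u)" if "-1 < u" "u < 1" for u
  unfolding G_def using Z[OF that] by (auto intro!: derivative_eq_intros)
 have G0: "G 0 = 0" unfolding G_def by simp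
 have mono: "G u < G w" if "-1 < u" "u < w" "w < 1" for u w
 proof (rule DERIV_pos_imp_increasing[OF that(2)])
  fix x assume "u \<le> x" "x \<le> w"
  then show "\<exists>y. (G has_real_derivative y) (at x) \<and> 0 < y"
   using G[of x] P_pos[of x] that by (intro exI[of _ "1 / P x"]) auto
 qed
 have bound: "s * G (s * u) \<ge> - ln (1 - u) / K" if s: "s = 1 \<or> s = -1" and u: "0 \<le> u" "u < 1" for s u :: real
 proof -
  let ?F = "\<lambda>u. s * G (s * u) + ln (1 - u) / K"
  have "?F 0 \<le> ?F u"
  proof (rule DERIV_nonneg_imp_nondecreasing[OF u(1)])
   fix x assume x: "0 \<le> x" "x \<le> u"
   have sx: "-1 < s * x" "s * x < 1" "\<bar>s * x\<bar> = x" using s x u by auto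
   have "((\<lambda>u. ln (1 - u)) has_real_derivative - 1 / (1 - x)) (at x)" "((*) s has_real_derivative s) (at x)"
    using x u by (auto intro!: derivative_eq_intros)
   from DERIV_add[OF DERIV_cmult[OF DERIV_chain2[OF G[OF sx(1,2)] this(2)]] DERIV_cdivide[OF this(1), of K], of s]
   have "(?F has_real_derivative (s * (1 / P (s * x) * s) + - 1 / (1 - x) / K)) (at x)" .
   moreover have "s * (1 / P (s * x) * s) + - 1 / (1 - x) / K = 1 / P (s * x) - 1 / (K * (1 - x))"
    using s by (auto simp: mult.commute)
   ultimately have "(?F has_real_derivative (1 / P (s * x) - 1 / (K * (1 - x)))) (at x)" by simp
   moreover have "1 / (K * (1 - x)) \<le> 1 / P (s * x)"
    using kK(4)[of "s * x"] P_pos[OF sx(1,2)] sx(3) x u by (intro divide_left_mono) (auto intro: mult_pos_pos kK)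
   ultimately show "\<exists>y. (?F has_real_derivative y) (at x) \<and> 0 \<le> y" by (intro exI conjI) auto
  qed
  then show ?thesis using G0 by simp
 qed
 have ex: "\<exists>u. -1 < u \<and> u < 1 \<and> G u = z" for z
 proof -
  define s :: real where "s = (if z \<ge> 0 then 1 else -1)"
  have s: "s = 1 \<or> s = -1" "s * \<bar>z\<bar> = z" unfolding s_def by auto
  \<comment> \<open>The height at which the logarithmic lower bound for \<open>G\<close> equals
    \<open>\<bar>z\<bar>\<close>.\<close>
  define w where "w = 1 - exp (- K * \<bar>z\<bar>)"
  have w: "0 \<le> w" "w < 1" unfolding w_def using kK(2) by auto
  have "\<bar>z\<bar> \<le> s * G (s * w)" using bound[OF s(1) w] kK(2) unfolding w_def by simp
  moreover have "isCont (\<lambda>u. s * G (s * u)) u" if "0 \<le> u" "u \<le> w" for u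
   using s(1) that w by (intro continuous_intros isCont_o2[OF _ DERIV_isCont[OF G]]) auto
  ultimately obtain u where u: "0 \<le> u" "u \<le> w" "s * G (s * u) = \<bar>z\<bar>"
   using IVT[of "\<lambda>u. s * G (s * u)" 0 "\<bar>z\<bar>" w] G0 w by auto
  then have "G (s * u) = z" using s by auto
  then show ?thesis using s(1) u w by (intro exI[of _ "s * u"]) auto
 qed
 define U where "U z = (SOME u. -1 < u \<and> u < 1 \<and> G u = z)" for z
 have U: "-1 < U z" "U z < 1" "G (U z) = z" for z
  using someI_ex[OF ex[of z]] unfolding U_def by auto
 have UG: "U (G u) = u" if "-1 < u" "u < 1" for u
  using mono[of u "U (G u)"] mono[of "U (G u)" u] U[of "G u"] that by (metis linorder_neqE_linordered_idom order_less_irrefl)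
 have cont: "isCont U z" for z
 proof -
  define d where "d = min (1 - U z) (U z + 1) / 2"
  have d: "d > 0" unfolding d_def using U(1,2)[of z] by auto
  have "d < 1 - U z" "d < U z + 1" unfolding d_def using U(1,2)[of z] by auto
  then have near: "-1 < w \<and> w < 1" if "\<bar>w - U z\<bar> \<le> d" for w using that by (simp add: abs_le_iff)
  have "isCont U (G (U z))"
   by (rule isCont_inverse_function[OF d]) (use near UG DERIV_isCont[OF G] in auto)
  then show ?thesis using U(3) by simp
 qed
 have dU: "(U has_real_derivative P (U z)) (at z)" for z
 proof -
  have "(U has_real_derivative inverse (1 / P (U z))) (at z)"
   by (rule DERIV_inverse_function[where f = G and g = U and a = "z - 1" and b = "z + 1", OF G[OF U(1,2)]])
    (use U P_pos[OF U(1,2)[of z]] cont in auto)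
  then show ?thesis by simp
 qed
 have Umono: "U x \<le> U y" if "x \<le> y" for x y
 proof (rule DERIV_nonneg_imp_nondecreasing[OF that])
  show "\<exists>y. (U has_real_derivative y) (at z) \<and> 0 \<le> y" for z
   using dU[of z] P_pos[OF U(1,2)[of z]] less_imp_le by blast
 qed
 have U0: "U 0 = 0" using UG[of 0] G0 by simp
 have pos: "0 \<le> U z" if "0 \<le> z" for z using Umono[OF that] U0 by simp
 have neg: "U z \<le> 0" if "z \<le> 0" for z using Umono[OF that] U0 by simp
 have decay: "1 - \<bar>U z\<bar> \<le> exp (- k * \<bar>z\<bar>)" for z
 proof -
  define s :: real where "s = (if z \<ge> 0 then 1 else -1)"
  have s: "s = 1 \<or> s = -1" "s * \<bar>z\<bar> = z" unfolding s_def by auto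
  have sU: "s * U (s * t) = \<bar>U (s * t)\<bar>" if "0 \<le> t" for t using s(1) pos[of t] neg[of "- t"] that by auto
  let ?y = "\<lambda>t. (1 - s * U (s * t)) * exp (k * t)"
  have "?y \<bar>z\<bar> \<le> ?y 0"
  proof (rule DERIV_nonpos_imp_nonincreasing[OF abs_ge_zero])
   fix t assume t: "0 \<le> t" "t \<le> \<bar>z\<bar>"
   have "((*) s has_real_derivative s) (at t)" by (auto intro!: derivative_eq_intros)
   from DERIV_chain2[OF dU this] have "(?y has_real_derivative exp (k * t) * (k * (1 - s * U (s * t)) - P (U (s * t)))) (at t)"
    using s(1) by (auto intro!: derivative_eq_intros simp: algebra_simps)
   moreover have "k * (1 - s * U (s * t)) - P (U (s * t)) \<le> 0" using kK(3)[of "U (s * t)"] sU[OF t(1)] U(1,2)[of "s * t"] by simp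
   then have "exp (k * t) * (k * (1 - s * U (s * t)) - P (U (s * t))) \<le> 0" by (simp add: mult_le_0_iff)
   ultimately show "\<exists>y. (?y has_real_derivative y) (at t) \<and> y \<le> 0" by blast
  qed
  then have "(1 - \<bar>U z\<bar>) * exp (k * \<bar>z\<bar>) * exp (- k * \<bar>z\<bar>) \<le> 1 * exp (- k * \<bar>z\<bar>)"
   using U0 sU[of "\<bar>z\<bar>"] s(2) by (intro mult_right_mono) auto
  then show ?thesis by (simp add: mult.assoc flip: exp_add)
 qed
 show thesis by (rule that[OF kK(1) dU _ pos neg decay]) (use U in auto)
qed

end

section \<open>The corrector equation of the standing wave\<close>

context bistable
begin

definition psi_slope :: real where "psi_slope = (fv (-1) / fp (-1) - fv 1 / fp 1) / 2"
text \<open>The affine function whose values at the wells are \<open>- fv / fp\<close>, which makes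
  the zeroth order part of the corrector equation vanish at both wells.\<close>

definition psi :: "real => real" where "psi u = - (fv 1 / fp 1 + fv (-1) / fp (-1)) / 2 + psi_slope * u"

text \<open>Writing the corrector as \<open>psi (U z) + y\<close>, this is the right hand side left
  for \<open>y\<close>: \<open>y'' + fp U * y = defect U\<close>. The term with
  \<open>psi_slope\<close> comes from \<open>U'' = - f U 0\<close>. The subtraction of
  \<open>psi\<close> makes it vanish at both wells.\<close>

definition defect :: "real => real" where
 "defect u = - c0 * P u - fv u - (fp u * psi u - psi_slope * f u 0)"

lemma psi_deriv: "(psi has_real_derivative psi_slope) (at u)"
 unfolding psi_def by (auto intro!: derivative_eq_intros)

lemma psi_ends: "fv 1 + fp 1 * psi 1 = 0" "fv (-1) + fp (-1) * psi (-1) = 0"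
proof -
 have "fp 1 \<noteq> 0" "fp (-1) \<noteq> 0" using stable deriv_eqs by auto
 then show "fv 1 + fp 1 * psi 1 = 0" "fv (-1) + fp (-1) * psi (-1) = 0"
  unfolding psi_def psi_slope_def by (simp_all add: field_simps)
qed

lemma partials_cont: "continuous_on {-1..1} fp" "continuous_on {-1..1} fv"
proof -
 have "continuous_on UNIV (\<lambda>z. frechet_derivative (\<lambda>(p, q). f p q) (at z) v)" for v
  using smooth_on_derivD(3)[OF smooth_on_derivD(1)[OF smooth_f]] .
 then have "continuous_on {-1..1} (\<lambda>p. frechet_derivative (\<lambda>(p, q). f p q) (at (p, 0)) v)" for v
  by (rule continuous_on_compose2[where f = "\<lambda>p. (p, 0)"]) (auto intro: continuous_intros)
 then show "continuous_on {-1..1} fp" "continuous_on {-1..1} fv" unfolding fp_def[abs_def] fv_def[abs_def] by blast+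
qed

lemma psi_cont: "continuous_on S psi" unfolding psi_def by (intro continuous_intros)

lemma P_cont_on: "continuous_on S P" using P_cont by (simp add: continuous_at_imp_continuous_on)

lemma ft_cont_on: "continuous_on S (\<lambda>u. f u 0)" using ft_cont by (simp add: continuous_at_imp_continuous_on)

lemma defect_cont: "continuous_on {-1..1} defect"
 unfolding defect_def by (intro continuous_intros partials_cont psi_cont P_cont_on ft_cont_on)

text \<open>The choice of \<open>c0\<close> is exactly the solvability condition of the corrector equation.\<close>

lemma defect_integral: "integral {-1..1} defect = 0"
proof -
 define I J where "I = integral {-1..1} P" and "J = integral {-1..1} fv"
 have int: "P integrable_on {-1..1}" "fv integrable_on {-1..1}" "(\<lambda>u. f u 0) integrable_on {-1..1}"
  "(\<lambda>u. fp u * psi u) integrable_on {-1..1}"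
  by (auto intro!: integrable_continuous_real continuous_intros partials_cont psi_cont P_cont_on ft_cont_on)
 have I: "I \<noteq> 0"
 proof
  assume "I = 0"
  then have "\<forall>x\<in>{-1..1}. P x = 0"
   using integral_eq_0_iff[OF P_cont_on, of "-1" 1] P_nonneg unfolding I_def by auto
  then have "P 0 = 0" by simp
  then show False using P_pos[of 0] by simp
 qed
 have c: "c0 * I = - J"
  using c0_eq I unfolding I_def J_def P_def[abs_def] deriv_eqs by simp
 \<comment> \<open>The terms with \<open>psi\<close> integrate to zero: \<open>f u 0 * psi u\<close>
   vanishes at both wells, and \<open>f\<close> is balanced.\<close>
 have d: "((\<lambda>u. f u 0 * psi u) has_real_derivative (fp u * psi u + f u 0 * psi_slope)) (at u)" for u
  using DERIV_mult[OF ft_deriv psi_deriv, of u] by (simp add: mult.commute)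
 have "((\<lambda>u. fp u * psi u + f u 0 * psi_slope) has_integral (f 1 0 * psi 1 - f (-1) 0 * psi (-1))) {-1..1}"
  by (rule fundamental_theorem_of_calculus)
   (use has_field_derivative_at_within[OF d] in \<open>simp_all add: has_real_derivative_iff_has_vector_derivative\<close>)
 moreover have "f 1 0 = 0" "f (-1) 0 = 0" using ft_zero by auto
 ultimately have 1: "((\<lambda>u. fp u * psi u + f u 0 * psi_slope) has_integral 0) {-1..1}" by simp
 have 2: "((\<lambda>u. f u 0) has_integral 0) {-1..1}" using int(3) balanced by (simp add: has_integral_iff)
 have 3: "((\<lambda>u. fp u * psi u - psi_slope * f u 0) has_integral (0 - (2 * psi_slope) * 0)) {-1..1}"
  by (rule has_integral_eq[OF _ has_integral_diff[OF 1 has_integral_mult_right[OF 2, of "2 * psi_slope"]]]) (simp add: algebra_simps)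
 have "(defect has_integral ((- c0) * I - J - (0 - (2 * psi_slope) * 0))) {-1..1}"
  unfolding defect_def[abs_def] I_def J_def
  by (intro has_integral_diff has_integral_mult_right integrable_integral int 3)
 then show ?thesis using c by (simp add: integral_unique)
qed

text \<open>Every term is compared with its value at the nearer well \<open>s\<close>; there the sum
  vanishes by \<open>psi_ends\<close>, and all ingredients are Lipschitz.\<close>

lemma defect_bound: obtains C where "C > 0" "\<And>u. \<bar>u\<bar> \<le> 1 ==> \<bar>defect u\<bar> \<le> C * (1 - \<bar>u\<bar>)"
proof -
 obtain k K where K: "K > 0" "\<And>u. \<bar>u\<bar> \<le> 1 ==> P u \<le> K * (1 - \<bar>u\<bar>)" using P_linear_bounds by metis
 obtain L where L: "L > 0" "\<And>x y. \<bar>x\<bar> \<le> 1 ==> \<bar>y\<bar> \<le> 1 ==> \<bar>f y 0 - f x 0\<bar> \<le> L * \<bar>y - x\<bar>"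
  "\<And>x y. \<bar>x\<bar> \<le> 1 ==> \<bar>y\<bar> \<le> 1 ==> \<bar>fp y - fp x\<bar> \<le> L * \<bar>y - x\<bar>"
  "\<And>x y. \<bar>x\<bar> \<le> 1 ==> \<bar>y\<bar> \<le> 1 ==> \<bar>fv y - fv x\<bar> \<le> L * \<bar>y - x\<bar>"
  "\<And>x. \<bar>x\<bar> \<le> 1 ==> \<bar>f x 0\<bar> \<le> L \<and> \<bar>fp x\<bar> \<le> L \<and> \<bar>fv x\<bar> \<le> L"
  using partials_lipschitz by metis
 define m where "m = \<bar>psi 1\<bar> + \<bar>psi (-1)\<bar>"
 define C where "C = \<bar>c0\<bar> * K + L + L * \<bar>psi_slope\<bar> + m * L + \<bar>psi_slope\<bar> * L"
 have "\<bar>defect u\<bar> \<le> C * \<bar>u - s\<bar>" if u: "\<bar>u\<bar> \<le> 1" and s: "s = 1 \<or> s = -1" "1 - \<bar>u\<bar> \<le> \<bar>u - s\<bar>" for u s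
 proof -
  let ?r = "\<bar>u - s\<bar>"
  have s1: "\<bar>s\<bar> \<le> 1" using s by auto
  have s0: "fv s + fp s * psi s = 0" "f s 0 = 0" "\<bar>psi s\<bar> \<le> m" using s psi_ends ft_zero unfolding m_def by auto
  have e1: "\<bar>c0 * P u\<bar> \<le> \<bar>c0\<bar> * (K * ?r)"
  proof -
   have "P u \<le> K * ?r" using K(2)[OF u] s(2) K(1) by (meson mult_left_mono less_imp_le order_trans)
   moreover have "P u \<ge> 0" using P_nonneg u by (simp add: abs_le_iff)
   ultimately show ?thesis by (simp add: abs_mult mult_left_mono)
  qed
  have e2: "\<bar>fv u - fv s\<bar> \<le> L * ?r" by (rule L(4)[OF s1 u])
  have e3: "\<bar>fp u * (psi u - psi s)\<bar> \<le> L * (\<bar>psi_slope\<bar> * ?r)"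
  proof -
   have "psi u - psi s = psi_slope * (u - s)" unfolding psi_def by (simp add: algebra_simps)
   then show ?thesis using L(5)[OF u] by (simp add: abs_mult mult_right_mono)
  qed
  have e4: "\<bar>psi s * (fp u - fp s)\<bar> \<le> m * (L * ?r)"
   unfolding abs_mult using s0(3) L(3)[OF s1 u] by (intro mult_mono) auto
  have e5: "\<bar>psi_slope * f u 0\<bar> \<le> \<bar>psi_slope\<bar> * (L * ?r)"
   unfolding abs_mult using L(2)[OF s1 u] s0(2) by (intro mult_left_mono) auto
  have eq: "defect u = - (c0 * P u) - (fv u - fv s) - fp u * (psi u - psi s) - psi s * (fp u - fp s) + psi_slope * f u 0 - (fv s + fp s * psi s)"
   unfolding defect_def by (simp add: algebra_simps)
  have gen: "\<bar>- x1 - x2 - x3 - x4 + x5 - 0\<bar> \<le> y1 + y2 + y3 + y4 + y5"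
   if "\<bar>x1\<bar> \<le> y1" "\<bar>x2\<bar> \<le> y2" "\<bar>x3\<bar> \<le> y3" "\<bar>x4\<bar> \<le> y4" "\<bar>x5\<bar> \<le> y5" for x1 x2 x3 x4 x5 y1 y2 y3 y4 y5 :: real
   using that by linarith
  have "\<bar>defect u\<bar> \<le> \<bar>c0\<bar> * (K * ?r) + L * ?r + L * (\<bar>psi_slope\<bar> * ?r) + m * (L * ?r) + \<bar>psi_slope\<bar> * (L * ?r)"
   unfolding eq s0(1) by (rule gen[OF e1 e2 e3 e4 e5])
  then show ?thesis unfolding C_def by (simp add: algebra_simps)
 qed
 note key = this
 have "\<bar>defect u\<bar> \<le> C * (1 - \<bar>u\<bar>)" if u: "\<bar>u\<bar> \<le> 1" for u
 proof (cases "u \<ge> 0")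
  case True then show ?thesis using key[OF u, of 1] u by simp
 next
  case False then show ?thesis using key[OF u, of "-1"] u by (simp add: add.commute)
 qed
 moreover have "C > 0" unfolding C_def m_def using K(1) L(1) by (intro add_pos_nonneg add_nonneg_pos) auto
 ultimately show thesis using that by blast
qed

definition primitive :: "real => real" where "primitive u = integral {-1..u} defect"

lemma primitive_deriv:
 assumes "-1 < u" "u < 1" shows "(primitive has_real_derivative defect u) (at u)"
proof -
 have "((\<lambda>u. integral {-1..u} defect) has_real_derivative defect u) (at u within {-1..1})"
  by (rule integral_has_real_derivative[OF defect_cont]) (use assms in auto)
 moreover have "at u within {-1..1} = at u" using assms by (intro at_within_interior) auto
 ultimately show ?thesis unfolding primitive_def[abs_def] by simp
qed

text \<open>Integrating the linear bound of \<open>defect\<close> from the nearer well gives a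
  square. At the well 1 this rests on the total integral being zero, that is, on the value of
  \<open>c0\<close>.\<close>

lemma primitive_bound:
 obtains C where "C > 0" "\<And>u. \<bar>u\<bar> \<le> 1 ==> \<bar>primitive u\<bar> \<le> C * (1 - \<bar>u\<bar>)^2"
proof -
 obtain C where C: "C > 0" "\<And>u. \<bar>u\<bar> \<le> 1 ==> \<bar>defect u\<bar> \<le> C * (1 - \<bar>u\<bar>)" using defect_bound by blast
 have "\<bar>primitive u\<bar> \<le> C * (1 - \<bar>u\<bar>)^2" if u: "\<bar>u\<bar> \<le> 1" for u
 proof (cases "u \<le> 0")
  case True
  have "norm (integral {-1..u} defect) \<le> (C * (1 + u)) * (u - - 1)"
  proof (rule integral_bound)
   show "continuous_on {-1..u} defect" by (rule continuous_on_subset[OF defect_cont]) (use u in auto)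
   fix t assume t: "t \<in> {-1..u}"
   have "\<bar>t\<bar> \<le> 1" using t u by (simp add: abs_le_iff)
   from C(2)[OF this] have "\<bar>defect t\<bar> \<le> C * (1 - \<bar>t\<bar>)" .
   also have "\<dots> \<le> C * (1 + u)" using t True C(1) by (intro mult_left_mono) auto
   finally show "norm (defect t) \<le> C * (1 + u)" by simp
  qed (use u in auto)
  then show ?thesis unfolding primitive_def using True by (simp add: power2_eq_square add.commute)
 next
  case False
  have "integral {-1..u} defect + integral {u..1} defect = integral {-1..1} defect"
   by (rule Henstock_Kurzweil_Integration.integral_combine) (use u integrable_continuous_real[OF defect_cont] in auto)
  then have "primitive u = - integral {u..1} defect" unfolding primitive_def using defect_integral by simp
  moreover have "norm (integral {u..1} defect) \<le> (C * (1 - u)) * (1 - u)"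
  proof (rule integral_bound)
   show "continuous_on {u..1} defect" by (rule continuous_on_subset[OF defect_cont]) (use False in auto)
   fix t assume t: "t \<in> {u..1}"
   have "\<bar>defect t\<bar> \<le> C * (1 - \<bar>t\<bar>)" using C(2)[of t] t False by simp
   also have "\<dots> \<le> C * (1 - u)" using t False C(1) by (intro mult_left_mono) auto
   finally show "norm (defect t) \<le> C * (1 - u)" by simp
  qed (use u in auto)
  ultimately show ?thesis using False by (simp add: power2_eq_square)
 qed
 with C(1) show thesis using that by blast
qed

text \<open>Reduction of order: \<open>U' = P U\<close> solves the homogeneous equation, and with
  \<open>y = U' * w\<close> the equation becomes \<open>(U'^2 * w')' = U' * defect U\<close>, so
  \<open>w' = primitive U / (P U)^2\<close>. This quotient is bounded, as the numerator vanishes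
  quadratically and \<open>P\<close> linearly at the wells. Thus \<open>w\<close> grows at most
  linearly and is beaten by the exponential decay of \<open>U'\<close>. Of that decay only the rate
  \<open>1 / (1 + z^2)\<close> is kept, which is all the barriers need.\<close>

theorem wave_profile:
 obtains U \<Psi> \<Psi>1 \<Psi>2 C k where "C > 0" "k > 0"
  "\<And>z. (U has_real_derivative P (U z)) (at z)" "\<And>z. ((\<lambda>z. P (U z)) has_real_derivative - f (U z) 0) (at z)"
  "\<And>z. -1 < U z \<and> U z < 1" "\<And>z. 0 < P (U z)" "\<And>z. k * (1 - \<bar>U z\<bar>) \<le> P (U z)"
  "\<And>z. 0 \<le> z ==> 1 - C / (1 + z^2) \<le> U z" "\<And>z. z \<le> 0 ==> U z \<le> - 1 + C / (1 + z^2)"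
  "\<And>z. (\<Psi> has_real_derivative \<Psi>1 z) (at z)" "\<And>z. (\<Psi>1 has_real_derivative \<Psi>2 z) (at z)"
  "\<And>z. \<Psi>2 z + fp (U z) * \<Psi> z = - c0 * P (U z) - fv (U z)"
  "\<And>z. \<bar>\<Psi> z\<bar> \<le> C" "\<And>z. \<bar>\<Psi>1 z\<bar> \<le> C"
  "\<And>z. P (U z) \<le> C / (1 + z^2)" "\<And>z. \<bar>f (U z) 0\<bar> \<le> C / (1 + z^2)" "\<And>z. \<bar>\<Psi>2 z\<bar> \<le> C / (1 + z^2)"
proof -
 obtain U k where U: "k > 0" "\<And>z. (U has_real_derivative P (U z)) (at z)" "\<And>z. -1 < U z \<and> U z < 1"
  "\<And>z. 0 \<le> z ==> 0 \<le> U z" "\<And>z. z \<le> 0 ==> U z \<le> 0" "\<And>z. 1 - \<bar>U z\<bar> \<le> exp (- k * \<bar>z\<bar>)"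
  by (rule standing_wave, rule that)
 obtain kl K where kK: "kl > 0" "K > 0" "\<And>u. \<bar>u\<bar> \<le> 1 ==> kl * (1 - \<bar>u\<bar>) \<le> P u" "\<And>u. \<bar>u\<bar> \<le> 1 ==> P u \<le> K * (1 - \<bar>u\<bar>)"
  by (rule P_linear_bounds, rule that)
 obtain Cd where Cd: "Cd > 0" "\<And>u. \<bar>u\<bar> \<le> 1 ==> \<bar>defect u\<bar> \<le> Cd * (1 - \<bar>u\<bar>)" using defect_bound by blast
 obtain CH where CH: "CH > 0" "\<And>u. \<bar>u\<bar> \<le> 1 ==> \<bar>primitive u\<bar> \<le> CH * (1 - \<bar>u\<bar>)^2" using primitive_bound by blast
 obtain L where L: "L > 0" "\<And>x y. \<bar>x\<bar> \<le> 1 ==> \<bar>y\<bar> \<le> 1 ==> \<bar>f y 0 - f x 0\<bar> \<le> L * \<bar>y - x\<bar>"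
  "\<And>x. \<bar>x\<bar> \<le> 1 ==> \<bar>f x 0\<bar> \<le> L \<and> \<bar>fp x\<bar> \<le> L \<and> \<bar>fv x\<bar> \<le> L"
  using partials_lipschitz by metis
 obtain CE where CE: "CE > 0" "\<And>x. x \<ge> 0 ==> exp (- k * x) * (1 + x) * (1 + x^2) \<le> CE" using exp_beats_cubic[OF U(1)] by blast
 have U1: "\<bar>U z\<bar> \<le> 1" "\<bar>U z\<bar> < 1" for z using U(3)[of z] by auto
 have Ppos: "0 < P (U z)" for z using P_pos U(3) by blast
 define g where "g z = 1 - \<bar>U z\<bar>" for z
 have g: "g z > 0" "g z \<le> 1" for z unfolding g_def using U1(2)[of z] by auto
 have decay: "g z * (1 + \<bar>z\<bar>) \<le> CE / (1 + z^2)" for z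
 proof -
  have pos: "1 + z^2 > 0" by (simp add: add_pos_nonneg)
  have "g z * (1 + \<bar>z\<bar>) * (1 + z^2) \<le> exp (- k * \<bar>z\<bar>) * (1 + \<bar>z\<bar>) * (1 + z^2)"
   using U(6)[of z] unfolding g_def by (intro mult_right_mono) auto
  also have "\<dots> \<le> CE" using CE(2)[of "\<bar>z\<bar>"] by simp
  finally show ?thesis using pos by (simp add: pos_le_divide_eq)
 qed
 have gd: "g z \<le> CE / (1 + z^2)" for z
  using decay[of z] g(1)[of z] by (smt (verit) mult_le_cancel_left1 abs_ge_zero)
 have z1: "1 + z^2 \<ge> (1::real)" for z by simp
 have CEb: "CE / (1 + z^2) \<le> CE" for z
  using CE(1) z1[of z] by (simp add: divide_le_eq) (smt (verit) mult_left_mono zero_le_power2 mult_nonneg_nonneg)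
 have dP: "((\<lambda>z. P (U z)) has_real_derivative - f (U z) 0) (at z)" for z
 proof -
  have pos: "2 * (W (U z) - W (-1)) > 0" using W_pos U(3)[of z] by simp
  have "((\<lambda>z. W (U z)) has_real_derivative - f (U z) 0 * P (U z)) (at z)"
   by (rule DERIV_chain2[OF W_deriv U(2)])
  then have "((\<lambda>z. 2 * (W (U z) - W (-1))) has_real_derivative 2 * (- f (U z) 0 * P (U z))) (at z)"
   by (auto intro!: derivative_eq_intros)
  from DERIV_chain2[OF DERIV_real_sqrt[OF pos] this]
  have "((\<lambda>z. P (U z)) has_real_derivative inverse (P (U z)) / 2 * (2 * (- f (U z) 0 * P (U z)))) (at z)"
   unfolding P_def .
  then show ?thesis using Ppos[of z] by (simp add: field_simps)
 qed
 have dH: "((\<lambda>z. primitive (U z)) has_real_derivative defect (U z) * P (U z)) (at z)" for z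
  using DERIV_chain2[OF primitive_deriv U(2)] U(3) by blast
 let ?q = "\<lambda>z. primitive (U z) / (P (U z))^2"
 have "isCont ?q z" for z
  using Ppos[of z] DERIV_isCont[OF dP] DERIV_isCont[OF dH] by (intro continuous_intros) auto
 then obtain V where "\<And>z. (V has_vector_derivative ?q z) (at z)"
  using einterval_antiderivative[of "-\<infinity>" "\<infinity>" ?q] by auto
 then have V: "(V has_real_derivative ?q z) (at z)" for z by (simp add: has_real_derivative_iff_has_vector_derivative)
 define w where "w z = V z - V 0" for z
 have w: "(w has_real_derivative ?q z) (at z)" for z unfolding w_def using V by (auto intro!: derivative_eq_intros)
 define Cq where "Cq = CH / kl^2"
 have Cq: "Cq > 0" unfolding Cq_def using CH kK by simp
 have qb: "\<bar>?q z\<bar> \<le> Cq" for z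
 proof -
  have "\<bar>primitive (U z)\<bar> \<le> CH * (g z)^2" using CH(2)[OF U1(1)] unfolding g_def .
  moreover have "(kl * g z)^2 \<le> (P (U z))^2" using kK(1,3) U1(1) g(1)[of z] unfolding g_def by (intro power_mono) auto
  ultimately have "\<bar>primitive (U z)\<bar> / (P (U z))^2 \<le> CH * (g z)^2 / (kl * g z)^2"
   using kK(1) g(1)[of z] CH(1) by (intro frac_le) auto
  also have "\<dots> = Cq" unfolding Cq_def using g(1)[of z] by (simp add: power_mult_distrib)
  finally show ?thesis by (simp add: abs_divide)
 qed
 have wb: "\<bar>w z\<bar> \<le> Cq * \<bar>z\<bar>" for z
 proof -
  have "norm (w z - w 0) \<le> Cq * norm (z - 0)"
  proof (rule field_differentiable_bound[of UNIV w ?q])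
   show "norm (?q z) \<le> Cq" for z using qb[of z] by simp
  qed (use w in auto)
  then show ?thesis unfolding w_def by simp
 qed
 define \<Psi> where "\<Psi> z = psi (U z) + P (U z) * w z" for z
 define \<Psi>1 where "\<Psi>1 z = psi_slope * P (U z) - f (U z) 0 * w z + primitive (U z) / P (U z)" for z
 define \<Psi>2 where "\<Psi>2 z = - psi_slope * f (U z) 0 - fp (U z) * P (U z) * w z + defect (U z)" for z
 have d\<Psi>: "(\<Psi> has_real_derivative \<Psi>1 z) (at z)" for z
 proof -
  have "(\<Psi> has_real_derivative (psi_slope * P (U z) + (- f (U z) 0 * w z + P (U z) * ?q z))) (at z)"
   unfolding \<Psi>_def[abs_def]
   by (rule DERIV_cong[OF DERIV_add[OF DERIV_chain2[OF psi_deriv U(2)] DERIV_mult[OF dP w]]]) simp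
  then show ?thesis unfolding \<Psi>1_def using Ppos[of z] by (simp add: power2_eq_square algebra_simps)
 qed
 have dft: "((\<lambda>z. f (U z) 0) has_real_derivative fp (U z) * P (U z)) (at z)" for z
  by (rule DERIV_chain2[OF ft_deriv U(2)])
 have d\<Psi>1: "(\<Psi>1 has_real_derivative \<Psi>2 z) (at z)" for z
 proof -
  have Pz: "P (U z) \<noteq> 0" using Ppos[of z] by simp
  have "(\<Psi>1 has_real_derivative (psi_slope * - f (U z) 0 - (fp (U z) * P (U z) * w z + f (U z) 0 * ?q z)
    + (defect (U z) * P (U z) * P (U z) - primitive (U z) * - f (U z) 0) / (P (U z) * P (U z)))) (at z)"
   unfolding \<Psi>1_def[abs_def]
   by (rule DERIV_cong[OF DERIV_add[OF DERIV_diff[OF DERIV_cmult[OF dP] DERIV_mult[OF dft w]] DERIV_divide[OF dH dP Pz]]])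
    (simp add: algebra_simps)
  moreover have "(psi_slope * - f (U z) 0 - (fp (U z) * P (U z) * w z + f (U z) 0 * ?q z)
    + (defect (U z) * P (U z) * P (U z) - primitive (U z) * - f (U z) 0) / (P (U z) * P (U z))) = \<Psi>2 z"
   unfolding \<Psi>2_def using Pz by (simp add: diff_divide_distrib add_divide_distrib power2_eq_square)
  ultimately show ?thesis by simp
 qed
 have ode: "\<Psi>2 z + fp (U z) * \<Psi> z = - c0 * P (U z) - fv (U z)" for z
  unfolding \<Psi>2_def \<Psi>_def defect_def by (simp add: algebra_simps)
 have ftb: "\<bar>f (U z) 0\<bar> \<le> L * g z" for z
 proof (cases "U z \<ge> 0")
  case True
  have "\<bar>f (U z) 0 - f 1 0\<bar> \<le> L * \<bar>U z - 1\<bar>" using U1(1) by (intro L(2)) auto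
  then show ?thesis using True U1(1)[of z] ft_zero[of 1] unfolding g_def by simp
 next
  case False
  have "\<bar>f (U z) 0 - f (-1) 0\<bar> \<le> L * \<bar>U z - (-1)\<bar>" using U1(1) by (intro L(2)) auto
  then show ?thesis using False U1(1)[of z] ft_zero[of "-1"] unfolding g_def by (simp add: add.commute)
 qed
 have Pb: "P (U z) \<le> K * g z" for z using kK(4)[OF U1(1)] unfolding g_def .
 have gw: "g z * \<bar>w z\<bar> \<le> Cq * (CE / (1 + z^2))" for z
 proof -
  have "g z * \<bar>w z\<bar> \<le> g z * (Cq * \<bar>z\<bar>)" using wb[of z] g(1)[of z] by (intro mult_left_mono) auto
  also have "\<dots> \<le> g z * (Cq * (1 + \<bar>z\<bar>))" using g(1)[of z] Cq by (intro mult_left_mono) auto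
  also have "\<dots> = Cq * (g z * (1 + \<bar>z\<bar>))" by simp
  also have "\<dots> \<le> Cq * (CE / (1 + z^2))" using decay[of z] Cq by (intro mult_left_mono) auto
  finally show ?thesis .
 qed
 define m where "m = \<bar>psi 0\<bar> + \<bar>psi_slope\<bar>"
 have psib: "\<bar>psi (U z)\<bar> \<le> m" for z
 proof -
  have "psi (U z) = psi 0 + psi_slope * U z" unfolding psi_def by simp
  moreover have "\<bar>psi_slope * U z\<bar> \<le> \<bar>psi_slope\<bar> * 1" unfolding abs_mult using U1(1)[of z] by (intro mult_left_mono) auto
  ultimately show ?thesis unfolding m_def by linarith
 qed
 define C where "C = CE + K * CE + L * CE + (m + K * (Cq * CE)) + (\<bar>psi_slope\<bar> * K + L * (Cq * CE) + CH / kl)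
   + (\<bar>psi_slope\<bar> * L * CE + L * K * (Cq * CE) + Cd * CE)"
 have nn: "0 \<le> K * CE" "0 \<le> L * CE" "0 \<le> m + K * (Cq * CE)" "0 \<le> \<bar>psi_slope\<bar> * K + L * (Cq * CE) + CH / kl"
  "0 \<le> \<bar>psi_slope\<bar> * L * CE + L * K * (Cq * CE) + Cd * CE" "0 \<le> m"
  unfolding m_def using CE(1) kK L(1) Cq CH(1) Cd(1) by (auto intro!: add_nonneg_nonneg)
 have Cpos: "C > 0" unfolding C_def using CE(1) nn by linarith
 have div: "x / (1 + z^2) \<le> y / (1 + z^2)" if "x \<le> y" for x y z :: real
  using that by (intro divide_right_mono) auto
 have "\<bar>\<Psi> z\<bar> \<le> C" for z
 proof -
  have "\<bar>P (U z) * w z\<bar> \<le> K * g z * \<bar>w z\<bar>" using Pb[of z] Ppos[of z] by (simp add: abs_mult mult_right_mono)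
  also have "\<dots> = K * (g z * \<bar>w z\<bar>)" by simp
  also have "\<dots> \<le> K * (Cq * CE)"
   using gw[of z] CEb[of z] Cq kK(2) by (meson mult_left_mono order_trans less_imp_le)
  finally show ?thesis unfolding \<Psi>_def using psib[of z] nn CE(1) unfolding C_def by linarith
 qed
 moreover have "\<bar>\<Psi>1 z\<bar> \<le> C" for z
 proof -
  have "\<bar>psi_slope * P (U z)\<bar> \<le> \<bar>psi_slope\<bar> * K"
  proof -
   have "K * g z \<le> K * 1" using g(2)[of z] kK(2) by (intro mult_left_mono) auto
   then have "P (U z) \<le> K" using Pb[of z] by simp
   then show ?thesis using Ppos[of z] by (simp add: abs_mult mult_left_mono)
  qed
  moreover have "\<bar>f (U z) 0 * w z\<bar> \<le> L * (Cq * CE)"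
  proof -
   have "\<bar>f (U z) 0 * w z\<bar> \<le> L * g z * \<bar>w z\<bar>" unfolding abs_mult using ftb[of z] by (rule mult_right_mono) simp
   also have "\<dots> = L * (g z * \<bar>w z\<bar>)" by simp
   also have "\<dots> \<le> L * (Cq * CE)"
    using gw[of z] CEb[of z] Cq L(1) by (meson mult_left_mono order_trans less_imp_le)
   finally show ?thesis .
  qed
  moreover have "\<bar>primitive (U z) / P (U z)\<bar> \<le> CH / kl"
  proof -
   have "\<bar>primitive (U z)\<bar> \<le> CH * (g z)^2" using CH(2)[OF U1(1)] unfolding g_def .
   then have "\<bar>primitive (U z)\<bar> / P (U z) \<le> CH * (g z)^2 / (kl * g z)"
    using kK(1) kK(3)[OF U1(1), of z] g(1)[of z] CH(1) unfolding g_def by (intro frac_le) auto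
   also have "\<dots> = CH / kl * g z" using g(1)[of z] by (simp add: power2_eq_square)
   also have "\<dots> \<le> CH / kl * 1" using g(2)[of z] CH(1) kK(1) by (intro mult_left_mono) auto
   finally show ?thesis using Ppos[of z] by (simp add: abs_divide)
  qed
  ultimately show ?thesis unfolding \<Psi>1_def C_def using nn CE(1) by linarith
 qed
 moreover have "P (U z) \<le> C / (1 + z^2)" for z
 proof -
  have "P (U z) \<le> K * (CE / (1 + z^2))" using Pb[of z] gd[of z] kK(2) by (meson mult_left_mono order_trans less_imp_le)
  also have "\<dots> = (K * CE) / (1 + z^2)" by simp
  also have "\<dots> \<le> C / (1 + z^2)" by (rule div) (use nn CE(1) in \<open>simp add: C_def\<close>)
  finally show ?thesis .
 qed
 moreover have "\<bar>f (U z) 0\<bar> \<le> C / (1 + z^2)" for z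
 proof -
  have "\<bar>f (U z) 0\<bar> \<le> L * (CE / (1 + z^2))" using ftb[of z] gd[of z] L(1) by (meson mult_left_mono order_trans less_imp_le)
  also have "\<dots> = (L * CE) / (1 + z^2)" by simp
  also have "\<dots> \<le> C / (1 + z^2)" by (rule div) (use nn CE(1) in \<open>simp add: C_def\<close>)
  finally show ?thesis .
 qed
 moreover have "\<bar>\<Psi>2 z\<bar> \<le> C / (1 + z^2)" for z
 proof -
  let ?e = "CE / (1 + z^2)"
  have "\<bar>- psi_slope * f (U z) 0\<bar> \<le> \<bar>psi_slope\<bar> * (L * ?e)"
  proof -
   have "\<bar>f (U z) 0\<bar> \<le> L * ?e" using ftb[of z] gd[of z] L(1) by (meson mult_left_mono order_trans less_imp_le)
   from mult_left_mono[OF this abs_ge_zero[of psi_slope]] show ?thesis by (simp only: abs_mult abs_minus_cancel)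
  qed
  moreover have "\<bar>fp (U z) * P (U z) * w z\<bar> \<le> L * (K * (Cq * ?e))"
  proof -
   have "\<bar>P (U z) * w z\<bar> \<le> K * g z * \<bar>w z\<bar>" using Pb[of z] Ppos[of z] by (simp add: abs_mult mult_right_mono)
   also have "\<dots> = K * (g z * \<bar>w z\<bar>)" by simp
   also have "\<dots> \<le> K * (Cq * ?e)" using gw[of z] kK(2) by (intro mult_left_mono) auto
   finally have "\<bar>P (U z) * w z\<bar> \<le> K * (Cq * ?e)" .
   moreover have "\<bar>fp (U z)\<bar> \<le> L" using L(3)[OF U1(1)] by blast
   ultimately have "\<bar>fp (U z)\<bar> * \<bar>P (U z) * w z\<bar> \<le> L * (K * (Cq * ?e))" using L(1) by (intro mult_mono) auto
   then show ?thesis by (simp add: abs_mult mult.assoc)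
  qed
  moreover have "\<bar>defect (U z)\<bar> \<le> Cd * ?e"
   using Cd(2)[OF U1(1)[of z]] gd[of z] Cd(1) unfolding g_def by (meson mult_left_mono order_trans less_imp_le)
  ultimately have "\<bar>\<Psi>2 z\<bar> \<le> \<bar>psi_slope\<bar> * (L * ?e) + L * (K * (Cq * ?e)) + Cd * ?e" unfolding \<Psi>2_def by linarith
  also have "\<dots> = (\<bar>psi_slope\<bar> * L * CE + L * K * (Cq * CE) + Cd * CE) / (1 + z^2)" by (simp add: add_divide_distrib)
  also have "\<dots> \<le> C / (1 + z^2)" by (rule div) (use nn CE(1) in \<open>simp add: C_def\<close>)
  finally show ?thesis .
 qed
 moreover have "1 - C / (1 + z^2) \<le> U z" if "0 \<le> z" for z
  using gd[of z] div[of CE C z] nn U(4)[OF that] unfolding C_def g_def by simp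
 moreover have "U z \<le> - 1 + C / (1 + z^2)" if "z \<le> 0" for z
  using gd[of z] div[of CE C z] nn U(5)[OF that] unfolding C_def g_def by simp
 ultimately show thesis
  using that[OF Cpos kK(1) U(2) dP U(3) Ppos kK(3)[OF U1(1)] _ _ d\<Psi> d\<Psi>1 ode] by blast
qed

end

section \<open>Barriers following the moving interface\<close>

text \<open>Chosen so that \<open>K / (2 * M) = 2 + M + 2 * M * A\<close> with
  \<open>A = M * (M + 1)\<close>: the multiple of \<open>eps * r\<close> that has to be paid for in
  the transition layer.\<close>

definition motion_rate :: "real => real" where
 "motion_rate M = 2 * M * (2 + M + 2 * M * (M * (M + 1)))"

text \<open>The bookkeeping of the residual, freed from functions: \<open>p\<close> is the slope of
  the wave, \<open>\<Phi>\<close> the derivative of the reaction, and at every height either the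
  reaction is damping or the wave is steep. In the first case the height \<open>q\<close> pays for
  the errors, in the second the shift \<open>r\<close>. The part with \<open>e\<close> decays on the
  time scale \<open>eps^2\<close> and lets \<open>q\<close> start at height
  \<open>2 * \<sigma>\<close>. The bound on \<open>\<sigma>\<close> keeps \<open>q\<close> so small
  that the quadratic term is at most \<open>q / M\<close>.\<close>

lemma motion_inequality:
 fixes M \<sigma> \<delta> eps e E E1 A b c K r r' q q' N p \<Phi> S :: real
 assumes M: "1 \<le> M" and \<sigma>: "0 < \<sigma>" "\<sigma> \<le> 1 / (4 * M^2)" and \<delta>: "0 < \<delta>" and eps: "0 < eps"
  and e: "0 < e" "e \<le> 1" and E: "1 \<le> E" "E \<le> E1"
  and A: "A = M * (M + 1)" and b: "b = 1 / (2 * M)" and c: "c = 20 * M^3 * \<sigma>" and K: "K = motion_rate M"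
  and r: "r = 4 * \<delta> * E - c * eps * e" and r': "r' = 4 * \<delta> * K * E + c * b * e / eps"
  and q: "q = 2 * \<sigma> * e + eps * A * r" and q': "q' = - (2 * \<sigma> * b * e / eps^2) + eps * A * r'"
  and N: "0 < N"
  and s1: "c * eps \<le> \<delta>" and s2: "A * (4 * \<delta> * E1) * eps \<le> 1 / (2 * M^2)" and s3: "N * c * b * eps \<le> \<sigma> / M"
  and s4: "N * (1 + 4 * \<delta> * K * E1) * eps < 3 * \<delta>" and s5: "2 * M * N * eps \<le> 1"
  and p: "0 \<le> p" and \<Phi>: "\<bar>\<Phi>\<bar> \<le> M" "\<Phi> \<le> - (2 / M) \<or> 1 / M \<le> p"
  and S: "eps * p * (r' - M * r) - eps * M * r - \<Phi> * q + eps^2 * q' - M * q^2 - N * eps^2 * (1 + r') \<le> S"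
 shows "0 < S"
proof -
 have M0: "M > 0" using M by simp
 have pos: "A > 0" "b > 0" "c > 0" "K > 0" unfolding A b c K motion_rate_def using M0 \<sigma>
  by (auto intro!: mult_pos_pos add_pos_pos)
 have KM: "M \<le> K"
 proof -
  have "M * 1 \<le> M * (2 * (2 + M + 2 * M * (M * (M + 1))))"
   using M0 by (intro mult_left_mono) (auto intro!: add_nonneg_nonneg)
  then show ?thesis unfolding K motion_rate_def by (simp add: algebra_simps)
 qed
 have ce: "0 \<le> c * eps * e" "c * eps * e \<le> \<delta>"
 proof -
  show "0 \<le> c * eps * e" using pos eps e by simp
  have "c * eps * e \<le> c * eps * 1" using pos eps e by (intro mult_left_mono) auto
  then show "c * eps * e \<le> \<delta>" using s1 by simp
 qed
 have dE: "\<delta> \<le> \<delta> * E" "\<delta> * E \<le> \<delta> * E1" using \<delta> E by simp_all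
 have rb: "3 * \<delta> \<le> r" "r \<le> 4 * \<delta> * E" "r \<le> 4 * \<delta> * E1" using r ce dE by linarith+
 have rp: "r > 0" using rb \<delta> by linarith
 have r'K: "K * r + c * b * e / eps \<le> r'"
 proof -
  have "K * r \<le> K * (4 * \<delta> * E)" using rb(2) pos by (intro mult_left_mono) auto
  then show ?thesis unfolding r' by (simp add: algebra_simps)
 qed
 have cb: "c * b * e / eps \<ge> 0" using pos e eps by simp
 have r'M: "0 \<le> r' - M * r"
 proof -
  have "M * r \<le> K * r" using KM rp by simp
  then show ?thesis using r'K cb by linarith
 qed
 have r'0: "r' \<ge> 0" using r'M mult_pos_pos[OF M0 rp] by linarith
 have Ar: "0 \<le> eps * A * r" "eps * A * r \<le> 1 / (2 * M^2)"
 proof -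
  show "0 \<le> eps * A * r" using pos eps rp by simp
  have "eps * A * r \<le> eps * A * (4 * \<delta> * E1)" using rb(3) pos eps by (intro mult_left_mono) auto
  then show "eps * A * r \<le> 1 / (2 * M^2)" using s2 by (simp add: mult_ac)
 qed
 have se: "0 < \<sigma> * e" "\<sigma> * e \<le> \<sigma>" using \<sigma> e by simp_all
 have qb: "0 < q" "q \<le> 1 / M^2"
 proof -
  show "0 < q" using q se Ar by linarith
  have "1 / (4 * M^2) * 2 + 1 / (2 * M^2) = 1 / M^2" by simp
  then show "q \<le> 1 / M^2" using q se Ar \<sigma>(2) by linarith
 qed
 have Mq: "M * q^2 \<le> q / M"
 proof -
  have "q * (M * q) \<le> q * (M * (1 / M^2))" using qb M0 by (intro mult_left_mono) auto
  then show ?thesis using M0 by (simp add: power2_eq_square mult_ac)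
 qed
 have eq': "eps^2 * q' = - (2 * \<sigma> * b * e) + eps^3 * A * r'"
  unfolding q' using eps by (simp add: field_simps power2_eq_square power3_eq_cube)
 have sb: "2 * \<sigma> * b * e = \<sigma> * e / M" unfolding b by simp
 have "eps^3 * A * r' \<ge> 0" using eps pos r'0 by simp
 then have q'b: "eps^2 * q' \<ge> - (\<sigma> * e / M)" unfolding eq' sb by linarith
 have tail: "N * eps^2 * (1 + 4 * \<delta> * K * E) < eps * r"
 proof -
  have "4 * \<delta> * K * E \<le> 4 * \<delta> * K * E1" using E pos \<delta> by (intro mult_left_mono) auto
  then have "N * eps^2 * (1 + 4 * \<delta> * K * E) \<le> N * eps^2 * (1 + 4 * \<delta> * K * E1)" using N by (intro mult_left_mono) auto
  also have "\<dots> = eps * (N * (1 + 4 * \<delta> * K * E1) * eps)" by (simp add: power2_eq_square mult_ac)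
  also have "\<dots> < eps * (3 * \<delta>)" using s4 eps by (intro mult_strict_left_mono)
  also have "\<dots> \<le> eps * r" using rb(1) eps by (intro mult_left_mono) auto
  finally show ?thesis .
 qed
 show ?thesis
 proof (cases "\<Phi> \<le> - (2 / M)")
  \<comment> \<open>Of the damping \<open>2 * q / M\<close> one half pays for the quadratic term.
    The other half is \<open>2 * \<sigma> * e / M + eps * (M + 1) * r\<close>, which is what
    \<open>A\<close> was chosen for, and covers the remaining errors.\<close>
  case True
  have 1: "2 * q / M \<le> - \<Phi> * q" using mult_right_mono[OF True, of q] qb by simp
  have 2: "0 \<le> eps * p * (r' - M * r)" using eps p r'M by simp
  have 3: "q / M = 2 * (\<sigma> * e / M) + eps * (M * r) + eps * r"
   unfolding q A using M0 by (simp add: field_simps)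
  have 4: "N * eps^2 * (1 + r') = N * eps^2 * (1 + 4 * \<delta> * K * E) + N * c * b * eps * e"
   unfolding r' using eps by (simp add: field_simps power2_eq_square)
  have "N * c * b * eps * e \<le> \<sigma> / M * e" using s3 e by (intro mult_right_mono) auto
  then have 5: "N * c * b * eps * e \<le> \<sigma> * e / M" by simp
  have 6: "eps * M * r = eps * (M * r)" "2 * q / M = q / M + q / M" by simp_all
  show ?thesis using S 1 2 3 4 5 6 Mq q'b tail by linarith
 next
  \<comment> \<open>Here the reaction may amplify. Of \<open>eps * r' / M\<close> one half takes the
    part of the remainder containing \<open>r'\<close>. The other half splits by
    \<open>r' \<ge> K * r + c * b * e / eps\<close>: the rate \<open>K\<close> covers the terms in
    \<open>eps * r\<close>, and \<open>c\<close> those in \<open>\<sigma> * e\<close>.\<close>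
  case False
  then have pM: "1 / M \<le> p" using \<Phi>(2) by blast
  have 1: "eps * (r' - M * r) / M \<le> eps * p * (r' - M * r)"
  proof -
   have "(eps * (r' - M * r)) * (1 / M) \<le> (eps * (r' - M * r)) * p" using pM eps r'M by (intro mult_left_mono) auto
   then show ?thesis by (simp add: mult_ac)
  qed
  have 2: "eps * (r' - M * r) / M = eps * r' / M - eps * r" using M0 by (simp add: field_simps)
  have 3: "- (M * q) \<le> - \<Phi> * q"
   using mult_right_mono[of \<Phi> M q] \<Phi>(1) qb by simp
  have 4: "q / M \<le> M * q"
  proof -
   have "q * 1 \<le> q * (M * M)" using M qb mult_mono[of 1 M 1 M] by (intro mult_left_mono) auto
   then show ?thesis using M0 by (simp add: field_simps)
  qed
  have 5: "N * eps^2 * r' \<le> eps * r' / M / 2"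
  proof -
   have "(2 * M * N * eps) * (eps * r') \<le> 1 * (eps * r')" using s5 eps r'0 by (intro mult_right_mono) auto
   then show ?thesis using M0 by (simp add: field_simps power2_eq_square)
  qed
  have 6: "eps * (K * r) / M / 2 + c * b * e / M / 2 \<le> eps * r' / M / 2"
  proof -
   have "eps * (K * r + c * b * e / eps) \<le> eps * r'" using r'K eps by (intro mult_left_mono) auto
   then have "eps * (K * r) + c * b * e \<le> eps * r'" using eps by (simp add: algebra_simps)
   then have "(eps * (K * r) + c * b * e) / M \<le> eps * r' / M" using M0 by (intro divide_right_mono) auto
   moreover have "a / 2 + b / 2 \<le> c / 2" if "a + b \<le> c" for a b c :: real using that by linarith
   ultimately show ?thesis unfolding add_divide_distrib by blast
  qed
  have 7: "eps * (K * r) / M / 2 = 2 * (eps * r) + M * eps * r + 2 * (M * (eps * A * r))"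
   unfolding K motion_rate_def A using M0 by (simp add: field_simps)
  have 8: "c * b * e / M / 2 = 5 * (M * (\<sigma> * e))"
   unfolding c b using M0 by (simp add: field_simps power3_eq_cube)
  have 9: "M * q = 2 * (M * (\<sigma> * e)) + M * (eps * A * r)" unfolding q by (simp add: algebra_simps)
  have 10: "\<sigma> * e / M \<le> M * (\<sigma> * e)"
  proof -
   have "(\<sigma> * e) * 1 \<le> (\<sigma> * e) * (M * M)" using M se mult_mono[of 1 M 1 M] by (intro mult_left_mono) auto
   then show ?thesis using M0 by (simp add: field_simps)
  qed
  have 11: "N * eps^2 * (1 + r') = N * eps^2 + N * eps^2 * r'" "eps * M * r = M * eps * r" by (simp_all add: algebra_simps)
  have 12: "N * eps^2 < eps * r"
  proof -
   have "N * eps^2 * 1 \<le> N * eps^2 * (1 + 4 * \<delta> * K * E)" using N pos \<delta> E by (intro mult_left_mono) auto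
   then show ?thesis using tail by linarith
  qed
  have gen: "0 < S" if "X1 - X2 - X3 + X4 - X5 - X6 \<le> S" "Y \<le> X1" "Y = 2 * w - x" "- mq \<le> - X3" "y \<le> mq" "X6 = n + nr" "nr \<le> w"
   "kr + s5 \<le> w" "kr = 2 * x + X2 + 2 * ma" "s5 = 5 * ms" "mq = 2 * ms + ma" "sm \<le> ms" "n < x" "X5 \<le> y" "- sm \<le> X4"
   for X1 X2 X3 X4 X5 X6 Y w x mq y n nr kr s5 ma ms sm :: real
   using that by linarith
  show ?thesis
  proof (rule gen[OF S 1 _ _ 4 _ 5 6 _ 8 9 10 12 Mq q'b])
   show "eps * (r' - M * r) / M = 2 * (eps * r' / M / 2) - eps * r" using 2 by simp
   show "- (M * q) \<le> - (\<Phi> * q)" using 3 by simp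
   show "N * eps^2 * (1 + r') = N * eps^2 + N * eps^2 * r'" by (rule 11)
   show "eps * (K * r) / M / 2 = 2 * (eps * r) + eps * M * r + 2 * (M * (eps * A * r))" using 7 11 by simp
  qed
 qed
qed

text \<open>The terms of order one and of order \<open>eps\<close> of the residual cancel by the equations of \<open>U\<close> and \<open>\<Psi>\<close>.\<close>

lemma barrier_residual:
 fixes eps p f0 \<Phi> \<phi> \<Psi> \<Psi>1 \<Psi>2 c0 v v1 vh v0 q q' r r' \<theta> G L \<zeta> L\<zeta> F z d CU Cd V Z Lc Ct r0 M N \<delta> Cv E H s :: real
 assumes eps: "0 < eps" "eps \<le> 1"
  and ode: "\<Psi>2 + \<Phi> * \<Psi> = - c0 * p - \<phi>"
  and taylor: "\<bar>F - f0 - \<Phi> * s - \<phi> * (eps * vh)\<bar> \<le> Ct * (s^2 + (eps * vh)^2)" and s: "s = q + eps * v * \<Psi> + eps^2 * \<zeta>"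
  and bnd: "\<bar>\<Psi>\<bar> \<le> CU" "\<bar>\<Psi>1\<bar> \<le> CU" "0 \<le> p" "p \<le> CU / (1 + z^2)" "\<bar>f0\<bar> \<le> CU / (1 + z^2)" "\<bar>\<Psi>2\<bar> \<le> CU / (1 + z^2)"
  and bndD: "\<bar>G\<bar> \<le> Cd" "\<bar>L\<bar> \<le> Cd" "\<bar>\<theta>\<bar> \<le> Cd" "\<bar>d\<bar> < r0 --> G = 1 \<and> \<bar>\<theta> - L + c0 * v0\<bar> \<le> Cd * \<bar>d\<bar>"
  and bndz: "\<bar>\<zeta>\<bar> \<le> Z" "\<bar>L\<zeta>\<bar> \<le> Z" and bndv: "\<bar>v\<bar> \<le> V" "\<bar>v1\<bar> \<le> V" "\<bar>vh\<bar> \<le> V" "\<bar>v - v0\<bar> \<le> \<delta>" "\<bar>vh - v0\<bar> \<le> Cv * (\<delta> * E)"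
  and bndf: "\<bar>\<Phi>\<bar> \<le> Lc" "\<bar>\<phi>\<bar> \<le> Lc" and z: "eps * z = d + r" and r: "\<delta> \<le> r" "\<delta> * E \<le> r" "r \<le> r0 / 2" and r': "0 \<le> r'"
  and C: "0 < CU" "0 < Cd" "0 \<le> Cv" "0 < Ct" "0 < r0" "0 \<le> Z" "0 \<le> \<delta>"
  and M: "Cd + \<bar>c0\<bar> \<le> M" "Lc * (1 + Cv) \<le> M" "2 * Ct \<le> M"
  and H: "H = 4 * CU / r0^2"
  and N: "N = Cd * CU + H * (2 * Cd + \<bar>c0\<bar> * V) + (Cd + 1) * ((1 + V) * H) + V * CU * (2 * Cd) + V * CU + V * CU
    + Z + Lc * Z + Ct * (2 * (V * CU + Z)^2 + V^2)"
 shows "eps * p * (r' - M * r) - eps * M * r - \<Phi> * q + eps^2 * q' - M * q^2 - N * eps^2 * (1 + r')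
   \<le> eps^2 * (((p + eps * v * \<Psi>1) / eps * (\<theta> + r') + eps * v1 * \<Psi> + q')
    - ((- f0 + eps * v * \<Psi>2) / eps^2 * G + (p + eps * v * \<Psi>1) / eps * L + eps^2 * L\<zeta>)) - F"
proof -
 have V: "V \<ge> 0" using bndv(1) by linarith
 have Lc: "Lc \<ge> 0" using bndf(1) by linarith
 have H0: "H \<ge> 0" unfolding H using C by simp
 have r0': "r \<ge> 0" using r C by linarith
 have e2: "0 < eps^2" using eps by simp
 \<comment> \<open>Where the distance carries no information on gradient and motion,
   \<open>\<bar>eps * z\<bar>\<close> is at least \<open>r0 / 2\<close>, since \<open>r\<close> is
   at most \<open>r0 / 2\<close>; the decay of the profile then turns bounded factors into terms of
   order \<open>eps^2\<close>.\<close>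
 have off: "CU / (1 + z^2) \<le> H * eps^2" if "r0 \<le> \<bar>d\<bar>"
 proof -
  have "\<bar>eps * z\<bar> \<ge> r0 / 2" unfolding z using that r r0' by linarith
  then have "(r0 / 2)^2 \<le> \<bar>eps * z\<bar>^2" using C by (intro power_mono) auto
  then have "r0^2 / 4 \<le> eps^2 * z^2" by (simp add: power_mult_distrib power_divide)
  also have "\<dots> \<le> eps^2 * (1 + z^2)" using e2 by simp
  finally have "CU * (r0^2 / 4) \<le> CU * (eps^2 * (1 + z^2))" using C by (intro mult_left_mono) auto
  moreover have "1 + z^2 > 0" by (simp add: add_pos_nonneg)
  ultimately show ?thesis unfolding H using C by (simp add: field_simps)
 qed
 have pz: "p * \<bar>z\<bar> \<le> CU"
 proof -
  have "1 + z^2 > 0" by (simp add: add_pos_nonneg)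
  have "0 \<le> (\<bar>z\<bar> - 1)^2 + z^2 + 1" by simp
  then have "\<bar>z\<bar> \<le> 1 + z^2" by (simp add: power2_diff)
  then have "CU / (1 + z^2) * \<bar>z\<bar> \<le> CU / (1 + z^2) * (1 + z^2)" using C by (intro mult_left_mono) auto
  also have "\<dots> = CU" using \<open>1 + z^2 > 0\<close> by simp
  finally have "CU / (1 + z^2) * \<bar>z\<bar> \<le> CU" .
  moreover have "p * \<bar>z\<bar> \<le> CU / (1 + z^2) * \<bar>z\<bar>" using bnd by (intro mult_right_mono) auto
  ultimately show ?thesis by linarith
 qed
 \<comment> \<open>Here the motion law enters. Its error is linear in \<open>\<bar>d\<bar>\<close>,
   hence in \<open>eps * \<bar>z\<bar> + r\<close>; the first part gains a factor \<open>eps\<close>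
   because \<open>p * \<bar>z\<bar>\<close> is bounded, the second is left to the growth of
   \<open>r\<close>.\<close>
 have T1: "\<bar>eps * p * (\<theta> - L + c0 * v)\<bar> \<le> eps * p * (Cd + \<bar>c0\<bar>) * r + (Cd * CU + H * (2 * Cd + \<bar>c0\<bar> * V)) * eps^2"
 proof (cases "\<bar>d\<bar> < r0")
  case True
  have "\<bar>c0 * (v - v0)\<bar> \<le> \<bar>c0\<bar> * r" unfolding abs_mult using bndv(4) r by (intro mult_left_mono) auto
  moreover have "\<theta> - L + c0 * v = (\<theta> - L + c0 * v0) + c0 * (v - v0)" by (simp add: algebra_simps)
  moreover have "Cd * \<bar>d\<bar> \<le> Cd * (eps * \<bar>z\<bar> + r)"
  proof (intro mult_left_mono)
   have "\<bar>d\<bar> = \<bar>eps * z - r\<bar>" using z by simp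
   also have "\<dots> \<le> \<bar>eps * z\<bar> + r" using r0' by linarith
   finally show "\<bar>d\<bar> \<le> eps * \<bar>z\<bar> + r" using eps by (simp add: abs_mult)
  qed (use C in auto)
  ultimately have "\<bar>\<theta> - L + c0 * v\<bar> \<le> Cd * (eps * \<bar>z\<bar> + r) + \<bar>c0\<bar> * r" using bndD(4) True by linarith
  then have "eps * p * \<bar>\<theta> - L + c0 * v\<bar> \<le> eps * p * (Cd * (eps * \<bar>z\<bar> + r) + \<bar>c0\<bar> * r)" using eps bnd by (intro mult_left_mono) auto
  also have "\<dots> = eps * p * (Cd + \<bar>c0\<bar>) * r + (Cd * eps^2) * (p * \<bar>z\<bar>)" by (simp add: algebra_simps power2_eq_square)
  also have "\<dots> \<le> eps * p * (Cd + \<bar>c0\<bar>) * r + (Cd * eps^2) * CU" using pz C by (intro add_left_mono mult_left_mono) auto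
  also have "\<dots> = eps * p * (Cd + \<bar>c0\<bar>) * r + (Cd * CU) * eps^2" by simp
  also have "\<dots> \<le> eps * p * (Cd + \<bar>c0\<bar>) * r + (Cd * CU + H * (2 * Cd + \<bar>c0\<bar> * V)) * eps^2"
   using H0 C V by (intro add_left_mono mult_right_mono) auto
  finally show ?thesis using eps bnd by (simp add: abs_mult)
 next
  case False
  have "\<bar>c0 * v\<bar> \<le> \<bar>c0\<bar> * V" unfolding abs_mult using bndv by (intro mult_left_mono) auto
  then have a: "\<bar>\<theta> - L + c0 * v\<bar> \<le> 2 * Cd + \<bar>c0\<bar> * V" using bndD by linarith
  have "p \<le> H * eps^2" using off False bnd by linarith
  moreover have "eps * p \<le> 1 * p" using eps bnd by (intro mult_right_mono) auto
  ultimately have "eps * p \<le> H * eps^2" by linarith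
  from mult_mono[OF this a] have "(eps * p) * \<bar>\<theta> - L + c0 * v\<bar> \<le> (H * eps^2) * (2 * Cd + \<bar>c0\<bar> * V)" using H0 by simp
  also have "\<dots> = (H * (2 * Cd + \<bar>c0\<bar> * V)) * eps^2" by simp
  also have "\<dots> \<le> (Cd * CU + H * (2 * Cd + \<bar>c0\<bar> * V)) * eps^2" using C by (intro mult_right_mono) auto
  also have "\<dots> \<le> eps * p * (Cd + \<bar>c0\<bar>) * r + (Cd * CU + H * (2 * Cd + \<bar>c0\<bar> * V)) * eps^2" using eps bnd r0' C by simp
  finally show ?thesis using eps bnd by (simp add: abs_mult)
 qed
 have T2: "\<bar>eps * \<phi> * (v - vh)\<bar> \<le> eps * M * r"
 proof -
  have "Cv * (\<delta> * E) \<le> Cv * r" using r C by (intro mult_left_mono) auto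
  then have "\<bar>v - vh\<bar> \<le> (1 + Cv) * r" using bndv(4,5) r unfolding distrib_right by linarith
  then have "\<bar>\<phi>\<bar> * \<bar>v - vh\<bar> \<le> Lc * ((1 + Cv) * r)" using bndf Lc by (intro mult_mono) auto
  also have "\<dots> = (Lc * (1 + Cv)) * r" by simp
  also have "\<dots> \<le> M * r" using M r0' by (intro mult_right_mono) auto
  finally have "eps * (\<bar>\<phi>\<bar> * \<bar>v - vh\<bar>) \<le> eps * (M * r)" using eps by (intro mult_left_mono) auto
  then show ?thesis using eps by (simp add: abs_mult mult_ac)
 qed
 \<comment> \<open>In the tube the gradient has length one and this term is absent; outside,
   \<open>f0\<close> and \<open>\<Psi>2\<close> are small.\<close>
 have T3: "\<bar>(G - 1) * (f0 - eps * v * \<Psi>2)\<bar> \<le> ((Cd + 1) * ((1 + V) * H)) * eps^2"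
 proof (cases "\<bar>d\<bar> < r0")
  case True then show ?thesis using bndD(4) C V H0 by simp
 next
  case False
  define h where "h = H * eps^2"
  have h: "\<bar>f0\<bar> \<le> h" "\<bar>\<Psi>2\<bar> \<le> h" "0 \<le> h" unfolding h_def using off False bnd H0 by fastforce+
  have "eps * \<bar>v\<bar> \<le> 1 * V" using eps bndv V by (intro mult_mono) auto
  from mult_mono[OF this h(2)] have "(eps * \<bar>v\<bar>) * \<bar>\<Psi>2\<bar> \<le> (1 * V) * h" using h V by simp
  then have "\<bar>eps * v * \<Psi>2\<bar> \<le> V * h" using eps by (simp add: abs_mult)
  then have "\<bar>f0 - eps * v * \<Psi>2\<bar> \<le> (1 + V) * h" using h unfolding distrib_right by linarith
  moreover have "\<bar>G - 1\<bar> \<le> Cd + 1" using bndD by linarith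
  ultimately have "\<bar>G - 1\<bar> * \<bar>f0 - eps * v * \<Psi>2\<bar> \<le> (Cd + 1) * ((1 + V) * h)" using C by (intro mult_mono) auto
  then show ?thesis unfolding h_def by (simp add: abs_mult mult_ac)
 qed
 have v\<Psi>1: "\<bar>v * \<Psi>1\<bar> \<le> V * CU" "\<bar>v * \<Psi>\<bar> \<le> V * CU" "\<bar>v1 * \<Psi>\<bar> \<le> V * CU"
  unfolding abs_mult
  by (rule mult_mono[OF bndv(1) bnd(2) V abs_ge_zero] mult_mono[OF bndv(1) bnd(1) V abs_ge_zero] mult_mono[OF bndv(2) bnd(1) V abs_ge_zero])+
 have T4: "\<bar>eps^2 * (v * \<Psi>1 * (\<theta> - L))\<bar> \<le> (V * CU * (2 * Cd)) * eps^2"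
 proof -
  have "\<bar>\<theta> - L\<bar> \<le> 2 * Cd" using bndD by linarith
  then have "\<bar>v * \<Psi>1\<bar> * \<bar>\<theta> - L\<bar> \<le> V * CU * (2 * Cd)" using v\<Psi>1 V C by (intro mult_mono) auto
  from mult_left_mono[OF this, of "eps^2"] show ?thesis by (simp add: abs_mult mult_ac)
 qed
 have T5: "\<bar>eps^2 * (v * \<Psi>1 * r')\<bar> \<le> (V * CU) * (eps^2 * r')"
  using mult_right_mono[OF v\<Psi>1(1), of "eps^2 * r'"] r' by (simp add: abs_mult mult_ac)
 have T6: "\<bar>eps^3 * (v1 * \<Psi>)\<bar> \<le> (V * CU) * eps^2"
 proof -
  have "eps^3 \<le> eps^2" using eps by (intro power_decreasing) auto
  then have "eps^3 * \<bar>v1 * \<Psi>\<bar> \<le> eps^2 * (V * CU)" using v\<Psi>1 by (intro mult_mono) auto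
  then show ?thesis using eps by (simp add: abs_mult mult_ac)
 qed
 have T7: "\<bar>eps^4 * L\<zeta>\<bar> \<le> Z * eps^2"
 proof -
  have "eps^4 \<le> eps^2" using eps by (intro power_decreasing) auto
  then have "eps^4 * \<bar>L\<zeta>\<bar> \<le> eps^2 * Z" using bndz by (intro mult_mono) auto
  then show ?thesis by (simp add: abs_mult mult_ac)
 qed
 have T8: "\<bar>eps^2 * (\<Phi> * \<zeta>)\<bar> \<le> (Lc * Z) * eps^2"
 proof -
  have "\<bar>\<Phi>\<bar> * \<bar>\<zeta>\<bar> \<le> Lc * Z" using bndf bndz Lc by (intro mult_mono) auto
  from mult_left_mono[OF this, of "eps^2"] show ?thesis by (simp add: abs_mult mult_ac)
 qed
 have T9: "Ct * (s^2 + (eps * vh)^2) \<le> M * q^2 + (Ct * (2 * (V * CU + Z)^2 + V^2)) * eps^2"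
 proof -
  define y where "y = eps * v * \<Psi> + eps^2 * \<zeta>"
  have "eps^2 * \<bar>\<zeta>\<bar> \<le> eps * Z" using eps bndz by (intro mult_mono) (auto simp: power2_eq_square mult_left_le)
  moreover have "eps * \<bar>v * \<Psi>\<bar> \<le> eps * (V * CU)" using v\<Psi>1 eps by (intro mult_left_mono) auto
  moreover have "\<bar>y\<bar> \<le> eps * \<bar>v * \<Psi>\<bar> + eps^2 * \<bar>\<zeta>\<bar>" unfolding y_def using eps abs_triangle_ineq[of "eps * v * \<Psi>" "eps^2 * \<zeta>"] by (simp add: abs_mult)
  ultimately have "\<bar>y\<bar> \<le> eps * (V * CU + Z)" unfolding distrib_left by linarith
  then have "\<bar>y\<bar>^2 \<le> (eps * (V * CU + Z))^2" by (intro power_mono) auto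
  then have y2: "y^2 \<le> eps^2 * (V * CU + Z)^2" by (simp add: power_mult_distrib)
  have "s = q + y" unfolding s y_def by simp
  moreover have "0 \<le> (q - y)^2" by simp
  ultimately have s2: "s^2 \<le> 2 * q^2 + 2 * y^2" by (simp add: power2_diff power2_sum)
  have "\<bar>vh\<bar>^2 \<le> V^2" using bndv by (intro power_mono) auto
  then have "(eps * vh)^2 \<le> eps^2 * V^2" by (simp add: power_mult_distrib mult_left_mono)
  with s2 y2 have "s^2 + (eps * vh)^2 \<le> 2 * q^2 + 2 * (eps^2 * (V * CU + Z)^2) + eps^2 * V^2" by linarith
  then have "Ct * (s^2 + (eps * vh)^2) \<le> Ct * (2 * q^2 + 2 * (eps^2 * (V * CU + Z)^2) + eps^2 * V^2)" using C by (intro mult_left_mono) auto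
  also have "\<dots> = (2 * Ct) * q^2 + (Ct * (2 * (V * CU + Z)^2 + V^2)) * eps^2" by (simp add: algebra_simps)
  also have "\<dots> \<le> M * q^2 + (Ct * (2 * (V * CU + Z)^2 + V^2)) * eps^2" using M by (intro add_right_mono mult_right_mono) auto
  finally show ?thesis .
 qed
 have PM: "eps * p * (Cd + \<bar>c0\<bar>) * r \<le> eps * p * M * r" using M eps bnd r0' by (intro mult_right_mono mult_left_mono) auto
 have ode': "\<Psi>2 = - c0 * p - \<phi> - \<Phi> * \<Psi>" using ode by linarith
 define X where "X = eps^2 * (((p + eps * v * \<Psi>1) / eps * (\<theta> + r') + eps * v1 * \<Psi> + q')
    - ((- f0 + eps * v * \<Psi>2) / eps^2 * G + (p + eps * v * \<Psi>1) / eps * L + eps^2 * L\<zeta>))"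
 have X1: "X = eps * (p + eps * v * \<Psi>1) * (\<theta> + r') + eps^3 * (v1 * \<Psi>) + eps^2 * q'
   + f0 * G - eps * v * \<Psi>2 * G - eps * (p + eps * v * \<Psi>1) * L - eps^4 * L\<zeta>"
  unfolding X_def using eps by (simp add: field_simps power2_eq_square power3_eq_cube power4_eq_xxxx)
 have "eps * (p + eps * v * \<Psi>1) * (\<theta> + r') - eps * (p + eps * v * \<Psi>1) * L
   = eps * p * r' + eps * p * (\<theta> - L + c0 * v) - eps * v * (c0 * p) + eps^2 * (v * \<Psi>1 * (\<theta> - L)) + eps^2 * (v * \<Psi>1 * r')"
  by (simp add: algebra_simps power2_eq_square)
 moreover have "f0 * G - eps * v * \<Psi>2 * G = f0 + (G - 1) * (f0 - eps * v * \<Psi>2) - eps * v * \<Psi>2" by (simp add: algebra_simps)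
 moreover have "eps * v * \<Psi>2 = - (eps * v * (c0 * p)) - eps * v * \<phi> - eps * v * (\<Phi> * \<Psi>)" unfolding ode' by (simp add: algebra_simps)
 moreover have "\<Phi> * s = \<Phi> * q + eps * v * (\<Phi> * \<Psi>) + eps^2 * (\<Phi> * \<zeta>)" unfolding s by (simp add: algebra_simps)
 moreover have "eps * \<phi> * (v - vh) = eps * v * \<phi> - \<phi> * (eps * vh)" by (simp add: algebra_simps)
 ultimately have X2: "X - F = eps * p * r' + eps * p * (\<theta> - L + c0 * v) + eps * \<phi> * (v - vh) - \<Phi> * q + eps^2 * q'
   + (G - 1) * (f0 - eps * v * \<Psi>2) + eps^2 * (v * \<Psi>1 * (\<theta> - L)) + eps^2 * (v * \<Psi>1 * r') + eps^3 * (v1 * \<Psi>) - eps^4 * L\<zeta>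
   - eps^2 * (\<Phi> * \<zeta>) - (F - f0 - \<Phi> * s - \<phi> * (eps * vh))"
  unfolding X1 by linarith
 have 1: "eps * p * (r' - M * r) = eps * p * r' - eps * p * M * r" by (simp add: algebra_simps)
 have N': "N - V * CU \<ge> 0" unfolding N using C V H0 Lc by (auto intro!: add_nonneg_nonneg)
 have 2: "N * eps^2 * (1 + r') \<ge> N * eps^2 + (V * CU) * (eps^2 * r')"
 proof -
  have "0 \<le> (N - V * CU) * (eps^2 * r')" using N' r' by simp
  then show ?thesis by (simp add: algebra_simps)
 qed
 define y1 y2 y3 y4 y5 y6 y7 where "y1 = (Cd * CU + H * (2 * Cd + \<bar>c0\<bar> * V)) * eps^2" "y2 = ((Cd + 1) * ((1 + V) * H)) * eps^2"
  "y3 = (V * CU * (2 * Cd)) * eps^2" "y4 = (V * CU) * eps^2" "y5 = Z * eps^2" "y6 = (Lc * Z) * eps^2"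
  "y7 = (Ct * (2 * (V * CU + Z)^2 + V^2)) * eps^2"
 have 3: "N * eps^2 = y1 + y2 + y3 + y4 + y4 + y5 + y6 + y7"
  unfolding N y1_y2_y3_y4_y5_y6_y7_def by (simp only: distrib_right)
 have lo: "- y \<le> x" "x \<le> y" if "\<bar>x\<bar> \<le> y" for x y :: real using that by auto
 have gen: "a1 - a2 - a3 + a4 - a5 - a6 \<le> S"
  if "a1 = w - w'" "n + m \<le> a6" "n = y1 + y2 + y3 + y4 + y4 + y5 + y6 + y7" "w'' \<le> w'" "tt \<le> a5 + y7"
   "S = w + x1 + x2 - a3 + a4 + x3 + x4 + x5 + x6 - x7 - x8 - x9" "- (w'' + y1) \<le> x1" "- a2 \<le> x2" "- y2 \<le> x3"
   "- y3 \<le> x4" "- m \<le> x5" "- y4 \<le> x6" "x7 \<le> y5" "x8 \<le> y6" "x9 \<le> tt" "0 \<le> y4"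
  for a1 a2 a3 a4 a5 a6 S w w' w'' n m y1 y2 y3 y4 y5 y6 y7 tt x1 x2 x3 x4 x5 x6 x7 x8 x9 :: real
  using that by linarith
 show ?thesis unfolding X_def[symmetric]
 proof (rule gen[OF 1 2 3 PM _ X2 lo(1) lo(1)[OF T2] lo(1) lo(1) lo(1)[OF T5] lo(1) lo(2) lo(2) lo(2)[OF taylor]])
  show "0 \<le> y4" unfolding y1_y2_y3_y4_y5_y6_y7_def using V C by simp
 qed (use T1 T3 T4 T6 T7 T8 T9 in \<open>simp_all only: y1_y2_y3_y4_y5_y6_y7_def\<close>)
qed

section \<open>Construction of the barriers that follow the interface\<close>

context bistable
begin

text \<open>Close to the wells \<open>fp\<close> is negative by continuity, and at a fixed distance
  from them \<open>P\<close> is bounded below. This is the alternative on which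
  \<open>motion_inequality\<close> is built.\<close>

lemma well_or_slope:
 obtains \<beta> where "\<beta> > 0" "\<And>u. \<bar>u\<bar> \<le> 1 ==> fp u \<le> - \<beta> \<or> \<beta> \<le> P u"
proof -
 obtain k K where k: "k > 0" "\<And>u. \<bar>u\<bar> \<le> 1 ==> k * (1 - \<bar>u\<bar>) \<le> P u" using P_linear_bounds by metis
 obtain L where L: "L > 0" "\<And>x y. \<bar>x\<bar> \<le> 1 ==> \<bar>y\<bar> \<le> 1 ==> \<bar>fp y - fp x\<bar> \<le> L * \<bar>y - x\<bar>"
  using partials_lipschitz by metis
 define m where "m = min (- fp 1) (- fp (-1))"
 have m: "m > 0" "fp 1 \<le> - m" "fp (-1) \<le> - m" unfolding m_def using stable deriv_eqs by auto
 define \<beta> where "\<beta> = min (m / 2) (k * (m / (2 * L)))"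
 have \<beta>: "\<beta> \<le> m / 2" "\<beta> \<le> k * (m / (2 * L))" unfolding \<beta>_def by simp_all
 show thesis
 proof (rule that)
  show "\<beta> > 0" unfolding \<beta>_def using m(1) k(1) L(1) by simp
  fix u :: real assume u: "\<bar>u\<bar> \<le> 1"
  show "fp u \<le> - \<beta> \<or> \<beta> \<le> P u"
  proof (cases "1 - \<bar>u\<bar> \<le> m / (2 * L)")
   case True
   define s :: real where "s = (if u \<ge> 0 then 1 else - 1)"
   have s: "\<bar>s\<bar> \<le> 1" "\<bar>u - s\<bar> = 1 - \<bar>u\<bar>" "fp s \<le> - m" using u m unfolding s_def by auto
   have "L * \<bar>u - s\<bar> \<le> L * (m / (2 * L))" using True s L(1) by (intro mult_left_mono) auto
   then have "L * \<bar>u - s\<bar> \<le> m / 2" using L(1) by simp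
   then show ?thesis using L(2)[OF s(1) u] s(3) \<beta>(1) by linarith
  next
   case False
   then have "k * (m / (2 * L)) \<le> k * (1 - \<bar>u\<bar>)" using k(1) by (intro mult_left_mono) auto
   then show ?thesis using k(2)[OF u] \<beta>(2) by linarith
  qed
 qed
qed

end

lemma eventually_mult_less_at_right:
 fixes a b :: real
 assumes "b > 0" shows "\<forall>\<^sub>F eps in at_right 0. a * eps < b"
proof -
 have "((\<lambda>eps. a * eps) \<longlongrightarrow> a * 0) (at_right 0)" by (intro tendsto_intros)
 then show ?thesis using assms by (intro order_tendstoD) auto
qed

text \<open>At the frontier of \<Omega> the truncated distance is locally constant, so each barrier
  is there a constant plus \<open>eps^2 * \<zeta>\<close> and inherits the outward slope of
  \<open>\<zeta>\<close>.\<close>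

lemma corrector_outward:
 fixes \<zeta> :: "'a::real_normed_vector => real"
 assumes "(\<zeta> has_derivative b) (at x)" "b n > 0" "eps > 0" "\<forall>\<^sub>F y in nhds x. k + eps^2 * \<zeta> y = F y"
 shows "\<exists>b. (F has_derivative b) (at x) \<and> b n > 0"
proof -
 have d: "((\<lambda>y. k + eps^2 * \<zeta> y) has_derivative (\<lambda>h. eps^2 * b h)) (at x)"
  by (auto intro!: derivative_eq_intros assms(1))
 have "\<forall>\<^sub>F y in at x. k + eps^2 * \<zeta> y = F y" "k + eps^2 * \<zeta> x = F x"
  using assms(4) unfolding eventually_nhds_conv_at by blast+
 from has_derivative_transform_eventually[OF d this UNIV_I]
 show ?thesis using assms(2,3) by (intro exI[of _ "\<lambda>h. eps^2 * b h"]) simp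
qed

text \<open>The bounds at time \<open>t1\<close> are from below, to dominate the state left by the
  generation phase; the bounds for later times are from above, and the limit is read off from them.
  The last clause is the tolerance for the unknown integral: the barrier must work for every
  \<open>vh\<close> in an interval about the volume difference whose width grows like the shift of
  the barrier.\<close>

definition motion_barrier ::
 "(real => real => real) => 'a::euclidean_space set => real => (real => real) => ('a => real => real) =>
  real => real => real => real => real => real => ('a => real => real) => bool" where
 "motion_barrier f \<Omega> T v0 D K \<delta> \<sigma> Cv eps t1 B \<longleftrightarrow>
   continuous_on (UNIV \<times> {t1..T}) (\<lambda>(x, t). B x t) \<and>
   (\<forall>x. - 1 + 3 / 2 * \<sigma> \<le> B x t1) \<and> (\<forall>x. - (3 * \<delta>) \<le> D x t1 --> 1 + 3 / 2 * \<sigma> \<le> B x t1) \<and>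
   (\<forall>x. \<forall>t\<in>{t1..T}. B x t \<le> 1 + 3 * \<sigma> \<and> (D x t \<le> - (5 * \<delta> * exp (K * t)) --> B x t \<le> - 1 + 3 * \<sigma>)) \<and>
   (\<forall>x. \<forall>t\<in>{t1<..T}. \<forall>vh. \<bar>vh - v0 t\<bar> \<le> Cv * (\<delta> * exp (K * t)) --> supersol_at f \<Omega> eps B vh T x t)"

text \<open>\<open>M0\<close> depends on the nonlinearity, the distance and \<open>Cv\<close>, but
  neither on \<open>\<delta>\<close> nor on \<open>\<sigma>\<close>, so the growth rate is fixed
  before the tolerances. The claim holds for all larger \<open>M\<close> as well, so that upper and
  lower barriers can share one rate.\<close>

theorem (in bistable) motion_barrier_exists:
 fixes \<Omega> :: "'a::euclidean_space set"
 assumes D: "flow_distance \<Omega> T c0 v0 D Cd r0" and v0: "continuous_on {0..T} v0"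
  and \<zeta>: "0 \<le> Z" "continuous_on UNIV \<zeta>" "\<And>x. \<bar>\<zeta> x\<bar> \<le> Z" "\<And>x. \<exists>G L. has_jet \<zeta> x G L \<and> \<bar>L\<bar> \<le> Z"
   "\<And>x. x \<in> frontier \<Omega> ==> \<exists>n b. exterior_unit_normal \<Omega> x n \<and> (\<zeta> has_derivative b) (at x) \<and> b n > 0"
  and Cv: "0 \<le> Cv"
 shows "\<exists>M0\<ge>1. \<forall>M\<ge>M0. \<forall>\<delta> \<sigma>. 0 < \<delta> --> 0 < \<sigma> --> \<sigma> \<le> 1 / (4 * M^2) --> 8 * \<delta> * exp (motion_rate M * T) \<le> r0 -->
   (\<forall>\<^sub>F eps in at_right 0. \<forall>t1\<in>{0..T}. \<exists>B. motion_barrier f \<Omega> T v0 D (motion_rate M) \<delta> \<sigma> Cv eps t1 B)"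
proof -
 obtain U \<Psi> \<Psi>1 \<Psi>2 CU k where CU: "CU > 0"
  and dU: "\<And>z. (U has_real_derivative P (U z)) (at z)" and dP: "\<And>z. ((\<lambda>z. P (U z)) has_real_derivative - f (U z) 0) (at z)"
  and U1: "\<And>z. -1 < U z \<and> U z < 1" and Ppos: "\<And>z. 0 < P (U z)"
  and U_right: "\<And>z. 0 \<le> z ==> 1 - CU / (1 + z^2) \<le> U z" and U_left: "\<And>z. z \<le> 0 ==> U z \<le> - 1 + CU / (1 + z^2)"
  and d\<Psi>: "\<And>z. (\<Psi> has_real_derivative \<Psi>1 z) (at z)" "\<And>z. (\<Psi>1 has_real_derivative \<Psi>2 z) (at z)"
  and ode: "\<And>z. \<Psi>2 z + fp (U z) * \<Psi> z = - c0 * P (U z) - fv (U z)"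
  and b\<Psi>: "\<And>z. \<bar>\<Psi> z\<bar> \<le> CU" "\<And>z. \<bar>\<Psi>1 z\<bar> \<le> CU"
  and bz: "\<And>z. P (U z) \<le> CU / (1 + z^2)" "\<And>z. \<bar>f (U z) 0\<bar> \<le> CU / (1 + z^2)" "\<And>z. \<bar>\<Psi>2 z\<bar> \<le> CU / (1 + z^2)"
  by (rule wave_profile, rule that)
 obtain Ct where Ct: "Ct > 0" "\<And>p s r. \<bar>p\<bar> \<le> 4 ==> \<bar>p + s\<bar> \<le> 4 ==> \<bar>r\<bar> \<le> 1 ==>
   \<bar>f (p + s) r - f p 0 - fp p * s - fv p * r\<bar> \<le> Ct * (s^2 + r^2)"
  using f_taylor[of 4] by auto
 obtain Lc where Lc: "Lc > 0" "\<And>x. \<bar>x\<bar> \<le> 1 ==> \<bar>f x 0\<bar> \<le> Lc \<and> \<bar>fp x\<bar> \<le> Lc \<and> \<bar>fv x\<bar> \<le> Lc"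
  using partials_lipschitz by metis
 obtain \<beta> where \<beta>: "\<beta> > 0" "\<And>u. \<bar>u\<bar> \<le> 1 ==> fp u \<le> - \<beta> \<or> \<beta> \<le> P u" using well_or_slope by blast
 have U1': "\<bar>U z\<bar> \<le> 1" for z using U1[of z] by auto
 have Cd: "Cd > 0" "r0 > 0" and Dc: "continuous_on (UNIV \<times> {0..T}) (\<lambda>(x, t). D x t)"
  using D unfolding flow_distance_def by auto
 have Dflat: "\<forall>\<^sub>F y in nhds x. D y t = D x t" if "t \<in> {0..T}" "x \<in> frontier \<Omega>" for t x
  using D that unfolding flow_distance_def by blast
 define M0 where "M0 = 1 + (Cd + \<bar>c0\<bar>) + Lc * (1 + Cv) + Lc + 2 * Ct + 2 / \<beta>"
 have M0: "1 \<le> M0" "Cd + \<bar>c0\<bar> \<le> M0" "Lc * (1 + Cv) \<le> M0" "Lc \<le> M0" "2 * Ct \<le> M0" "2 / \<beta> \<le> M0"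
  unfolding M0_def using Cd Lc(1) Ct(1) \<beta>(1) Cv by simp_all
 show ?thesis
 proof (intro exI[of _ M0] conjI allI impI M0(1))
  fix M \<delta> \<sigma> assume MM: "M0 \<le> M" and \<delta>: "0 < \<delta>" and \<sigma>: "0 < \<sigma>" "\<sigma> \<le> 1 / (4 * M^2)" and \<delta>r: "8 * \<delta> * exp (motion_rate M * T) \<le> r0"
  have M: "1 \<le> M" "Cd + \<bar>c0\<bar> \<le> M" "Lc * (1 + Cv) \<le> M" "Lc \<le> M" "2 * Ct \<le> M" using MM M0 by linarith+
  have wells: "fp (U z) \<le> - (2 / M) \<or> 1 / M \<le> P (U z)" for z
  proof -
   have "2 / \<beta> \<le> M" using MM M0(6) by linarith
   then have "2 / M \<le> \<beta>" using \<beta>(1) M(1) by (simp add: field_simps)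
   moreover have "1 / M \<le> 2 / M" using M(1) by (intro divide_right_mono) auto
   ultimately show ?thesis using \<beta>(2)[OF U1'[of z]] by linarith
  qed
  define K A b c E1 where "K = motion_rate M" "A = M * (M + 1)" "b = 1 / (2 * M)" "c = 20 * M^3 * \<sigma>" "E1 = exp (K * T)"
  note defs = this
  have K0: "K \<ge> 0" unfolding defs motion_rate_def using M(1) by (auto intro!: mult_nonneg_nonneg add_nonneg_nonneg)
  have pos: "A > 0" "b > 0" "c > 0" unfolding defs using M(1) \<sigma>(1) by (auto intro!: mult_pos_pos)
  \<comment> \<open>The barrier needs a time derivative of this factor; the error
    \<open>\<delta>\<close> of the approximation is of the size of the shift \<open>r\<close> and is
    absorbed with it.\<close>
  obtain v where v: "real_polynomial_function v" "\<And>t. t \<in> {0..T} ==> \<bar>v0 t - v t\<bar> < \<delta>"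
   using Stone_Weierstrass_real_polynomial_function[OF compact_Icc v0 \<delta>] by blast
  obtain v1 where v1: "real_polynomial_function v1" "\<And>t. (v has_real_derivative v1 t) (at t)"
   using has_real_derivative_polynomial_function[OF v(1)] by blast
  have bdd: "\<exists>C. \<forall>t\<in>{0..T}. \<bar>g t\<bar> \<le> C" if g: "continuous_on {0..T} g" for g :: "real => real"
   using compact_imp_bounded[OF compact_continuous_image[OF g compact_Icc]] unfolding bounded_iff by auto
  have vc: "continuous_on {0..T} v" "continuous_on {0..T} v1"
   using v(1) v1(1) continuous_on_polymonial_function real_polynomial_function_eq by blast+
  obtain V0 V1 V2 where VV: "\<forall>t\<in>{0..T}. \<bar>v0 t\<bar> \<le> V0" "\<forall>t\<in>{0..T}. \<bar>v t\<bar> \<le> V1" "\<forall>t\<in>{0..T}. \<bar>v1 t\<bar> \<le> V2"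
   using bdd[OF v0] bdd[OF vc(1)] bdd[OF vc(2)] by blast
  define V where "V = \<bar>V0\<bar> + \<bar>V1\<bar> + \<bar>V2\<bar> + Cv * (\<delta> * E1)"
  have "0 \<le> Cv * (\<delta> * E1)" unfolding defs using Cv \<delta> by simp
  then have V: "0 \<le> V" "\<And>t. t \<in> {0..T} ==> \<bar>v t\<bar> \<le> V \<and> \<bar>v1 t\<bar> \<le> V \<and> \<bar>v0 t\<bar> + Cv * (\<delta> * E1) \<le> V"
   unfolding V_def using VV by fastforce+
  define H where "H = 4 * CU / r0^2"
  define N where "N = Cd * CU + H * (2 * Cd + \<bar>c0\<bar> * V) + (Cd + 1) * ((1 + V) * H) + V * CU * (2 * Cd) + V * CU + V * CU
    + Z + Lc * Z + Ct * (2 * (V * CU + Z)^2 + V^2)"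
  have H0: "0 \<le> H" unfolding H_def using CU by simp
  have N0: "0 < N" unfolding N_def using Cd CU V(1) H0 \<zeta>(1) Lc(1) Ct(1) by (intro add_pos_nonneg) auto
  have ev: "\<forall>\<^sub>F eps in at_right 0. 0 < eps \<and> 1 * eps < 1 \<and> c * eps < \<delta> / 2 \<and> (A * (4 * \<delta> * E1)) * eps < 1 / (2 * M^2) \<and>
    (A * (4 * \<delta> * E1)) * eps < \<sigma> / 4 \<and> (N * c * b) * eps < \<sigma> / M \<and> (N * (1 + 4 * \<delta> * K * E1)) * eps < 3 * \<delta> \<and> (2 * M * N) * eps < 1
    \<and> (V * CU + Z) * eps < \<sigma> / 4 \<and> (4 * CU / \<delta>^2) * eps < \<sigma> / 4 \<and> V * eps < 1"
   using M(1) \<delta> \<sigma>(1) by (intro eventually_conj eventually_mult_less_at_right eventually_at_right_less) auto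
  then show "\<forall>\<^sub>F eps in at_right 0. \<forall>t1\<in>{0..T}. \<exists>B. motion_barrier f \<Omega> T v0 D (motion_rate M) \<delta> \<sigma> Cv eps t1 B"
  proof eventually_elim
   case (elim eps)
   then have eps: "0 < eps" "eps \<le> 1" and s1: "c * eps \<le> \<delta> / 2" and s2: "A * (4 * \<delta> * E1) * eps \<le> 1 / (2 * M^2)"
    and s2': "A * (4 * \<delta> * E1) * eps \<le> \<sigma> / 4" and s3: "N * c * b * eps \<le> \<sigma> / M"
    and s4: "N * (1 + 4 * \<delta> * K * E1) * eps < 3 * \<delta>" and s5: "2 * M * N * eps \<le> 1"
    and s6: "(V * CU + Z) * eps \<le> \<sigma> / 4" and s7: "(4 * CU / \<delta>^2) * eps \<le> \<sigma> / 4" and s8: "V * eps \<le> 1" by auto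
   have s1': "c * eps \<le> \<delta>" using s1 \<delta> by linarith
   show ?case
   proof
    fix t1 assume t1: "t1 \<in> {0..T}"
    \<comment> \<open>An initial layer of duration of order \<open>eps^2\<close>, during which the
      height \<open>q\<close> falls from at least \<open>2 * \<sigma>\<close> towards size
      \<open>eps\<close>, at the cost of a small shift.\<close>
    define e where "e t = exp (- (b / eps^2) * (t - t1))" for t
    define r where "r t = 4 * \<delta> * exp (K * t) - c * eps * e t" for t
    define r' where "r' t = 4 * \<delta> * K * exp (K * t) + c * b * e t / eps" for t
    define q where "q t = 2 * \<sigma> * e t + eps * A * r t" for t
    define q' where "q' t = - (2 * \<sigma> * b * e t / eps^2) + eps * A * r' t" for t
    define z where "z x t = (D x t + r t) / eps" for x t
    define B where "B x t = U (z x t) + eps * v t * \<Psi> (z x t) + q t + eps^2 * \<zeta> x" for x t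
    have de: "(e has_real_derivative - (b / eps^2) * e t) (at t)" for t
    proof -
     have "((\<lambda>t. exp (k * (t - t1))) has_real_derivative k * exp (k * (t - t1))) (at t)" for k
      by (auto intro!: derivative_eq_intros)
     then show ?thesis unfolding e_def .
    qed
    have dr: "(r has_real_derivative r' t) (at t)" for t
     unfolding r_def r'_def using eps(1)
     by (auto intro!: derivative_eq_intros de simp: field_simps power2_eq_square)
    have dq: "(q has_real_derivative q' t) (at t)" for t
     unfolding q_def q'_def by (auto intro!: derivative_eq_intros de dr)
    have range: "0 < e t \<and> e t \<le> 1 \<and> 1 \<le> exp (K * t) \<and> exp (K * t) \<le> E1 \<and> 7 / 2 * \<delta> * exp (K * t) \<le> r t \<and>
      r t \<le> 4 * \<delta> * exp (K * t) \<and> 0 \<le> q t \<and> q t \<le> 9 / 4 * \<sigma> \<and> 0 \<le> r' t" if t: "t \<in> {t1..T}" for t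
    proof -
     have "0 \<le> (b / eps^2) * (t - t1)" using pos t by simp
     then have e: "0 < e t" "e t \<le> 1" unfolding e_def by simp_all
     have E: "1 \<le> exp (K * t)" "exp (K * t) \<le> E1" unfolding defs(5) using K0 t t1 by (auto intro!: mult_left_mono)
     have "c * eps * e t \<le> c * eps * 1" using e pos eps by (intro mult_left_mono) auto
     moreover have "\<delta> \<le> \<delta> * exp (K * t)" using E \<delta> by simp
     moreover have "0 \<le> c * eps * e t" using e pos eps by simp
     ultimately have r: "7 / 2 * \<delta> * exp (K * t) \<le> r t" "r t \<le> 4 * \<delta> * exp (K * t)" unfolding r_def using s1 by linarith+
     have "0 \<le> 7 / 2 * \<delta> * exp (K * t)" using \<delta> by simp
     then have r0: "0 \<le> r t" using r(1) by linarith
     have "4 * \<delta> * exp (K * t) \<le> 4 * \<delta> * E1" using E \<delta> by simp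
     then have "eps * A * r t \<le> eps * A * (4 * \<delta> * E1)" using pos eps r by (intro mult_left_mono) auto
     then have "eps * A * r t \<le> \<sigma> / 4" using s2' by (simp add: mult_ac)
     moreover have "0 \<le> eps * A * r t" using pos eps r0 by simp
     moreover have "2 * \<sigma> * e t \<le> 2 * \<sigma> * 1" "0 \<le> 2 * \<sigma> * e t" using e \<sigma> by simp_all
     ultimately have "0 \<le> q t" "q t \<le> 9 / 4 * \<sigma>" unfolding q_def by linarith+
     moreover have "0 \<le> r' t" unfolding r'_def using \<delta> K0 pos e eps by simp
     ultimately show ?thesis using e E r by blast
    qed
    have small: "\<bar>eps * v t * \<Psi> y + eps^2 * \<zeta> x\<bar> \<le> \<sigma> / 4" if t: "t \<in> {0..T}" for t x y
    proof -
     have "\<bar>v t\<bar> * \<bar>\<Psi> y\<bar> \<le> V * CU" using V t b\<Psi> by (intro mult_mono) auto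
     then have "eps * (\<bar>v t\<bar> * \<bar>\<Psi> y\<bar>) \<le> eps * (V * CU)" using eps by (intro mult_left_mono) auto
     moreover have "eps^2 * \<bar>\<zeta> x\<bar> \<le> eps * Z" using eps \<zeta>(1,3) by (intro mult_mono) (auto simp: power2_eq_square mult_left_le)
     moreover have "\<bar>eps * v t * \<Psi> y\<bar> = eps * (\<bar>v t\<bar> * \<bar>\<Psi> y\<bar>)" "\<bar>eps^2 * \<zeta> x\<bar> = eps^2 * \<bar>\<zeta> x\<bar>" using eps by (simp_all add: abs_mult)
     moreover have "(V * CU + Z) * eps = eps * (V * CU) + eps * Z" by (simp add: algebra_simps)
     ultimately show ?thesis using s6 by linarith
    qed
    \<comment> \<open>At a distance of order \<open>\<delta>\<close> from the shifted interface the
      scaled variable is of order \<open>\<delta> / eps\<close>, so for small \<open>eps\<close> the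
      wave is within \<open>\<sigma> / 4\<close> of its well.\<close>
    have tail: "CU / (1 + y^2) \<le> \<sigma> / 4" if "\<delta> / 2 \<le> \<bar>eps * y\<bar>" for y
    proof -
     have "(\<delta> / 2)^2 \<le> \<bar>eps * y\<bar>^2" using that \<delta> by (intro power_mono) auto
     then have "\<delta>^2 \<le> 4 * (eps^2 * y^2)" by (simp add: power_mult_distrib power_divide)
     also have "\<dots> \<le> 4 * (eps * (1 + y^2))" using eps by (intro mult_left_mono mult_mono) (auto simp: power2_eq_square mult_left_le)
     finally have "CU * \<delta>^2 \<le> CU * (4 * (eps * (1 + y^2)))" using CU by (intro mult_left_mono) auto
     moreover have "1 + y^2 > 0" by (simp add: add_pos_nonneg)
     ultimately have "CU / (1 + y^2) \<le> (4 * CU / \<delta>^2) * eps" using \<delta> by (simp add: field_simps)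
     then show ?thesis using s7 by linarith
    qed
    have ez: "eps * z x t = D x t + r t" for x t unfolding z_def using eps by simp
    have "motion_barrier f \<Omega> T v0 D K \<delta> \<sigma> Cv eps t1 B"
     unfolding motion_barrier_def
    proof (intro conjI allI ballI impI)
     have c1: "continuous_on UNIV U" "continuous_on UNIV \<Psi>"
      using DERIV_isCont[OF dU] DERIV_isCont[OF d\<Psi>(1)] by (auto intro!: continuous_at_imp_continuous_on)
     have c2: "continuous_on S r" "continuous_on S q" "continuous_on S v" for S
      using DERIV_isCont[OF dr] DERIV_isCont[OF dq] DERIV_isCont[OF v1(2)] by (auto intro!: continuous_at_imp_continuous_on)
     let ?S = "UNIV \<times> {t1..T} :: ('a \<times> real) set"
     have cD: "continuous_on ?S (\<lambda>w. D (fst w) (snd w))"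
     proof -
      have "?S \<subseteq> UNIV \<times> {0..T}" using t1 by auto
      from continuous_on_subset[OF Dc this] show ?thesis by (simp add: split_beta)
     qed
     have c3: "continuous_on ?S (\<lambda>w. r (snd w))" "continuous_on ?S (\<lambda>w. q (snd w))" "continuous_on ?S (\<lambda>w. v (snd w))"
      by (rule continuous_on_compose2[OF c2(1)[of UNIV]] continuous_on_compose2[OF c2(2)[of UNIV]]
        continuous_on_compose2[OF c2(3)[of UNIV]]; auto intro!: continuous_intros)+
     have cz: "continuous_on ?S (\<lambda>w. z (fst w) (snd w))"
      unfolding z_def using eps by (intro continuous_intros cD c3) auto
     have c\<zeta>: "continuous_on ?S (\<lambda>w. \<zeta> (fst w))"
      by (rule continuous_on_compose2[OF \<zeta>(2)]) (auto intro!: continuous_intros)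
     show "continuous_on ?S (\<lambda>(x, t). B x t)" unfolding B_def split_beta
      by (intro continuous_intros continuous_on_compose2[OF c1(1) cz] continuous_on_compose2[OF c1(2) cz] c3 c\<zeta>) auto
    next
     have t1T: "t1 \<in> {t1..T}" using t1 by auto
     have q1: "2 * \<sigma> \<le> q t1"
     proof -
      have "7 / 2 * \<delta> * exp (K * t1) \<ge> 0" using \<delta> by simp
      then have "r t1 \<ge> 0" using range[OF t1T] by linarith
      then have "0 \<le> eps * A * r t1" using pos eps by simp
      moreover have "e t1 = 1" unfolding e_def by simp
      ultimately show ?thesis unfolding q_def by simp
     qed
     fix x
     show "- 1 + 3 / 2 * \<sigma> \<le> B x t1"
      using q1 small[OF t1, of "z x t1" x] U1[of "z x t1"] \<sigma> unfolding B_def by linarith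
     assume d: "- (3 * \<delta>) \<le> D x t1"
     have "\<delta> * 1 \<le> \<delta> * exp (K * t1)" using range[OF t1T] \<delta> by (intro mult_left_mono) auto
     \<comment> \<open>The shift is at least \<open>7 / 2 * \<delta>\<close>, which against
       \<open>- (3 * \<delta>)\<close> leaves the margin needed by \<open>tail\<close>.\<close>
     then have ge: "\<delta> / 2 \<le> eps * z x t1" unfolding ez using d range[OF t1T] by linarith
     then have "0 < eps * z x t1" using \<delta> by linarith
     then have "0 \<le> z x t1" using eps by (simp add: zero_less_mult_iff)
     from U_right[OF this] tail[of "z x t1"] ge have "1 - \<sigma> / 4 \<le> U (z x t1)" by linarith
     then show "1 + 3 / 2 * \<sigma> \<le> B x t1"
      using q1 small[OF t1, of "z x t1" x] unfolding B_def by linarith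
    next
     fix x t assume t: "t \<in> {t1..T}"
     then have t0: "t \<in> {0..T}" using t1 by auto
     show "B x t \<le> 1 + 3 * \<sigma>"
      using range[OF t] small[OF t0, of "z x t" x] U1[of "z x t"] \<sigma> unfolding B_def by linarith
     assume d: "D x t \<le> - (5 * \<delta> * exp (K * t))"
     have "\<delta> * 1 \<le> \<delta> * exp (K * t)" using range[OF t] \<delta> by (intro mult_left_mono) auto
     then have le: "eps * z x t \<le> - \<delta>" unfolding ez using d range[OF t] by linarith
     then have "eps * z x t < 0" using \<delta> by linarith
     then have "z x t \<le> 0" using eps by (simp add: mult_less_0_iff)
     from U_left[OF this] tail[of "z x t"] le \<delta> have "U (z x t) \<le> - 1 + \<sigma> / 4" by linarith
     then show "B x t \<le> - 1 + 3 * \<sigma>"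
      using range[OF t] small[OF t0, of "z x t" x] \<sigma> unfolding B_def by linarith
    next
     fix x t vh assume t: "t \<in> {t1<..T}" and vh: "\<bar>vh - v0 t\<bar> \<le> Cv * (\<delta> * exp (K * t))"
     then have tt: "t \<in> {t1..T}" and t0: "t \<in> {0..T}" using t1 by auto
     note rg = range[OF tt]
     have vhV: "\<bar>vh\<bar> \<le> V"
     proof -
      have "Cv * (\<delta> * exp (K * t)) \<le> Cv * (\<delta> * E1)" using Cv \<delta> rg by (intro mult_left_mono) auto
      then show ?thesis using V(2)[OF t0] vh by linarith
     qed
     show "supersol_at f \<Omega> eps B vh T x t" unfolding supersol_at_def
     proof (intro conjI impI)
      assume "x \<in> \<Omega>"
      obtain G L \<theta> where jD: "has_jet (\<lambda>y. D y t) x G L" and tD: "((\<lambda>s. D x s) has_real_derivative \<theta>) (at t within {0..T})"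
       and bD: "\<bar>G\<bar> \<le> Cd" "\<bar>L\<bar> \<le> Cd" "\<bar>\<theta>\<bar> \<le> Cd" "\<bar>D x t\<bar> < r0 --> G = 1 \<and> \<bar>\<theta> - L + c0 * v0 t\<bar> \<le> Cd * \<bar>D x t\<bar>"
       using D t0 unfolding flow_distance_def by metis
      obtain G\<zeta> L\<zeta> where j\<zeta>: "has_jet \<zeta> x G\<zeta> L\<zeta>" "\<bar>L\<zeta>\<bar> \<le> Z" using \<zeta>(4) by blast
      let ?z = "z x t"
      define h where "h y = U ((y + r t) / eps) + eps * v t * \<Psi> ((y + r t) / eps) + q t" for y
      define h1 where "h1 y = (P (U ((y + r t) / eps)) + eps * v t * \<Psi>1 ((y + r t) / eps)) / eps" for y
      have di: "((\<lambda>y. (y + r t) / eps) has_real_derivative 1 / eps) (at y)" for y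
       using eps by (auto intro!: derivative_eq_intros)
      have dh: "(h has_real_derivative h1 y) (at y)" for y
       unfolding h_def h1_def
       by (rule DERIV_cong[OF DERIV_add[OF DERIV_add[OF DERIV_chain2[OF dU di] DERIV_cmult[OF DERIV_chain2[OF d\<Psi>(1) di]]] DERIV_const]])
        (use eps in \<open>simp add: field_simps\<close>)
      have dh1: "(h1 has_real_derivative (- f (U ?z) 0 + eps * v t * \<Psi>2 ?z) / eps^2) (at (D x t))"
       unfolding h1_def z_def
       by (rule DERIV_cong[OF DERIV_cdivide[OF DERIV_add[OF DERIV_chain2[OF dP di] DERIV_cmult[OF DERIV_chain2[OF d\<Psi>(2) di]]]]])
        (use eps in \<open>simp add: field_simps power2_eq_square\<close>)
      have "has_jet (\<lambda>y. h (D y t)) x ((h1 (D x t))^2 * G) ((- f (U ?z) 0 + eps * v t * \<Psi>2 ?z) / eps^2 * G + h1 (D x t) * L)"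
       by (rule has_jet_compose[OF jD _ dh1]) (simp add: dh)
      from has_jet_add[OF this has_jet_cmult[OF j\<zeta>(1), of "eps^2"]]
      obtain G'' where jB: "has_jet (\<lambda>y. B y t) x G'' ((- f (U ?z) 0 + eps * v t * \<Psi>2 ?z) / eps^2 * G
        + (P (U ?z) + eps * v t * \<Psi>1 ?z) / eps * L + eps^2 * L\<zeta>)"
       unfolding B_def z_def h_def h1_def by blast
      have tr: "(r has_real_derivative r' t) (at t within {0..T})" "(q has_real_derivative q' t) (at t within {0..T})"
       "(v has_real_derivative v1 t) (at t within {0..T})"
       using dr dq v1(2) by (blast intro: has_field_derivative_at_within)+
      have tz: "((\<lambda>s. z x s) has_real_derivative (\<theta> + r' t) / eps) (at t within {0..T})"
       unfolding z_def by (rule DERIV_cdivide[OF DERIV_add[OF tD tr(1)]])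
      have tB: "((\<lambda>s. B x s) has_real_derivative
        (P (U ?z) + eps * v t * \<Psi>1 ?z) / eps * (\<theta> + r' t) + eps * v1 t * \<Psi> ?z + q' t) (at t within {0..T})"
       unfolding B_def
       by (rule DERIV_cong[OF DERIV_add[OF DERIV_add[OF DERIV_add[OF DERIV_chain2[OF dU tz]
          DERIV_mult[OF DERIV_cmult[OF tr(3)] DERIV_chain2[OF d\<Psi>(1) tz]]] tr(2)] DERIV_const]])
        (use eps in \<open>simp add: field_simps\<close>)
      define s where "s = q t + eps * v t * \<Psi> ?z + eps^2 * \<zeta> x"
      have \<sigma>1: "\<sigma> \<le> 1 / 4"
      proof -
       have "1 \<le> M^2" using M(1) by (simp add: one_le_power)
       then have "1 / (4 * M^2) \<le> 1 / (4 * 1)" by (intro divide_left_mono) auto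
       then show ?thesis using \<sigma>(2) by simp
      qed
      have sb: "\<bar>s\<bar> \<le> 1" unfolding s_def using rg small[OF t0, of ?z x] \<sigma>1 \<sigma>(1) by linarith
      have evh: "\<bar>eps * vh\<bar> \<le> 1"
      proof -
       have "\<bar>eps * vh\<bar> = \<bar>vh\<bar> * eps" using eps by (simp add: abs_mult)
       also have "\<dots> \<le> V * eps" using vhV eps by (intro mult_right_mono) auto
       finally show ?thesis using s8 by linarith
      qed
      have taylor: "\<bar>f (B x t) (eps * vh) - f (U ?z) 0 - fp (U ?z) * s - fv (U ?z) * (eps * vh)\<bar> \<le> Ct * (s^2 + (eps * vh)^2)"
      proof -
       have "B x t = U ?z + s" unfolding B_def s_def by simp
       moreover have "\<bar>U ?z\<bar> \<le> 4" "\<bar>U ?z + s\<bar> \<le> 4" using U1'[of ?z] sb by linarith+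
       ultimately show ?thesis using Ct(2)[of "U ?z" s "eps * vh"] evh by simp
      qed
      have rr: "\<delta> \<le> r t" "\<delta> * exp (K * t) \<le> r t" "r t \<le> r0 / 2"
      proof -
       have "\<delta> * 1 \<le> \<delta> * exp (K * t)" using rg \<delta> by (intro mult_left_mono) auto
       then show "\<delta> \<le> r t" "\<delta> * exp (K * t) \<le> r t" using rg \<delta> by linarith+
       have "\<delta> * exp (K * t) \<le> \<delta> * E1" using rg \<delta> by (intro mult_left_mono) auto
       moreover have "8 * \<delta> * E1 \<le> r0" using \<delta>r unfolding defs(1,5) .
       ultimately show "r t \<le> r0 / 2" using rg by linarith
      qed
      have vd: "\<bar>v t - v0 t\<bar> \<le> \<delta>" using v(2)[OF t0] by linarith
      let ?X = "((P (U ?z) + eps * v t * \<Psi>1 ?z) / eps * (\<theta> + r' t) + eps * v1 t * \<Psi> ?z + q' t)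
       - ((- f (U ?z) 0 + eps * v t * \<Psi>2 ?z) / eps^2 * G + (P (U ?z) + eps * v t * \<Psi>1 ?z) / eps * L + eps^2 * L\<zeta>)"
      have S: "eps * P (U ?z) * (r' t - M * r t) - eps * M * r t - fp (U ?z) * q t + eps^2 * q' t - M * (q t)^2 - N * eps^2 * (1 + r' t)
        \<le> eps^2 * ?X - f (B x t) (eps * vh)"
      proof -
       have vt: "\<bar>v t\<bar> \<le> V" "\<bar>v1 t\<bar> \<le> V" using V(2)[OF t0] by blast+
       have fb: "\<bar>fp (U ?z)\<bar> \<le> Lc" "\<bar>fv (U ?z)\<bar> \<le> Lc" using Lc(2)[OF U1'[of ?z]] by blast+
       have rp: "0 \<le> r' t" using rg by blast
       show ?thesis
        by (rule barrier_residual[OF eps ode[of ?z] taylor s_def b\<Psi>(1)[of ?z] b\<Psi>(2)[of ?z] less_imp_le[OF Ppos[of ?z]]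
          bz(1)[of ?z] bz(2)[of ?z] bz(3)[of ?z] bD \<zeta>(3)[of x] j\<zeta>(2) vt vhV vd vh fb ez[of x t] rr rp CU Cd(1) Cv Ct(1) Cd(2)
          \<zeta>(1) less_imp_le[OF \<delta>] M(2,3,5) H_def N_def])
      qed
      have "0 < eps^2 * ?X - f (B x t) (eps * vh)"
      proof (rule motion_inequality[OF M(1) \<sigma> \<delta> eps(1) _ _ _ _ defs(2,3,4,1) _ _ _ _ N0 s1' s2 s3 s4 s5 _ _ wells[of ?z] S])
       show "0 < e t" "e t \<le> 1" "1 \<le> exp (K * t)" "exp (K * t) \<le> E1" using rg by auto
       show "r t = 4 * \<delta> * exp (K * t) - c * eps * e t" by (rule r_def)
       show "r' t = 4 * \<delta> * K * exp (K * t) + c * b * e t / eps" by (rule r'_def)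
       show "q t = 2 * \<sigma> * e t + eps * A * r t" by (rule q_def)
       show "q' t = - (2 * \<sigma> * b * e t / eps^2) + eps * A * r' t" by (rule q'_def)
       show "0 \<le> P (U ?z)" using Ppos[of ?z] by simp
       show "\<bar>fp (U ?z)\<bar> \<le> M" using Lc(2)[OF U1'[of ?z]] M(4) by linarith
      qed
      then have "?X > 1 / eps^2 * f (B x t) (eps * vh)" using eps by (simp add: pos_divide_less_eq mult.commute)
      then show "\<exists>\<beta> G L. ((\<lambda>s. B x s) has_real_derivative \<beta>) (at t within {0..T}) \<and>
        has_jet (\<lambda>y. B y t) x G L \<and> \<beta> - L > 1 / eps^2 * f (B x t) (eps * vh)"
       using tB jB by blast
     next
      assume x: "x \<in> frontier \<Omega>"
      obtain n b' where nb: "exterior_unit_normal \<Omega> x n" "(\<zeta> has_derivative b') (at x)" "b' n > 0" using \<zeta>(5)[OF x] by blast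
      define k0 where "k0 = U (z x t) + eps * v t * \<Psi> (z x t) + q t"
      have "\<forall>\<^sub>F y in nhds x. k0 + eps^2 * \<zeta> y = B y t"
       using Dflat[OF t0 x] by eventually_elim (simp add: B_def k0_def z_def)
      from corrector_outward[OF nb(2,3) eps(1) this]
      show "\<exists>n b. exterior_unit_normal \<Omega> x n \<and> ((\<lambda>y. B y t) has_derivative b) (at x) \<and> b n > 0"
       using nb(1) by blast
     qed
    qed
    then show "\<exists>B. motion_barrier f \<Omega> T v0 D (motion_rate M) \<delta> \<sigma> Cv eps t1 B" unfolding defs(1) by blast
   qed
  qed
 qed
qed

section \<open>Generation of the interface\<close>

text \<open>\<open>B1\<close> gives the coarse bound that holds everywhere, \<open>B2\<close> pushes
  the solution towards -1 on the inner side at a distance from the interface. \<open>B2\<close> may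
  grow beyond all bounds near and outside the interface and is therefore required to be a
  supersolution only up to the height \<open>R + 1\<close>, which the coarse bound guarantees at
  points of touching.\<close>

definition generation_barriers ::
 "(real => real => real) => 'a::euclidean_space set => real => ('a => real) => ('a => real => real) =>
  real => real => real => real => real => real => ('a => real => real) => ('a => real => real) => bool" where
 "generation_barriers f \<Omega> T u0 D R \<delta> \<sigma> Vh eps t1 B1 B2 \<longleftrightarrow>
   continuous_on (UNIV \<times> UNIV) (\<lambda>(x, t). B1 x t) \<and> continuous_on (UNIV \<times> UNIV) (\<lambda>(x, t). B2 x t) \<and>
   (\<forall>x\<in>closure \<Omega>. u0 x < B1 x 0 \<and> u0 x < B2 x 0) \<and>
   (\<forall>x. \<forall>t\<ge>0. B1 x t \<le> R + 1) \<and>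
   (\<forall>x. B1 x t1 \<le> 1 + 3 / 2 * \<sigma> \<and> (D x 0 \<le> - (2 * \<delta>) --> B2 x t1 \<le> - 1 + 3 / 2 * \<sigma>)) \<and>
   (\<forall>x\<in>closure \<Omega>. \<forall>t\<in>{0<..t1}. \<forall>vh. \<bar>vh\<bar> \<le> Vh -->
    supersol_at f \<Omega> eps B1 vh T x t \<and> (B2 x t \<le> R + 1 --> supersol_at f \<Omega> eps B2 vh T x t))"

context bistable
begin

lemma f_lipschitz:
 assumes "R > 0"
 obtains L where "L > 0" "\<And>p s r. \<bar>p\<bar> \<le> R ==> \<bar>p + s\<bar> \<le> R ==> \<bar>r\<bar> \<le> 1 ==> \<bar>f (p + s) r - f p 0\<bar> \<le> L * (\<bar>s\<bar> + \<bar>r\<bar>)"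
proof -
 let ?K = "{-R..R} \<times> {-1..1::real}"
 have K: "compact ?K" "?K \<subseteq> UNIV" "convex ?K" by (auto intro: compact_Times convex_Times)
 obtain L where L: "L > 0" "\<And>x y. x \<in> ?K ==> y \<in> ?K ==>
    norm ((\<lambda>(p, q). f p q) y - (\<lambda>(p, q). f p q) x) \<le> L * norm (y - x)"
  using smooth_on_lipschitz[OF smooth_f K] by metis
 show thesis
 proof (rule that[OF L(1)])
  fix p s r :: real assume *: "\<bar>p\<bar> \<le> R" "\<bar>p + s\<bar> \<le> R" "\<bar>r\<bar> \<le> 1"
  then have "(p, 0) \<in> ?K" "(p + s, r) \<in> ?K" by (auto simp: abs_le_iff)
  from L(2)[OF this] have "\<bar>f (p + s) r - f p 0\<bar> \<le> L * norm (s, r)" by simp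
  also have "\<dots> \<le> L * (\<bar>s\<bar> + \<bar>r\<bar>)" using norm_Pair_le[of s r] L(1) by simp
  finally show "\<bar>f (p + s) r - f p 0\<bar> \<le> L * (\<bar>s\<bar> + \<bar>r\<bar>)" .
 qed
qed

text \<open>The margin is stated as a multiple of three because it is spent on three things: the
  descent of the barrier, the errors of nonlocal term and corrector, and diffusion.\<close>

lemma ft_negative_margin:
 assumes "\<And>p. p \<in> {l..h} ==> f p 0 < 0"
 obtains \<kappa> where "\<kappa> > 0" "\<And>p. p \<in> {l..h} ==> f p 0 \<le> - (3 * \<kappa>)"
proof (cases "l \<le> h")
 case True
 obtain p0 where p0: "p0 \<in> {l..h}" "\<And>p. p \<in> {l..h} ==> f p 0 \<le> f p0 0"
  using continuous_attains_sup[OF compact_Icc _ ft_cont_on, of l h] True by auto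
 show ?thesis using that[of "- f p0 0 / 3"] p0 assms[OF p0(1)] by simp
next
 case False then show ?thesis using that[of 1] by simp
qed

text \<open>In the time \<open>\<tau> = t / eps^2\<close> the reaction is of order one and diffusion
  of order \<open>eps^2\<close>. Where \<open>f\<close> is negative a sufficiently slow linear
  descent is a supersolution, which suffices for \<open>B1\<close>. To \<open>B2\<close> the term
  \<open>exp (L * \<tau>) * S x\<close> is added: it lifts the barrier over the initial data
  elsewhere, vanishes where the descent has to be visible, and its growth compensates the Lipschitz
  constant of \<open>f\<close>. All \<open>m \<ge> m0\<close> are allowed, so that upper and lower
  barriers end at the same time.\<close>

theorem generation_barriers_exist:
 fixes \<Omega> :: "'a::euclidean_space set"
 assumes \<Omega>: "bounded \<Omega>" and D: "flow_distance \<Omega> T c0 v0 D Cd r0" "0 \<le> T"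
  and \<zeta>: "0 \<le> Z" "continuous_on UNIV \<zeta>" "\<And>x. \<bar>\<zeta> x\<bar> \<le> Z" "\<And>x. \<exists>G L. has_jet \<zeta> x G L \<and> \<bar>L\<bar> \<le> Z"
   "\<And>x. x \<in> frontier \<Omega> ==> \<exists>n b. exterior_unit_normal \<Omega> x n \<and> (\<zeta> has_derivative b) (at x) \<and> b n > 0"
  and u0: "continuous_on (closure \<Omega>) u0" "\<And>x. x \<in> closure \<Omega> ==> \<bar>u0 x\<bar> \<le> R - 1"
   "\<And>x. x \<in> closure \<Omega> ==> D x 0 < 0 ==> u0 x < a"
  and R: "3 \<le> R" and \<delta>: "0 < \<delta>" and \<sigma>: "0 < \<sigma>" "\<sigma> < 1 + a" "\<sigma> \<le> 1" and Vh: "0 \<le> Vh"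
 shows "\<exists>m0>0. \<forall>m\<ge>m0. \<forall>\<^sub>F eps in at_right 0. \<exists>B1 B2. generation_barriers f \<Omega> T u0 D R \<delta> \<sigma> Vh eps (eps^2 * m) B1 B2"
proof -
 have a: "-1 < a" "a < 1" using a_bounds by auto
 have Cd: "Cd > 0" and Dc: "continuous_on (UNIV \<times> {0..T}) (\<lambda>(x, t). D x t)"
  using D unfolding flow_distance_def by auto
 have D0: "continuous_on UNIV (\<lambda>x. D x 0)"
  by (rule continuous_on_slice[OF Dc]) (use D(2) in auto)
 have cO: "compact (closure \<Omega>)" using \<Omega> by (simp add: compact_closure)
 \<comment> \<open>On the compact set where the initial distance is at most
   \<open>- \<delta>\<close> the data stay below \<open>a\<close> by a fixed amount.\<close>
 obtain c1 where c1: "c1 > 0" "- 1 + \<sigma> \<le> a - c1" "\<And>x. x \<in> closure \<Omega> ==> D x 0 \<le> - \<delta> ==> u0 x \<le> a - 2 * c1"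
 proof -
  define S where "S = closure \<Omega> \<inter> {x. D x 0 \<le> - \<delta>}"
  have "closed {x. D x 0 \<le> - \<delta>}" using D0 by (intro closed_Collect_le) auto
  then have S: "compact S" unfolding S_def using cO by blast
  have "\<exists>c>0. \<forall>x\<in>S. u0 x \<le> a - 2 * c"
  proof (cases "S = {}")
   case False
   have "continuous_on S u0" by (rule continuous_on_subset[OF u0(1)]) (simp add: S_def)
   from continuous_attains_sup[OF S False this] obtain y where y: "y \<in> S" "\<And>x. x \<in> S ==> u0 x \<le> u0 y" by blast
   have "u0 y < a" using u0(3)[of y] y(1) \<delta> unfolding S_def by auto
   then show ?thesis using y(2) by (intro exI[of _ "(a - u0 y) / 2"]) (auto simp: field_simps)
  qed (auto intro: exI[of _ 1])
  then obtain c where c: "c > 0" "\<And>x. x \<in> S ==> u0 x \<le> a - 2 * c" by blast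
  show thesis
  proof (rule that[of "min c (1 + a - \<sigma>)"])
   show "min c (1 + a - \<sigma>) > 0" "- 1 + \<sigma> \<le> a - min c (1 + a - \<sigma>)" using c(1) \<sigma> by auto
   fix x assume "x \<in> closure \<Omega>" "D x 0 \<le> - \<delta>"
   then have "u0 x \<le> a - 2 * c" using c(2) unfolding S_def by blast
   also have "\<dots> \<le> a - 2 * min c (1 + a - \<sigma>)" by simp
   finally show "u0 x \<le> a - 2 * min c (1 + a - \<sigma>)" .
  qed
 qed
 obtain \<kappa> where \<kappa>: "\<kappa> > 0" "\<And>p. p \<in> {1 + \<sigma>..R} \<or> p \<in> {- 1 + \<sigma>..a - c1} ==> f p 0 \<le> - (3 * \<kappa>)"
 proof -
  obtain k1 where k1: "k1 > 0" "\<And>p. p \<in> {1 + \<sigma>..R} ==> f p 0 \<le> - (3 * k1)"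
   using ft_negative_margin[of "1 + \<sigma>" R] ft_signs(4) \<sigma>(1) by auto
  obtain k2 where k2: "k2 > 0" "\<And>p. p \<in> {- 1 + \<sigma>..a - c1} ==> f p 0 \<le> - (3 * k2)"
   using ft_negative_margin[of "- 1 + \<sigma>" "a - c1"] ft_signs(2) \<sigma>(1) c1(1) by auto
  show thesis
  proof (rule that[of "min k1 k2"])
   show "min k1 k2 > 0" using k1 k2 by simp
   fix p assume "p \<in> {1 + \<sigma>..R} \<or> p \<in> {- 1 + \<sigma>..a - c1}"
   then have "f p 0 \<le> - (3 * k1) \<or> f p 0 \<le> - (3 * k2)" using k1(2) k2(2) by blast
   moreover have "- (3 * k1) \<le> - (3 * min k1 k2)" "- (3 * k2) \<le> - (3 * min k1 k2)" by simp_all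
   ultimately show "f p 0 \<le> - (3 * min k1 k2)" using order_trans by blast
  qed
 qed
 obtain L where L: "L > 0" "\<And>p s r. \<bar>p\<bar> \<le> R + 3 ==> \<bar>p + s\<bar> \<le> R + 3 ==> \<bar>r\<bar> \<le> 1 ==> \<bar>f (p + s) r - f p 0\<bar> \<le> L * (\<bar>s\<bar> + \<bar>r\<bar>)"
  using f_lipschitz[of "R + 3"] R by auto
 obtain Db where Db: "\<And>x. x \<in> closure \<Omega> ==> \<bar>D x 0\<bar> \<le> Db" "0 \<le> Db"
 proof -
  have "bounded ((\<lambda>x. D x 0) ` closure \<Omega>)"
   by (intro compact_imp_bounded compact_continuous_image cO continuous_on_subset[OF D0]) auto
  then obtain B where "\<forall>x\<in>closure \<Omega>. \<bar>D x 0\<bar> \<le> B" unfolding bounded_iff by auto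
  then show thesis using that[of "\<bar>B\<bar>"] by force
 qed
 \<comment> \<open>With this factor \<open>S\<close> is at least \<open>2 * R + 2\<close> where the
   distance exceeds \<open>- \<delta>\<close>, while it vanishes where the distance is at most
   \<open>- (2 * \<delta>)\<close>.\<close>
 define k where "k = (2 * R + 2) / \<delta>^3"
 have k: "k > 0" "k * \<delta>^3 = 2 * R + 2" unfolding k_def using R \<delta> by simp_all
 define mm where "mm = Db + 2 * \<delta>"
 have mm: "mm \<ge> 0" unfolding mm_def using Db(2) \<delta> by simp
 define S where "S x = k * (max 0 (D x 0 + 2 * \<delta>))^3" for x
 define Ks where "Ks = k * (6 * mm) * Cd + k * (3 * mm^2) * Cd"
 have S0: "S x \<ge> 0" for x unfolding S_def using k by simp
 have Ks0: "Ks \<ge> 0" unfolding Ks_def using k mm Cd by simp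
 have Sc: "continuous_on UNIV S" unfolding S_def by (intro continuous_intros D0)
 have Sjet: "\<exists>G l. has_jet S x G l \<and> \<bar>l\<bar> \<le> Ks" if x: "x \<in> closure \<Omega>" for x
 proof -
  obtain G l \<theta> where j: "has_jet (\<lambda>y. D y 0) x G l" "\<bar>G\<bar> \<le> Cd" "\<bar>l\<bar> \<le> Cd"
   using D unfolding flow_distance_def by (metis atLeastAtMost_iff order_refl)
  have sh: "((\<lambda>y. y + 2 * \<delta>) has_real_derivative 1) (at y)" for y by (auto intro!: derivative_eq_intros)
  have d1: "((\<lambda>y. k * (max 0 (y + 2 * \<delta>))^3) has_real_derivative k * (3 * (max 0 (y + 2 * \<delta>))^2)) (at y)" for y
   using DERIV_cmult[OF DERIV_chain2[OF has_real_derivative_cube_pos_part sh], of k y] by simp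
  have d2: "((\<lambda>y. k * (3 * (max 0 (y + 2 * \<delta>))^2)) has_real_derivative k * (6 * max 0 (y + 2 * \<delta>))) (at y)" for y
   using DERIV_cmult[OF DERIV_cmult[OF DERIV_chain2[OF has_real_derivative_square_pos_part sh], of 3], of k y] by simp
  let ?m = "max 0 (D x 0 + 2 * \<delta>)"
  have m: "0 \<le> ?m" "?m \<le> mm" unfolding mm_def using Db(1)[OF x] Db(2) \<delta> by auto
  have "has_jet S x ((k * (3 * ?m^2))^2 * G) (k * (6 * ?m) * G + k * (3 * ?m^2) * l)"
   unfolding S_def by (rule has_jet_compose[OF j(1) _ d2]) (simp add: d1)
  moreover have "\<bar>k * (6 * ?m) * G + k * (3 * ?m^2) * l\<bar> \<le> Ks"
  proof -
   have "\<bar>k * (6 * ?m) * G\<bar> \<le> k * (6 * mm) * Cd"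
    unfolding abs_mult using m j k mm Cd by (intro mult_mono) auto
   moreover have "?m^2 \<le> mm^2" using m by (intro power_mono) auto
   then have "\<bar>k * (3 * ?m^2) * l\<bar> \<le> k * (3 * mm^2) * Cd"
    unfolding abs_mult using j k Cd by (intro mult_mono) auto
   ultimately show ?thesis unfolding Ks_def by linarith
  qed
  ultimately show ?thesis by blast
 qed
 define m0 where "m0 = (R + 2) / \<kappa>"
 show ?thesis
 proof (intro exI[of _ m0] conjI allI impI)
  show "0 < m0" unfolding m0_def using R \<kappa>(1) by simp
  fix m assume m: "m0 \<le> m"
  then have m_pos: "m > 0" using \<open>0 < m0\<close> by linarith
  \<comment> \<open>The slopes at which the two barriers come down to \<open>1 + \<sigma>\<close>
    and \<open>- 1 + \<sigma>\<close> exactly at \<open>\<tau> = m\<close>; the choice of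
    \<open>m0\<close> makes them at most \<open>\<kappa>\<close>.\<close>
  define k1 k2 where "k1 = (a - c1 + 1 - \<sigma>) / m" and "k2 = (R - 1 - \<sigma>) / m"
  have k12: "0 \<le> k1" "0 \<le> k2" "k1 \<le> \<kappa>" "k2 \<le> \<kappa>" "k1 * m = a - c1 + 1 - \<sigma>" "k2 * m = R - 1 - \<sigma>"
  proof -
   show "0 \<le> k1" "0 \<le> k2" unfolding k1_def k2_def using c1 R \<sigma> m_pos by auto
   have "R + 2 \<le> \<kappa> * m" using m \<kappa>(1) unfolding m0_def by (simp add: field_simps)
   then show "k1 \<le> \<kappa>" "k2 \<le> \<kappa>" unfolding k1_def k2_def using c1(1) R \<sigma> a m_pos by (simp_all add: pos_divide_le_eq)
   show "k1 * m = a - c1 + 1 - \<sigma>" "k2 * m = R - 1 - \<sigma>" unfolding k1_def k2_def using m_pos by simp_all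
  qed
  define Ke where "Ke = exp (L * m) * Ks"
  have Ke0: "Ke \<ge> 0" unfolding Ke_def using Ks0 by simp
  have "\<forall>\<^sub>F eps in at_right 0. 0 < eps \<and> 1 * eps < 1 \<and> (L * (Z + Vh)) * eps < \<kappa> \<and> (Ke + Z) * eps < \<kappa> \<and> Z * eps < \<sigma> / 2 \<and> Z * eps < c1 \<and> Vh * eps < 1"
   using \<kappa>(1) \<sigma>(1) c1(1) by (intro eventually_conj eventually_mult_less_at_right eventually_at_right_less) auto
  then show "\<forall>\<^sub>F eps in at_right 0. \<exists>B1 B2. generation_barriers f \<Omega> T u0 D R \<delta> \<sigma> Vh eps (eps^2 * m) B1 B2"
  proof eventually_elim
   case (elim eps)
   then have eps: "0 < eps" "eps \<le> 1" and s1: "L * (Z + Vh) * eps < \<kappa>" and s2: "(Ke + Z) * eps < \<kappa>"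
    and s3: "Z * eps < \<sigma> / 2" "Z * eps < c1" and s4: "Vh * eps < 1" by auto
   have eps2: "eps^2 \<le> eps" "0 < eps^2" using eps by (simp_all add: power2_eq_square mult_left_le)
   have \<zeta>s: "\<bar>eps^2 * \<zeta> x\<bar> \<le> Z * eps" for x
   proof -
    have "eps^2 * \<bar>\<zeta> x\<bar> \<le> eps * Z" using eps2 eps \<zeta>(3) by (intro mult_mono) auto
    then show ?thesis by (simp add: abs_mult mult.commute)
   qed
   \<comment> \<open>The inequality for both barriers at once: \<open>p\<close> is the descending
     height, \<open>s\<close> the lifting term, and \<open>L * s\<close> is matched by the time
     derivative of the exponential.\<close>
   have step: "f (p + s + eps^2 * \<zeta> x) (eps * vh) < - k' + L * s - eps^2 * (ls + eps^2 * l)"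
    if p: "p \<in> {1 + \<sigma>..R} \<or> p \<in> {- 1 + \<sigma>..a - c1}" and s: "0 \<le> s" "p + s + eps^2 * \<zeta> x \<le> R + 1" and k': "k' \<le> \<kappa>"
     and l: "\<bar>ls\<bar> \<le> Ke" "\<bar>l\<bar> \<le> Z" and vh: "\<bar>vh\<bar> \<le> Vh" for p s x k' ls l vh
   proof -
    have pR: "\<bar>p\<bar> \<le> R" using p \<sigma> c1 a R by auto
    have e: "\<bar>eps * vh\<bar> \<le> Vh * eps" using vh eps by (simp add: abs_mult mult.commute mult_right_mono)
    have "\<bar>p + (s + eps^2 * \<zeta> x)\<bar> \<le> R + 3" using pR s \<zeta>s[of x] s3 \<sigma> by linarith
    then have "\<bar>f (p + (s + eps^2 * \<zeta> x)) (eps * vh) - f p 0\<bar> \<le> L * (\<bar>s + eps^2 * \<zeta> x\<bar> + \<bar>eps * vh\<bar>)"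
     using pR e s4 by (intro L(2)) auto
    also have "\<dots> \<le> L * (s + (Z + Vh) * eps)"
    proof (intro mult_left_mono)
     show "\<bar>s + eps^2 * \<zeta> x\<bar> + \<bar>eps * vh\<bar> \<le> s + (Z + Vh) * eps"
      unfolding distrib_right using s \<zeta>s[of x] e by linarith
    qed (use L in auto)
    also have "\<dots> = L * s + L * (Z + Vh) * eps" by (simp add: algebra_simps)
    finally have f: "f (p + s + eps^2 * \<zeta> x) (eps * vh) \<le> f p 0 + (L * s + L * (Z + Vh) * eps)" by (simp add: add.assoc)
    have "eps^2 * \<bar>l\<bar> \<le> 1 * Z" using eps2 eps l by (intro mult_mono) auto
    then have "\<bar>eps^2 * l\<bar> \<le> Z" by (simp add: abs_mult)
    then have "\<bar>ls + eps^2 * l\<bar> \<le> Ke + Z" using l by linarith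
    then have "eps^2 * \<bar>ls + eps^2 * l\<bar> \<le> eps * (Ke + Z)" using eps2 eps by (intro mult_mono) auto
    then have "\<bar>eps^2 * (ls + eps^2 * l)\<bar> \<le> (Ke + Z) * eps" by (simp add: abs_mult mult.commute)
    then show ?thesis using f \<kappa>(2)[OF p] k' s1 s2 by linarith
   qed
   define B1 where "B1 x t = R - k2 * (t / eps^2) + eps^2 * \<zeta> x" for x t
   define B2 where "B2 x t = a - c1 - k1 * (t / eps^2) + exp (L * (t / eps^2)) * S x + eps^2 * \<zeta> x" for x t
   have "generation_barriers f \<Omega> T u0 D R \<delta> \<sigma> Vh eps (eps^2 * m) B1 B2"
    unfolding generation_barriers_def
   proof (intro conjI ballI allI impI)
    have c\<zeta>: "continuous_on (UNIV \<times> UNIV) (\<lambda>w::'a \<times> real. \<zeta> (fst w))" "continuous_on (UNIV \<times> UNIV) (\<lambda>w::'a \<times> real. S (fst w))"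
     by (rule continuous_on_compose2[OF \<zeta>(2) continuous_on_fst[OF continuous_on_id]] continuous_on_compose2[OF Sc continuous_on_fst[OF continuous_on_id]]; simp)+
    show "continuous_on (UNIV \<times> UNIV) (\<lambda>(x, t). B1 x t)" "continuous_on (UNIV \<times> UNIV) (\<lambda>(x, t). B2 x t)"
     unfolding B1_def B2_def split_beta using eps by (intro continuous_intros c\<zeta>; simp)+
   next
    fix x assume x: "x \<in> closure \<Omega>"
    show "u0 x < B1 x 0" unfolding B1_def using u0(2)[OF x] \<zeta>s[of x] s3 \<sigma> by simp
    show "u0 x < B2 x 0"
    proof (cases "D x 0 \<le> - \<delta>")
     case True
     then show ?thesis unfolding B2_def using c1(3)[OF x] \<zeta>s[of x] s3 S0[of x] c1(1) by simp
    next
     case False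
     then have "\<delta>^3 \<le> (max 0 (D x 0 + 2 * \<delta>))^3" using \<delta> by (intro power_mono) auto
     then have "2 * R + 2 \<le> S x" unfolding S_def using k by (metis mult_left_mono less_imp_le)
     then show ?thesis unfolding B2_def using u0(2)[OF x] \<zeta>s[of x] s3 \<sigma> c1 a R by simp
    qed
   next
    fix x and t :: real assume "t \<ge> 0"
    then have "0 \<le> k2 * (t / eps^2)" using k12 by simp
    then show "B1 x t \<le> R + 1" unfolding B1_def using \<zeta>s[of x] s3 \<sigma> by simp
   next
    fix x
    have tm: "eps^2 * m / eps^2 = m" using eps by simp
    show "B1 x (eps^2 * m) \<le> 1 + 3 / 2 * \<sigma>" unfolding B1_def tm k12 using \<zeta>s[of x] s3 by simp
    assume "D x 0 \<le> - (2 * \<delta>)"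
    then have "S x = 0" unfolding S_def by (simp add: max_def)
    then show "B2 x (eps^2 * m) \<le> - 1 + 3 / 2 * \<sigma>" unfolding B2_def tm k12 using \<zeta>s[of x] s3 by simp
   next
    fix x t vh assume x: "x \<in> closure \<Omega>" and t: "t \<in> {0<..eps^2 * m}" and vh: "\<bar>vh\<bar> \<le> Vh"
    define \<tau> where "\<tau> = t / eps^2"
    have \<tau>: "0 \<le> \<tau>" "\<tau> \<le> m" unfolding \<tau>_def using t eps2(2) by (auto simp: pos_divide_le_eq mult.commute)
    have k\<tau>: "0 \<le> k1 * \<tau>" "0 \<le> k2 * \<tau>" "k1 * \<tau> \<le> a - c1 + 1 - \<sigma>" "k2 * \<tau> \<le> R - 1 - \<sigma>"
     using \<tau> k12 mult_left_mono[OF \<tau>(2) k12(1)] mult_left_mono[OF \<tau>(2) k12(2)] by auto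
    obtain G\<zeta> l where j\<zeta>: "has_jet \<zeta> x G\<zeta> l" "\<bar>l\<bar> \<le> Z" using \<zeta>(4) by blast
    have frontier: "\<exists>n b. exterior_unit_normal \<Omega> x n \<and> (F has_derivative b) (at x) \<and> b n > 0"
     if "x \<in> frontier \<Omega>" "\<forall>\<^sub>F y in nhds x. q + eps^2 * \<zeta> y = F y" for q F
     using \<zeta>(5)[OF that(1)] corrector_outward[OF _ _ eps(1) that(2)] by metis
    have lin: "((\<lambda>s. q - j * (s / eps^2)) has_real_derivative - (j / eps^2)) (at t within I)" for q j I
    proof -
     have "((\<lambda>s. q - i * s) has_real_derivative - i) (at t within I)" for i
      by (auto intro!: derivative_eq_intros)
     from this[of "j / eps^2"] show ?thesis by simp
    qed
    have scale: "1 / eps^2 * F < \<beta> - l'" if "F < eps^2 * \<beta> - eps^2 * l'" for F \<beta> l'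
    proof -
     have "F < (\<beta> - l') * eps^2" using that by (simp add: algebra_simps)
     then have "F / eps^2 < \<beta> - l'" using eps2(2) by (simp only: pos_divide_less_eq)
     then show ?thesis by simp
    qed
    show "supersol_at f \<Omega> eps B1 vh T x t" unfolding supersol_at_def
    proof (intro conjI impI)
     assume "x \<in> \<Omega>"
     have tB: "((\<lambda>s. B1 x s) has_real_derivative - (k2 / eps^2)) (at t within {0..T})"
      unfolding B1_def by (rule DERIV_cong[OF DERIV_add[OF lin DERIV_const]]) simp
     obtain G where jB: "has_jet (\<lambda>y. B1 y t) x G (0 + eps^2 * l)"
      using has_jet_add[OF has_jet_const has_jet_cmult[OF j\<zeta>(1), of "eps^2"]] unfolding B1_def by blast
     have pk: "R - k2 * \<tau> \<in> {1 + \<sigma>..R}" using k\<tau> by auto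
     have le: "R - k2 * \<tau> + 0 + eps^2 * \<zeta> x \<le> R + 1" using k\<tau> \<zeta>s[of x] s3 \<sigma> by linarith
     have "f (R - k2 * \<tau> + 0 + eps^2 * \<zeta> x) (eps * vh) < - k2 + L * 0 - eps^2 * (0 + eps^2 * l)"
      by (rule step[OF disjI1[OF pk] order_refl le k12(4) _ j\<zeta>(2) vh]) (use Ke0 in simp)
     then have "f (B1 x t) (eps * vh) < eps^2 * (- (k2 / eps^2)) - eps^2 * (0 + eps^2 * l)"
      unfolding B1_def \<tau>_def[symmetric] using eps by simp
     from scale[OF this] tB jB show "\<exists>\<beta> G L. ((\<lambda>s. B1 x s) has_real_derivative \<beta>) (at t within {0..T}) \<and>
       has_jet (\<lambda>y. B1 y t) x G L \<and> \<beta> - L > 1 / eps^2 * f (B1 x t) (eps * vh)" by blast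
    next
     assume "x \<in> frontier \<Omega>"
     then show "\<exists>n b. exterior_unit_normal \<Omega> x n \<and> ((\<lambda>y. B1 y t) has_derivative b) (at x) \<and> b n > 0"
      by (rule frontier[where q = "R - k2 * (t / eps^2)"]) (simp add: B1_def)
    qed
    assume le: "B2 x t \<le> R + 1"
    show "supersol_at f \<Omega> eps B2 vh T x t" unfolding supersol_at_def
    proof (intro conjI impI)
     assume "x \<in> \<Omega>"
     define E where "E = exp (L * \<tau>)"
     obtain Gs ls where js: "has_jet S x Gs ls" "\<bar>ls\<bar> \<le> Ks" using Sjet[OF x] by blast
     have dE: "((\<lambda>s. exp (L * (s / eps^2))) has_real_derivative L / eps^2 * E) (at t within {0..T})"
     proof -
      have "((\<lambda>s. exp (i * s)) has_real_derivative i * exp (i * t)) (at t within {0..T})" for i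
       by (auto intro!: derivative_eq_intros)
      from this[of "L / eps^2"] show ?thesis unfolding E_def \<tau>_def by simp
     qed
     have tB: "((\<lambda>s. B2 x s) has_real_derivative (- (k1 / eps^2) + L / eps^2 * E * S x)) (at t within {0..T})"
      unfolding B2_def by (rule DERIV_cong[OF DERIV_add[OF DERIV_add[OF lin DERIV_mult[OF dE DERIV_const]] DERIV_const]]) simp
     obtain G1 where "has_jet (\<lambda>y. (a - c1 - k1 * (t / eps^2)) + E * S y) x G1 (0 + E * ls)"
      using has_jet_add[OF has_jet_const has_jet_cmult[OF js(1), of E]] by blast
     from has_jet_add[OF this has_jet_cmult[OF j\<zeta>(1), of "eps^2"]]
     obtain G where jB: "has_jet (\<lambda>y. B2 y t) x G (0 + E * ls + eps^2 * l)"
      unfolding B2_def E_def \<tau>_def by blast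
     have Els: "\<bar>E * ls\<bar> \<le> Ke"
     proof -
      have "L * \<tau> \<le> L * m" using \<tau> L(1) by (intro mult_left_mono) auto
      then have "E \<le> exp (L * m)" unfolding E_def by simp
      moreover have "E > 0" unfolding E_def by simp
      ultimately show ?thesis unfolding Ke_def abs_mult using js(2) by (intro mult_mono) auto
     qed
     have pk: "a - c1 - k1 * \<tau> \<in> {- 1 + \<sigma>..a - c1}" using k\<tau> by auto
     have Bt: "B2 x t = a - c1 - k1 * \<tau> + E * S x + eps^2 * \<zeta> x" unfolding B2_def E_def \<tau>_def by simp
     have sE: "0 \<le> E * S x" unfolding E_def using S0 by simp
     have "f (B2 x t) (eps * vh) < - k1 + L * (E * S x) - eps^2 * (E * ls + eps^2 * l)"
      unfolding Bt by (rule step[OF disjI2[OF pk] sE le[unfolded Bt] k12(3) Els j\<zeta>(2) vh])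
     moreover have "eps^2 * (- (k1 / eps^2) + L / eps^2 * E * S x) = - k1 + L * (E * S x)" using eps by (simp add: field_simps)
     ultimately have "f (B2 x t) (eps * vh) < eps^2 * (- (k1 / eps^2) + L / eps^2 * E * S x) - eps^2 * (0 + E * ls + eps^2 * l)" by simp
     from scale[OF this] tB jB show "\<exists>\<beta> G L. ((\<lambda>s. B2 x s) has_real_derivative \<beta>) (at t within {0..T}) \<and>
       has_jet (\<lambda>y. B2 y t) x G L \<and> \<beta> - L > 1 / eps^2 * f (B2 x t) (eps * vh)" by blast
    next
     assume xf: "x \<in> frontier \<Omega>"
     have "\<forall>\<^sub>F y in nhds x. D y 0 = D x 0" using D xf unfolding flow_distance_def by auto
     then have "\<forall>\<^sub>F y in nhds x. (a - c1 - k1 * (t / eps^2) + exp (L * (t / eps^2)) * S x) + eps^2 * \<zeta> y = B2 y t"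
      by eventually_elim (simp add: B2_def S_def)
     from frontier[OF xf this]
     show "\<exists>n b. exterior_unit_normal \<Omega> x n \<and> ((\<lambda>y. B2 y t) has_derivative b) (at x) \<and> b n > 0" .
    qed
   qed
   then show "\<exists>B1 B2. generation_barriers f \<Omega> T u0 D R \<delta> \<sigma> Vh eps (eps^2 * m) B1 B2" by blast
  qed
 qed
qed

end

section \<open>Convergence\<close>

lemma abs_integral_le_measure:
 fixes g :: "'a::euclidean_space => real"
 assumes Om: "open \<Omega>" "bounded \<Omega>" and g: "continuous_on \<Omega> g" "\<And>x. x \<in> \<Omega> ==> \<bar>g x\<bar> \<le> R"
 shows "\<bar>integral \<Omega> g\<bar> \<le> R * measure lebesgue \<Omega>"
proof -
 have L: "\<Omega> \<in> lmeasurable" using Om by (simp add: lmeasurable_open)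
 have c: "(\<lambda>_. 1 :: real) integrable_on \<Omega>" using integrable_on_const[OF L] .
 have "norm (integral \<Omega> g) \<le> integral \<Omega> (\<lambda>_. R * 1)"
  using continuous_bounded_integrable[OF Om g] g(2) integrable_on_const[OF L, of "R * 1"]
  by (intro Henstock_Kurzweil_Integration.integral_norm_bound_integral) auto
 also have "\<dots> = R * measure lebesgue \<Omega>"
  unfolding lmeasure_integral[OF L] by (rule Henstock_Kurzweil_Integration.integral_mult_right)
 finally show ?thesis by simp
qed

lemma AC_sol_slice:
 assumes "AC_sol f \<Omega> eps u" "0 \<le> t" shows "continuous_on \<Omega> (\<lambda>x. u x t)"
proof -
 have "continuous_on (closure \<Omega> \<times> {0..}) (\<lambda>(x, t). u x t)" using assms(1) unfolding AC_sol_def by blast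
 moreover have "continuous_on \<Omega> (\<lambda>x. (x, t))" by (intro continuous_intros)
 moreover have "(\<lambda>x. (x, t)) ` \<Omega> \<subseteq> closure \<Omega> \<times> {0..}" using assms(2) closure_subset by auto
 ultimately have "continuous_on \<Omega> (\<lambda>x. (\<lambda>(x, t). u x t) (x, t))" by (rule continuous_on_compose2)
 then show ?thesis by simp
qed

lemma generation_barriersD:
 assumes "generation_barriers f \<Omega> T u0 D R \<delta> \<sigma> Vh eps t1 B1 B2"
 shows "x \<in> closure \<Omega> ==> u0 x < B1 x 0" "x \<in> closure \<Omega> ==> u0 x < B2 x 0" "0 \<le> t ==> B1 x t \<le> R + 1"
  "B1 x t1 \<le> 1 + 3 / 2 * \<sigma>" "D x 0 \<le> - (2 * \<delta>) ==> B2 x t1 \<le> - 1 + 3 / 2 * \<sigma>"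
  "x \<in> closure \<Omega> ==> t \<in> {0<..t1} ==> \<bar>vh\<bar> \<le> Vh ==> supersol_at f \<Omega> eps B1 vh T x t"
  "x \<in> closure \<Omega> ==> t \<in> {0<..t1} ==> \<bar>vh\<bar> \<le> Vh ==> B2 x t \<le> R + 1 ==> supersol_at f \<Omega> eps B2 vh T x t"
 using assms unfolding generation_barriers_def by blast+

lemma motion_barrierD:
 assumes "motion_barrier f \<Omega> T v0 D K \<delta> \<sigma> Cv eps t1 B"
 shows "- 1 + 3 / 2 * \<sigma> \<le> B x t1" "- (3 * \<delta>) \<le> D x t1 ==> 1 + 3 / 2 * \<sigma> \<le> B x t1"
  "t \<in> {t1..T} ==> B x t \<le> 1 + 3 * \<sigma>" "t \<in> {t1..T} ==> D x t \<le> - (5 * \<delta> * exp (K * t)) ==> B x t \<le> - 1 + 3 * \<sigma>"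
  "t \<in> {t1<..T} ==> \<bar>vh - v0 t\<bar> \<le> Cv * (\<delta> * exp (K * t)) ==> supersol_at f \<Omega> eps B vh T x t"
 using assms unfolding motion_barrier_def by blast+

text \<open>In the generation phase a bound for the integral is enough, and it follows from the
  coarse barriers alone. In the motion phase the integral is close to the volume difference
  precisely because the solution lies between the two barriers: away from a slab of width
  \<open>5 * \<delta> * exp (K * s)\<close> it is within \<open>3 * \<sigma>\<close> of the sign of
  \<open>D\<close>.\<close>

lemma solution_between_barriers:
 fixes \<Omega> :: "'a::euclidean_space set"
 assumes Om: "open \<Omega>" "bounded \<Omega>" and sol: "AC_sol f \<Omega> eps u" and u0: "\<And>x. x \<in> closure \<Omega> ==> u x 0 = u0 x"
  and gen: "generation_barriers f \<Omega> T u0 D R \<delta> \<sigma> ((R + 1) * measure lebesgue \<Omega>) eps t1 B1 B2"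
   "generation_barriers (reflect f) \<Omega> T (\<lambda>x. - u0 x) (\<lambda>x t. - D x t) R \<delta> \<sigma> ((R + 1) * measure lebesgue \<Omega>) eps t1 C1 C2"
  and mot: "motion_barrier f \<Omega> T v0 D K \<delta> \<sigma> (1 + 15 * Cm) eps t1 B"
   "motion_barrier (reflect f) \<Omega> T (\<lambda>t. - v0 t) (\<lambda>x t. - D x t) K \<delta> \<sigma> (1 + 15 * Cm) eps t1 C"
  and t1: "0 \<le> t1" "t1 \<le> T" and close: "\<And>x. x \<in> closure \<Omega> ==> \<bar>D x t1 - D x 0\<bar> \<le> \<delta>"
  and \<delta>\<sigma>: "0 < \<delta>" "0 < \<sigma>" "3 * \<sigma> \<le> 1" "3 * \<sigma> * measure lebesgue \<Omega> \<le> \<delta>" and K: "0 \<le> K"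
  and Dc: "continuous_on (UNIV \<times> {0..T}) (\<lambda>(x, t). D x t)"
  and vol: "\<And>t. t \<in> {0..T} ==> v0 t = measure lebesgue {x\<in>\<Omega>. D x t > 0} - measure lebesgue {x\<in>\<Omega>. D x t < 0}"
  and slab: "\<And>t s. t \<in> {0..T} ==> s > 0 ==> measure lebesgue {x\<in>\<Omega>. \<bar>D x t\<bar> \<le> s} \<le> Cm * s"
  and xt: "x \<in> closure \<Omega>" "t \<in> {t1..T}"
 shows "- C x t < u x t \<and> u x t < B x t"
proof -
 let ?Vh = "(R + 1) * measure lebesgue \<Omega>"
 have gc: "continuous_on (UNIV \<times> UNIV) (\<lambda>(x, t). B1 x t)" "continuous_on (UNIV \<times> UNIV) (\<lambda>(x, t). B2 x t)"
  "continuous_on (UNIV \<times> UNIV) (\<lambda>(x, t). C1 x t)" "continuous_on (UNIV \<times> UNIV) (\<lambda>(x, t). C2 x t)"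
  using gen unfolding generation_barriers_def by blast+
 have mc: "continuous_on (UNIV \<times> {t1..T}) (\<lambda>(x, t). B x t)" "continuous_on (UNIV \<times> {t1..T}) (\<lambda>(x, t). C x t)"
  using mot unfolding motion_barrier_def by blast+
 have g0: "u0 y < B1 y 0" "u0 y < B2 y 0" "- C1 y 0 < u0 y" "- C2 y 0 < u0 y" if "y \<in> closure \<Omega>" for y
  using generation_barriersD(1,2)[OF gen(1) that] generation_barriersD(1,2)[OF gen(2) that] by linarith+
 have gR: "B1 y s \<le> R + 1" "- (R + 1) \<le> - C1 y s" if "0 \<le> s" for y s
  using generation_barriersD(3)[OF gen(1) that, of y] generation_barriersD(3)[OF gen(2) that, of y] by linarith+
 have g1: "B1 y t1 \<le> 1 + 3 / 2 * \<sigma>" "- (1 + 3 / 2 * \<sigma>) \<le> - C1 y t1" "D y 0 \<le> - (2 * \<delta>) ==> B2 y t1 \<le> - 1 + 3 / 2 * \<sigma>"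
  "2 * \<delta> \<le> D y 0 ==> 1 - 3 / 2 * \<sigma> \<le> - C2 y t1" for y
  using generation_barriersD(4,5)[OF gen(1), of y] generation_barriersD(4,5)[OF gen(2), of y] by linarith+
 have gs: "supersol_at f \<Omega> eps B1 vh T y s" "supersol_at (reflect f) \<Omega> eps C1 vh T y s"
  "B2 y s \<le> R + 1 ==> supersol_at f \<Omega> eps B2 vh T y s" "C2 y s \<le> R + 1 ==> supersol_at (reflect f) \<Omega> eps C2 vh T y s"
  if "y \<in> closure \<Omega>" "0 < s" "s \<le> t1" "\<bar>vh\<bar> \<le> ?Vh" for y s vh
 proof -
  have "s \<in> {0<..t1}" using that by simp
  with generation_barriersD(6,7)[OF gen(1) that(1)] generation_barriersD(6,7)[OF gen(2) that(1)] that(4) show "supersol_at f \<Omega> eps B1 vh T y s" "supersol_at (reflect f) \<Omega> eps C1 vh T y s"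
   "B2 y s \<le> R + 1 ==> supersol_at f \<Omega> eps B2 vh T y s" "C2 y s \<le> R + 1 ==> supersol_at (reflect f) \<Omega> eps C2 vh T y s"
   by blast+
 qed
 have cs: "continuous_on (closure \<Omega> \<times> {s..s'}) (\<lambda>(x, t). F x t)" if "continuous_on (UNIV \<times> I) (\<lambda>(x, t). F x t)" "{s..s'} \<subseteq> I"
  for F :: "'a => real => real" and s s' and I :: "real set"
  by (rule continuous_on_subset[OF that(1)]) (use that(2) in auto)
 have csm: "continuous_on (closure \<Omega> \<times> {s..s'}) (\<lambda>(x, t). - F x t)" if "continuous_on (UNIV \<times> I) (\<lambda>(x, t). F x t)" "{s..s'} \<subseteq> I"
  for F :: "'a => real => real" and s s' and I :: "real set"
  using continuous_on_minus[OF cs[OF that]] by (simp add: split_beta)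
 have Vb: "\<bar>integral \<Omega> (\<lambda>y. u y s)\<bar> \<le> ?Vh" if "0 \<le> s" "\<And>y. y \<in> closure \<Omega> ==> \<bar>u y s\<bar> \<le> R + 1" for s
  by (rule abs_integral_le_measure[OF Om AC_sol_slice[OF sol that(1)] that(2)]) (use closure_subset in auto)
 have init0: "- C1 y 0 < u y 0" "u y 0 < B1 y 0" "- C2 y 0 < u y 0" "u y 0 < B2 y 0" if "y \<in> closure \<Omega>" for y
  using g0[OF that] u0[OF that] by auto
 \<comment> \<open>The two coarse barriers are compared together: their order at the touching time
   bounds the integral by \<open>?Vh\<close>.\<close>
 have coarse: "- C1 y s < u y s \<and> u y s < B1 y s" if y: "y \<in> closure \<Omega>" and s: "s \<in> {0..t1}" for y s
 proof (rule comparison[OF sol Om order_refl t1 cs[OF gc(1)] csm[OF gc(3)] _ _ y s])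
  fix s w assume s: "0 < s" "s \<le> t1" and b: "\<And>y. y \<in> closure \<Omega> ==> - C1 y s \<le> u y s \<and> u y s \<le> B1 y s" and w: "w \<in> closure \<Omega>"
  have "\<bar>u y s\<bar> \<le> R + 1" if "y \<in> closure \<Omega>" for y
  proof -
   have "- (R + 1) \<le> u y s" "u y s \<le> R + 1" using b[OF that] gR[of s y] s by linarith+
   then show ?thesis by simp
  qed
  then have V: "\<bar>integral \<Omega> (\<lambda>y. u y s)\<bar> \<le> ?Vh" using s by (intro Vb) auto
  show "(u w s = B1 w s --> supersol_at f \<Omega> eps B1 (integral \<Omega> (\<lambda>y. u y s)) T w s) \<and>
    (u w s = - C1 w s --> supersol_at (reflect f) \<Omega> eps (\<lambda>x t. - (- C1 x t)) (- integral \<Omega> (\<lambda>y. u y s)) T w s)"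
   using gs(1)[OF w s V] gs(2)[OF w s, of "- integral \<Omega> (\<lambda>y. u y s)"] V by simp
 qed (use init0 in auto)
 have V: "\<bar>integral \<Omega> (\<lambda>y. u y s)\<bar> \<le> ?Vh" and uR: "y \<in> closure \<Omega> ==> \<bar>u y s\<bar> \<le> R + 1" if s: "0 < s" "s \<le> t1" for s y
 proof -
  have *: "\<bar>u y s\<bar> \<le> R + 1" if "y \<in> closure \<Omega>" for y
  proof -
   have "- C1 y s < u y s \<and> u y s < B1 y s" using coarse[OF that, of s] s by simp
   then have "- (R + 1) \<le> u y s" "u y s \<le> R + 1" using gR[of s y] s by linarith+
   then show ?thesis by simp
  qed
  then show "y \<in> closure \<Omega> ==> \<bar>u y s\<bar> \<le> R + 1" by blast
  show "\<bar>integral \<Omega> (\<lambda>y. u y s)\<bar> \<le> ?Vh" using * s by (intro Vb) auto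
 qed
 \<comment> \<open>From here on the coarse bound is known, so the height restriction on
   \<open>B2\<close> holds wherever the solution touches it.\<close>
 have upper: "- C1 y s < u y s \<and> u y s < B2 y s" if y: "y \<in> closure \<Omega>" and s: "s \<in> {0..t1}" for y s
 proof (rule comparison[OF sol Om order_refl t1 cs[OF gc(2)] csm[OF gc(3)] _ _ y s])
  fix s w assume s: "0 < s" "s \<le> t1" and w: "w \<in> closure \<Omega>"
  have "u w s \<le> R + 1" using uR[OF s w] by simp
  then show "(u w s = B2 w s --> supersol_at f \<Omega> eps B2 (integral \<Omega> (\<lambda>y. u y s)) T w s) \<and>
    (u w s = - C1 w s --> supersol_at (reflect f) \<Omega> eps (\<lambda>x t. - (- C1 x t)) (- integral \<Omega> (\<lambda>y. u y s)) T w s)"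
   using gs(3)[OF w s V[OF s]] gs(2)[OF w s, of "- integral \<Omega> (\<lambda>y. u y s)"] V[OF s] by simp
 qed (use init0 in auto)
 have lower: "- C2 y s < u y s \<and> u y s < B1 y s" if y: "y \<in> closure \<Omega>" and s: "s \<in> {0..t1}" for y s
 proof (rule comparison[OF sol Om order_refl t1 cs[OF gc(1)] csm[OF gc(4)] _ _ y s])
  fix s w assume s: "0 < s" "s \<le> t1" and w: "w \<in> closure \<Omega>"
  have "- u w s \<le> R + 1" using uR[OF s w] by simp
  then show "(u w s = B1 w s --> supersol_at f \<Omega> eps B1 (integral \<Omega> (\<lambda>y. u y s)) T w s) \<and>
    (u w s = - C2 w s --> supersol_at (reflect f) \<Omega> eps (\<lambda>x t. - (- C2 x t)) (- integral \<Omega> (\<lambda>y. u y s)) T w s)"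
   using gs(1)[OF w s V[OF s]] gs(4)[OF w s, of "- integral \<Omega> (\<lambda>y. u y s)"] V[OF s] by simp
 qed (use init0 in auto)
 have m1: "- 1 + 3 / 2 * \<sigma> \<le> B y t1" "- (3 * \<delta>) \<le> D y t1 ==> 1 + 3 / 2 * \<sigma> \<le> B y t1"
  "- C y t1 \<le> 1 - 3 / 2 * \<sigma>" "D y t1 \<le> 3 * \<delta> ==> - C y t1 \<le> - (1 + 3 / 2 * \<sigma>)" for y
  using motion_barrierD(1,2)[OF mot(1), of y] motion_barrierD(1,2)[OF mot(2), of y] by linarith+
 have mb: "B y s \<le> 1 + 3 * \<sigma>" "D y s \<le> - (5 * \<delta> * exp (K * s)) ==> B y s \<le> - 1 + 3 * \<sigma>"
  "- (1 + 3 * \<sigma>) \<le> - C y s" "5 * \<delta> * exp (K * s) \<le> D y s ==> 1 - 3 * \<sigma> \<le> - C y s" if "s \<in> {t1..T}" for y s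
  using motion_barrierD(3,4)[OF mot(1) that, of y] motion_barrierD(3,4)[OF mot(2) that, of y] by linarith+
 have ms: "supersol_at f \<Omega> eps B vh T y s" "supersol_at (reflect f) \<Omega> eps C (- vh) T y s"
  if "s \<in> {t1<..T}" "\<bar>vh - v0 s\<bar> \<le> (1 + 15 * Cm) * (\<delta> * exp (K * s))" for y s vh
 proof -
  have "\<bar>- vh - - v0 s\<bar> \<le> (1 + 15 * Cm) * (\<delta> * exp (K * s))" using that(2) by linarith
  from motion_barrierD(5)[OF mot(1) that] motion_barrierD(5)[OF mot(2) that(1) this]
  show "supersol_at f \<Omega> eps B vh T y s" "supersol_at (reflect f) \<Omega> eps C (- vh) T y s" .
 qed
 show ?thesis
 proof (rule comparison[OF sol Om t1 order_refl cs[OF mc(1)] csm[OF mc(2)] _ _ xt])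
  fix y assume y: "y \<in> closure \<Omega>"
  have t1t: "t1 \<in> {0..t1}" using t1 by simp
  \<comment> \<open>Handover between the phases. Where the distance is at least
    \<open>- (3 * \<delta>)\<close> the new barrier lies above the coarse one; elsewhere the initial
    distance was at most \<open>- (2 * \<delta>)\<close>, as it has moved by at most
    \<open>\<delta>\<close>, and \<open>B2\<close> has come down.\<close>
  have "u y t1 < B y t1"
  proof (cases "- (3 * \<delta>) \<le> D y t1")
   case True then show ?thesis using coarse[OF y t1t] g1(1)[of y] m1(2)[of y] by linarith
  next
   case False
   then have "D y 0 \<le> - (2 * \<delta>)" using close[OF y] by linarith
   then show ?thesis using upper[OF y t1t] g1(3)[of y] m1(1)[of y] by linarith
  qed
  moreover have "- C y t1 < u y t1"
  proof (cases "D y t1 \<le> 3 * \<delta>")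
   case True then show ?thesis using coarse[OF y t1t] g1(2)[of y] m1(4)[of y] by linarith
  next
   case False
   then have "2 * \<delta> \<le> D y 0" using close[OF y] by linarith
   then show ?thesis using lower[OF y t1t] g1(4)[of y] m1(3)[of y] by linarith
  qed
  ultimately show "- C y t1 < u y t1 \<and> u y t1 < B y t1" by blast
 next
  fix s w assume s: "t1 < s" "s \<le> T" and b: "\<And>y. y \<in> closure \<Omega> ==> - C y s \<le> u y s \<and> u y s \<le> B y s"
  have st: "s \<in> {t1..T}" "s \<in> {0..T}" "s \<in> {t1<..T}" "0 \<le> s" using s t1 by auto
  have b': "- C y s \<le> u y s \<and> u y s \<le> B y s" if "y \<in> \<Omega>" for y using b that closure_subset by blast
  define E where "E = exp (K * s)"
  have E: "1 \<le> E" unfolding E_def using K st(4) by simp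
  have dE: "\<delta> \<le> \<delta> * E" "0 < 5 * \<delta> * E" using \<delta>\<sigma>(1) E by simp_all
  \<comment> \<open>Origin of \<open>1 + 15 * Cm\<close>: the first term is at most
    \<open>\<delta>\<close>, and the slab contributes three times
    \<open>Cm * (5 * \<delta> * E)\<close>.\<close>
  have "\<bar>integral \<Omega> (\<lambda>y. u y s) - (measure lebesgue {x\<in>\<Omega>. D x s > 0} - measure lebesgue {x\<in>\<Omega>. D x s < 0})\<bar>
    \<le> 3 * \<sigma> * measure lebesgue \<Omega> + 3 * measure lebesgue {x\<in>\<Omega>. \<bar>D x s\<bar> \<le> 5 * \<delta> * E}"
  proof (rule integral_near_sign[where R = 2, simplified, OF Om AC_sol_slice[OF sol st(4)] _ continuous_on_slice[OF Dc st(2)]])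
   fix y assume y: "y \<in> \<Omega>"
   show "\<bar>u y s\<bar> \<le> 2"
   proof -
    have "- 2 \<le> u y s" "u y s \<le> 2" using b'[OF y] mb(1,3)[OF st(1), of y] \<delta>\<sigma> by linarith+
    then show ?thesis by simp
   qed
   assume F: "5 * \<delta> * E < \<bar>D y s\<bar>"
   consider "D y s > 0" "5 * \<delta> * E \<le> D y s" | "D y s < 0" "D y s \<le> - (5 * \<delta> * E)" using F dE(2) by linarith
   then show "\<bar>u y s - sgn (D y s)\<bar> \<le> 3 * \<sigma>"
   proof cases
    case 1 then show ?thesis using b'[OF y] mb(1,4)[OF st(1), of y] unfolding E_def by (auto simp: abs_le_iff)
   next
    case 2 then show ?thesis using b'[OF y] mb(2,3)[OF st(1), of y] unfolding E_def by (auto simp: abs_le_iff)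
   qed
  qed (use \<delta>\<sigma> in auto)
  moreover have "measure lebesgue {x\<in>\<Omega>. \<bar>D x s\<bar> \<le> 5 * \<delta> * E} \<le> Cm * (5 * \<delta> * E)" by (rule slab[OF st(2) dE(2)])
  moreover have "(1 + 15 * Cm) * (\<delta> * E) = \<delta> * E + 3 * (Cm * (5 * \<delta> * E))" by (simp add: algebra_simps)
  moreover have "\<bar>i - v\<bar> \<le> x" if "\<bar>i - w\<bar> \<le> p + 3 * q" "q \<le> y" "x = d + 3 * y" "v = w" "e \<le> d" "p \<le> e"
   for i v w p q x y d e :: real using that by simp
  ultimately have near: "\<bar>integral \<Omega> (\<lambda>y. u y s) - v0 s\<bar> \<le> (1 + 15 * Cm) * (\<delta> * exp (K * s))"
   using vol[OF st(2)] dE(1) \<delta>\<sigma>(4) unfolding E_def[symmetric] by blast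
  show "(u w s = B w s --> supersol_at f \<Omega> eps B (integral \<Omega> (\<lambda>y. u y s)) T w s) \<and>
    (u w s = - C w s --> supersol_at (reflect f) \<Omega> eps (\<lambda>x t. - (- C x t)) (- integral \<Omega> (\<lambda>y. u y s)) T w s)"
   using ms[OF st(3) near] by simp
 qed (use t1 in auto)
qed

lemma motion_rate_nonneg: "1 \<le> M ==> 0 \<le> motion_rate M"
 unfolding motion_rate_def by (auto intro!: mult_nonneg_nonneg add_nonneg_nonneg)

text \<open>The tolerances depend on the point: \<open>\<delta>\<close> is chosen from
  \<open>\<bar>D x t\<bar>\<close> after the growth rate is known, so the limit is pointwise. Both
  barriers share \<open>M\<close>, \<open>\<delta>\<close>, \<open>\<sigma>\<close>,
  \<open>R\<close> and \<open>m\<close>, hence the maxima of the constants obtained for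
  \<open>f\<close> and for its reflection.\<close>

theorem interface_limit:
 fixes \<Omega> :: "'a::euclidean_space set"
 assumes bi: "bistable f W a c0" and dom: "smooth_bounded_domain \<Omega>"
  and D: "flow_distance \<Omega> T c0 v0 D Cd r0" and v0: "continuous_on {0..T} v0"
  and vol: "\<And>t. t \<in> {0..T} ==> v0 t = measure lebesgue {x\<in>\<Omega>. D x t > 0} - measure lebesgue {x\<in>\<Omega>. D x t < 0}"
  and slab: "\<And>t s. t \<in> {0..T} ==> s > 0 ==> measure lebesgue {x\<in>\<Omega>. \<bar>D x t\<bar> \<le> s} \<le> Cm * s" and Cm: "0 \<le> Cm"
  and u0: "continuous_on (closure \<Omega>) u0" "\<And>x. x \<in> closure \<Omega> ==> D x 0 < 0 ==> u0 x < a"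
   "\<And>x. x \<in> closure \<Omega> ==> D x 0 > 0 ==> a < u0 x"
  and sol: "\<forall>\<^sub>F eps in at_right 0. AC_sol f \<Omega> eps (u eps) \<and> (\<forall>x\<in>closure \<Omega>. u eps x 0 = u0 x)"
  and t: "t \<in> {0<..T}" and x: "x \<in> closure \<Omega>" and nz: "D x t \<noteq> 0"
 shows "((\<lambda>eps. u eps x t) \<longlongrightarrow> sgn (D x t)) (at_right 0)"
proof (rule tendstoI)
 fix \<eta> :: real assume \<eta>: "0 < \<eta>"
 interpret F: bistable f W a c0 by (rule bi)
 interpret R: bistable "reflect f" "\<lambda>p. W (- p)" "- a" c0 by (rule bistable_reflect(1)[OF bi])
 note D' = flow_distance_uminus[OF D]
 have v0': "continuous_on {0..T} (\<lambda>t. - v0 t)" using v0 by (intro continuous_intros)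
 have Om: "open \<Omega>" "bounded \<Omega>" using dom unfolding smooth_bounded_domain_def by auto
 have cO: "compact (closure \<Omega>)" using Om(2) by (simp add: compact_closure)
 have T0: "0 \<le> T" using t by auto
 have r0: "r0 > 0" and Dc: "continuous_on (UNIV \<times> {0..T}) (\<lambda>(x, t). D x t)"
  using D unfolding flow_distance_def by auto
 obtain \<zeta> Z where Z: "Z > 0" and \<zeta>: "continuous_on UNIV \<zeta>" "\<And>x. \<bar>\<zeta> x\<bar> \<le> Z" "\<And>x. \<exists>G L. has_jet \<zeta> x G L \<and> \<bar>L\<bar> \<le> Z"
   "\<And>x. x \<in> frontier \<Omega> ==> \<exists>n b. exterior_unit_normal \<Omega> x n \<and> (\<zeta> has_derivative b) (at x) \<and> b n > 0"
  by (rule boundary_corrector[OF dom], rule that)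
 define Cv where "Cv = 1 + 15 * Cm"
 have Cv: "0 \<le> Cv" unfolding Cv_def using Cm by simp
 define mo where "mo M f v D \<delta> \<sigma> eps \<longleftrightarrow> (\<forall>t1\<in>{0..T}. \<exists>B. motion_barrier f \<Omega> T v D (motion_rate M) \<delta> \<sigma> Cv eps t1 B)"
  for M f v and D :: "'a => real => real" and \<delta> \<sigma> eps
 obtain M1 where M1: "1 \<le> M1" "\<And>M \<delta> \<sigma>. M1 \<le> M ==> 0 < \<delta> ==> 0 < \<sigma> ==> \<sigma> \<le> 1 / (4 * M^2) ==> 8 * \<delta> * exp (motion_rate M * T) \<le> r0 ==>
   \<forall>\<^sub>F eps in at_right 0. mo M f v0 D \<delta> \<sigma> eps"
  using F.motion_barrier_exists[OF D v0 less_imp_le[OF Z] \<zeta> Cv] unfolding mo_def by blast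
 obtain M2 where M2: "1 \<le> M2" "\<And>M \<delta> \<sigma>. M2 \<le> M ==> 0 < \<delta> ==> 0 < \<sigma> ==> \<sigma> \<le> 1 / (4 * M^2) ==> 8 * \<delta> * exp (motion_rate M * T) \<le> r0 ==>
   \<forall>\<^sub>F eps in at_right 0. mo M (reflect f) (\<lambda>t. - v0 t) (\<lambda>x t. - D x t) \<delta> \<sigma> eps"
  using R.motion_barrier_exists[OF D' v0' less_imp_le[OF Z] \<zeta> Cv] unfolding mo_def by blast
 define M where "M = max M1 M2"
 have M: "M1 \<le> M" "M2 \<le> M" "1 \<le> M" unfolding M_def using M1(1) by auto
 define K where "K = motion_rate M"
 have K: "0 \<le> K" unfolding K_def by (rule motion_rate_nonneg[OF M(3)])
 \<comment> \<open>The shifted interface of either barrier must not reach \<open>x\<close> at time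
   \<open>t\<close>, and the largest shift must stay within the width \<open>r0\<close> on which the
   motion law is known.\<close>
 define \<delta> where "\<delta> = min r0 \<bar>D x t\<bar> / (8 * exp (K * T))"
 have \<delta>: "0 < \<delta>" "8 * \<delta> * exp (K * T) \<le> r0" "8 * \<delta> * exp (K * T) \<le> \<bar>D x t\<bar>" unfolding \<delta>_def using r0 nz by auto
 define mO where "mO = measure lebesgue \<Omega>"
 have mO: "mO \<ge> 0" unfolding mO_def by simp
 obtain \<sigma> where \<sigma>: "0 < \<sigma>" "\<sigma> \<le> 1 / (4 * M^2)" "3 * \<sigma> < \<eta>" "3 * \<sigma> * mO \<le> \<delta>" "\<sigma> < 1 + a" "\<sigma> < 1 - a" "3 * \<sigma> \<le> 1"
 proof -
  have "\<forall>\<^sub>F \<sigma> in at_right 0. 0 < \<sigma> \<and> 1 * \<sigma> < 1 / (4 * M^2) \<and> 3 * \<sigma> < \<eta> \<and> (3 * mO) * \<sigma> < \<delta> \<and> 1 * \<sigma> < 1 + a \<and> 1 * \<sigma> < 1 - a \<and> 3 * \<sigma> < 1"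
   using F.a_bounds M \<eta> \<delta>(1) by (intro eventually_conj eventually_mult_less_at_right eventually_at_right_less) auto
  then obtain \<sigma> :: real where "0 < \<sigma> \<and> 1 * \<sigma> < 1 / (4 * M^2) \<and> 3 * \<sigma> < \<eta> \<and> (3 * mO) * \<sigma> < \<delta> \<and> 1 * \<sigma> < 1 + a \<and> 1 * \<sigma> < 1 - a \<and> 3 * \<sigma> < 1"
   using eventually_happens'[of "at_right (0::real)"] by auto
  then show thesis by (intro that[of \<sigma>]) (auto simp: mult_ac)
 qed
 obtain R where R: "3 \<le> R" "\<And>x. x \<in> closure \<Omega> ==> \<bar>u0 x\<bar> \<le> R - 1"
 proof -
  obtain b where "\<forall>x\<in>closure \<Omega>. \<bar>u0 x\<bar> \<le> b"
   using compact_imp_bounded[OF compact_continuous_image[OF u0(1) cO]] unfolding bounded_iff by auto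
  then show thesis using that[of "\<bar>b\<bar> + 3"] by force
 qed
 define Vh where "Vh = (R + 1) * mO"
 have Vh: "0 \<le> Vh" unfolding Vh_def using R(1) mO by simp
 define ge where "ge m f u0 D eps \<longleftrightarrow> (\<exists>B1 B2. generation_barriers f \<Omega> T u0 D R \<delta> \<sigma> Vh eps (eps^2 * m) B1 B2)"
  for m f and u0 :: "'a => real" and D :: "'a => real => real" and eps
 have \<sigma>1: "\<sigma> \<le> 1" "\<sigma> < 1 + - a" using \<sigma> by auto
 obtain m1 where m1: "m1 > 0" "\<And>m. m1 \<le> m ==> \<forall>\<^sub>F eps in at_right 0. ge m f u0 D eps"
  using F.generation_barriers_exist[OF Om(2) D T0 less_imp_le[OF Z] \<zeta> u0(1) R(2) u0(2) R(1) \<delta>(1) \<sigma>(1,5) \<sigma>1(1) Vh] unfolding ge_def by blast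
 have u0': "continuous_on (closure \<Omega>) (\<lambda>x. - u0 x)" "\<And>x. x \<in> closure \<Omega> ==> \<bar>- u0 x\<bar> \<le> R - 1"
  "\<And>x. x \<in> closure \<Omega> ==> - D x 0 < 0 ==> - u0 x < - a"
  using u0 R(2) by (auto intro: continuous_intros)
 obtain m2 where m2: "m2 > 0" "\<And>m. m2 \<le> m ==> \<forall>\<^sub>F eps in at_right 0. ge m (reflect f) (\<lambda>x. - u0 x) (\<lambda>x t. - D x t) eps"
  using R.generation_barriers_exist[OF Om(2) D' T0 less_imp_le[OF Z] \<zeta> u0' R(1) \<delta>(1) \<sigma>(1) \<sigma>1(2,1) Vh] unfolding ge_def by blast
 define m where "m = max m1 m2"
 have m: "m1 \<le> m" "m2 \<le> m" "m > 0" unfolding m_def using m1(1) by auto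
 \<comment> \<open>For small \<open>eps\<close> the generation phase is shorter than
   \<open>\<rho>\<close>, so the distance changes by at most \<open>\<delta>\<close> during
   it.\<close>
 obtain \<rho> where \<rho>: "\<rho> > 0" "\<And>y s. y \<in> closure \<Omega> ==> 0 \<le> s ==> s < \<rho> ==> s \<le> T ==> \<bar>D y s - D y 0\<bar> \<le> \<delta>"
 proof -
  have "uniformly_continuous_on (closure \<Omega> \<times> {0..T}) (\<lambda>(x, t). D x t)"
   by (intro compact_uniformly_continuous compact_Times cO compact_Icc continuous_on_subset[OF Dc]) auto
  then obtain \<rho> where \<rho>: "\<rho> > 0" "\<And>z z'. z \<in> closure \<Omega> \<times> {0..T} ==> z' \<in> closure \<Omega> \<times> {0..T} ==> dist z' z < \<rho> ==>
    dist ((\<lambda>(x, t). D x t) z') ((\<lambda>(x, t). D x t) z) < \<delta>"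
   unfolding uniformly_continuous_on_def using \<delta>(1) by metis
  have "\<bar>D y s - D y 0\<bar> \<le> \<delta>" if "y \<in> closure \<Omega>" "0 \<le> s" "s < \<rho>" "s \<le> T" for y s
   using \<rho>(2)[of "(y, 0)" "(y, s)"] that by (simp add: dist_Pair_Pair dist_real_def)
  with \<rho>(1) show thesis using that by blast
 qed
 have small: "\<forall>\<^sub>F eps in at_right 0. 0 < eps \<and> 1 * eps < 1 \<and> m * eps < t \<and> m * eps < \<rho>"
  using t \<rho>(1) by (intro eventually_conj eventually_mult_less_at_right eventually_at_right_less) auto
 have "\<forall>\<^sub>F eps in at_right 0. (0 < eps \<and> 1 * eps < 1 \<and> m * eps < t \<and> m * eps < \<rho>) \<and>
   (AC_sol f \<Omega> eps (u eps) \<and> (\<forall>x\<in>closure \<Omega>. u eps x 0 = u0 x)) \<and> mo M f v0 D \<delta> \<sigma> eps \<and>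
   mo M (reflect f) (\<lambda>t. - v0 t) (\<lambda>x t. - D x t) \<delta> \<sigma> eps \<and> ge m f u0 D eps \<and> ge m (reflect f) (\<lambda>x. - u0 x) (\<lambda>x t. - D x t) eps"
  by (intro eventually_conj[OF small] eventually_conj[OF sol] eventually_conj[OF M1(2)[OF M(1) \<delta>(1) \<sigma>(1,2) \<delta>(2)[unfolded K_def]]]
    eventually_conj[OF M2(2)[OF M(2) \<delta>(1) \<sigma>(1,2) \<delta>(2)[unfolded K_def]]] eventually_conj[OF m1(2)[OF m(1)] m2(2)[OF m(2)]])
 then show "\<forall>\<^sub>F eps in at_right 0. dist (u eps x t) (sgn (D x t)) < \<eta>"
 proof eventually_elim
  case (elim eps)
  then have eps: "0 < eps" "eps < 1" "m * eps < t" "m * eps < \<rho>" and sol: "AC_sol f \<Omega> eps (u eps)" "\<And>x. x \<in> closure \<Omega> ==> u eps x 0 = u0 x" by auto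
  define t1 where "t1 = eps^2 * m"
  have "eps^2 * m \<le> eps * m" using eps m(3) by (intro mult_right_mono) (auto simp: power2_eq_square mult_left_le)
  then have "t1 \<le> m * eps" unfolding t1_def by (simp add: mult.commute)
  moreover have "0 \<le> t1" unfolding t1_def using m(3) by simp
  ultimately have t1: "0 \<le> t1" "t1 < t" "t1 < \<rho>" "t1 \<le> T" using eps t by auto
  then have t1T: "t1 \<in> {0..T}" by simp
  obtain B C where BC: "motion_barrier f \<Omega> T v0 D K \<delta> \<sigma> Cv eps t1 B"
   "motion_barrier (reflect f) \<Omega> T (\<lambda>t. - v0 t) (\<lambda>x t. - D x t) K \<delta> \<sigma> Cv eps t1 C"
   using elim t1T unfolding mo_def K_def by blast
  obtain B1 B2 C1 C2 where G: "generation_barriers f \<Omega> T u0 D R \<delta> \<sigma> Vh eps t1 B1 B2"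
   "generation_barriers (reflect f) \<Omega> T (\<lambda>x. - u0 x) (\<lambda>x t. - D x t) R \<delta> \<sigma> Vh eps t1 C1 C2"
   using elim unfolding ge_def t1_def by blast
  have tt: "t \<in> {t1..T}" using t t1 by auto
  have "- C x t < u eps x t \<and> u eps x t < B x t"
   by (rule solution_between_barriers[OF Om sol G[unfolded Vh_def mO_def] BC[unfolded Cv_def] t1(1,4) \<rho>(2)[OF _ t1(1,3,4)]
     \<delta>(1) \<sigma>(1,7) \<sigma>(4)[unfolded mO_def] K Dc vol slab x tt])
  moreover have "5 * \<delta> * exp (K * t) \<le> \<bar>D x t\<bar>"
  proof -
   have "5 * \<delta> * exp (K * t) \<le> 8 * \<delta> * exp (K * T)" using K t \<delta>(1) by (intro mult_mono) (auto intro: mult_left_mono)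
   then show ?thesis using \<delta>(3) by linarith
  qed
  moreover have "B x t \<le> 1 + 3 * \<sigma>" "D x t \<le> - (5 * \<delta> * exp (K * t)) ==> B x t \<le> - 1 + 3 * \<sigma>"
   "- (1 + 3 * \<sigma>) \<le> - C x t" "5 * \<delta> * exp (K * t) \<le> D x t ==> 1 - 3 * \<sigma> \<le> - C x t"
   using motion_barrierD(3,4)[OF BC(1) tt, of x] motion_barrierD(3,4)[OF BC(2) tt, of x] by linarith+
  ultimately have "\<bar>u eps x t - sgn (D x t)\<bar> \<le> 3 * \<sigma>" using nz by (cases "D x t > 0") (auto simp: abs_le_iff)
  then show "dist (u eps x t) (sgn (D x t)) < \<eta>" using \<sigma>(3) by (simp add: dist_real_def)
 qed
qed


text \<open>The geometry reaches the analysis only through \<open>flow_distance\<close>, the signs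
  of \<open>D\<close>, the slab bound and the continuity of \<open>vol_diff\<close>.\<close>

theorem corollary1p2:
  fixes \<Omega> U \<Gamma>0 :: "(real ^ 'n) set"
    and f :: "real \<Rightarrow> real \<Rightarrow> real"
    and W :: "real \<Rightarrow> real"
    and a c0 C0 T :: real
    and u0 :: "real ^ 'n \<Rightarrow> real"
    and u :: "real \<Rightarrow> real ^ 'n \<Rightarrow> real \<Rightarrow> real"
    and \<Gamma> :: "real \<Rightarrow> (real ^ 'n) set"
  assumes "CARD('n) \<ge> 2"
    and "smooth_bounded_domain \<Omega>"
    and "smooth_on UNIV (\<lambda>(p, q). f p q)"
    and "\<And>p. (W has_real_derivative - f p 0) (at p)"
    and "-1 < a" "a < 1" "{p. f p 0 = 0} = {-1, a, 1}"
    and "deriv (\<lambda>p. f p 0) (-1) < 0" "deriv (\<lambda>p. f p 0) 1 < 0" "deriv (\<lambda>p. f p 0) a > 0"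
    and "integral {-1..1} (\<lambda>p. f p 0) = 0"
    and "open U" "closure \<Omega> \<subseteq> U" "smooth_on U u0"
    and "C0 \<ge> 1"
    and "(SUP x\<in>closure \<Omega>. \<bar>u0 x\<bar>) + (SUP x\<in>closure \<Omega>. norm (grad u0 x))
          + (SUP x\<in>closure \<Omega>. onorm (hess u0 x)) \<le> C0"
    and "\<Gamma>0 = {x\<in>\<Omega>. u0 x = a}" "\<And>x. x \<in> frontier \<Omega> \<Longrightarrow> u0 x \<noteq> a"
    and "smooth_closed_hypersurface \<Gamma>0"
    and "\<And>x. x \<in> \<Gamma>0 \<Longrightarrow> grad u0 x \<noteq> 0"
    and "\<And>x. x \<in> outer_region \<Omega> \<Gamma>0 \<Longrightarrow> u0 x > a"
    and "\<And>x. x \<in> inner_region \<Omega> \<Gamma>0 \<Longrightarrow> u0 x < a"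
    and "c0 = - integral {-1..1} (\<lambda>p. deriv (f p) 0)
              / integral {-1..1} (\<lambda>p. sqrt (2 * (W p - W (-1))))"
    and "T > 0" "limit_problem_solution \<Omega> c0 \<Gamma>0 T \<Gamma>"
    and "eventually (\<lambda>\<epsilon>. nonlocal_AC_solution f \<Omega> u0 \<epsilon> (u \<epsilon>)) (at_right 0)"
  shows "\<forall>t\<in>{0<..T}.
           (\<forall>x\<in>inner_region \<Omega> (\<Gamma> t). ((\<lambda>\<epsilon>. u \<epsilon> x t) \<longlongrightarrow> -1) (at_right 0)) \<and>
           (\<forall>x\<in>outer_region \<Omega> (\<Gamma> t). ((\<lambda>\<epsilon>. u \<epsilon> x t) \<longlongrightarrow> 1) (at_right 0))"
proof -
 have Om: "open \<Omega>" "bounded \<Omega>" using assms(2) unfolding smooth_bounded_domain_def by auto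
 have bi: "bistable f W a c0" by unfold_locales (use assms in auto)
 interpret limit_flow \<Omega> c0 T \<Gamma>0 \<Gamma> by unfold_locales (use assms Om in auto)
 obtain D C r where D: "flow_distance \<Omega> T c0 vol_diff D C r"
  "\<And>x t. t \<in> {0..T} ==> D x t < 0 \<longleftrightarrow> x \<in> inside (\<Gamma> t)"
  "\<And>x t. t \<in> {0..T} ==> D x t > 0 \<longleftrightarrow> x \<in> outside (\<Gamma> t)"
  "\<And>t s. t \<in> {0..T} ==> s > 0 ==> measure lebesgue {x\<in>\<Omega>. \<bar>D x t\<bar> \<le> s} \<le> C * s"
  "continuous_on {0..T} vol_diff"
  by (rule flow_distance_exists, rule that)
 have C: "0 \<le> C" using D(1) unfolding flow_distance_def by simp
 have regions: "inner_region \<Omega> (\<Gamma> t) = {x\<in>\<Omega>. D x t < 0}" "outer_region \<Omega> (\<Gamma> t) = {x\<in>\<Omega>. D x t > 0}"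
  if "t \<in> {0..T}" for t
  using D(2,3)[OF that] unfolding inner_region_def outer_region_def by auto
 have vol: "vol_diff t = measure lebesgue {x\<in>\<Omega>. D x t > 0} - measure lebesgue {x\<in>\<Omega>. D x t < 0}" if "t \<in> {0..T}" for t
  unfolding vol_diff_def regions[OF that] by simp
 have T0: "0 \<in> {0..T}" using assms(24) by simp
 have \<Gamma>0: "\<Gamma> 0 = \<Gamma>0" using assms(25) unfolding limit_problem_solution_def by blast
 have u0: "continuous_on (closure \<Omega>) u0"
  by (rule continuous_on_subset[OF smooth_on_derivD(3)[OF assms(14)] assms(13)])
 have in0: "u0 x < a" if "x \<in> \<Omega>" "D x 0 < 0" for x
  using assms(22)[of x] regions(1)[OF T0] \<Gamma>0 that by simp
 have out0: "a < u0 x" if "x \<in> \<Omega>" "D x 0 > 0" for x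
  using assms(21)[of x] regions(2)[OF T0] \<Gamma>0 that by simp
 have D0: "continuous_on UNIV (\<lambda>x. D x 0)"
  by (rule continuous_on_slice[OF _ T0]) (use D(1) in \<open>simp add: flow_distance_def\<close>)
 \<comment> \<open>The order of the initial data relative to \<open>a\<close> is assumed within
   \<Omega>, whereas comparison takes place on the closure. Continuity gives the weak inequality on
   the frontier, and \<open>u0 x \<noteq> a\<close> there makes it strict.\<close>
 have up_to_boundary: "g x < 0"
  if x: "x \<in> closure \<Omega>" "h x < 0" and h: "continuous_on UNIV h" and g: "continuous_on (closure \<Omega>) g"
   "\<And>y. y \<in> \<Omega> ==> h y < 0 ==> g y < 0" "\<And>y. y \<in> frontier \<Omega> ==> g y \<noteq> 0" for g h :: "real ^ 'n => real" and x
 proof (cases "x \<in> \<Omega>")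
  case True then show ?thesis using g(2) x by blast
 next
  case False
  then have f: "x \<in> frontier \<Omega>" using x Om(1) by (simp add: frontier_def interior_open)
  have op: "open {y. h y < 0}" using h by (intro open_Collect_less) auto
  have "x \<in> closure (\<Omega> \<inter> {y. h y < 0})"
   using open_Int_closure_subset[OF op, of \<Omega>] x by (auto simp: Int_commute)
  moreover have "continuous_on (closure (\<Omega> \<inter> {y. h y < 0})) g"
   by (rule continuous_on_subset[OF g(1)]) (simp add: closure_mono)
  ultimately have "g x \<le> 0"
   by (intro continuous_le_on_closure[of "\<Omega> \<inter> {y. h y < 0}" g x 0]) (use g(2) in \<open>auto intro: less_imp_le\<close>)
  then show ?thesis using g(3)[OF f] by simp
 qed
 have in1: "u0 x < a" if "x \<in> closure \<Omega>" "D x 0 < 0" for x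
 proof -
  have "u0 x - a < 0"
   by (rule up_to_boundary[OF that D0]) (use u0 in0 assms(18) in \<open>auto intro!: continuous_intros\<close>)
  then show ?thesis by simp
 qed
 have out1: "a < u0 x" if "x \<in> closure \<Omega>" "D x 0 > 0" for x
 proof -
  have "a - u0 x < 0"
  proof (rule up_to_boundary[OF that(1), of "\<lambda>x. - D x 0"])
   show "a - u0 y \<noteq> 0" if "y \<in> frontier \<Omega>" for y using assms(18)[OF that] by simp
  qed (use D0 u0 out0 that in \<open>auto intro!: continuous_intros\<close>)
  then show ?thesis by simp
 qed
 \<comment> \<open>The initial condition too is given on \<Omega> and extends to the closure by
   continuity.\<close>
 have sol: "\<forall>\<^sub>F eps in at_right 0. AC_sol f \<Omega> eps (u eps) \<and> (\<forall>x\<in>closure \<Omega>. u eps x 0 = u0 x)"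
  using assms(26)
 proof eventually_elim
  case (elim eps)
  have "continuous_on (closure \<Omega> \<times> {0..}) (\<lambda>(x, t). u eps x t)" and eq: "\<And>x. x \<in> \<Omega> ==> u eps x 0 = u0 x"
   using elim unfolding nonlocal_AC_solution_def by blast+
  from this(1) have "continuous_on (closure \<Omega>) (\<lambda>x. (\<lambda>(x, t). u eps x t) (x, 0))"
   by (rule continuous_on_compose2) (auto intro!: continuous_intros)
  then have c: "continuous_on (closure \<Omega>) (\<lambda>x. u eps x 0 - u0 x)" using u0 by (auto intro!: continuous_intros)
  have "u eps x 0 - u0 x = 0" if "x \<in> closure \<Omega>" for x
   by (rule continuous_constant_on_closure[OF c _ that]) (simp add: eq)
  then show ?case using nonlocal_AC_solution_imp_AC_sol[OF elim Om(1)] by simp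
 qed
 have lim: "((\<lambda>eps. u eps x t) \<longlongrightarrow> sgn (D x t)) (at_right 0)" if "t \<in> {0<..T}" "x \<in> \<Omega>" "D x t \<noteq> 0" for x t
  by (rule interface_limit[OF bi assms(2) D(1,5) vol D(4) C u0 in1 out1 sol that(1) _ that(3)])
   (use that(2) closure_subset in auto)
 show ?thesis
 proof (intro ballI conjI)
  fix t x assume t: "t \<in> {0<..T}"
  then have t0: "t \<in> {0..T}" by simp
  show "((\<lambda>eps. u eps x t) \<longlongrightarrow> -1) (at_right 0)" if "x \<in> inner_region \<Omega> (\<Gamma> t)"
   using lim[OF t, of x] that unfolding regions[OF t0] by simp
  show "((\<lambda>eps. u eps x t) \<longlongrightarrow> 1) (at_right 0)" if "x \<in> outer_region \<Omega> (\<Gamma> t)"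
   using lim[OF t, of x] that unfolding regions[OF t0] by simp
 qed
qed

end
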